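(* Let $v$ be a weak solution of the inviscid Leray-$\alpha$ model, with $u=(I-\alpha^2\Delta)^{-1}v$, such that $v\in L^3((0,T);B^\theta_{3,\infty}(\mathbb{T}^3))$ with $\theta>0$. Then $D_1(u,v)=0$. In particular, the solution conserves energy, i.e. $\|v(t_1,\cdot)\|_{L^2}=\|v(t_2,\cdot)\|_{L^2}$ for almost all $t_1,t_2\in(0,T)$.
   Context: Fix $\alpha>0$, $T>0$; $\mathbb{T}^3$ is the flat three-dimensional torus; repeated indices are summed. $B^\theta_{3,\infty}$ denotes the usual Besov space. A pair $v,p\in L^\infty((0,T);L^2(\mathbb{T}^3))$ ($v$ vector-valued, $p$ scalar), with $u=(I-\alpha^2\Delta)^{-1}v$, i.e. $v=u-\alpha^2\Delta u$, is a weak solution of the inviscid Leray-$\alpha$ model ($\partial_t v+\nabla\cdot(u\otimes v)+\nabla p=0$, $\nabla\cdot u=\nabla\cdot v=0$) if for all $\psi\in\mathcal{D}(\mathbb{T}^3\times(0,T);\mathbb{R}^3)$ and $\chi\in\mathcal{D}(\mathbb{T}^3\times(0,T);\mathbb{R})$ $$\int_0^T\!\!\int_{\mathbb{T}^3} v_i\partial_t\psi_i\,dx\,dt+\int_0^T\!\!\int_{\mathbb{T}^3} v_ju_i\partial_i\psi_j\,dx\,dt+\int_0^T\!\!\int_{\mathbb{T}^3} p\,\partial_i\psi_i\,dx\,dt=0,\qquad \int_0^T\!\!\int_{\mathbb{T}^3}u_i\partial_i\chi\,dx\,dt=0,$$ with $\int_{\mathbb{T}^3}p(x,t)\,dx=0$.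 Here $\mathcal{D}$ denotes smooth compactly supported functions. Let $\phi:\mathbb{R}^3\to\mathbb{R}$ be a standard radial $C_c^\infty$ mollifier with $\int\phi=1$, $\phi_\epsilon(x)=\epsilon^{-3}\phi(x/\epsilon)$, and $\delta w(\xi;x,t)=w(x+\xi,t)-w(x,t)$ (periodic extension). The defect term is the limit in the sense of distributions $$D_1(u,v)(x,t)=\frac12\lim_{\epsilon\to0}\int_{\mathbb{R}^3}\nabla\phi_\epsilon(\xi)\cdot\delta u(\xi;x,t)\,|\delta v(\xi;x,t)|^2\,d\xi .$$ *)

theory Defs
  imports "HOL-Analysis.Analysis"
begin

text \<open>Functions on the flat torus \<open>\<real>\<^sup>3 / \<int>\<^sup>3\<close> are represented by \<open>\<int>\<^sup>3\<close>-periodic functions on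
  \<open>\<real>\<^sup>3\<close>, integrated over the unit cell. A function on the product of the torus with \<open>(0, T)\<close>
  is a function of \<open>(x, t)\<close> that is periodic in \<open>x\<close>; its values for \<open>t\<close> outside \<open>(0, T)\<close> play no role.\<close>

type_synonym space = "real ^ 3"
type_synonym spacetime = "space \<times> real"

subsection \<open>Smooth functions\<close>

definition partial ::
    "'a \<Rightarrow> ('a::euclidean_space \<Rightarrow> 'b::real_normed_vector) \<Rightarrow> 'a \<Rightarrow> 'b" where
  "partial b f x = frechet_derivative f (at x) b"

primrec Ck :: "nat \<Rightarrow> ('a::euclidean_space \<Rightarrow> 'b::real_normed_vector) \<Rightarrow> bool" where
  "Ck 0 f \<longleftrightarrow> continuous_on UNIV f"
| "Ck (Suc n) f \<longleftrightarrow> (\<forall>x. f differentiable at x) \<and> (\<forall>b\<in>Basis. Ck n (partial b f))"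

definition smooth :: "('a::euclidean_space \<Rightarrow> 'b::real_normed_vector) \<Rightarrow> bool" where
  "smooth f \<longleftrightarrow> (\<forall>n. Ck n f)"

definition dx :: "3 \<Rightarrow> (space \<Rightarrow> 'b::real_normed_vector) \<Rightarrow> space \<Rightarrow> 'b" where
  "dx i f = partial (axis i 1) f"

definition grad :: "(space \<Rightarrow> real) \<Rightarrow> space \<Rightarrow> space" where
  "grad f x = (\<chi> i. dx i f x)"

definition laplacian :: "(space \<Rightarrow> real) \<Rightarrow> space \<Rightarrow> real" where
  "laplacian f x = (\<Sum>i\<in>UNIV. dx i (dx i f) x)"

definition st_dx :: "3 \<Rightarrow> (spacetime \<Rightarrow> 'b::real_normed_vector) \<Rightarrow> spacetime \<Rightarrow> 'b" where
  "st_dx i f = partial (axis i 1, 0) f"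

definition st_dt :: "(spacetime \<Rightarrow> 'b::real_normed_vector) \<Rightarrow> spacetime \<Rightarrow> 'b" where
  "st_dt f = partial (0, 1) f"

subsection \<open>Function spaces on the torus\<close>

definition cell :: "space set" where
  "cell = cbox 0 One"

definition periodic :: "(space \<Rightarrow> 'b) \<Rightarrow> bool" where
  "periodic f \<longleftrightarrow> (\<forall>x i. f (x + axis i 1) = f x)"

definition in_Lp :: "real \<Rightarrow> (space \<Rightarrow> 'b::euclidean_space) \<Rightarrow> bool" where
  "in_Lp r f \<longleftrightarrow> periodic f \<and> f \<in> borel_measurable borel \<and>
     set_integrable lborel cell (\<lambda>x. norm (f x) powr r)"

definition Lp_norm :: "real \<Rightarrow> (space \<Rightarrow> 'b::euclidean_space) \<Rightarrow> real" where
  "Lp_norm r f = (LBINT x:cell. norm (f x) powr r) powr (1 / r)"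

definition fdiff :: "space \<Rightarrow> (space \<Rightarrow> 'b::ab_group_add) \<Rightarrow> space \<Rightarrow> 'b" where
  "fdiff \<xi> f x = f (x + \<xi>) - f x"

text \<open>The Besov space \<open>B\<^sup>\<theta>\<^bsub>r,\<infinity>\<^esub>\<close> for arbitrary \<open>\<theta> > 0\<close>, normed by finite differences of order
  \<open>\<lfloor>\<theta>\<rfloor> + 1\<close>, so that for \<open>0 < \<theta> < 1\<close> the seminorm is the usual
  \<open>sup \<bar>\<xi>\<bar>\<^bsup>-\<theta>\<^esup> \<parallel>f(\<cdot> + \<xi>) - f\<parallel>\<close>. First differences alone would leave only the constants
  when \<open>\<theta> > 1\<close>.\<close>

definition besov_quotients :: "real \<Rightarrow> real \<Rightarrow> (space \<Rightarrow> 'b::euclidean_space) \<Rightarrow> real set" where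
  "besov_quotients \<theta> r f =
     (\<lambda>\<xi>. norm \<xi> powr (- \<theta>) * Lp_norm r ((fdiff \<xi> ^^ (nat \<lfloor>\<theta>\<rfloor> + 1)) f)) ` (- {0})"

definition in_besov :: "real \<Rightarrow> real \<Rightarrow> (space \<Rightarrow> 'b::euclidean_space) \<Rightarrow> bool" where
  "in_besov \<theta> r f \<longleftrightarrow> in_Lp r f \<and> bdd_above (besov_quotients \<theta> r f)"

definition besov_norm :: "real \<Rightarrow> real \<Rightarrow> (space \<Rightarrow> 'b::euclidean_space) \<Rightarrow> real" where
  "besov_norm \<theta> r f = Lp_norm r f + Sup (besov_quotients \<theta> r f)"

subsection \<open>Functions of space and time\<close>

text \<open>Every class of almost everywhere equal functions has a representative that is jointly
  Borel measurable and periodic at every point; elements of Bochner spaces are given by such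
  representatives.\<close>

definition st_function :: "real \<Rightarrow> (spacetime \<Rightarrow> 'b::euclidean_space) \<Rightarrow> bool" where
  "st_function T f \<longleftrightarrow> set_borel_measurable borel (UNIV \<times> {0<..<T}) f \<and>
     (\<forall>t\<in>{0<..<T}. periodic (\<lambda>x. f (x, t)))"

definition in_Linf_L2 :: "real \<Rightarrow> (spacetime \<Rightarrow> 'b::euclidean_space) \<Rightarrow> bool" where
  "in_Linf_L2 T f \<longleftrightarrow> st_function T f \<and>
     (\<exists>C. AE t in lborel. t \<in> {0<..<T} \<longrightarrow>
        in_Lp 2 (\<lambda>x. f (x, t)) \<and> Lp_norm 2 (\<lambda>x. f (x, t)) \<le> C)"

text \<open>\<open>L\<^sup>3((0, T); B\<^sup>\<theta>\<^bsub>3,\<infinity>\<^esub>)\<close>. Only joint measurability is required, not strong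
  measurability into the non-separable space \<open>B\<^sup>\<theta>\<^bsub>3,\<infinity>\<^esub>\<close>.\<close>

definition in_L3_besov :: "real \<Rightarrow> real \<Rightarrow> (spacetime \<Rightarrow> 'b::euclidean_space) \<Rightarrow> bool" where
  "in_L3_besov T \<theta> f \<longleftrightarrow> st_function T f \<and>
     (AE t in lborel. t \<in> {0<..<T} \<longrightarrow> in_besov \<theta> 3 (\<lambda>x. f (x, t))) \<and>
     (\<integral>\<^sup>+t\<in>{0<..<T}. ennreal (besov_norm \<theta> 3 (\<lambda>x. f (x, t)) ^ 3) \<partial>lborel) < \<infinity>"

definition st_integral :: "real \<Rightarrow> (spacetime \<Rightarrow> real) \<Rightarrow> real" where
  "st_integral T f = (LBINT t:{0<..<T}. (LBINT x:cell. f (x, t)))"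

text \<open>Test functions on the torus times \<open>(0, T)\<close>, extended by zero to all times.\<close>

definition st_test :: "real \<Rightarrow> (spacetime \<Rightarrow> 'b::euclidean_space) \<Rightarrow> bool" where
  "st_test T \<psi> \<longleftrightarrow> smooth \<psi> \<and> (\<forall>t. periodic (\<lambda>x. \<psi> (x, t))) \<and>
     (\<exists>a b. 0 < a \<and> b < T \<and> (\<forall>x t. t \<notin> {a..b} \<longrightarrow> \<psi> (x, t) = 0))"

definition distributional_limit ::
    "real \<Rightarrow> (real \<Rightarrow> spacetime \<Rightarrow> real) \<Rightarrow> ((spacetime \<Rightarrow> real) \<Rightarrow> real) \<Rightarrow> bool" where
  "distributional_limit T F D \<longleftrightarrow>
     (\<forall>\<eta>. st_test T \<eta> \<longrightarrow>
        ((\<lambda>\<epsilon>. st_integral T (\<lambda>z. F \<epsilon> z * \<eta> z)) \<longlongrightarrow> D \<eta>) (at_right 0))"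

subsection \<open>The inviscid Leray-\<open>\<alpha>\<close> model\<close>

text \<open>\<open>u = (I - \<alpha>\<^sup>2\<Delta>)\<^sup>-\<^sup>1 v\<close> on the torus: \<open>u\<close> is square integrable and
  \<open>u - \<alpha>\<^sup>2\<Delta>u = v\<close> holds as distributions, i.e. against smooth periodic \<open>\<psi>\<close>.\<close>

definition inverse_helmholtz :: "real \<Rightarrow> (space \<Rightarrow> space) \<Rightarrow> (space \<Rightarrow> space) \<Rightarrow> bool" where
  "inverse_helmholtz \<alpha> v u \<longleftrightarrow> in_Lp 2 u \<and>
     (\<forall>\<psi>. smooth \<psi> \<and> periodic \<psi> \<longrightarrow>
        (LBINT x:cell. (\<psi> x - \<alpha>\<^sup>2 * laplacian \<psi> x) *\<^sub>R u x) = (LBINT x:cell. \<psi> x *\<^sub>R v x))"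

definition leray_alpha_weak_solution ::
    "real \<Rightarrow> real \<Rightarrow> (spacetime \<Rightarrow> space) \<Rightarrow> (spacetime \<Rightarrow> space) \<Rightarrow> (spacetime \<Rightarrow> real) \<Rightarrow> bool" where
  "leray_alpha_weak_solution \<alpha> T u v p \<longleftrightarrow>
     in_Linf_L2 T v \<and> in_Linf_L2 T p \<and> st_function T u \<and>
     (AE t in lborel. t \<in> {0<..<T} \<longrightarrow>
        inverse_helmholtz \<alpha> (\<lambda>x. v (x, t)) (\<lambda>x. u (x, t))) \<and>
     (\<forall>\<psi> :: spacetime \<Rightarrow> space. st_test T \<psi> \<longrightarrow>
        st_integral T (\<lambda>z. \<Sum>i\<in>UNIV. v z $ i * st_dt \<psi> z $ i)
        + st_integral T (\<lambda>z. \<Sum>i\<in>UNIV. \<Sum>j\<in>UNIV. v z $ j * u z $ i * st_dx i \<psi> z $ j)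
        + st_integral T (\<lambda>z. p z * (\<Sum>i\<in>UNIV. st_dx i \<psi> z $ i)) = 0) \<and>
     (\<forall>\<eta> :: spacetime \<Rightarrow> real. st_test T \<eta> \<longrightarrow>
        st_integral T (\<lambda>z. \<Sum>i\<in>UNIV. u z $ i * st_dx i \<eta> z) = 0) \<and>
     (AE t in lborel. t \<in> {0<..<T} \<longrightarrow> (LBINT x:cell. p (x, t)) = 0)"

subsection \<open>The defect term\<close>

definition mollifier :: "(space \<Rightarrow> real) \<Rightarrow> bool" where
  "mollifier \<phi> \<longleftrightarrow> smooth \<phi> \<and> bounded {x. \<phi> x \<noteq> 0} \<and>
     (\<forall>x y. norm x = norm y \<longrightarrow> \<phi> x = \<phi> y) \<and> (LBINT x. \<phi> x) = 1"

definition rescale :: "(space \<Rightarrow> real) \<Rightarrow> real \<Rightarrow> space \<Rightarrow> real" where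
  "rescale \<phi> \<epsilon> x = \<phi> (x /\<^sub>R \<epsilon>) / \<epsilon> ^ 3"

definition defect_approx ::
    "(space \<Rightarrow> real) \<Rightarrow> (spacetime \<Rightarrow> space) \<Rightarrow> (spacetime \<Rightarrow> space) \<Rightarrow> real \<Rightarrow> spacetime \<Rightarrow> real" where
  "defect_approx \<phi> u v \<epsilon> = (\<lambda>(x, t).
     1 / 2 * (LBINT \<xi>. (grad (rescale \<phi> \<epsilon>) \<xi> \<bullet> fdiff \<xi> (\<lambda>y. u (y, t)) x)
                        * (norm (fdiff \<xi> (\<lambda>y. v (y, t)) x))\<^sup>2))"

text \<open>\<open>has_defect T \<phi> u v D\<close>: the limit defining \<open>D\<^sub>1(u, v)\<close> exists and is the distribution \<open>D\<close>.\<close>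

definition has_defect ::
    "real \<Rightarrow> (space \<Rightarrow> real) \<Rightarrow> (spacetime \<Rightarrow> space) \<Rightarrow> (spacetime \<Rightarrow> space) \<Rightarrow>
     ((spacetime \<Rightarrow> real) \<Rightarrow> real) \<Rightarrow> bool" where
  "has_defect T \<phi> u v D \<longleftrightarrow> distributional_limit T (defect_approx \<phi> u v) D"

end

theory Submission
  imports Defs
begin

text \<open>The increments of \<open>u\<close> and of \<open>v\<close> enter the defect term with very different strength. Since
  \<open>u = (I - \<alpha>\<^sup>2\<Delta>)\<^sup>-\<^sup>1 v\<close> gains two derivatives, \<open>\<delta>u(\<xi>)\<close> is of order \<open>\<bar>\<xi>\<bar>\<close> in \<open>L\<^sup>3\<close> as soon as
  \<open>v \<in> L\<^sup>3\<close> (\<open>helmholtz_L3_bounds\<close>), and this exactly cancels the factor \<open>1/\<epsilon>\<close> of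
  \<open>\<nabla>\<phi>\<^sub>\<epsilon>\<close>. What remains is \<open>\<delta>v(\<xi>)\<close> in \<open>L\<^sup>3\<close> of space-time for \<open>\<bar>\<xi>\<bar> \<le> C\<epsilon>\<close>, which tends to
  zero by continuity of translations (\<open>spacetime_translation\<close>). So the defect vanishes for every
  \<open>v \<in> L\<^sup>3\<close> (\<open>defect_small\<close>), and the Besov norm is used only through the \<open>L\<^sup>3\<close> norm that it contains.

  The elliptic estimate avoids fundamental solutions and singular integrals. A bump \<open>m\<close> has a
  compactly supported potential \<open>\<Theta>\<close> with \<open>\<nabla>\<Theta> = x m\<close>, and then the derivative of the rescaled
  bump in the scale \<open>s\<close> is \<open>-s\<close> times the Laplacian of the rescaled potential. Integrating over scales
  writes \<open>u\<close> as a smooth average plus an integral of convolutions of \<open>u - v\<close>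
  (\<open>helmholtz_scale_formula\<close>), to which the inequalities of Young and Minkowski apply.

  Conservation of energy follows from the identity of Duchon and Robert. At a fixed time, for a
  solenoidal \<open>u\<close> and an even kernel \<open>K\<close>, the defect integral is \<open>-4\<close> times the energy flux
  \<open>\<integral> u\<^sub>i v \<cdot> (\<partial>\<^sub>iK * v)\<close> (\<open>energy_flux_identity\<close>). The flux in turn is half of the time
  derivative of \<open>\<integral> v \<cdot> (K * v)\<close>. As \<open>v\<close> has no time derivative, this is shown by doubling the time
  variable: the equation at time \<open>t\<close> is tested with \<open>K * v\<close> at time \<open>s\<close>, and the symmetry of the
  pairing removes the singular terms when \<open>t - s\<close> tends to \<open>0\<close> (\<open>energy_balance\<close>). In the limit
  \<open>\<epsilon> \<rightarrow> 0\<close> the function \<open>t \<mapsto> \<parallel>v(t)\<parallel>\<^sub>2\<^sup>2\<close> has vanishing weak derivative and is constant.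

  The tests must be solenoidal to eliminate the pressure, so \<open>div (K * v) = 0\<close> is needed at all points
  and almost all times; this is extracted from the weak constraint in \<open>divergence_free_AE\<close> and passed
  from \<open>u\<close> to \<open>v\<close> by the Helmholtz equation.\<close>

section \<open>Notation\<close>

text \<open>Measurability in several variables is stated for products of space (\<open>X\<close>) and time (\<open>T\<close>); the
  binders \<open>nnT\<close> and \<open>nnL\<close> are nonnegative integrals over the torus and over all of space or time.\<close>

abbreviation Borel :: "('a::topological_space \<Rightarrow> 'b::topological_space) set"
 where "Borel \<equiv> borel_measurable borel"

abbreviation Borel2 :: "('a::topological_space \<times> 'b::topological_space \<Rightarrow> 'c::topological_space) set"
 where "Borel2 \<equiv> borel_measurable (borel \<Otimes>\<^sub>M borel)"

abbreviation "borelTX \<equiv> (borel :: real measure) \<Otimes>\<^sub>M (borel :: space measure)"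
abbreviation "borelXT \<equiv> (borel :: space measure) \<Otimes>\<^sub>M (borel :: real measure)"
abbreviation "borelXX \<equiv> (borel :: space measure) \<Otimes>\<^sub>M (borel :: space measure)"
abbreviation "borelTT \<equiv> (borel :: real measure) \<Otimes>\<^sub>M (borel :: real measure)"
abbreviation "borelXXT \<equiv> (borel :: space measure) \<Otimes>\<^sub>M borelXT"
abbreviation "borelXTX \<equiv> borelXT \<Otimes>\<^sub>M (borel :: space measure)"
abbreviation "borelTXX \<equiv> borelTX \<Otimes>\<^sub>M (borel :: space measure)"
abbreviation "borelTTX \<equiv> borelTT \<Otimes>\<^sub>M (borel :: space measure)"

abbreviation nn_lborel :: "('a::euclidean_space \<Rightarrow> ennreal) \<Rightarrow> ennreal" (binder "nnL" 10)
 where "nn_lborel \<equiv> nn_integral lborel"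

lemmas L_integrable_add = Bochner_Integration.integrable_add
lemmas L_integrable_bound = Bochner_Integration.integrable_bound
lemmas L_integrable_diff = Bochner_Integration.integrable_diff
lemmas L_integrable_sum = Bochner_Integration.integrable_sum
lemmas L_integral_add = Bochner_Integration.integral_add
lemmas L_integral_cong = Bochner_Integration.integral_cong
lemmas L_integral_diff = Bochner_Integration.integral_diff
lemmas L_integral_minus = Bochner_Integration.integral_minus
lemmas L_integral_nonneg = Bochner_Integration.integral_nonneg
lemmas L_integral_sum = Bochner_Integration.integral_sum

section \<open>Calculus of smooth functions\<close>

lemma partial_eq: "(f has_derivative f') (at x) ==> partial b f x = f' b"
 unfolding partial_def by (simp add: frechet_derivative_at[symmetric])

lemma Ck_SucI:
 assumes "\<And>x. (f has_derivative D x) (at x)" "\<And>b. b \<in> Basis ==> Ck n (\<lambda>x. D x b)"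
 shows "Ck (Suc n) f"
proof -
 have "partial b f = (\<lambda>x. D x b)" for b
  using assms(1) partial_eq by blast
 then show ?thesis using assms by (auto simp: differentiable_def)
qed

lemma Ck_SucD:
 assumes "Ck (Suc n) f"
 shows "(f has_derivative frechet_derivative f (at x)) (at x)"
 using assms by (simp add: frechet_derivative_works[symmetric])

lemma Ck_Suc_partial: "Ck (Suc n) f ==> b \<in> Basis ==> Ck n (partial b f)"
 by simp

lemma Ck_lower: "Ck (Suc n) f ==> Ck n f"
proof (induction n arbitrary: f)
 case 0
 then show ?case
  by (auto intro!: continuous_at_imp_continuous_on differentiable_imp_continuous_within)
next
 case (Suc n)
 then show ?case by (metis Ck.simps(2))
qed

lemma Ck_continuous: "Ck n f ==> continuous_on UNIV f"
 by (induction n) (use Ck_lower in \<open>auto simp del: Ck.simps(2)\<close>)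

lemma Ck_const: "Ck n (\<lambda>x. c)"
proof (induction n arbitrary: c)
 case (Suc n)
 show ?case
  by (rule Ck_SucI[where D = "\<lambda>_ _. 0"]) (use Suc in auto)
qed simp

lemma Ck_bounded_linear:
 assumes "bounded_linear h" and "Ck n f"
 shows "Ck n (\<lambda>x. h (f x))"
 using assms(2)
proof (induction n arbitrary: f)
 case 0
 then show ?case
  using assms(1) by (auto intro: bounded_linear.continuous_on)
next
 case (Suc n)
 show ?case
 proof (rule Ck_SucI)
  show "((\<lambda>x. h (f x)) has_derivative (\<lambda>b. h (frechet_derivative f (at x) b))) (at x)" for x
   by (rule bounded_linear.has_derivative[OF assms(1)]) (rule Ck_SucD[OF Suc.prems])
  show "Ck n (\<lambda>x. h (frechet_derivative f (at x) b))" if "b \<in> Basis" for b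
   using Suc.IH[OF Ck_Suc_partial[OF Suc.prems that]] by (simp add: partial_def)
 qed
qed

lemma Ck_add: "Ck n f ==> Ck n g ==> Ck n (\<lambda>x. f x + g x)"
proof (induction n arbitrary: f g)
 case 0
 then show ?case by (auto intro: continuous_on_add)
next
 case (Suc n)
 show ?case
 proof (rule Ck_SucI)
  show "((\<lambda>x. f x + g x) has_derivative
    (\<lambda>b. frechet_derivative f (at x) b + frechet_derivative g (at x) b)) (at x)" for x
   by (intro has_derivative_add Ck_SucD[OF Suc.prems(1)] Ck_SucD[OF Suc.prems(2)])
  show "Ck n (\<lambda>x. frechet_derivative f (at x) b + frechet_derivative g (at x) b)" 
   if "b \<in> Basis" for b
   using Suc.IH[OF Ck_Suc_partial[OF Suc.prems(1) that] Ck_Suc_partial[OF Suc.prems(2) that]]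
   by (simp add: partial_def)
 qed
qed

lemma Ck_sum: "(\<And>i. i \<in> I ==> Ck n (f i)) ==> Ck n (\<lambda>x. \<Sum>i\<in>I. f i x)"
 by (induction I rule: infinite_finite_induct) (auto intro: Ck_const Ck_add)

lemma Ck_scaleR:
 fixes f :: "'a::euclidean_space \<Rightarrow> real"
 shows "Ck n f ==> Ck n g ==> Ck n (\<lambda>x. f x *\<^sub>R g x)"
proof (induction n arbitrary: f g)
 case 0
 then show ?case by (auto intro: continuous_on_scaleR)
next
 case (Suc n)
 show ?case
 proof (rule Ck_SucI)
  show "((\<lambda>x. f x *\<^sub>R g x) has_derivative
    (\<lambda>b. f x *\<^sub>R frechet_derivative g (at x) b + frechet_derivative f (at x) b *\<^sub>R g x)) (at x)" for x
   by (intro has_derivative_scaleR Ck_SucD[OF Suc.prems(1)] Ck_SucD[OF Suc.prems(2)])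
  show "Ck n (\<lambda>x. f x *\<^sub>R frechet_derivative g (at x) b + frechet_derivative f (at x) b *\<^sub>R g x)" 
   if "b \<in> Basis" for b
   using Suc.IH[OF Ck_lower[OF Suc.prems(1)] Ck_Suc_partial[OF Suc.prems(2) that]]
    Suc.IH[OF Ck_Suc_partial[OF Suc.prems(1) that] Ck_lower[OF Suc.prems(2)]]
   by (auto simp: partial_def intro: Ck_add)
 qed
qed

lemma Ck_mult:
 fixes f g :: "'a::euclidean_space \<Rightarrow> real"
 shows "Ck n f ==> Ck n g ==> Ck n (\<lambda>x. f x * g x)"
 using Ck_scaleR[of n f g] by simp

lemma Ck_linear:
 assumes "bounded_linear L"
 shows "Ck n L"
proof (cases n)
 case 0
 then show ?thesis using assms by (simp add: linear_continuous_on)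
next
 case (Suc m)
 show ?thesis unfolding Suc
  by (rule Ck_SucI[where D = "\<lambda>_. L"])
   (use assms in \<open>auto intro: bounded_linear_imp_has_derivative Ck_const\<close>)
qed

lemma frechet_derivative_sum_partial:
 assumes "f differentiable at x"
 shows "frechet_derivative f (at x) h = (\<Sum>b\<in>Basis. (h \<bullet> b) *\<^sub>R partial b f x)"
proof -
 have L: "linear (frechet_derivative f (at x))"
  using assms linear_frechet_derivative by blast
 have "frechet_derivative f (at x) h = frechet_derivative f (at x) (\<Sum>b\<in>Basis. (h \<bullet> b) *\<^sub>R b)"
  by (simp add: euclidean_representation)
 also have "... = (\<Sum>b\<in>Basis. (h \<bullet> b) *\<^sub>R partial b f x)"
  unfolding linear_sum[OF L] linear_scale[OF L] partial_def ..
 finally show ?thesis .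
qed

lemma Ck_affine:
 fixes L :: "'a::euclidean_space \<Rightarrow> 'b::euclidean_space"
 assumes L: "bounded_linear L" and "Ck n f"
 shows "Ck n (\<lambda>x. f (L x + c))"
 using assms(2)
proof (induction n arbitrary: f)
 case 0
 have "continuous_on UNIV (\<lambda>x. L x + c)"
  by (intro continuous_intros linear_continuous_on L)
 then show ?case using 0 by (auto intro: continuous_on_compose2)
next
 case (Suc n)
 have A: "((\<lambda>x. L x + c) has_derivative L) (at x)" for x
  by (intro has_derivative_add_const bounded_linear_imp_has_derivative L)
 show ?case
 proof (rule Ck_SucI)
  show "((\<lambda>x. f (L x + c)) has_derivative (\<lambda>b. frechet_derivative f (at (L x + c)) (L b))) (at x)" for x
   using diff_chain_at[OF A Ck_SucD[OF Suc.prems]] by (simp add: o_def)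
  show "Ck n (\<lambda>x. frechet_derivative f (at (L x + c)) (L b))" if "b \<in> Basis" for b
  proof -
   have "(\<lambda>x. frechet_derivative f (at (L x + c)) (L b)) =
     (\<lambda>x. \<Sum>b'\<in>Basis. (L b \<bullet> b') *\<^sub>R partial b' f (L x + c))"
    using Suc.prems by (intro ext frechet_derivative_sum_partial) simp
   moreover have "Ck n (\<lambda>x. \<Sum>b'\<in>Basis. (L b \<bullet> b') *\<^sub>R partial b' f (L x + c))"
    by (intro Ck_sum Ck_scaleR Ck_const Suc.IH Ck_Suc_partial[OF Suc.prems])
   ultimately show ?thesis by simp
  qed
 qed
qed

lemma Ck_compose_real:
 fixes f :: "real \<Rightarrow> real" and g :: "'a::euclidean_space \<Rightarrow> real"
 shows "Ck n f ==> Ck n g ==> Ck n (\<lambda>x. f (g x))"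
proof (induction n arbitrary: f g)
 case 0
 then show ?case by (auto intro: continuous_on_compose2)
next
 case (Suc n)
 show ?case
 proof (rule Ck_SucI)
  show "((\<lambda>x. f (g x)) has_derivative
    (\<lambda>b. frechet_derivative f (at (g x)) (frechet_derivative g (at x) b))) (at x)" for x
   using diff_chain_at[OF Ck_SucD[OF Suc.prems(2)] Ck_SucD[OF Suc.prems(1)]] by (simp add: o_def)
  show "Ck n (\<lambda>x. frechet_derivative f (at (g x)) (frechet_derivative g (at x) b))" 
   if "b \<in> Basis" for b
  proof -
   have "(\<lambda>x. frechet_derivative f (at (g x)) (frechet_derivative g (at x) b)) =
    (\<lambda>x. partial b g x * partial 1 f (g x))"
    using Suc.prems(1) frechet_derivative_sum_partial[of f] by (auto simp: partial_def[of b])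
   moreover have "Ck n (partial 1 f)" by (rule Ck_Suc_partial[OF Suc.prems(1)]) simp
   ultimately show ?thesis
    using Ck_mult[OF Ck_Suc_partial[OF Suc.prems(2) that] Suc.IH[OF _ Ck_lower[OF Suc.prems(2)]]]
    by simp
  qed
 qed
qed

lemma smooth_const: "smooth (\<lambda>x. c)" by (simp add: smooth_def Ck_const)
lemma smooth_add: "smooth f ==> smooth g ==> smooth (\<lambda>x. f x + g x)"
 by (simp add: smooth_def Ck_add)
lemma smooth_sum: "(\<And>i. i \<in> I ==> smooth (f i)) ==> smooth (\<lambda>x. \<Sum>i\<in>I. f i x)"
 by (simp add: smooth_def Ck_sum)
lemma smooth_scaleR:
 fixes f :: "'a::euclidean_space \<Rightarrow> real"
 shows "smooth f ==> smooth g ==> smooth (\<lambda>x. f x *\<^sub>R g x)"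
 by (simp add: smooth_def Ck_scaleR)
lemma smooth_mult:
 fixes f g :: "'a::euclidean_space \<Rightarrow> real"
 shows "smooth f ==> smooth g ==> smooth (\<lambda>x. f x * g x)"
 by (simp add: smooth_def Ck_mult)
lemma smooth_linear: "bounded_linear L ==> smooth L"
 by (simp add: smooth_def Ck_linear)
lemma smooth_affine:
 fixes L :: "'a::euclidean_space \<Rightarrow> 'b::euclidean_space"
 shows "bounded_linear L ==> smooth f ==> smooth (\<lambda>x. f (L x + c))"
 by (simp add: smooth_def Ck_affine)
lemma smooth_compose_real:
 fixes f :: "real \<Rightarrow> real" and g :: "'a::euclidean_space \<Rightarrow> real"
 shows "smooth f ==> smooth g ==> smooth (\<lambda>x. f (g x))"
 by (simp add: smooth_def Ck_compose_real)

lemma smooth_partial: "smooth f ==> b \<in> Basis ==> smooth (partial b f)"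
 unfolding smooth_def using Ck_Suc_partial by blast

lemma smooth_differentiable: "smooth f ==> f differentiable at x"
 unfolding smooth_def using Ck.simps(2) by blast

lemma smooth_has_derivative: "smooth f ==> (f has_derivative frechet_derivative f (at x)) (at x)"
 using smooth_differentiable frechet_derivative_works by blast

lemma smooth_continuous: "smooth f ==> continuous_on UNIV f"
 unfolding smooth_def using Ck_continuous by blast

lemma smoothI_derivative:
 assumes "\<And>x. (f has_derivative D x) (at x)" "\<And>b. b \<in> Basis ==> smooth (\<lambda>x. D x b)"
 shows "smooth f"
 unfolding smooth_def
proof
 fix n
 show "Ck n f"
  by (rule Ck_lower, rule Ck_SucI[OF assms(1)]) (use assms(2) in \<open>auto simp: smooth_def\<close>)
qed

lemma smooth_norm_sq: "smooth (\<lambda>x::'a::euclidean_space. x \<bullet> x)"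
proof -
 have "(\<lambda>x::'a. x \<bullet> x) = (\<lambda>x. \<Sum>b\<in>Basis. (x \<bullet> b) * (x \<bullet> b))"
  by (rule ext) (rule euclidean_inner)
 then show ?thesis
  by (simp only:) (intro smooth_sum smooth_mult smooth_linear bounded_linear_inner_left)
qed

lemma smooth_real_has_derivative:
 assumes "smooth (f :: real \<Rightarrow> real)"
 shows "(f has_real_derivative partial 1 f x) (at x)"
proof -
 have "frechet_derivative f (at x) = (\<lambda>h. h * partial 1 f x)"
  using frechet_derivative_sum_partial[OF smooth_differentiable[OF assms]] by auto
 then have "frechet_derivative f (at x) = (*) (partial 1 f x)"
  by (simp add: fun_eq_iff)
 then show ?thesis
  using smooth_has_derivative[OF assms, of x] by (simp add: has_field_derivative_def)
qed

lemma partial_real: "(f has_real_derivative D) (at x) ==> partial 1 f x = D"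
 unfolding has_field_derivative_def by (drule partial_eq[of _ _ _ 1]) simp

section \<open>Cut-off functions\<close>

text \<open>The family is closed under differentiation up to linear combinations, which gives smoothness by induction.\<close>

definition flat :: "nat \<Rightarrow> real \<Rightarrow> real" where
 "flat k x = (if x > 0 then exp (- (1 / x)) / x ^ k else 0)"

lemma flat_bound: "\<bar>flat k x\<bar> \<le> fact (k + 2) * x\<^sup>2"
proof (cases "x > 0")
 case True
 define y where "y = 1 / x"
 have y: "y > 0" using True by (simp add: y_def)
 have "y ^ (k + 2) / fact (k + 2) \<le> exp y"
 proof -
  have "(\<Sum>n\<in>{k+2}. y ^ n /\<^sub>R fact n) \<le> exp y"
   unfolding exp_def using y by (intro sum_le_suminf summable_exp_generic) auto
  then show ?thesis by (simp add: divide_inverse mult.commute)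
 qed
 then have "y ^ (k + 2) \<le> fact (k + 2) * exp y"
  by (simp add: pos_divide_le_eq mult.commute del: fact_Suc)
 then have "exp (- y) * y ^ k \<le> fact (k+2) * (1 / y)\<^sup>2"
  using y by (simp add: exp_minus field_simps power_add power2_eq_square del: fact_Suc)
 then show ?thesis using True by (simp add: flat_def y_def power_one_over field_simps)
qed (simp add: flat_def)

lemma flat_has_derivative:
 "(flat k has_real_derivative flat (k + 2) x - real k * flat (k + 1) x) (at x)"
proof (cases x "0::real" rule: linorder_cases)
 case less
 have "((\<lambda>x. 0) has_real_derivative 0) (at x)" by simp
 then have "(flat k has_real_derivative 0) (at x)"
  by (rule has_field_derivative_transform_within_open[where S = "{..<0}"])
   (use less in \<open>auto simp: flat_def\<close>)
 then show ?thesis using less by (simp add: flat_def)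
next
 case equal
 have "((\<lambda>h. (flat k (0 + h) - flat k 0) / h) \<longlongrightarrow> 0) (at 0)"
 proof (rule Lim_null_comparison)
  show "\<forall>\<^sub>F h in at 0. norm ((flat k (0 + h) - flat k 0) / h) \<le> fact (k+2) * \<bar>h\<bar>"
  proof (rule eventuallyI)
   fix h :: real
   show "norm ((flat k (0 + h) - flat k 0) / h) \<le> fact (k+2) * \<bar>h\<bar>"
   proof (cases "h = 0")
    case False
    have "\<bar>flat k h\<bar> \<le> fact (k+2) * \<bar>h\<bar> * \<bar>h\<bar>"
     using flat_bound[of k h] by (simp add: power2_eq_square mult.assoc abs_mult_self_eq)
    then show ?thesis using False by (simp add: flat_def[of _ 0] abs_divide divide_le_eq)
   qed simp
  qed
  show "((\<lambda>h. fact (k+2) * \<bar>h\<bar>) \<longlongrightarrow> 0) (at (0::real))"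
   by (auto intro!: tendsto_eq_intros)
 qed
 then show ?thesis using equal unfolding DERIV_def by (simp add: flat_def)
next
 case greater
 have "((\<lambda>x. exp (- (1 / x)) / x ^ k) has_real_derivative flat (k + 2) x - real k * flat (k + 1) x) (at x)"
  using greater
  by (auto intro!: derivative_eq_intros simp: flat_def field_simps power2_eq_square)
   (cases k; simp add: field_simps)
 then show ?thesis
  by (rule has_field_derivative_transform_within_open[where S = "{0<..}"])
   (use greater in \<open>auto simp: flat_def\<close>)
qed

lemma smooth_flat: "smooth (flat k)"
proof -
 have "Ck n (flat k)" for n
 proof (induction n arbitrary: k)
  case 0
  show ?case
   using flat_has_derivative by (auto intro!: continuous_at_imp_continuous_on DERIV_isCont)
 next
  case (Suc n)
  show ?case
  proof (rule Ck_SucI)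
   show "(flat k has_derivative (\<lambda>h. h * (flat (k + 2) x - real k * flat (k + 1) x))) (at x)" for x
    using flat_has_derivative[of k x] unfolding has_field_derivative_def
    by (rule has_derivative_eq_rhs) (simp add: fun_eq_iff)
   have "Ck n (\<lambda>x. flat (k + 2) x + (- real k) * flat (k + 1) x)"
    by (intro Ck_add Ck_mult Ck_const Suc)
   then show "Ck n (\<lambda>x. b * (flat (k + 2) x - real k * flat (k + 1) x))" if "b \<in> Basis" for b
    using that by simp
  qed
 qed
 then show ?thesis by (simp add: smooth_def)
qed

lemma flat_0_bounds: "0 \<le> flat 0 x" "flat 0 x \<le> 1" "x \<le> 0 ==> flat 0 x = 0" "x > 0 ==> flat 0 x > 0"
 by (auto simp: flat_def)

section \<open>Integration of periodic functions\<close>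

definition unit_cube :: "space set" where
 "unit_cube = {x. \<forall>i. 0 \<le> x $ i \<and> x $ i < 1}"

definition torus :: "space measure" where
 "torus = density lborel (indicator unit_cube)"

abbreviation nn_torus :: "(space \<Rightarrow> ennreal) \<Rightarrow> ennreal" (binder "nnT" 10)
 where "nn_torus \<equiv> nn_integral torus"

definition lattice :: "space set" where
 "lattice = {k. \<forall>i. k $ i \<in> \<int>}"

text \<open>Subtracting \<open>vfloor x\<close> moves \<open>x\<close> into the half open cell; this folds space onto the torus.\<close>

definition vfloor :: "space \<Rightarrow> space" where
 "vfloor x = (\<chi> i. of_int \<lfloor>x $ i\<rfloor>)"

lemma vfloor_lattice: "vfloor x \<in> lattice"
 by (simp add: vfloor_def lattice_def)

lemma minus_vfloor: "x - vfloor x \<in> unit_cube"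
 by (simp add: vfloor_def unit_cube_def) linarith

lemma lattice_uminus: "k \<in> lattice ==> - k \<in> lattice"
 by (simp add: lattice_def)

lemma unit_cube_lattice_unique:
 assumes "k \<in> lattice" "x - k \<in> unit_cube"
 shows "k = vfloor x"
proof -
 have "k $ i = of_int \<lfloor>x $ i\<rfloor>" for i
 proof -
  obtain m where m: "k $ i = of_int m" using assms(1) by (auto simp: lattice_def elim: Ints_cases)
  have "0 \<le> x $ i - k $ i" "x $ i - k $ i < 1" using assms(2) by (auto simp: unit_cube_def)
  then have "\<lfloor>x $ i\<rfloor> = m" using m by linarith
  then show ?thesis using m by simp
 qed
 then show ?thesis by (simp add: vfloor_def vec_eq_iff)
qed

lemma lattice_image: "lattice = (\<lambda>g::3\<Rightarrow>int. \<chi> i. of_int (g i)) ` UNIV"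
proof -
 have "\<exists>g::3\<Rightarrow>int. k = (\<chi> i. of_int (g i))" if "k \<in> lattice" for k
  using that by (intro exI[of _ "\<lambda>i. \<lfloor>k $ i\<rfloor>"]) (auto simp: lattice_def vec_eq_iff elim: Ints_cases)
 then show ?thesis unfolding lattice_def by fastforce
qed

lemma countable_lattice: "countable lattice"
 unfolding lattice_image by (rule countable_image) simp

lemma finite_lattice_bounded: "finite {k \<in> lattice. \<forall>i. \<bar>k $ i\<bar> \<le> real m}"
proof -
 have "finite (Pi\<^sub>E (UNIV::3 set) (\<lambda>_. {- int m..int m}))" by (rule finite_PiE) auto
 moreover have "{k \<in> lattice. \<forall>i. \<bar>k $ i\<bar> \<le> real m} \<subseteq> (\<lambda>g. \<chi> i. of_int (g i)) ` (Pi\<^sub>E (UNIV::3 set) (\<lambda>_. {- int m..int m}))"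
 proof
  fix k assume "k \<in> {k \<in> lattice. \<forall>i. \<bar>k $ i\<bar> \<le> real m}"
  then obtain g :: "3 \<Rightarrow> int" where g: "k = (\<chi> i. of_int (g i))" and b: "\<And>i. \<bar>k $ i\<bar> \<le> real m"
   by (auto simp: lattice_image)
  have "g i \<in> {- int m..int m}" for i using b[of i] unfolding g by auto
  then show "k \<in> (\<lambda>g. \<chi> i. of_int (g i)) ` (Pi\<^sub>E (UNIV::3 set) (\<lambda>_. {- int m..int m}))"
   using g by (auto simp: PiE_def)
 qed
 ultimately show ?thesis by (rule finite_subset[rotated, OF finite_imageI])
qed

lemma unit_cube_box: "box 0 One \<subseteq> unit_cube" "unit_cube \<subseteq> cell"
proof -
 have "(One::space) $ i = 1" for i
 proof -
  have "(One::space) \<bullet> axis i 1 = 1"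
   by (rule inner_sum_Basis) (auto simp: Basis_vec_def)
  then show ?thesis by (simp add: inner_axis)
 qed
 then show "box 0 One \<subseteq> unit_cube" "unit_cube \<subseteq> cell"
  by (auto simp: unit_cube_def cell_def mem_box_cart less_imp_le)
qed

lemma measurable_vec_nth[measurable]: "(\<lambda>x::space. x $ i) \<in> Borel"
 by (intro borel_measurable_continuous_onI continuous_intros)

lemma sets_unit_cube[measurable]: "unit_cube \<in> sets borel"
 unfolding unit_cube_def by measurable

lemma sets_cell[measurable]: "cell \<in> sets borel"
 by (simp add: cell_def)

lemma AE_cell: "AE x in lborel. x \<in> cell \<longleftrightarrow> x \<in> unit_cube"
proof -
 have "cbox 0 One - box 0 (One::space) \<in> null_sets lborel"
  using negligible_frontier_interval[of 0 "One::space"]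
  by (simp add: negligible_iff_null_sets null_sets_completion_iff)
 then have "AE x in lborel. x \<notin> cbox 0 One - box 0 (One::space)"
  by (rule AE_not_in)
 then show ?thesis
  by eventually_elim (use unit_cube_box in \<open>auto simp: cell_def\<close>)
qed

lemma sets_torus[simp, measurable_cong]: "sets torus = sets borel"
 by (simp add: torus_def)

lemma space_torus[simp]: "space torus = UNIV"
 by (simp add: torus_def)

lemma nn_integral_torus:
 "f \<in> Borel ==> (nnT x. f x) = (nnL x. indicator unit_cube x * f x)"
 unfolding torus_def by (subst nn_integral_density) auto

lemma torus_indicator_real: "torus = density lborel (\<lambda>x. ennreal (indicator unit_cube x))"
 unfolding torus_def by (rule arg_cong[where f = "density lborel"]) (auto simp: indicator_def fun_eq_iff)

lemma integral_torus:
 fixes f :: "space \<Rightarrow> 'b::{banach, second_countable_topology}"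
 assumes [measurable]: "f \<in> Borel"
 shows "(LINT x|torus. f x) = (LBINT x:cell. f x)"
  and "integrable torus f \<longleftrightarrow> set_integrable lborel cell f"
proof -
 have eq: "AE x in lborel. indicator unit_cube x *\<^sub>R f x = indicator cell x *\<^sub>R f x"
  using AE_cell by eventually_elim (auto simp: indicator_def)
 show "(LINT x|torus. f x) = (LBINT x:cell. f x)"
  unfolding torus_indicator_real set_lebesgue_integral_def
  by (subst integral_density) (auto intro!: integral_cong_AE eq)
 show "integrable torus f \<longleftrightarrow> set_integrable lborel cell f"
  unfolding torus_indicator_real set_integrable_def
  by (subst integrable_density) (simp_all add: integrable_cong_AE[OF _ _ eq])
qed

lemma emeasure_torus_UNIV: "emeasure torus UNIV = 1"
proof -
 have "emeasure torus UNIV = (nnL x. indicator unit_cube x)"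
  using nn_integral_torus[of "\<lambda>_. 1"] by simp
 also have "... = (nnL x. indicator cell x)"
  by (rule nn_integral_cong_AE) (use AE_cell in eventually_elim, auto simp: indicator_def)
 also have "... = emeasure lborel (cbox (0::space) One)"
  by (simp add: cell_def)
 also have "... = 1"
  by (subst emeasure_lborel_cbox) auto
 finally show ?thesis .
qed

lemma finite_measure_torus: "finite_measure torus"
 by (rule finite_measureI) (simp add: emeasure_torus_UNIV)

interpretation torus: finite_measure torus
 by (rule finite_measure_torus)

lemma measure_torus_UNIV[simp]: "measure torus UNIV = 1"
 by (simp add: measure_def emeasure_torus_UNIV)

lemma periodic_lattice:
 assumes f: "periodic f" and k: "k \<in> lattice"
 shows "f (x + k) = f x"
proof -
 have n: "f (x + real n *\<^sub>R axis i 1) = f x" for x i n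
 proof (induction n)
  case (Suc n)
  have "f (x + real (Suc n) *\<^sub>R axis i 1) = f ((x + real n *\<^sub>R axis i 1) + axis i 1)"
   by (simp add: scaleR_left_distrib add.assoc add.commute[of "axis i 1"])
  then show ?case using f Suc by (simp add: periodic_def)
 qed simp
 have z: "f (x + of_int m *\<^sub>R axis i 1) = f x" for x i m
 proof (cases "m \<ge> 0")
  case True
  then show ?thesis using n[of x "nat m" i] by simp
 next
  case False
  then show ?thesis using n[of "x + of_int m *\<^sub>R axis i 1" "nat (- m)" i] by simp
 qed
 obtain g :: "3 \<Rightarrow> int" where g: "k = (\<chi> i. of_int (g i))"
  using k by (auto simp: lattice_image)
 have "f (x + (\<Sum>i\<in>A. of_int (g i) *\<^sub>R axis i 1)) = f x" if "finite A" for A x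
  using that
 proof (induction A arbitrary: x)
  case (insert i A)
  have "f (x + (\<Sum>i\<in>insert i A. of_int (g i) *\<^sub>R axis i 1))
    = f ((x + of_int (g i) *\<^sub>R axis i 1) + (\<Sum>i\<in>A. of_int (g i) *\<^sub>R axis i 1))"
   using insert by (simp add: add.assoc)
  then show ?case by (simp add: insert.IH z)
 qed simp
 moreover have "k = (\<Sum>i\<in>UNIV. of_int (g i) *\<^sub>R axis i 1)"
  using basis_expansion[of k] by (simp add: g scalar_mult_eq_scaleR)
 ultimately show ?thesis by simp
qed

lemma periodic_shift: "periodic f ==> periodic (\<lambda>x. f (x + a))"
proof -
 assume f: "periodic f"
 have "f (x + axis i 1 + a) = f (x + a)" for x i
  using f[unfolded periodic_def, rule_format, of "x + a" i] by (simp add: algebra_simps)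
 then show ?thesis by (simp add: periodic_def)
qed

lemma periodic_reflect: "periodic f ==> periodic (\<lambda>x. f (a - x))"
proof -
 assume f: "periodic f"
 have "f (a - (x + axis i 1)) = f (a - x)" for x i
  using f[unfolded periodic_def, rule_format, of "a - (x + axis i 1)" i] by (simp add: algebra_simps)
 then show ?thesis by (simp add: periodic_def)
qed

lemma periodic_compose: "periodic f ==> periodic (\<lambda>x. h (f x))"
 by (simp add: periodic_def)

lemma periodic_compose2: "periodic f ==> periodic g ==> periodic (\<lambda>x. h (f x) (g x))"
 by (simp add: periodic_def)

text \<open>Every Borel set is cut into pieces along the lattice translates of the unit cube.\<close>

lemma nn_integral_unfold:
 assumes g: "periodic g" and [measurable]: "g \<in> Borel" "S \<in> sets borel"
 shows "(nnL x. indicator S x * g x)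
  = (nnT x. g x * (\<integral>\<^sup>+k. indicator S (x + k) \<partial>count_space lattice))"
proof -
 have one: "(\<integral>\<^sup>+k. indicator unit_cube (x - k) \<partial>count_space lattice) = (1::ennreal)" for x
 proof -
  have "indicator unit_cube (x - k) = indicator {vfloor x} k" if "k \<in> lattice" for k
  proof -
   have "x - k \<in> unit_cube \<longleftrightarrow> k = vfloor x"
    using unit_cube_lattice_unique[OF that, of x] minus_vfloor[of x] by blast
   then show ?thesis by (simp add: indicator_def)
  qed
  then have "(\<integral>\<^sup>+k. indicator unit_cube (x - k) \<partial>count_space lattice)
    = (\<integral>\<^sup>+k. indicator {vfloor x} k \<partial>count_space lattice)"
   by (intro nn_integral_cong) auto
  then show ?thesis using vfloor_lattice by simp
 qed
 have m: "(\<lambda>x. h (x + k)) \<in> Borel" if "h \<in> Borel" for k and h :: "space \<Rightarrow> ennreal"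
  using that by measurable
 have "(nnL x. indicator S x * g x)
   = (nnL x. (\<integral>\<^sup>+k. indicator S x * g x * indicator unit_cube (x - k) \<partial>count_space lattice))"
  by (simp add: nn_integral_cmult one)
 also have "... = (\<integral>\<^sup>+k. (nnL x. indicator S x * g x * indicator unit_cube (x - k)) \<partial>count_space lattice)"
  by (rule nn_integral_count_space_nn_integral) (auto simp: countable_lattice)
 also have "... = (\<integral>\<^sup>+k. (nnL x. indicator S (x + k) * g x * indicator unit_cube x) \<partial>count_space lattice)"
 proof (rule nn_integral_cong)
  fix k assume "k \<in> space (count_space lattice)"
  then have k: "k \<in> lattice" by simp
  have "(nnL x. indicator S x * g x * indicator unit_cube (x - k))
    = (nnL x. indicator S (k + x) * g (k + x) * indicator unit_cube ((k + x) - k))"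
   by (subst lborel_distr_plus[of k, symmetric], subst nn_integral_distr) auto
  then show "(nnL x. indicator S x * g x * indicator unit_cube (x - k))
    = (nnL x. indicator S (x + k) * g x * indicator unit_cube x)"
   using periodic_lattice[OF g k] by (simp add: add.commute[of k])
 qed
 also have "... = (nnL x. (\<integral>\<^sup>+k. indicator S (x + k) * g x * indicator unit_cube x \<partial>count_space lattice))"
  by (rule nn_integral_count_space_nn_integral[symmetric]) (auto simp: countable_lattice)
 also have "... = (nnL x. indicator unit_cube x * (g x * (\<integral>\<^sup>+k. indicator S (x + k) \<partial>count_space lattice)))"
  by (intro nn_integral_cong) (simp add: mult.assoc nn_integral_multc, simp add: mult_ac)
 also have "... = (nnT x. g x * (\<integral>\<^sup>+k. indicator S (x + k) \<partial>count_space lattice))"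
 proof (rule nn_integral_torus[symmetric])
  have "(\<lambda>x. \<integral>\<^sup>+k. indicator S (x + k) \<partial>count_space lattice) \<in> Borel"
  proof -
   interpret L: sigma_finite_measure "count_space lattice"
    using countable_lattice by (rule sigma_finite_measure_count_space_countable)
   have "(\<lambda>z. indicator S (snd z + fst z) :: ennreal)
     \<in> borel_measurable (count_space lattice \<Otimes>\<^sub>M borel)"
    by (rule measurable_pair_measure_countable1[OF countable_lattice]) auto
   then have "(\<lambda>(x, k). indicator S (x + k) :: ennreal)
     \<in> borel_measurable (borel \<Otimes>\<^sub>M count_space lattice)"
    by (rule measurable_compose[OF measurable_pair_swap', THEN measurable_cong[THEN iffD1, rotated]]) auto
   then show ?thesis by (rule L.borel_measurable_nn_integral)
  qed
  then show "(\<lambda>x. g x * (\<integral>\<^sup>+k. indicator S (x + k) \<partial>count_space lattice)) \<in> Borel"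
   by measurable
 qed
 finally show ?thesis .
qed

lemma nn_integral_torus_affine:
 assumes g: "periodic g" and [measurable]: "g \<in> Borel" and c: "c = 1 \<or> c = - 1"
 shows "(nnT x. g (a + c *\<^sub>R x)) = (nnT x. g x)"
proof -
 have cc: "c *\<^sub>R (c *\<^sub>R x) = x" for x :: space using c by auto
 define S where "S = {y. c *\<^sub>R (y - a) \<in> unit_cube}"
 have [measurable]: "S \<in> sets borel"
  unfolding S_def by measurable
 have "(nnT x. g (a + c *\<^sub>R x)) = (nnL x. indicator unit_cube x * g (a + c *\<^sub>R x))"
  by (rule nn_integral_torus) measurable
 also have "... = (nnL x. indicator S (a + c *\<^sub>R x) * g (a + c *\<^sub>R x))"
 proof -
  have "indicator unit_cube x = (indicator S (a + c *\<^sub>R x) :: ennreal)" for x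
   using cc[of x] by (simp add: S_def indicator_def del: scaleR_scaleR)
  then show ?thesis by simp
 qed
 also have "... = (nnL x. indicator S x * g x)"
 proof -
  have "lborel = density (distr lborel borel (\<lambda>x::space. a + c *\<^sub>R x)) (\<lambda>_. \<bar>c\<bar>^DIM(space))"
   by (rule lborel_affine) (use c in auto)
  also have "... = distr lborel borel (\<lambda>x::space. a + c *\<^sub>R x)"
   using c by (auto simp: density_1)
  finally have "(nnL x. indicator S x * g x) = (\<integral>\<^sup>+x. indicator S x * g x \<partial>distr lborel borel (\<lambda>x::space. a + c *\<^sub>R x))"
   by simp
  then show ?thesis by (subst (asm) nn_integral_distr) auto
 qed
 also have "... = (nnT x. g x * (\<integral>\<^sup>+k. indicator S (x + k) \<partial>count_space lattice))"
  by (rule nn_integral_unfold[OF g]) auto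
 also have "... = (nnT x. g x)"
 proof (rule nn_integral_cong)
  fix x :: space
  define k0 where "k0 = - (c *\<^sub>R vfloor (c *\<^sub>R (x - a)))"
  have k0: "k0 \<in> lattice" unfolding k0_def using c vfloor_lattice lattice_uminus by auto
  have "indicator S (x + k) = indicator {k0} k" if "k \<in> lattice" for k
  proof -
   have "x + k \<in> S \<longleftrightarrow> c *\<^sub>R (x - a) - (- (c *\<^sub>R k)) \<in> unit_cube"
    by (simp add: S_def algebra_simps)
   also have "... \<longleftrightarrow> - (c *\<^sub>R k) = vfloor (c *\<^sub>R (x - a))"
   proof
    have "- (c *\<^sub>R k) \<in> lattice" using that c lattice_uminus by auto
    then show "c *\<^sub>R (x - a) - (- (c *\<^sub>R k)) \<in> unit_cube ==> - (c *\<^sub>R k) = vfloor (c *\<^sub>R (x - a))"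
     by (rule unit_cube_lattice_unique)
    show "- (c *\<^sub>R k) = vfloor (c *\<^sub>R (x - a)) ==> c *\<^sub>R (x - a) - (- (c *\<^sub>R k)) \<in> unit_cube"
     using minus_vfloor[of "c *\<^sub>R (x - a)"] by metis
   qed
   also have "... \<longleftrightarrow> k = k0" unfolding k0_def using c by (auto dest: arg_cong[where f = uminus])
   finally show ?thesis by (simp add: indicator_def)
  qed
  then have "(\<integral>\<^sup>+k. indicator S (x + k) \<partial>count_space lattice) = (\<integral>\<^sup>+k. indicator {k0} k \<partial>count_space lattice)"
   by (intro nn_integral_cong) auto
  then show "g x * (\<integral>\<^sup>+k. indicator S (x + k) \<partial>count_space lattice) = g x"
   using k0 by simp
 qed
 finally show ?thesis .
qed

lemma periodic_vfrac: "periodic f ==> f (x - vfloor x) = f x"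
 using periodic_lattice[OF _ lattice_uminus[OF vfloor_lattice]] by fastforce

lemma vfrac_periodic: "periodic (\<lambda>x. x - vfloor x)"
proof -
 have "vfloor (x + axis i 1) = vfloor x + axis i 1" for x i
  by (auto simp: vfloor_def vec_eq_iff axis_def)
 then show ?thesis by (simp add: periodic_def)
qed

lemma measurable_vfrac[measurable]: "(\<lambda>x. x - vfloor x) \<in> Borel"
proof -
 have *: "vfloor x = (\<Sum>i\<in>UNIV. of_int \<lfloor>x $ i\<rfloor> *\<^sub>R axis i 1)" for x
  using basis_expansion[of "vfloor x"] by (simp add: vfloor_def scalar_mult_eq_scaleR)
 show ?thesis unfolding * by measurable
qed

lemma distr_torus_affine:
 assumes c: "c = 1 \<or> c = - 1"
 shows "distr torus torus (\<lambda>x. (a + c *\<^sub>R x) - vfloor (a + c *\<^sub>R x)) = torus"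
proof (rule measure_eqI)
 let ?\<tau> = "\<lambda>x. (a + c *\<^sub>R x) - vfloor (a + c *\<^sub>R x)"
 have [measurable]: "?\<tau> \<in> measurable borel borel"
  by (rule measurable_compose[OF _ measurable_vfrac]) measurable
 then have [measurable]: "?\<tau> \<in> measurable torus torus"
  by (simp add: measurable_cong_sets[OF sets_torus sets_torus])
 fix A assume "A \<in> sets (distr torus torus ?\<tau>)"
 then have A[measurable]: "A \<in> sets borel" by simp
 let ?g = "\<lambda>x. indicator A (x - vfloor x) :: ennreal"
 have [measurable]: "?g \<in> Borel"
  by (rule measurable_compose[OF measurable_vfrac]) measurable
 have "emeasure (distr torus torus ?\<tau>) A = (\<integral>\<^sup>+x. indicator A x \<partial>distr torus torus ?\<tau>)"
  using A by (subst nn_integral_indicator) auto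
 also have "... = (nnT x. ?g (a + c *\<^sub>R x))"
  using A by (subst nn_integral_distr) auto
 also have "... = (nnT x. ?g x)"
  by (rule nn_integral_torus_affine[OF periodic_compose[OF vfrac_periodic] _ c]) measurable
 also have "... = (nnT x. indicator A x)"
 proof -
  have "vfloor x = 0" if "x \<in> unit_cube" for x
   using unit_cube_lattice_unique[of 0 x] that by (simp add: lattice_def)
  then have "indicator unit_cube x * ?g x = indicator unit_cube x * indicator A x" for x
   by (auto simp: indicator_def)
  then show ?thesis by (subst (1 2) nn_integral_torus) auto
 qed
 also have "... = emeasure torus A" using A by (subst nn_integral_indicator) auto
 finally show "emeasure (distr torus torus ?\<tau>) A = emeasure torus A" .
qed simp

lemma integral_torus_affine:
 fixes f :: "space \<Rightarrow> 'b::{banach, second_countable_topology}"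
 assumes f: "periodic f" and [measurable]: "f \<in> Borel" and c: "c = 1 \<or> c = - 1"
 shows "(LINT x|torus. f (a + c *\<^sub>R x)) = (LINT x|torus. f x)"
  and "integrable torus (\<lambda>x. f (a + c *\<^sub>R x)) \<longleftrightarrow> integrable torus f"
proof -
 let ?\<tau> = "\<lambda>x. (a + c *\<^sub>R x) - vfloor (a + c *\<^sub>R x)"
 have "?\<tau> \<in> measurable borel borel"
  by (rule measurable_compose[OF _ measurable_vfrac]) measurable
 then have m[measurable]: "?\<tau> \<in> measurable torus torus"
  by (simp add: measurable_cong_sets[OF sets_torus sets_torus])
 have mf: "f \<in> borel_measurable torus" by measurable
 show "(LINT x|torus. f (a + c *\<^sub>R x)) = (LINT x|torus. f x)"
  using integral_distr[OF m mf] by (simp add: distr_torus_affine[OF c] periodic_vfrac[OF f])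
 show "integrable torus (\<lambda>x. f (a + c *\<^sub>R x)) \<longleftrightarrow> integrable torus f"
  using integrable_distr_eq[OF m mf] by (simp add: distr_torus_affine[OF c] periodic_vfrac[OF f])
qed

lemma integral_torus_shift:
 fixes f :: "space \<Rightarrow> 'b::{banach, second_countable_topology}"
 assumes "periodic f" and "f \<in> Borel"
 shows "(LINT x|torus. f (x + a)) = (LINT x|torus. f x)"
  and "integrable torus (\<lambda>x. f (x + a)) \<longleftrightarrow> integrable torus f"
 using integral_torus_affine[OF assms, of 1 a] by (simp_all add: add.commute)

lemma nn_integral_torus_shift:
 assumes "periodic g" and "g \<in> Borel"
 shows "(nnT x. g (x + a)) = (nnT x. g x)"
 using nn_integral_torus_affine[OF assms, of 1 a] by (simp add: add.commute)

lemma nn_integral_torus_reflect: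
 assumes "periodic g" and "g \<in> Borel"
 shows "(nnT x. g (a - x)) = (nnT x. g x)"
 using nn_integral_torus_affine[OF assms, of "-1" a] by simp

lemma nn_integral_periodic_bounded_set:
 assumes [measurable]: "S \<in> sets borel" and "bounded S"
 obtains C :: real where "C \<ge> 0"
  "\<And>g. periodic g ==> g \<in> Borel ==>
   (nnL x. indicator S x * g x) \<le> ennreal C * (nnT x. g x)"
proof -
 obtain R where R: "\<And>x. x \<in> S ==> norm x \<le> R" using assms(2) by (auto simp: bounded_iff)
 obtain m :: nat where m: "R + 1 \<le> real m" using real_arch_simple by blast
 define J where "J = {k \<in> lattice. \<forall>i. \<bar>k $ i\<bar> \<le> real m}"
 have J: "finite J" unfolding J_def by (rule finite_lattice_bounded)
 have le: "(\<integral>\<^sup>+k. indicator S (x + k) \<partial>count_space lattice) \<le> ennreal (real (card J))" if "x \<in> unit_cube" for x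
 proof -
  have "(\<integral>\<^sup>+k. indicator S (x + k) \<partial>count_space lattice) \<le> (\<integral>\<^sup>+k. indicator J k \<partial>count_space lattice)"
  proof (rule nn_integral_mono)
   fix k assume "k \<in> space (count_space lattice)"
   moreover have "\<bar>k $ i\<bar> \<le> real m" if "x + k \<in> S" for i
   proof -
    have "\<bar>(x + k) $ i\<bar> \<le> R" using R[OF that] component_le_norm_cart[of "x + k" i] by linarith
    moreover have "0 \<le> x $ i" "x $ i < 1" using \<open>x \<in> unit_cube\<close> by (auto simp: unit_cube_def)
    ultimately show ?thesis using m by simp
   qed
   ultimately show "indicator S (x + k) \<le> (indicator J k :: ennreal)"
    by (auto simp: indicator_def J_def)
  qed
  also have "... = emeasure (count_space lattice) J"
   by (rule nn_integral_indicator) (auto simp: J_def)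
  also have "... = ennreal (real (card J))"
   using J by (subst emeasure_count_space_finite) (auto simp: J_def ennreal_of_nat_eq_real_of_nat)
  finally show ?thesis .
 qed
 show thesis
 proof (rule that[of "real (card J)"])
  fix g :: "space \<Rightarrow> ennreal"
  assume g: "periodic g" and [measurable]: "g \<in> Borel"
  have AE: "AE x in torus. x \<in> unit_cube"
   unfolding torus_def by (subst AE_density) (auto simp: indicator_def)
  have "(nnL x. indicator S x * g x)
   = (nnT x. g x * (\<integral>\<^sup>+k. indicator S (x + k) \<partial>count_space lattice))"
   by (rule nn_integral_unfold[OF g]) auto
  also have "... \<le> (nnT x. ennreal (real (card J)) * g x)"
   by (rule nn_integral_mono_AE) (use AE in eventually_elim, simp add: mult.commute[of "g _"] le mult_right_mono)
  also have "... = ennreal (real (card J)) * (nnT x. g x)"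
   by (rule nn_integral_cmult) measurable
  finally show "(nnL x. indicator S x * g x) \<le> ennreal (real (card J)) * (nnT x. g x)" .
 qed simp
qed

section \<open>Convolution of periodic functions with smooth compactly supported kernels\<close>

definition bump_kernel :: "(space \<Rightarrow> real) \<Rightarrow> bool" where
 "bump_kernel K \<longleftrightarrow> smooth K \<and> bounded {x. K x \<noteq> 0}"

definition torus_L1 :: "(space \<Rightarrow> 'b::euclidean_space) \<Rightarrow> bool" where
 "torus_L1 f \<longleftrightarrow> periodic f \<and> f \<in> Borel \<and> integrable torus f"

text \<open>A kernel on space acts on periodic functions by convolution over all of space; no periodisation of the kernel is required.\<close>

definition conv :: "(space \<Rightarrow> real) \<Rightarrow> (space \<Rightarrow> 'b::euclidean_space) \<Rightarrow> space \<Rightarrow> 'b" where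
 "conv K f x = (LBINT y. K (x - y) *\<^sub>R f y)"

lemma torus_L1D:
 assumes "torus_L1 f"
 shows "periodic f" "f \<in> Borel" "integrable torus f"
 using assms by (auto simp: torus_L1_def)

lemma kernel_smooth: "bump_kernel K ==> smooth K"
 by (simp add: bump_kernel_def)

lemma kernel_continuous: "bump_kernel K ==> continuous_on UNIV K"
 by (simp add: kernel_smooth smooth_continuous)

lemma kernel_measurable: "bump_kernel K ==> K \<in> Borel"
 by (simp add: kernel_continuous borel_measurable_continuous_onI)

lemma kernel_partial:
 assumes "bump_kernel K" and b: "b \<in> Basis"
 shows "bump_kernel (partial b K)"
proof -
 have sm: "smooth K" and bd: "bounded {x. K x \<noteq> 0}" using assms by (auto simp: bump_kernel_def)
 have "partial b K x = 0" if "x \<notin> closure {x. K x \<noteq> 0}" for x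
 proof -
  have "((\<lambda>_. 0) has_derivative (\<lambda>_. 0)) (at x)" by simp
  then have "(K has_derivative (\<lambda>_. 0)) (at x)"
   by (rule has_derivative_transform_within_open[where s = "- closure {x. K x \<noteq> 0}"])
    (use that closure_subset[of "{x. K x \<noteq> 0}"] in auto)
  then show ?thesis by (simp add: partial_eq)
 qed
 then have "{x. partial b K x \<noteq> 0} \<subseteq> closure {x. K x \<noteq> 0}" by auto
 then have "bounded {x. partial b K x \<noteq> 0}"
  using bd bounded_closure bounded_subset by blast
 then show ?thesis using sm b by (simp add: bump_kernel_def smooth_partial)
qed

lemma kernel_bound:
 assumes "bump_kernel K"
 obtains R M where "R > 0" "M > 0" "\<And>x. \<bar>K x\<bar> \<le> M * indicator (cball 0 R) x"
proof -
 obtain R where R: "R > 0" "\<And>x. K x \<noteq> 0 ==> norm x \<le> R"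
  using assms unfolding bump_kernel_def bounded_pos by auto
 have "compact (K ` cball 0 R)"
  by (intro compact_continuous_image continuous_on_subset[OF kernel_continuous[OF assms]]) auto
 then obtain M where M: "M > 0" "\<And>y. y \<in> K ` cball 0 R ==> norm y \<le> M"
  using compact_imp_bounded bounded_pos by metis
 have "\<bar>K x\<bar> \<le> M * indicator (cball 0 R) x" for x
 proof (cases "x \<in> cball 0 R")
  case True
  then show ?thesis using M(2)[of "K x"] by auto
 next
  case False
  then have "K x = 0" using R(2)[of x] by auto
  then show ?thesis using M(1) by simp
 qed
 then show thesis using R(1) M(1) that by blast
qed

lemma kernel_lipschitz:
 assumes "bump_kernel K"
 obtains L where "L > 0" "\<And>x y. \<bar>K x - K y\<bar> \<le> L * norm (x - y)"
  "\<And>x h. \<bar>frechet_derivative K (at x) h\<bar> \<le> L * norm h"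
proof -
 have "\<exists>M > 0. \<forall>x. \<bar>partial b K x\<bar> \<le> M" if b: "b \<in> Basis" for b
 proof -
  obtain R M where "R > 0" "M > 0" "\<And>x. \<bar>partial b K x\<bar> \<le> M * indicator (cball 0 R) x"
   using kernel_bound[OF kernel_partial[OF assms b]] by blast
  moreover have "M * indicator (cball 0 R) x \<le> M" for x :: space
   using \<open>M > 0\<close> by (auto simp: indicator_def)
  ultimately show ?thesis by (meson order_trans)
 qed
 then obtain M where M: "\<And>b. b \<in> Basis ==> M b > 0 \<and> (\<forall>x. \<bar>partial b K x\<bar> \<le> M b)" by metis
 define L where "L = (\<Sum>b\<in>(Basis::space set). M b)"
 have d: "K differentiable at x" for x using kernel_smooth[OF assms] by (rule smooth_differentiable)
 have fr: "\<bar>frechet_derivative K (at x) h\<bar> \<le> L * norm h" for x h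
 proof -
  have "\<bar>frechet_derivative K (at x) h\<bar> \<le> (\<Sum>b\<in>Basis. \<bar>(h \<bullet> b) *\<^sub>R partial b K x\<bar>)"
   unfolding frechet_derivative_sum_partial[OF d] by (rule sum_abs)
  also have "... \<le> (\<Sum>b\<in>Basis. norm h * M b)"
   using M by (intro sum_mono) (auto simp: abs_mult intro!: mult_mono Basis_le_norm)
  finally show ?thesis by (simp add: L_def sum_distrib_left mult.commute)
 qed
 have "L > 0" unfolding L_def using M by (intro sum_pos) auto
 moreover have "\<bar>K x - K y\<bar> \<le> L * norm (x - y)" for x y
 proof -
  have "norm (K x - K y) \<le> L * norm (x - y)"
  proof (rule differentiable_bound[where S = UNIV and f' = "\<lambda>x. frechet_derivative K (at x)"])
   show "(K has_derivative frechet_derivative K (at x)) (at x within UNIV)" for x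
    using smooth_has_derivative[OF kernel_smooth[OF assms]] by simp
   show "onorm (frechet_derivative K (at x)) \<le> L" for x
    by (rule onorm_le) (use fr in auto)
  qed auto
  then show ?thesis by simp
 qed
 ultimately show thesis using fr that by blast
qed

lemma torus_L1_locally_integrable:
 fixes f :: "space \<Rightarrow> 'b::euclidean_space"
 assumes f: "torus_L1 f" and S[measurable]: "S \<in> sets borel" and "bounded S"
 shows "integrable lborel (\<lambda>x. indicator S x *\<^sub>R f x)"
proof -
 note [measurable] = torus_L1D(2)[OF f]
 obtain C where C: "C \<ge> 0" "\<And>g. periodic g ==> g \<in> Borel ==>
   (nnL x. indicator S x * g x) \<le> ennreal C * (nnT x. g x)"
  using nn_integral_periodic_bounded_set[OF S \<open>bounded S\<close>] by blast
 have "(nnL x. norm (indicator S x *\<^sub>R f x)) = (nnL x. indicator S x * ennreal (norm (f x)))"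
  by (intro nn_integral_cong) (auto simp: indicator_def)
 also have "... \<le> ennreal C * (nnT x. norm (f x))"
  by (rule C(2)[OF periodic_compose[OF torus_L1D(1)[OF f]]]) measurable
 also have "... < \<infinity>"
  using torus_L1D(3)[OF f] by (simp add: integrable_iff_bounded ennreal_mult_less_top)
 finally show ?thesis by (intro integrableI_bounded) measurable
qed

lemma conv_integrable:
 fixes f :: "space \<Rightarrow> 'b::euclidean_space"
 assumes K: "bump_kernel K" and f: "torus_L1 f"
 shows "integrable lborel (\<lambda>y. K (x - y) *\<^sub>R f y)"
proof -
 note [measurable] = torus_L1D(2)[OF f] kernel_measurable[OF K]
 obtain R M where RM: "R > 0" "M > 0" "\<And>x. \<bar>K x\<bar> \<le> M * indicator (cball 0 R) x"
  using kernel_bound[OF K] by blast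
 have "integrable lborel (\<lambda>y. M *\<^sub>R (indicator (cball x R) y *\<^sub>R f y))"
  by (intro integrable_scaleR_right torus_L1_locally_integrable[OF f]) auto
 then show ?thesis
 proof (rule L_integrable_bound)
  show "AE y in lborel. norm (K (x - y) *\<^sub>R f y) \<le> norm (M *\<^sub>R (indicator (cball x R) y *\<^sub>R f y))"
  proof (rule AE_I2)
   fix y
   have "\<bar>K (x - y)\<bar> \<le> M * indicator (cball x R) y"
    using RM(3)[of "x - y"] by (simp add: indicator_def dist_norm norm_minus_commute)
   then show "norm (K (x - y) *\<^sub>R f y) \<le> norm (M *\<^sub>R (indicator (cball x R) y *\<^sub>R f y))"
    using RM(2) by (simp add: mult_right_mono mult.assoc[symmetric])
  qed
 qed measurable
qed

lemma lborel_reflect: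
 fixes g :: "space \<Rightarrow> 'b::euclidean_space"
 assumes [measurable]: "g \<in> Borel"
 shows "(LBINT y. g (x - y)) = (LBINT y. g y)"
  and "integrable lborel (\<lambda>y. g (x - y)) \<longleftrightarrow> integrable lborel g"
proof -
 have "lborel = density (distr lborel borel (\<lambda>y::space. x + (- 1) *\<^sub>R y)) (\<lambda>_. ennreal (\<bar>- 1\<bar>^DIM(space)))"
  by (rule lborel_affine) auto
 also have "... = distr lborel borel (\<lambda>y::space. x - y)"
  by (simp add: density_1)
 finally have eq: "(lborel :: space measure) = distr lborel borel (\<lambda>y::space. x - y)" .
 have m: "(\<lambda>y::space. x - y) \<in> measurable lborel borel" by simp
 show "(LBINT y. g (x - y)) = (LBINT y. g y)"
  using integral_distr[OF m assms] by (simp add: eq[symmetric])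
 show "integrable lborel (\<lambda>y. g (x - y)) \<longleftrightarrow> integrable lborel g"
  using integrable_distr_eq[OF m assms] by (simp add: eq[symmetric])
qed

lemma conv_reflect:
 fixes f :: "space \<Rightarrow> 'b::euclidean_space"
 assumes "K \<in> Borel" "f \<in> Borel"
 shows "conv K f x = (LBINT z. K z *\<^sub>R f (x - z))"
proof -
 note [measurable] = assms
 have "(LBINT z. K (x - (x - z)) *\<^sub>R f (x - z)) = (LBINT y. K (x - y) *\<^sub>R f y)"
  by (rule lborel_reflect) measurable
 then show ?thesis by (simp add: conv_def)
qed

lemma conv_periodic:
 fixes f :: "space \<Rightarrow> 'b::euclidean_space"
 assumes K: "bump_kernel K" and f: "torus_L1 f"
 shows "periodic (conv K f)"
proof -
 have "f (x + axis i 1 - z) = f (x - z)" for x i z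
  using torus_L1D(1)[OF f, unfolded periodic_def, rule_format, of "x - z" i] by (simp add: algebra_simps)
 then show ?thesis
  by (simp add: periodic_def conv_reflect[OF kernel_measurable[OF K] torus_L1D(2)[OF f]])
qed

lemma conv_has_derivative:
 fixes f :: "space \<Rightarrow> 'b::euclidean_space"
 assumes K: "bump_kernel K" and f: "torus_L1 f"
 shows "(conv K f has_derivative (\<lambda>h. \<Sum>b\<in>Basis. (h \<bullet> b) *\<^sub>R conv (partial b K) f x)) (at x)"
proof -
 note [measurable] = torus_L1D(2)[OF f] kernel_measurable[OF K]
 have [measurable]: "partial b K \<in> Borel" if "b \<in> Basis" for b
  by (rule kernel_measurable[OF kernel_partial[OF K that]])
 let ?D = "\<lambda>h. \<Sum>b\<in>Basis. (h \<bullet> b) *\<^sub>R conv (partial b K) f x"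
 obtain R M where RM: "R > 0" "M > 0" "\<And>x. \<bar>K x\<bar> \<le> M * indicator (cball 0 R) x"
  using kernel_bound[OF K] by blast
 obtain L where L: "L > 0" "\<And>x y. \<bar>K x - K y\<bar> \<le> L * norm (x - y)"
  "\<And>x h. \<bar>frechet_derivative K (at x) h\<bar> \<le> L * norm h"
  using kernel_lipschitz[OF K] by blast
 have d: "K differentiable at x" for x using kernel_smooth[OF K] by (rule smooth_differentiable)
 define r where "r h y = K (x + h - y) - K (x - y) - frechet_derivative K (at (x - y)) h" for h y
 have r_sum: "r h y = K (x + h - y) - K (x - y) - (\<Sum>b\<in>Basis. (h \<bullet> b) *\<^sub>R partial b K (x - y))" for h y
  unfolding r_def frechet_derivative_sum_partial[OF d] ..
 have [measurable]: "r h \<in> Borel" for h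
  unfolding r_sum by measurable
 have r_int: "conv K f (x + h) - conv K f x - ?D h = (LBINT y. r h y *\<^sub>R f y)"
  "integrable lborel (\<lambda>y. r h y *\<^sub>R f y)" for h
 proof -
  note I = conv_integrable[OF K f] conv_integrable[OF kernel_partial[OF K] f]
  have *: "(\<lambda>y. r h y *\<^sub>R f y) = (\<lambda>y. K (x + h - y) *\<^sub>R f y - K (x - y) *\<^sub>R f y
    - (\<Sum>b\<in>Basis. (h \<bullet> b) *\<^sub>R (partial b K (x - y) *\<^sub>R f y)))"
   by (simp add: r_sum scaleR_diff_left scaleR_sum_left fun_eq_iff)
  show "integrable lborel (\<lambda>y. r h y *\<^sub>R f y)"
   unfolding * by (intro L_integrable_diff I L_integrable_sum integrable_scaleR_right)
  show "conv K f (x + h) - conv K f x - ?D h = (LBINT y. r h y *\<^sub>R f y)"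
   unfolding * conv_def
   by (subst L_integral_diff L_integral_sum,
     (intro L_integrable_diff I L_integrable_sum integrable_scaleR_right; assumption)+)+
    (simp only: integral_scaleR_right)
 qed
 have r_bound: "norm (r h y *\<^sub>R f y) / norm h \<le> 2 * L * norm (indicator (cball x (R + 1)) y *\<^sub>R f y)"
  if h: "h \<noteq> 0" "norm h < 1" for h y
 proof (cases "y \<in> cball x (R + 1)")
  case True
  have "\<bar>r h y\<bar> \<le> \<bar>K (x + h - y) - K (x - y)\<bar> + \<bar>frechet_derivative K (at (x - y)) h\<bar>"
   unfolding r_def by simp
  also have "... \<le> L * norm h + L * norm h"
   using L(2)[of "x + h - y" "x - y"] L(3)[of "x - y" h] by (intro add_mono) (auto simp: algebra_simps)
  finally have "\<bar>r h y\<bar> * norm (f y) \<le> 2 * L * norm h * norm (f y)"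
   by (intro mult_right_mono) auto
  then show ?thesis using True h by (simp add: field_simps)
 next
  case False
  have z: "K w = 0" if "norm w > R" for w using RM(3)[of w] that by (simp add: indicator_def)
  have n: "norm (x - y) > R + 1" using False by (simp add: dist_norm)
  have "norm (x + h - y) > R"
   using norm_triangle_ineq2[of "x - y" "- h"] n h by (simp add: algebra_simps)
  moreover have "frechet_derivative K (at (x - y)) = (\<lambda>_. 0)"
  proof -
   have "((\<lambda>_. 0) has_derivative (\<lambda>_. 0)) (at (x - y))" by simp
   then have "(K has_derivative (\<lambda>_. 0)) (at (x - y))"
    by (rule has_derivative_transform_within_open[where s = "- cball 0 R"])
     (use z n in \<open>auto simp: dist_norm norm_minus_commute\<close>)
   then show ?thesis by (metis frechet_derivative_at)
  qed
  ultimately have "r h y = 0" using z n by (simp add: r_def)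
  then show ?thesis using L by simp
 qed
 have "((\<lambda>h. norm (conv K f (x + h) - conv K f x - ?D h) / norm h) \<longlongrightarrow> 0) (at 0 within ball 0 1)"
  unfolding tendsto_at_iff_sequentially o_def
 proof (intro allI impI)
  fix h :: "nat \<Rightarrow> space"
  assume hb: "\<forall>n. h n \<in> ball 0 1 - {0}" and h0: "h \<longlonglongrightarrow> 0"
  have "(\<lambda>n. LBINT y. norm (r (h n) y *\<^sub>R f y) / norm (h n)) \<longlonglongrightarrow> (LBINT y::space. 0)"
  proof (rule integral_dominated_convergence[where w = "\<lambda>y. 2 * L * norm (indicator (cball x (R + 1)) y *\<^sub>R f y)"])
   show "integrable lborel (\<lambda>y. 2 * L * norm (indicator (cball x (R + 1)) y *\<^sub>R f y))"
    by (intro integrable_mult_right integrable_norm torus_L1_locally_integrable[OF f]) auto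
   show "AE y in lborel. norm (norm (r (h n) y *\<^sub>R f y) / norm (h n)) \<le> 2 * L * norm (indicator (cball x (R + 1)) y *\<^sub>R f y)" for n
    using r_bound[of "h n"] hb by (auto intro!: AE_I2)
   show "AE y in lborel. (\<lambda>n. norm (r (h n) y *\<^sub>R f y) / norm (h n)) \<longlonglongrightarrow> 0"
   proof (rule AE_I2)
    fix y
    have "((\<lambda>h. norm (K ((x - y) + h) - K (x - y) - frechet_derivative K (at (x - y)) h) / norm h) \<longlongrightarrow> 0) (at 0)"
     using smooth_has_derivative[OF kernel_smooth[OF K], of "x - y"] unfolding has_derivative_at by blast
    then have "(\<lambda>n. norm (K ((x - y) + h n) - K (x - y) - frechet_derivative K (at (x - y)) (h n)) / norm (h n)) \<longlonglongrightarrow> 0"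
     by (rule filterlim_compose) (use hb h0 in \<open>auto simp: filterlim_at\<close>)
    then have "(\<lambda>n. norm (r (h n) y) / norm (h n) * norm (f y)) \<longlonglongrightarrow> 0 * norm (f y)"
     by (intro tendsto_mult tendsto_const) (simp add: r_def algebra_simps)
    then show "(\<lambda>n. norm (r (h n) y *\<^sub>R f y) / norm (h n)) \<longlonglongrightarrow> 0"
     by (simp add: mult.commute)
   qed
  qed measurable
  then have "(\<lambda>n. LBINT y. norm (r (h n) y *\<^sub>R f y) / norm (h n)) \<longlonglongrightarrow> 0" by simp
  then show "(\<lambda>n. norm (conv K f (x + h n) - conv K f x - ?D (h n)) / norm (h n)) \<longlonglongrightarrow> 0"
  proof (rule Lim_null_comparison[rotated], intro always_eventually allI)
   fix n
   have "norm (conv K f (x + h n) - conv K f x - ?D (h n)) \<le> (LBINT y. norm (r (h n) y *\<^sub>R f y))"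
    unfolding r_int by (rule integral_norm_bound)
   then show "norm (norm (conv K f (x + h n) - conv K f x - ?D (h n)) / norm (h n))
    \<le> (LBINT y. norm (r (h n) y *\<^sub>R f y) / norm (h n))"
    by (simp add: divide_right_mono)
  qed
 qed
 moreover have "at (0::space) within ball 0 1 = at 0"
  by (rule at_within_open) auto
 moreover have "bounded_linear ?D"
  by (intro bounded_linear_sum bounded_linear_compose[OF bounded_linear_scaleR_left bounded_linear_inner_left])
 ultimately show ?thesis by (simp add: has_derivative_at)
qed

lemma partial_conv:
 assumes K: "bump_kernel K" and f: "torus_L1 f" and b: "b \<in> Basis"
 shows "partial b (conv K f) = conv (partial b K) f"
proof
 fix x
 have "partial b (conv K f) x = (\<Sum>c\<in>Basis. (b \<bullet> c) *\<^sub>R conv (partial c K) f x)"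
  by (rule partial_eq[OF conv_has_derivative[OF K f]])
 also have "... = (\<Sum>c\<in>Basis. if c = b then conv (partial c K) f x else 0)"
  using b by (intro sum.cong) (auto simp: inner_Basis)
 finally show "partial b (conv K f) x = conv (partial b K) f x"
  using b by simp
qed

lemma smooth_conv:
 assumes "bump_kernel K" and f: "torus_L1 f"
 shows "smooth (conv K f)"
proof -
 have "Ck n (conv K f)" for n
  using assms(1)
 proof (induction n arbitrary: K)
  case 0
  then show ?case
   using conv_has_derivative[OF _ f] 
   by (auto intro!: continuous_at_imp_continuous_on dest: has_derivative_continuous)
 next
  case (Suc n)
  have "conv K f differentiable at x" for x
   using conv_has_derivative[OF Suc.prems f] differentiable_def by blast
  moreover have "Ck n (partial b (conv K f))" if "b \<in> Basis" for b
   using Suc.IH[OF kernel_partial[OF Suc.prems that]] partial_conv[OF Suc.prems f that] by simp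
  ultimately show ?case by simp
 qed
 then show ?thesis by (simp add: smooth_def)
qed

section \<open>Continuity of translations in Lebesgue spaces\<close>

lemma power_add_le: "0 \<le> a ==> 0 \<le> b ==> (a + b) ^ p \<le> 2 ^ p * (a ^ p + b ^ p)" for a b :: real
proof -
 assume ab: "0 \<le> a" "0 \<le> b"
 have "(a + b) ^ p \<le> (2 * max a b) ^ p" using ab by (intro power_mono) auto
 also have "... = 2 ^ p * max a b ^ p" by (simp add: power_mult_distrib)
 also have "max a b ^ p \<le> a ^ p + b ^ p" using ab by (auto simp: max_def)
 finally show ?thesis by simp
qed

lemma nn_norm_power_add:
 fixes a b :: "'x \<Rightarrow> 'b::euclidean_space"
 assumes [measurable]: "a \<in> borel_measurable M" "b \<in> borel_measurable M"
 shows "(\<integral>\<^sup>+z. norm (a z + b z) ^ p \<partial>M)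
  \<le> ennreal (2 ^ p) * ((\<integral>\<^sup>+z. norm (a z) ^ p \<partial>M) + (\<integral>\<^sup>+z. norm (b z) ^ p \<partial>M))"
proof -
 have "(\<integral>\<^sup>+z. norm (a z + b z) ^ p \<partial>M) \<le> (\<integral>\<^sup>+z. ennreal (2 ^ p) * (ennreal (norm (a z) ^ p) + ennreal (norm (b z) ^ p)) \<partial>M)"
 proof (rule nn_integral_mono)
  fix z
  have "norm (a z + b z) ^ p \<le> (norm (a z) + norm (b z)) ^ p"
   by (intro power_mono norm_triangle_ineq) auto
  also have "... \<le> 2 ^ p * (norm (a z) ^ p + norm (b z) ^ p)"
   by (rule power_add_le) auto
  finally have "ennreal (norm (a z + b z) ^ p) \<le> ennreal (2 ^ p * (norm (a z) ^ p + norm (b z) ^ p))"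
   by (rule ennreal_leI)
  then show "ennreal (norm (a z + b z) ^ p) \<le> ennreal (2 ^ p) * (ennreal (norm (a z) ^ p) + ennreal (norm (b z) ^ p))"
   by (simp add: ennreal_mult[symmetric] ennreal_plus[symmetric] del: ennreal_plus)
 qed
 also have "... = ennreal (2 ^ p) * ((\<integral>\<^sup>+z. norm (a z) ^ p \<partial>M) + (\<integral>\<^sup>+z. norm (b z) ^ p \<partial>M))"
  by (simp add: nn_integral_cmult nn_integral_add)
 finally show ?thesis .
qed

lemma nn_integral_lborel_shift:
 fixes g :: "'a::euclidean_space \<Rightarrow> ennreal"
 assumes [measurable]: "g \<in> Borel"
 shows "(nnL z. g (z + h)) = (nnL z. g z)"
proof -
 have "(nnL z. g z) = (\<integral>\<^sup>+z. g z \<partial>distr lborel borel ((+) h))"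
  by (simp add: lborel_distr_plus)
 also have "... = (nnL z. g (h + z))" by (subst nn_integral_distr) auto
 finally show ?thesis by (simp add: add.commute)
qed

definition translation_continuous :: "nat \<Rightarrow> ('a::euclidean_space \<Rightarrow> 'b::euclidean_space) \<Rightarrow> bool" where
 "translation_continuous p f \<longleftrightarrow> f \<in> Borel \<and>
  (\<forall>e>0. \<exists>d>0. \<forall>h. norm h < d \<longrightarrow> (nnL z. norm (f (z + h) - f z) ^ p) \<le> ennreal e)"

lemma translation_continuous_add:
 assumes "translation_continuous p f" "translation_continuous p g"
 shows "translation_continuous p (\<lambda>z. f z + g z)"
 unfolding translation_continuous_def
proof (intro conjI allI impI)
 have [measurable]: "f \<in> Borel" "g \<in> Borel"
  using assms by (auto simp: translation_continuous_def)
 show "(\<lambda>z. f z + g z) \<in> Borel" by measurable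
 fix e :: real assume e: "e > 0"
 let ?e = "e / (2 * 2 ^ p)"
 have e': "?e > 0" using e by simp
 obtain d1 where d1: "d1 > 0" "\<And>h. norm h < d1 ==> (nnL z. norm (f (z + h) - f z) ^ p) \<le> ennreal ?e"
  using assms(1) e' unfolding translation_continuous_def by blast
 obtain d2 where d2: "d2 > 0" "\<And>h. norm h < d2 ==> (nnL z. norm (g (z + h) - g z) ^ p) \<le> ennreal ?e"
  using assms(2) e' unfolding translation_continuous_def by blast
 show "\<exists>d>0. \<forall>h. norm h < d \<longrightarrow> (nnL z. norm (f (z + h) + g (z + h) - (f z + g z)) ^ p) \<le> ennreal e"
 proof (intro exI[of _ "min d1 d2"] conjI allI impI)
  fix h :: 'a assume h: "norm h < min d1 d2"
  have "(nnL z. norm (f (z + h) + g (z + h) - (f z + g z)) ^ p)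
    = (nnL z. norm ((f (z + h) - f z) + (g (z + h) - g z)) ^ p)"
   by (simp add: algebra_simps)
  also have "... \<le> ennreal (2 ^ p) * ((nnL z. norm (f (z + h) - f z) ^ p) + (nnL z. norm (g (z + h) - g z) ^ p))"
   by (rule nn_norm_power_add) measurable
  also have "... \<le> ennreal (2 ^ p) * (ennreal ?e + ennreal ?e)"
   using d1(2)[of h] d2(2)[of h] h by (intro mult_left_mono add_mono) auto
  also have "... = ennreal (2 ^ p * (?e + ?e))"
   using e' by (simp add: ennreal_mult[symmetric] ennreal_plus[symmetric] del: ennreal_plus)
  also have "2 ^ p * (?e + ?e) = e" by (simp add: field_simps)
  finally show "(nnL z. norm (f (z + h) + g (z + h) - (f z + g z)) ^ p) \<le> ennreal e" .
 qed (use d1 d2 in auto)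
qed

lemma translation_continuous_0: "p > 0 ==> translation_continuous p (\<lambda>z. 0)"
 by (auto simp: translation_continuous_def power_0_left intro!: exI[of _ "1::real"])

lemma translation_continuous_sum:
 assumes "p > 0" "finite I" "\<And>i. i \<in> I ==> translation_continuous p (f i)"
 shows "translation_continuous p (\<lambda>z. \<Sum>i\<in>I. f i z)"
 using assms(2,3)
 by (induction I) (auto intro: translation_continuous_0[OF assms(1)] translation_continuous_add)

text \<open>Squeeze the set between a compact and an open set of nearly the same measure: a point that
 enters or leaves the set under a short translation lies, before or after it, in the thin gap.\<close>

lemma translation_continuous_indicator:
 fixes A :: "'a::euclidean_space set"
 assumes p: "p > 0" and A: "A \<in> sets borel" "bounded A"
 shows "translation_continuous p (\<lambda>z. indicator A z *\<^sub>R y)"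
 unfolding translation_continuous_def
proof (intro conjI allI impI)
 note [measurable] = A(1)
 show "(\<lambda>z. indicator A z *\<^sub>R y) \<in> Borel" by measurable
 fix e :: real assume e: "e > 0"
 define M where "M = norm y ^ p + 1"
 have M: "M > 0" by (simp add: M_def add_nonneg_pos)
 define e' where "e' = e / (4 * M)"
 have e': "e' > 0" using e M by (simp add: e'_def)
 obtain U where U: "open U" "A \<subseteq> U" "emeasure lborel (U - A) < e'"
  using outer_regular_lborel[OF A(1), of e'] e' by auto
 have "A \<in> sets lebesgue" using A(1) by auto
 then obtain C where C: "closed C" "C \<subseteq> A" "emeasure lebesgue (A - C) < ennreal e'"
  using sets_lebesgue_inner_closed[of A e'] e' by metis
 have [measurable]: "U \<in> sets borel" "C \<in> sets borel" using U C by auto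
 have "compact C" using C A(2) bounded_subset compact_eq_bounded_closed by blast
 then obtain d where d: "d > 0" "\<And>x y. x \<in> C ==> y \<in> - U ==> d \<le> dist x y"
  using separate_compact_closed[of C "- U"] U C by (metis closed_Compl disjoint_eq_subset_Compl double_compl subset_trans)
 let ?G = "U - C"
 have G: "emeasure lborel ?G \<le> ennreal (2 * e')"
 proof -
  have "?G \<subseteq> (U - A) \<union> (A - C)" using C U by auto
  then have "emeasure lborel ?G \<le> emeasure lborel ((U - A) \<union> (A - C))"
   by (intro emeasure_mono) auto
  also have "... \<le> emeasure lborel (U - A) + emeasure lborel (A - C)"
   by (intro emeasure_subadditive) auto
  also have "... \<le> ennreal e' + ennreal e'"
   using U(3) C(3) by (intro add_mono) (auto simp: less_imp_le)
  finally show ?thesis using e' by (simp add: ennreal_plus[symmetric] del: ennreal_plus)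
 qed
 show "\<exists>d>0. \<forall>h. norm h < d \<longrightarrow>
   (nnL z. norm (indicator A (z + h) *\<^sub>R y - indicator A z *\<^sub>R y) ^ p) \<le> ennreal e"
 proof (intro exI[of _ d] conjI allI impI)
  fix h :: 'a assume h: "norm h < d"
  have CU: "z + h \<in> U" if "z \<in> C" for z
   using d(2)[OF that, of "z + h"] h by (force simp: dist_norm)
  have CU': "z \<in> U" if "z + h \<in> C" for z
   using d(2)[OF that, of z] h by (force simp: dist_norm)
  have "(nnL z. norm (indicator A (z + h) *\<^sub>R y - indicator A z *\<^sub>R y) ^ p)
   \<le> (nnL z. ennreal M * (indicator ?G z + indicator ?G (z + h)))"
  proof (rule nn_integral_mono)
   fix z
   have *: "norm (indicator A (z + h) *\<^sub>R y - indicator A z *\<^sub>R y) ^ p \<le> M"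
    using p by (auto simp: indicator_def M_def power_0_left)
   show "ennreal (norm (indicator A (z + h) *\<^sub>R y - indicator A z *\<^sub>R y) ^ p)
     \<le> ennreal M * (indicator ?G z + indicator ?G (z + h))"
   proof (cases "z \<in> A \<longleftrightarrow> z + h \<in> A")
    case True
    then show ?thesis using p by (auto simp: indicator_def power_0_left)
   next
    case False
    then have "z \<in> ?G \<or> z + h \<in> ?G"
     using C U CU[of z] CU'[of z] by blast
    then have "1 \<le> (indicator ?G z + indicator ?G (z + h) :: ennreal)"
     by (auto simp: indicator_def)
    then have "ennreal M * 1 \<le> ennreal M * (indicator ?G z + indicator ?G (z + h))"
     by (rule mult_left_mono) simp
    then show ?thesis using ennreal_leI[OF *] by simp
   qed
  qed
  also have "... = ennreal M * (emeasure lborel ?G + (nnL z. indicator ?G (z + h)))"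
   by (subst nn_integral_cmult, measurable) (subst nn_integral_add, auto)
  also have "(nnL z. indicator ?G (z + h)) = emeasure lborel ?G"
   by (subst nn_integral_lborel_shift) auto
  also have "ennreal M * (emeasure lborel ?G + emeasure lborel ?G) \<le> ennreal M * (ennreal (2 * e') + ennreal (2 * e'))"
   using G by (intro mult_left_mono add_mono) auto
  also have "... = ennreal (M * (2 * e' + 2 * e'))"
   using e' M by (simp add: ennreal_mult[symmetric] ennreal_plus[symmetric] del: ennreal_plus)
  also have "M * (2 * e' + 2 * e') = e" using M by (simp add: e'_def field_simps)
  finally show "(nnL z. norm (indicator A (z + h) *\<^sub>R y - indicator A z *\<^sub>R y) ^ p) \<le> ennreal e" .
 qed (use d in auto)
qed

lemma translation_continuous_approx:
 fixes f :: "'a::euclidean_space \<Rightarrow> 'b::euclidean_space"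
 assumes [measurable]: "f \<in> Borel"
  and approx: "\<And>e. e > 0 ==> \<exists>g. translation_continuous p g \<and> (nnL z. norm (f z - g z) ^ p) \<le> ennreal e"
 shows "translation_continuous p f"
 unfolding translation_continuous_def
proof (intro conjI allI impI)
 show "f \<in> Borel" by fact
 fix e :: real assume e: "e > 0"
 define c where "c = 2 ^ p * (1 + 2 ^ p * (2::real))"
 have c: "c > 0" by (simp add: c_def add_pos_pos)
 define e' where "e' = e / c"
 have e': "e' > 0" using e c by (simp add: e'_def)
 obtain g where g: "translation_continuous p g" and fg: "(nnL z. norm (f z - g z) ^ p) \<le> ennreal e'"
  using approx[OF e'] by blast
 have [measurable]: "g \<in> Borel" using g by (simp add: translation_continuous_def)
 obtain d where d: "d > 0" "\<And>h. norm h < d ==> (nnL z. norm (g (z + h) - g z) ^ p) \<le> ennreal e'"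
  using g e' unfolding translation_continuous_def by blast
 show "\<exists>d>0. \<forall>h. norm h < d \<longrightarrow> (nnL z. norm (f (z + h) - f z) ^ p) \<le> ennreal e"
 proof (intro exI[of _ d] conjI allI impI)
  fix h :: 'a assume h: "norm h < d"
  let ?r = "\<lambda>z. f z - g z"
  have s: "(nnL z. norm (?r (z + h)) ^ p) = (nnL z. norm (?r z) ^ p)"
   using nn_integral_lborel_shift[of "\<lambda>z. ennreal (norm (f z - g z) ^ p)" h] by simp
  have "(nnL z. norm (f (z + h) - f z) ^ p)
    = (nnL z. norm ((g (z + h) - g z) + (?r (z + h) + - ?r z)) ^ p)"
   by (simp add: algebra_simps)
  also have "... \<le> ennreal (2 ^ p) * ((nnL z. norm (g (z + h) - g z) ^ p) + (nnL z. norm (?r (z + h) + - ?r z) ^ p))"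
   by (rule nn_norm_power_add) measurable
  also have "... \<le> ennreal (2 ^ p) * (ennreal e' + ennreal (2 ^ p) * ((nnL z. norm (?r (z + h)) ^ p) + (nnL z. norm (- ?r z) ^ p)))"
   using d(2)[OF h] by (intro mult_left_mono add_mono nn_norm_power_add) auto
  also have "... \<le> ennreal (2 ^ p) * (ennreal e' + ennreal (2 ^ p) * (ennreal e' + ennreal e'))"
   using fg unfolding s norm_minus_cancel by (intro mult_left_mono add_mono) auto
  also have "... = ennreal (2 ^ p * (e' + 2 ^ p * (e' + e')))"
   using e' by (simp add: ennreal_mult[symmetric] ennreal_plus[symmetric] del: ennreal_plus)
  also have "2 ^ p * (e' + 2 ^ p * (e' + e')) = e' * c"
   by (simp add: c_def algebra_simps)
  also have "e' * c = e"
   using c by (simp add: e'_def)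
  finally show "(nnL z. norm (f (z + h) - f z) ^ p) \<le> ennreal e" .
 qed (use d in auto)
qed

theorem translation_continuous_Lp:
 fixes f :: "'a::euclidean_space \<Rightarrow> 'b::euclidean_space"
 assumes p: "p > 0" and [measurable]: "f \<in> Borel"
  and fin: "(nnL z. norm (f z) ^ p) < \<infinity>"
 shows "translation_continuous p f"
proof (rule translation_continuous_approx)
 fix e :: real assume e: "e > 0"
 obtain F where F: "\<And>i::nat. simple_function borel (F i)"
   "\<And>x. (\<lambda>i. F i x) \<longlonglongrightarrow> f x" "\<And>i x. dist (F i x) 0 \<le> 2 * dist (f x) 0"
  using borel_measurable_implies_sequence_metric[of f borel 0] by auto
 have [measurable]: "F i \<in> Borel" for i
  using F(1) by (rule borel_measurable_simple_function)
 define G where "G i z = indicator (cball 0 (real i)) z *\<^sub>R F i z" for i z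
 have [measurable]: "cball (0::'a) (real i) \<in> sets borel" for i by simp
 have [measurable]: "G i \<in> Borel" for i unfolding G_def by measurable
 have tc: "translation_continuous p (G i)" for i
 proof -
  have fin: "finite (range (F i))" using F(1)[of i] by (simp add: simple_function_def)
  have "G i = (\<lambda>z::'a. \<Sum>y\<in>range (F i). indicator (F i -` {y} \<inter> cball 0 (real i)) z *\<^sub>R y)"
  proof
   fix z
   have "(\<Sum>y\<in>range (F i). indicator (F i -` {y} \<inter> cball 0 (real i)) z *\<^sub>R y)
     = (\<Sum>y\<in>range (F i). if y = F i z then indicator (cball 0 (real i)) z *\<^sub>R y else 0)"
    by (intro sum.cong) (auto simp: indicator_def)
   also have "... = G i z" using fin by (simp add: G_def)
   finally show "G i z = (\<Sum>y\<in>range (F i). indicator (F i -` {y} \<inter> cball 0 (real i)) z *\<^sub>R y)" ..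
  qed
  moreover have "F i -` {y} \<in> sets borel" for y
   using simple_functionD(2)[OF F(1), of i "{y}"] by simp
  ultimately show ?thesis
   by (simp only:)
    (intro translation_continuous_sum translation_continuous_indicator p fin sets.Int bounded_Int disjI2, auto)
 qed
 have "(\<lambda>i. nnL z. norm (f z - G i z) ^ p) \<longlonglongrightarrow> (\<integral>\<^sup>+z. 0 \<partial>(lborel::'a measure))"
 proof (rule nn_integral_dominated_convergence[where w = "\<lambda>z. ennreal (3 ^ p) * ennreal (norm (f z) ^ p)"])
  show "AE z in lborel. ennreal (norm (f z - G i z) ^ p) \<le> ennreal (3 ^ p) * ennreal (norm (f z) ^ p)" for i
  proof (rule AE_I2)
   fix z
   have "norm (f z - G i z) \<le> norm (f z) + norm (G i z)" by (rule norm_triangle_ineq4)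
   also have "... \<le> 3 * norm (f z)" using F(3)[of i z] by (auto simp: G_def indicator_def)
   finally have "norm (f z - G i z) ^ p \<le> 3 ^ p * norm (f z) ^ p"
    by (subst power_mult_distrib[symmetric]) (rule power_mono, auto)
   from ennreal_leI[OF this] show "ennreal (norm (f z - G i z) ^ p) \<le> ennreal (3 ^ p) * ennreal (norm (f z) ^ p)"
    by (simp add: ennreal_mult)
  qed
  show "(nnL z. ennreal (3 ^ p) * ennreal (norm (f z) ^ p)) < \<infinity>"
   using fin by (simp add: nn_integral_cmult ennreal_mult_less_top)
  show "AE z in lborel. (\<lambda>i. ennreal (norm (f z - G i z) ^ p)) \<longlonglongrightarrow> 0"
  proof (rule AE_I2)
   fix z :: 'a
   obtain n :: nat where n: "norm z \<le> real n" using real_arch_simple by blast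
   have "\<forall>\<^sub>F i in sequentially. F i z = G i z"
    using eventually_ge_at_top[of n] by eventually_elim (use n in \<open>auto simp: G_def\<close>)
   then have "(\<lambda>i. G i z) \<longlonglongrightarrow> f z"
    using F(2)[of z] by (rule Lim_transform_eventually[rotated])
   then have "(\<lambda>i. norm (f z - G i z) ^ p) \<longlonglongrightarrow> norm (f z - f z) ^ p"
    by (intro tendsto_intros)
   from tendsto_ennrealI[OF this] show "(\<lambda>i. ennreal (norm (f z - G i z) ^ p)) \<longlonglongrightarrow> 0"
    using p by (simp only: diff_self norm_zero power_0_left) simp
  qed
 qed measurable
 then have "(\<lambda>i. nnL z. norm (f z - G i z) ^ p) \<longlonglongrightarrow> 0" by simp
 then have "\<forall>\<^sub>F i in sequentially. (nnL z. norm (f z - G i z) ^ p) < ennreal e"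
  by (rule order_tendstoD(2)) (simp add: e)
 then obtain i where "(nnL z. norm (f z - G i z) ^ p) < ennreal e"
  using eventually_happens'[OF sequentially_bot] by blast
 then show "\<exists>g. translation_continuous p g \<and> (nnL z. norm (f z - g z) ^ p) \<le> ennreal e"
  using tc less_imp_le by blast
qed fact

section \<open>Fundamental lemma of the calculus of variations\<close>

definition time_test :: "real \<Rightarrow> (real \<Rightarrow> real) \<Rightarrow> bool" where
 "time_test T \<eta> \<longleftrightarrow> smooth \<eta> \<and> (\<exists>a b. 0 < a \<and> b < T \<and> (\<forall>t. t \<notin> {a..b} \<longrightarrow> \<eta> t = 0))"

lemma time_testI:
 "smooth \<eta> ==> 0 < a ==> b < T ==> (\<And>t. t \<notin> {a..b} ==> \<eta> t = 0) ==> time_test T \<eta>"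
 unfolding time_test_def by blast

lemma time_test_continuous: "time_test T \<eta> ==> continuous_on UNIV \<eta>"
 by (simp add: time_test_def smooth_continuous)

lemma time_test_bounded:
 assumes "time_test T \<eta>"
 obtains M where "M > 0" "\<And>t. \<bar>\<eta> t\<bar> \<le> M"
proof -
 obtain a b where ab: "\<And>t. t \<notin> {a..b} ==> \<eta> t = 0"
  using assms by (auto simp: time_test_def)
 have "compact (\<eta> ` {a..b})"
  by (intro compact_continuous_image continuous_on_subset[OF time_test_continuous[OF assms]]) auto
 then obtain M where M: "M > 0" "\<And>y. y \<in> \<eta> ` {a..b} ==> norm y \<le> M"
  using compact_imp_bounded bounded_pos by metis
 have "\<bar>\<eta> t\<bar> \<le> M" for t
  using M ab[of t] by (cases "t \<in> {a..b}") auto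
 then show thesis using that M(1) by blast
qed

lemma time_test_measurable: "time_test T \<eta> ==> \<eta> \<in> Borel"
 by (simp add: borel_measurable_continuous_onI time_test_continuous)

lemma time_test_integrable: "time_test T \<eta> ==> integrable lborel \<eta>"
proof -
 assume t: "time_test T \<eta>"
 then obtain a b where ab: "\<And>t. t \<notin> {a..b} ==> \<eta> t = 0"
  by (auto simp: time_test_def)
 have "integrable lborel (\<lambda>t. indicator {a..b} t *\<^sub>R \<eta> t)"
  by (rule borel_integrable_compact) (auto intro: continuous_on_subset[OF time_test_continuous[OF t]])
 moreover have "(\<lambda>t. indicator {a..b} t *\<^sub>R \<eta> t) = \<eta>"
  using ab by (auto simp: indicator_def fun_eq_iff)
 ultimately show ?thesis by simp
qed

lemma time_test_partial:
 assumes "time_test T \<eta>"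
 shows "time_test T (partial 1 \<eta>)"
proof -
 obtain a b where ab: "0 < a" "b < T" "\<And>t. t \<notin> {a..b} ==> \<eta> t = 0"
  using assms by (auto simp: time_test_def)
 have "partial 1 \<eta> t = 0" if t: "t \<notin> {a..b}" for t
 proof -
  have "((\<lambda>_. 0) has_derivative (\<lambda>_. 0)) (at t)" by simp
  then have "(\<eta> has_derivative (\<lambda>_. 0)) (at t)"
   by (rule has_derivative_transform_within_open[where s = "- {a..b}"]) (use ab t in auto)
  then show ?thesis by (simp add: partial_eq)
 qed
 then show ?thesis using assms ab(1,2) unfolding time_test_def by (auto intro: smooth_partial)
qed

lemma time_test_cutoff:
 assumes "0 \<le> a" "b \<le> T" "n > 0"
 shows "time_test T (\<lambda>t. flat 0 (n * (t - a) - 1) * flat 0 (n * (b - t) - 1))"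
proof -
 have "smooth (\<lambda>t. flat 0 (n * t + (- n * a - 1)) * flat 0 (- n * t + (n * b - 1)))"
  by (intro smooth_mult smooth_affine[where L = "\<lambda>t. n * t"] smooth_affine[where L = "\<lambda>t. - n * t"]
    smooth_flat bounded_linear_mult_right)
 then have "smooth (\<lambda>t. flat 0 (n * (t - a) - 1) * flat 0 (n * (b - t) - 1))"
  by (simp add: algebra_simps)
 moreover have "flat 0 (n * (t - a) - 1) * flat 0 (n * (b - t) - 1) = 0" if "t \<notin> {a + 1 / n..b - 1 / n}" for t
  using that assms by (auto simp: field_simps flat_0_bounds(3))
 moreover have "0 < a + 1 / n" "b - 1 / n < T"
 proof -
  have "1 / n > 0" using assms by simp
  then show "0 < a + 1 / n" "b - 1 / n < T" using assms by linarith+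
 qed
 ultimately show ?thesis by (intro time_testI[of _ "a + 1 / n" "b - 1 / n"]) auto
qed

lemma cutoff_tendsto:
 "(\<lambda>n. flat 0 (real (Suc n) * (t - a) - 1) * flat 0 (real (Suc n) * (b - t) - 1)) \<longlonglongrightarrow> indicator {a<..<b} t"
proof -
 have one: "(\<lambda>n. flat 0 (real (Suc n) * c - 1)) \<longlonglongrightarrow> 1" if c: "c > 0" for c
 proof -
  have f: "filterlim (\<lambda>n. real (Suc n) * c - 1) at_top sequentially"
  proof -
   have "filterlim (\<lambda>n. real (Suc n)) at_top sequentially"
    by (rule filterlim_compose[OF filterlim_real_sequentially filterlim_Suc])
   then have "filterlim (\<lambda>n. c * real (Suc n)) at_top sequentially"
    by (rule filterlim_tendsto_pos_mult_at_top[OF tendsto_const c])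
   then have "filterlim (\<lambda>n. - 1 + c * real (Suc n)) at_top sequentially"
    by (rule filterlim_tendsto_add_at_top[OF tendsto_const])
   then show ?thesis by (simp add: algebra_simps)
  qed
  have "((\<lambda>x::real. exp (- inverse x)) \<longlongrightarrow> exp (- 0)) at_top"
   by (intro tendsto_exp tendsto_minus tendsto_inverse_0_at_top filterlim_ident)
  then have "((\<lambda>x::real. exp (- (1 / x))) \<longlongrightarrow> 1) at_top"
   by (simp add: divide_inverse)
  then have "(flat 0 \<longlongrightarrow> 1) at_top"
   by (rule Lim_transform_eventually) (use eventually_gt_at_top[of 0] in eventually_elim, simp add: flat_def)
  then show ?thesis using f by (rule filterlim_compose)
 qed
 show ?thesis
 proof (cases "a < t \<and> t < b")
  case True
  then show ?thesis using tendsto_mult[OF one[of "t - a"] one[of "b - t"]] by (simp add: indicator_def)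
 next
  case False
  have "flat 0 (real (Suc n) * (t - a) - 1) * flat 0 (real (Suc n) * (b - t) - 1) = 0" for n
  proof -
   have "real (Suc n) * (t - a) \<le> 0 \<or> real (Suc n) * (b - t) \<le> 0"
    using False by (auto simp: mult_le_0_iff not_less)
   then show ?thesis by (auto simp: flat_0_bounds(3))
  qed
  then show ?thesis using False by (simp only: indicator_def) auto
 qed
qed

lemma fundamental_lemma:
 fixes h :: "real \<Rightarrow> real"
 assumes h: "integrable lborel h" and supp: "\<And>t. t \<notin> {0<..<T} ==> h t = 0"
  and test: "\<And>\<eta>. time_test T \<eta> ==> (LBINT t. h t * \<eta> t) = 0"
 shows "AE t in lborel. h t = 0"
proof -
 have [measurable]: "h \<in> Borel" using h by auto
 have half: "(LBINT t. h t * indicator {a<..} t) = 0" for a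
 proof -
  let ?a = "max a 0"
  let ?\<eta> = "\<lambda>n t. flat 0 (real (Suc n) * (t - ?a) - 1) * flat 0 (real (Suc n) * (T - t) - 1)"
  have [measurable]: "flat 0 \<in> Borel"
   by (simp add: borel_measurable_continuous_onI smooth_continuous smooth_flat)
  have "(\<lambda>n. LBINT t. h t * ?\<eta> n t) \<longlonglongrightarrow> (LBINT t. h t * indicator {?a<..<T} t)"
  proof (rule integral_dominated_convergence[where w = "\<lambda>t. norm (h t)"])
   show "AE t in lborel. (\<lambda>n. h t * ?\<eta> n t) \<longlonglongrightarrow> h t * indicator {?a<..<T} t"
    by (intro AE_I2 tendsto_mult tendsto_const cutoff_tendsto)
   show "AE t in lborel. norm (h t * ?\<eta> n t) \<le> norm (h t)" for n
   proof (rule AE_I2)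
    fix t
    have "\<bar>?\<eta> n t\<bar> \<le> 1"
     by (simp add: abs_mult flat_0_bounds mult_le_one)
    then show "norm (h t * ?\<eta> n t) \<le> norm (h t)"
     using mult_left_le[of "\<bar>?\<eta> n t\<bar>" "\<bar>h t\<bar>"] by (simp add: abs_mult)
   qed
  qed (use h in auto)
  moreover have "(LBINT t. h t * ?\<eta> n t) = 0" for n
   by (rule test[OF time_test_cutoff]) auto
  moreover have "h t * indicator {?a<..<T} t = h t * indicator {a<..} t" for t
   using supp[of t] by (auto simp: indicator_def)
  ultimately have "(\<lambda>n::nat. 0::real) \<longlonglongrightarrow> (LBINT t. h t * indicator {a<..} t)"
   by (simp only:)
  then show ?thesis by (simp add: LIMSEQ_const_iff)
 qed
 let ?P = "\<lambda>t. ennreal (h t)" and ?N = "\<lambda>t. ennreal (- h t)"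
 have finP: "(nnL t. ?P t) < \<infinity>" "(nnL t. ?N t) < \<infinity>"
  using h unfolding real_integrable_def by (auto simp: less_top)
 have "density lborel ?P = density lborel ?N"
 proof (rule measure_eqI_lessThan)
  fix a :: real
  have e: "emeasure (density lborel (\<lambda>t. ennreal (g t))) {a<..} = (nnL t. ennreal (g t * indicator {a<..} t))"
   if [measurable]: "g \<in> Borel" for g
   by (subst emeasure_density) (auto intro!: nn_integral_cong simp: indicator_def)
  have "(nnL t. ennreal (h t * indicator {a<..} t)) \<le> (nnL t. ?P t)"
   by (intro nn_integral_mono) (auto simp: indicator_def)
  then show fin: "emeasure (density lborel ?P) {a<..} < \<infinity>"
   using finP(1) by (simp add: e)
  have "(nnL t. ennreal (- h t * indicator {a<..} t)) \<le> (nnL t. ?N t)"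
   by (intro nn_integral_mono) (auto simp: indicator_def)
  then have fin': "emeasure (density lborel ?N) {a<..} < \<infinity>"
   using finP(2) e[of "\<lambda>t. - h t"] by simp
  have enn: "x = y" if "enn2real x = enn2real y" "x < \<infinity>" "y < \<infinity>" for x y
   using that by (metis ennreal_enn2real infinity_ennreal_def)
  have i: "integrable lborel (\<lambda>t. h t * indicator {a<..} t)"
   using h by (intro integrable_real_mult_indicator) auto
  have "0 = enn2real (nnL t. ennreal (h t * indicator {a<..} t))
    - enn2real (nnL t. ennreal (- (h t * indicator {a<..} t)))"
   using real_lebesgue_integral_def[OF i] half[of a] by simp
  then show "emeasure (density lborel ?P) {a<..} = emeasure (density lborel ?N) {a<..}"
   by (intro enn fin fin') (simp add: e[of h] e[of "\<lambda>t. - h t"])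
 qed auto
 then have "AE t in lborel. ?P t = ?N t"
  by (subst (asm) sigma_finite_measure.density_unique_iff[OF lborel.sigma_finite_measure_axioms]) auto
 then show ?thesis
 proof eventually_elim
  case (elim t)
  show ?case
  proof (cases "h t \<ge> 0")
   case True
   then have "ennreal (h t) = 0" using elim by (simp add: ennreal_neg)
   then show ?thesis using True by simp
  next
   case False
   then have "ennreal (- h t) = 0" using elim by (simp add: ennreal_neg)
   then show ?thesis using False by simp
  qed
 qed
qed

lemma time_test_primitive:
 assumes z: "time_test T z" and int0: "(LBINT t. z t) = 0"
 obtains \<eta> where "time_test T \<eta>" "partial 1 \<eta> = z"
proof -
 obtain a b where ab: "0 < a" "b < T" "\<And>t. t \<notin> {a..b} ==> z t = 0"
  using z by (auto simp: time_test_def)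
 have cont: "continuous_on A z" for A using time_test_continuous[OF z] continuous_on_subset by blast
 define \<eta> where "\<eta> t = integral {0..t} z" for t
 have zero: "\<eta> t = 0" if "t < a" for t
  unfolding \<eta>_def by (subst Henstock_Kurzweil_Integration.integral_cong[of _ z "\<lambda>_. 0"]) (use ab that in auto)
 have full: "\<eta> t = 0" if t: "t > b" "t \<ge> 0" for t
 proof -
  have "\<eta> t = (LBINT s:{0..t}. z s)" unfolding \<eta>_def
   by (rule set_borel_integral_eq_integral(2)[symmetric])
    (auto intro!: borel_integrable_compact[of _ z, folded set_integrable_def] cont)
  also have "... = (LBINT s. z s)"
   unfolding set_lebesgue_integral_def
  proof (rule L_integral_cong)
   fix s show "indicator {0..t} s *\<^sub>R z s = z s"
    using ab(1) ab(3)[of s] t by (cases "s \<in> {a..b}") (auto simp: indicator_def)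
  qed simp
  finally show ?thesis using int0 by simp
 qed
 have der: "(\<eta> has_real_derivative z t) (at t)" for t
 proof (cases "t < a")
  case True
  have "((\<lambda>_. 0) has_real_derivative 0) (at t)" by simp
  then have "(\<eta> has_real_derivative 0) (at t)"
   by (rule has_field_derivative_transform_within_open[where S = "{..<a}"]) (use zero True in auto)
  then show ?thesis using ab True by simp
 next
  case False
  then have t: "0 < t" using ab by simp
  have "(\<eta> has_real_derivative z t) (at t within {0..t+1})"
   unfolding \<eta>_def by (rule integral_has_real_derivative[OF cont]) (use t in auto)
  then show ?thesis using t by (subst (asm) at_within_interior) (auto simp: interior_atLeastAtMost_real)
 qed
 have sm: "smooth \<eta>"
 proof (rule smoothI_derivative)
  show "(\<eta> has_derivative (\<lambda>h. z x * h)) (at x)" for x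
   using der[of x] unfolding has_field_derivative_def by simp
  show "smooth (\<lambda>x. z x * h)" if "h \<in> Basis" for h
   using z by (intro smooth_mult smooth_const) (simp add: time_test_def)
 qed
 have "\<eta> t = 0" if "t \<notin> {a..max a b}" for t
  using zero[of t] full[of t] that ab by (cases "t < a") auto
 moreover have "max a b < T \<or> b < a" using ab by auto
 ultimately have "time_test T \<eta>"
 proof (cases "b < a")
  case True
  then have "z = (\<lambda>_. 0)" using ab by fastforce
  then have "\<eta> = (\<lambda>_. 0)" unfolding \<eta>_def by simp
  then have "\<forall>t. t \<notin> {1..T - 1} \<longrightarrow> \<eta> t = 0" by simp
  then show ?thesis by (intro time_testI[OF sm, of 1 "T - 1"]) auto
 next
  case False
  then show ?thesis using ab \<open>\<And>t. t \<notin> {a..max a b} ==> \<eta> t = 0\<close>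
   by (intro time_testI[OF sm, of a "max a b"]) auto
 qed
 moreover have "partial 1 \<eta> = z" using der by (intro ext) (rule partial_real)
 ultimately show thesis using that by blast
qed

lemma time_test_linear:
 assumes "time_test T f" "time_test T g"
 shows "time_test T (\<lambda>t. f t + c * g t)"
proof -
 obtain a b where ab: "0 < a" "b < T" "\<And>t. t \<notin> {a..b} ==> f t = 0"
  using assms by (auto simp: time_test_def)
 obtain a' b' where ab': "0 < a'" "b' < T" "\<And>t. t \<notin> {a'..b'} ==> g t = 0"
  using assms by (auto simp: time_test_def)
 have "smooth (\<lambda>t. f t + c * g t)"
  using assms by (intro smooth_add smooth_mult smooth_const) (auto simp: time_test_def)
 then show ?thesis
 proof (rule time_testI[of _ "min a a'" "max b b'"])
  fix t assume "t \<notin> {min a a'..max b b'}"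
  then have "t \<notin> {a..b}" "t \<notin> {a'..b'}" by auto
  then show "f t + c * g t = 0" using ab(3) ab'(3) by simp
 qed (use ab ab' in auto)
qed

text \<open>A test function with integral zero is the derivative of a test function, so \<open>h\<close> minus a suitable constant is orthogonal to all tests.\<close>

lemma du_Bois_Reymond:
 fixes h :: "real \<Rightarrow> real"
 assumes T: "T > 0" and h: "integrable lborel h" and supp: "\<And>t. t \<notin> {0<..<T} ==> h t = 0"
  and test: "\<And>\<eta>. time_test T \<eta> ==> (LBINT t. h t * partial 1 \<eta> t) = 0"
 shows "\<exists>c. AE t in lborel. t \<in> {0<..<T} \<longrightarrow> h t = c"
proof -
 have [measurable]: "h \<in> Borel" using h by auto
 have ih: "integrable lborel (\<lambda>t. h t * w t)" if w: "time_test T w" for w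
 proof -
  obtain M where M: "M > 0" "\<And>t. \<bar>w t\<bar> \<le> M" using time_test_bounded[OF w] by blast
  note [measurable] = time_test_measurable[OF w]
  have "integrable lborel (\<lambda>t. M * h t)" using h by simp
  then show ?thesis
   by (rule L_integrable_bound) (use M in \<open>auto simp: abs_mult mult.commute[of M] intro!: AE_I2 mult_left_mono\<close>)
 qed
 define n where "n = 4 / T"
 let ?r = "\<lambda>t. flat 0 (n * (t - 0) - 1) * flat 0 (n * (T - t) - 1)"
 have r: "time_test T ?r" using T by (intro time_test_cutoff) (auto simp: n_def)
 have "?r (T / 2) > 0"
  using T by (intro mult_pos_pos flat_0_bounds(4)) (auto simp: n_def)
 then have "(LBINT t. ?r t) \<noteq> 0"
 proof -
  assume pos: "?r (T / 2) > 0"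
  show ?thesis
  proof
   assume "(LBINT t. ?r t) = 0"
   moreover have "AE t in lborel. 0 \<le> ?r t" by (simp add: flat_0_bounds)
   ultimately have "AE t in lborel. ?r t = 0"
    using integral_nonneg_eq_0_iff_AE[OF time_test_integrable[OF r]] by blast
   then have "AE t in lebesgue. t \<in> {t. ?r t = 0}"
    by (intro AE_completion) (simp only: mem_Collect_eq)
   moreover have "closed {t. ?r t = 0}"
    by (intro closed_Collect_eq time_test_continuous[OF r] continuous_intros)
   ultimately have "T / 2 \<in> {t. ?r t = 0}"
    by (intro mem_closed_if_AE_lebesgue)
   then show False using pos by simp
  qed
 qed
 define \<rho> where "\<rho> t = 0 + (1 / (LBINT t. ?r t)) * ?r t" for t
 have "time_test T (\<lambda>_. 0)"
  by (rule time_testI[OF smooth_const, of 1 "T - 1"]) auto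
 then have \<rho>: "time_test T \<rho>" unfolding \<rho>_def using r by (rule time_test_linear)
 have \<rho>1: "(LBINT t. \<rho> t) = 1"
  using \<open>(LBINT t. ?r t) \<noteq> 0\<close> unfolding \<rho>_def by simp
 define c where "c = (LBINT t. h t * \<rho> t)"
 have "AE t in lborel. h t - c * indicator {0<..<T} t = 0"
 proof (rule fundamental_lemma)
  show "integrable lborel (\<lambda>t. h t - c * indicator {0<..<T} t)"
   using h T by (intro L_integrable_diff integrable_mult_right integrable_real_indicator) auto
  show "h t - c * indicator {0<..<T} t = 0" if "t \<notin> {0<..<T}" for t
   using supp[OF that] that by simp
  fix w assume w: "time_test T w"
  let ?I = "LBINT t. w t"
  have "time_test T (\<lambda>t. w t + (- ?I) * \<rho> t)" by (rule time_test_linear[OF w \<rho>])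
  moreover have "(LBINT t. w t + (- ?I) * \<rho> t) = 0"
   using time_test_integrable[OF w] time_test_integrable[OF \<rho>] \<rho>1 by simp
  ultimately obtain \<eta> where "time_test T \<eta>" "partial 1 \<eta> = (\<lambda>t. w t + (- ?I) * \<rho> t)"
   by (rule time_test_primitive)
  then have "0 = (LBINT t. h t * (w t + (- ?I) * \<rho> t))"
   using test by fastforce
  also have "... = (LBINT t. h t * w t - ?I * (h t * \<rho> t))"
   by (intro L_integral_cong) (auto simp: algebra_simps)
  also have "... = (LBINT t. h t * w t) - ?I * c"
   using ih[OF w] ih[OF \<rho>] by (simp add: c_def)
  finally have "(LBINT t. h t * w t) = c * ?I" by simp
  moreover have "(h t - c * indicator {0<..<T} t) * w t = h t * w t - c * w t" for t
  proof (cases "t \<in> {0<..<T}")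
   case False
   then have "w t = 0" using w by (auto simp: time_test_def)
   then show ?thesis by simp
  qed (simp add: algebra_simps)
  ultimately show "(LBINT t. (h t - c * indicator {0<..<T} t) * w t) = 0"
   using ih[OF w] time_test_integrable[OF w] by simp
 qed
 then have "AE t in lborel. t \<in> {0<..<T} \<longrightarrow> h t = c"
  by eventually_elim auto
 then show ?thesis ..
qed

section \<open>Convolution estimates on the torus\<close>

lemma power_tangent:
 fixes g c :: real
 assumes "0 \<le> g" "0 \<le> c" "p = 2 \<or> p = 3"
 shows "c ^ p + real p * c ^ (p - 1) * (g - c) \<le> g ^ p"
proof -
 have "g ^ 2 - (c ^ 2 + 2 * c * (g - c)) = (g - c)\<^sup>2" by (simp add: power2_eq_square algebra_simps)
 then have 2: "c ^ 2 + 2 * c * (g - c) \<le> g ^ 2" by (smt (verit) zero_le_power2)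
 have "g ^ 3 - (c ^ 3 + 3 * c ^ 2 * (g - c)) = (g - c)\<^sup>2 * (g + 2 * c)"
  by (simp add: power2_eq_square power3_eq_cube algebra_simps)
 moreover have "(g - c)\<^sup>2 * (g + 2 * c) \<ge> 0" using assms by (intro mult_nonneg_nonneg) auto
 ultimately have 3: "c ^ 3 + 3 * c ^ 2 * (g - c) \<le> g ^ 3" by linarith
 show ?thesis using assms(3) 2 3 by auto
qed

text \<open>Jensen's inequality for the square and the cube, with respect to a weight of arbitrary mass:
 integrate the tangent of the power at the mean value.\<close>

lemma integral_power_mean:
 fixes w g :: "'x \<Rightarrow> real"
 assumes w: "integrable M w" "\<And>x. 0 \<le> w x" and g: "g \<in> borel_measurable M" "\<And>x. 0 \<le> g x"
  and p: "p = 2 \<or> p = 3" and wg: "integrable M (\<lambda>x. w x * g x ^ p)"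
 shows "integrable M (\<lambda>x. w x * g x)"
  and "(LINT x|M. w x * g x) ^ p \<le> (LINT x|M. w x) ^ (p - 1) * (LINT x|M. w x * g x ^ p)"
proof -
 note [measurable] = g(1) borel_measurable_integrable[OF w(1)]
 have "integrable M (\<lambda>x. w x + w x * g x ^ p)" using w(1) wg by simp
 then show i: "integrable M (\<lambda>x. w x * g x)"
 proof (rule L_integrable_bound)
  show "AE x in M. norm (w x * g x) \<le> norm (w x + w x * g x ^ p)"
  proof (rule AE_I2)
   fix x
   have "g x \<le> 1 + g x ^ p"
   proof (cases "g x \<le> 1")
    case True
    then show ?thesis using g(2)[of x] by (simp add: add_increasing2)
   next
    case False
    then have "g x ^ 1 \<le> g x ^ p" using p by (intro power_increasing) auto
    then show ?thesis by simp
   qed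
   then have "w x * g x \<le> w x * (1 + g x ^ p)" using w(2) by (rule mult_left_mono)
   then show "norm (w x * g x) \<le> norm (w x + w x * g x ^ p)"
    using w(2)[of x] g(2)[of x] by (simp add: algebra_simps)
  qed
 qed measurable
 let ?A = "LINT x|M. w x" and ?I = "LINT x|M. w x * g x"
 have A: "0 \<le> ?A" using w(2) by (intro L_integral_nonneg) auto
 have I: "0 \<le> ?I" using w(2) g(2) by (intro L_integral_nonneg) auto
 show "?I ^ p \<le> ?A ^ (p - 1) * (LINT x|M. w x * g x ^ p)"
 proof (cases "?A = 0")
  case True
  then have "AE x in M. w x = 0"
   using integral_nonneg_eq_0_iff_AE[OF w(1)] w(2) by simp
  then have "?I = (LINT x|M. 0)" by (intro integral_cong_AE) (auto elim: eventually_mono)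
  then show ?thesis using p True by auto
 next
  case False
  define c where "c = ?I / ?A"
  have c: "0 \<le> c" "c * ?A = ?I" using A I False by (auto simp: c_def)
  let ?k = "c ^ p - real p * c ^ (p - 1) * c" and ?l = "real p * c ^ (p - 1)"
  have "(LINT x|M. ?k * w x + ?l * (w x * g x)) \<le> (LINT x|M. w x * g x ^ p)"
  proof (rule integral_mono)
   fix x
   have "w x * (c ^ p + real p * c ^ (p - 1) * (g x - c)) \<le> w x * g x ^ p"
    by (intro mult_left_mono power_tangent g(2) c(1) p w(2))
   then show "?k * w x + ?l * (w x * g x) \<le> w x * g x ^ p" by (simp add: algebra_simps)
  qed (use w i wg in auto)
  also have "(LINT x|M. ?k * w x + ?l * (w x * g x)) = ?k * ?A + ?l * ?I"
   using w i by simp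
  also have "... = c ^ p * ?A" unfolding c(2)[symmetric] by (simp add: algebra_simps)
  finally have "?A ^ (p - 1) * (c ^ p * ?A) \<le> ?A ^ (p - 1) * (LINT x|M. w x * g x ^ p)"
   using A by (intro mult_left_mono) auto
  moreover have "?A ^ (p - 1) * (c ^ p * ?A) = ?I ^ p"
   unfolding c(2)[symmetric] using p by (auto simp: power2_eq_square power3_eq_cube)
  ultimately show ?thesis by simp
 qed
qed

lemma kernel_integrable: "bump_kernel K ==> integrable lborel K"
proof -
 assume K: "bump_kernel K"
 note [measurable] = kernel_measurable[OF K]
 obtain R M where RM: "R > 0" "M > 0" "\<And>x. \<bar>K x\<bar> \<le> M * indicator (cball 0 R) x"
  using kernel_bound[OF K] by blast
 have "integrable lborel (\<lambda>x. M * indicator (cball (0::space) R) x)"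
  by (intro integrable_mult_right integrable_real_indicator) (auto simp: emeasure_bounded_finite[simplified])
 then show ?thesis
  by (rule L_integrable_bound) (use RM in \<open>auto simp: abs_mult intro!: AE_I2\<close>)
qed

interpretation torus_lborel: pair_sigma_finite torus "lborel :: space measure"
 by standard

text \<open>Fubini for a kernel in \<open>z\<close> against functions of \<open>x\<close> whose torus integral is bounded uniformly in \<open>z\<close>.\<close>

lemma kernel_swap:
 fixes h :: "space \<Rightarrow> space \<Rightarrow> 'b::euclidean_space"
 assumes K: "integrable lborel K"
  and [measurable]: "(\<lambda>(x, z). h x z) \<in> Borel2"
  and bound: "\<And>z. (nnT x. norm (h x z)) \<le> ennreal C"
 shows "integrable (torus \<Otimes>\<^sub>M lborel) (\<lambda>(x, z). K z *\<^sub>R h x z)"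
  and "integrable torus (\<lambda>x. (LBINT z. K z *\<^sub>R h x z))"
  and "integrable lborel (\<lambda>z. K z *\<^sub>R (LINT x|torus. h x z))"
  and "(LINT x|torus. (LBINT z. K z *\<^sub>R h x z)) = (LBINT z. K z *\<^sub>R (LINT x|torus. h x z))"
proof -
 have [measurable]: "K \<in> Borel" using K by auto
 have [measurable]: "(\<lambda>p. h (fst p) (snd p)) \<in> Borel2"
  using assms(2) by (simp add: case_prod_beta')
 have "(\<integral>\<^sup>+p. norm (K (snd p) *\<^sub>R h (fst p) (snd p)) \<partial>(torus \<Otimes>\<^sub>M lborel))
   = (nnL z. (nnT x. norm (K z *\<^sub>R h x z)))"
  by (subst torus_lborel.nn_integral_snd[symmetric]) auto
 also have "... = (nnL z. ennreal \<bar>K z\<bar> * (nnT x. norm (h x z)))"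
  by (intro nn_integral_cong) (simp add: ennreal_mult nn_integral_cmult)
 also have "... \<le> (nnL z. ennreal \<bar>K z\<bar> * ennreal C)"
  by (intro nn_integral_mono mult_left_mono bound) auto
 also have "... = (nnL z. norm (K z)) * ennreal C"
  by (simp add: nn_integral_multc)
 also have "... < \<infinity>"
  using K by (simp add: integrable_iff_bounded ennreal_mult_less_top)
 finally show I: "integrable (torus \<Otimes>\<^sub>M lborel) (\<lambda>(x, z). K z *\<^sub>R h x z)"
  by (intro integrableI_bounded) (auto simp: case_prod_beta')
 show "integrable torus (\<lambda>x. (LBINT z. K z *\<^sub>R h x z))"
  using torus_lborel.integrable_fst'[OF I] by simp
 have eq: "(LINT x|torus. K z *\<^sub>R h x z) = K z *\<^sub>R (LINT x|torus. h x z)" for z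
  by (cases "K z = 0") (auto simp: integral_scaleR_right)
 show "integrable lborel (\<lambda>z. K z *\<^sub>R (LINT x|torus. h x z))"
  using torus_lborel.integrable_snd[OF I] by (simp add: eq)
 show "(LINT x|torus. (LBINT z. K z *\<^sub>R h x z)) = (LBINT z. K z *\<^sub>R (LINT x|torus. h x z))"
  using torus_lborel.Fubini_integral[OF I] by (simp add: eq)
qed

definition torus_Lp :: "nat \<Rightarrow> (space \<Rightarrow> 'b::euclidean_space) \<Rightarrow> bool" where
 "torus_Lp p f \<longleftrightarrow> periodic f \<and> f \<in> Borel \<and> integrable torus (\<lambda>x. norm (f x) ^ p)"

lemma torus_LpD:
 assumes "torus_Lp p f"
 shows "periodic f" "f \<in> Borel" "integrable torus (\<lambda>x. norm (f x) ^ p)"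
 using assms by (auto simp: torus_Lp_def)

lemma torus_Lp_1: "torus_Lp 1 f \<longleftrightarrow> torus_L1 f"
 by (auto simp: torus_Lp_def torus_L1_def integrable_norm_iff)

lemma torus_Lp_mono:
 assumes f: "torus_Lp p f" and "q \<le> p"
 shows "torus_Lp q f"
proof -
 note [measurable] = torus_LpD(2)[OF f]
 have "integrable torus (\<lambda>x. 1 + norm (f x) ^ p)"
  using torus_LpD(3)[OF f] by (intro L_integrable_add) auto
 then have "integrable torus (\<lambda>x. norm (f x) ^ q)"
 proof (rule L_integrable_bound)
  show "AE x in torus. norm (norm (f x) ^ q) \<le> norm (1 + norm (f x) ^ p)"
  proof (rule AE_I2)
   fix x
   have "norm (f x) ^ q \<le> 1 + norm (f x) ^ p"
   proof (cases "norm (f x) \<le> 1")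
    case True
    then show ?thesis using power_le_one[of "norm (f x)" q] by (simp add: add_increasing2)
   next
    case False
    then have "norm (f x) ^ q \<le> norm (f x) ^ p" using \<open>q \<le> p\<close> by (intro power_increasing) auto
    then show ?thesis by simp
   qed
   then show "norm (norm (f x) ^ q) \<le> norm (1 + norm (f x) ^ p)" by simp
  qed
 qed measurable
 then show ?thesis using f by (simp add: torus_Lp_def)
qed

lemma torus_Lp_imp_L1: "torus_Lp p f ==> 1 \<le> p ==> torus_L1 f"
 using torus_Lp_mono torus_Lp_1 by blast

lemma torus_Lp_iff_nn:
 "torus_Lp p f \<longleftrightarrow> periodic f \<and> f \<in> Borel \<and> (nnT x. norm (f x) ^ p) < \<infinity>"
 by (auto simp: torus_Lp_def integrable_iff_bounded)

lemma torus_Lp_add: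
 assumes "torus_Lp p f" "torus_Lp p g"
 shows "torus_Lp p (\<lambda>x. f x + g x)"
proof -
 note [measurable] = torus_LpD(2)[OF assms(1)] torus_LpD(2)[OF assms(2)]
 have "(nnT x. norm (f x + g x) ^ p) \<le> ennreal (2 ^ p) * ((nnT x. norm (f x) ^ p) + (nnT x. norm (g x) ^ p))"
  by (rule nn_norm_power_add) measurable
 also have "... < \<infinity>"
  using assms by (simp add: torus_Lp_iff_nn ennreal_mult_less_top)
 finally show ?thesis
  using assms by (auto simp: torus_Lp_iff_nn intro: periodic_compose2)
qed

lemma torus_Lp_linear:
 assumes "torus_Lp p f" and h: "bounded_linear h"
 shows "torus_Lp p (\<lambda>x. h (f x))"
proof -
 note [measurable] = torus_LpD(2)[OF assms(1)]
 have [measurable]: "h \<in> Borel"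
  using h by (intro borel_measurable_continuous_onI linear_continuous_on)
 obtain B where B: "B > 0" "\<And>y. norm (h y) \<le> norm y * B"
  using bounded_linear.pos_bounded[OF h] by blast
 have "integrable torus (\<lambda>x. B ^ p * norm (f x) ^ p)"
  using torus_LpD(3)[OF assms(1)] by simp
 then have "integrable torus (\<lambda>x. norm (h (f x)) ^ p)"
 proof (rule L_integrable_bound)
  show "AE x in torus. norm (norm (h (f x)) ^ p) \<le> norm (B ^ p * norm (f x) ^ p)"
  proof (rule AE_I2)
   fix x
   have "norm (h (f x)) ^ p \<le> (norm (f x) * B) ^ p" by (intro power_mono B) auto
   then show "norm (norm (h (f x)) ^ p) \<le> norm (B ^ p * norm (f x) ^ p)"
    using B(1) by (simp add: power_mult_distrib mult.commute)
  qed
 qed measurable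
 then show ?thesis using assms(1) by (simp add: torus_Lp_def periodic_compose)
qed

lemma torus_Lp_shift:
 assumes "torus_Lp p f"
 shows "torus_Lp p (\<lambda>x. f (x + a))"
proof -
 note [measurable] = torus_LpD(2)[OF assms]
 have "integrable torus (\<lambda>x. norm (f (x + a)) ^ p) \<longleftrightarrow> integrable torus (\<lambda>x. norm (f x) ^ p)"
  by (rule integral_torus_shift(2)[of "\<lambda>x. norm (f x) ^ p"])
   (auto intro: periodic_compose torus_LpD(1)[OF assms])
 then show ?thesis using assms by (simp add: torus_Lp_def periodic_shift)
qed

lemma nn_integral_torus_norm_shift:
 fixes f :: "space \<Rightarrow> 'b::euclidean_space"
 assumes "periodic f" and [measurable]: "f \<in> Borel"
 shows "(nnT x. norm (f (x + a)) ^ p) = (nnT x. norm (f x) ^ p)"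
 by (rule nn_integral_torus_shift[of "\<lambda>x. ennreal (norm (f x) ^ p)"])
  (auto intro: periodic_compose assms)

lemma periodic_continuous_bounded:
 fixes f :: "space \<Rightarrow> 'b::euclidean_space"
 assumes "periodic f" "continuous_on UNIV f"
 obtains M where "M > 0" "\<And>x. norm (f x) \<le> M"
proof -
 have "compact (f ` cell)"
  unfolding cell_def by (intro compact_continuous_image continuous_on_subset[OF assms(2)]) auto
 then obtain M where M: "M > 0" "\<And>y. y \<in> f ` cell ==> norm y \<le> M"
  using compact_imp_bounded bounded_pos by metis
 have "norm (f x) \<le> M" for x
 proof -
  have "f (x - vfloor x) \<in> f ` cell"
   using minus_vfloor[of x] unit_cube_box(2) by blast
  then show ?thesis using M(2) periodic_vfrac[OF assms(1), of x] by metis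
 qed
 then show thesis using that M(1) by blast
qed

lemma torus_Lp_bounded:
 fixes f :: "space \<Rightarrow> 'b::euclidean_space"
 assumes "periodic f" and [measurable]: "f \<in> Borel" and M: "\<And>x. norm (f x) \<le> M"
 shows "torus_Lp p f"
proof -
 have "integrable torus (\<lambda>x. norm (f x) ^ p)"
  by (rule torus.integrable_const_bound[of _ "M ^ p"]) (use M in \<open>auto intro!: power_mono\<close>)
 then show ?thesis using assms by (simp add: torus_Lp_def)
qed

lemma torus_Lp_smooth:
 fixes f :: "space \<Rightarrow> 'b::euclidean_space"
 assumes "periodic f" "smooth f"
 shows "torus_Lp p f"
proof -
 obtain M where "\<And>x. norm (f x) \<le> M"
  using periodic_continuous_bounded[OF assms(1) smooth_continuous[OF assms(2)]] by blast
 then show ?thesis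
  using assms by (intro torus_Lp_bounded[of f M]) (auto intro: borel_measurable_continuous_onI smooth_continuous)
qed

lemma torus_L2_inner_integrable:
 fixes f g :: "space \<Rightarrow> 'b::euclidean_space"
 assumes f: "torus_Lp 2 f" and g: "torus_Lp 2 g"
 shows "integrable torus (\<lambda>x. f x \<bullet> g x)" and "integrable torus (\<lambda>x. norm (f x) * norm (g x))"
  and "(nnT x. norm (f x) * norm (g x))
   \<le> ennreal ((LINT x|torus. (norm (f x))\<^sup>2) + (LINT x|torus. (norm (g x))\<^sup>2))"
proof -
 note [measurable] = torus_LpD(2)[OF f] torus_LpD(2)[OF g]
 have "norm (f x) * norm (g x) \<le> (norm (f x))\<^sup>2 + (norm (g x))\<^sup>2" for x
 proof -
  have "2 * (norm (f x) * norm (g x)) \<le> (norm (f x))\<^sup>2 + (norm (g x))\<^sup>2"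
   using sum_squares_bound[of "norm (f x)" "norm (g x)"] by (simp only: mult.assoc)
  moreover have "0 \<le> norm (f x) * norm (g x)" by simp
  ultimately show ?thesis by linarith
 qed
 note b = this
 have i: "integrable torus (\<lambda>x. (norm (f x))\<^sup>2 + (norm (g x))\<^sup>2)"
  using torus_LpD(3)[OF f] torus_LpD(3)[OF g] by simp
 then show i2: "integrable torus (\<lambda>x. norm (f x) * norm (g x))"
  by (rule L_integrable_bound) (use b in auto)
 then show "integrable torus (\<lambda>x. f x \<bullet> g x)"
  by (rule L_integrable_bound) (auto intro!: AE_I2 simp: Cauchy_Schwarz_ineq2)
 have "(nnT x. norm (f x) * norm (g x)) \<le> (nnT x. ennreal ((norm (f x))\<^sup>2 + (norm (g x))\<^sup>2))"
  by (intro nn_integral_mono ennreal_leI b)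
 also have "... = ennreal (LINT x|torus. (norm (f x))\<^sup>2 + (norm (g x))\<^sup>2)"
  by (rule nn_integral_eq_integral[OF i]) auto
 also have "(LINT x|torus. (norm (f x))\<^sup>2 + (norm (g x))\<^sup>2) = (LINT x|torus. (norm (f x))\<^sup>2) + (LINT x|torus. (norm (g x))\<^sup>2)"
  using torus_LpD(3)[OF f] torus_LpD(3)[OF g] by simp
 finally show "(nnT x. norm (f x) * norm (g x))
   \<le> ennreal ((LINT x|torus. (norm (f x))\<^sup>2) + (LINT x|torus. (norm (g x))\<^sup>2))" .
qed

lemma integral_torus_norm_shift:
 fixes f :: "space \<Rightarrow> 'b::euclidean_space"
 assumes "periodic f" and [measurable]: "f \<in> Borel"
 shows "(LINT x|torus. norm (f (x + a)) ^ p) = (LINT x|torus. norm (f x) ^ p)"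
 by (rule integral_torus_shift(1)[of "\<lambda>x. norm (f x) ^ p"])
  (auto intro: periodic_compose assms)

lemma conv_pairing:
 fixes f g :: "space \<Rightarrow> 'b::euclidean_space"
 assumes K: "bump_kernel K" and f: "torus_Lp 2 f" and g: "torus_Lp 2 g"
 shows "(LINT x|torus. g x \<bullet> conv K f x) = (LBINT z. K z * (LINT x|torus. g x \<bullet> f (x - z)))"
proof -
 note [measurable] = torus_LpD(2)[OF f] torus_LpD(2)[OF g] kernel_measurable[OF K]
 have f1: "torus_L1 f" using torus_Lp_imp_L1[OF f] by simp
 have fz: "torus_Lp 2 (\<lambda>x. f (x - z))" for z using torus_Lp_shift[OF f, of "- z"] by simp
 have "(LINT x|torus. g x \<bullet> conv K f x) = (LINT x|torus. (LBINT z. K z *\<^sub>R (g x \<bullet> f (x - z))))"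
 proof (rule L_integral_cong)
  fix x
  have "integrable lborel (\<lambda>z. K z *\<^sub>R f (x - z))"
   using lborel_reflect(2)[of "\<lambda>y. K (x - y) *\<^sub>R f y" x] conv_integrable[OF K f1, of x] by simp
  then show "g x \<bullet> conv K f x = (LBINT z. K z *\<^sub>R (g x \<bullet> f (x - z)))"
   by (simp add: conv_reflect inner_commute[of "g x"] flip: integral_inner_left)
 qed simp
 also have "... = (LBINT z. K z *\<^sub>R (LINT x|torus. g x \<bullet> f (x - z)))"
 proof (rule kernel_swap(4)[OF kernel_integrable[OF K]])
  show "(\<lambda>(x, z). g x \<bullet> f (x - z)) \<in> Borel2"
   by measurable
  fix z
  have "(nnT x. norm (g x \<bullet> f (x - z))) \<le> (nnT x. norm (g x) * norm (f (x - z)))"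
   by (intro nn_integral_mono ennreal_leI) (simp add: Cauchy_Schwarz_ineq2)
  also have "... \<le> ennreal ((LINT x|torus. (norm (g x))\<^sup>2) + (LINT x|torus. (norm (f (x - z)))\<^sup>2))"
   by (rule torus_L2_inner_integrable(3)[OF g fz])
  also have "(LINT x|torus. (norm (f (x - z)))\<^sup>2) = (LINT x|torus. (norm (f x))\<^sup>2)"
   using integral_torus_norm_shift[of f "- z" 2] torus_LpD[OF f] by simp
  finally show "(nnT x. norm (g x \<bullet> f (x - z))) \<le> ennreal ((LINT x|torus. (norm (g x))\<^sup>2) + (LINT x|torus. (norm (f x))\<^sup>2))" .
 qed
 finally show ?thesis by simp
qed

lemma kernel_reflect: "bump_kernel K ==> bump_kernel (\<lambda>z. K (- z))"
proof -
 assume K: "bump_kernel K"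
 have "smooth (\<lambda>z. K (- z + 0))"
  by (rule smooth_affine[OF _ kernel_smooth[OF K]]) (rule bounded_linear_minus[OF bounded_linear_ident])
 moreover have "{z. K (- z) \<noteq> 0} = uminus ` {z. K z \<noteq> 0}"
  by (force simp: image_iff intro: exI[of _ "- _"])
 moreover have "bounded (uminus ` {z. K z \<noteq> 0})"
  using K by (simp add: bump_kernel_def bounded_uminus)
 ultimately show ?thesis by (simp add: bump_kernel_def)
qed

lemma conv_adjoint:
 fixes f g :: "space \<Rightarrow> 'b::euclidean_space"
 assumes K: "bump_kernel K" and f: "torus_Lp 2 f" and g: "torus_Lp 2 g"
 shows "(LINT x|torus. g x \<bullet> conv K f x) = (LINT x|torus. conv (\<lambda>z. K (- z)) g x \<bullet> f x)"
proof -
 note [measurable] = torus_LpD(2)[OF f] torus_LpD(2)[OF g] kernel_measurable[OF K]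
 have "(LINT x|torus. f x \<bullet> conv (\<lambda>z. K (- z)) g x) = (LBINT z. K (- z) * (LINT x|torus. f x \<bullet> g (x - z)))"
  by (rule conv_pairing[OF kernel_reflect[OF K] g f])
 also have "... = (LBINT z. K (- (0 - z)) * (LINT x|torus. f x \<bullet> g (x - (0 - z))))"
  by (rule lborel_reflect(1)[symmetric]) measurable
 also have "... = (LBINT z. K z * (LINT x|torus. g x \<bullet> f (x - z)))"
 proof (intro L_integral_cong refl)
  fix z
  have p: "periodic (\<lambda>x. g x \<bullet> f (x - z))"
   using periodic_compose2[OF torus_LpD(1)[OF g] periodic_shift[OF torus_LpD(1)[OF f], of "- z"]] by simp
  have "(LINT x|torus. f x \<bullet> g (x + z)) = (LINT x|torus. g x \<bullet> f (x - z))"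
   using integral_torus_shift(1)[OF p, of z] by (simp add: inner_commute)
  then show "K (- (0 - z)) * (LINT x|torus. f x \<bullet> g (x - (0 - z))) = K z * (LINT x|torus. g x \<bullet> f (x - z))"
   by simp
 qed
 also have "... = (LINT x|torus. g x \<bullet> conv K f x)"
  by (rule conv_pairing[OF K f g, symmetric])
 finally show ?thesis by (simp add: inner_commute)
qed

lemma conv_norm_power:
 fixes f :: "space \<Rightarrow> 'b::euclidean_space"
 assumes K: "bump_kernel K" and f: "torus_Lp p f" and p: "p = 2 \<or> p = 3"
 shows "norm (conv K f x) ^ p \<le> (LBINT z. \<bar>K z\<bar>) ^ (p - 1) * (LBINT z. \<bar>K z\<bar> * norm (f (x - z)) ^ p)"
  and "integrable lborel (\<lambda>z. \<bar>K z\<bar> * norm (f (x - z)) ^ p)"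
proof -
 note [measurable] = torus_LpD(2)[OF f] kernel_measurable[OF K]
 have fp: "torus_L1 (\<lambda>y. norm (f y) ^ p)"
  using torus_LpD[OF f] by (auto simp: torus_L1_def intro: periodic_compose)
 have "integrable lborel (\<lambda>z. K z *\<^sub>R norm (f (x - z)) ^ p)"
  using lborel_reflect(2)[of "\<lambda>y. K (x - y) *\<^sub>R norm (f y) ^ p" x] conv_integrable[OF K fp, of x] by simp
 then show i: "integrable lborel (\<lambda>z. \<bar>K z\<bar> * norm (f (x - z)) ^ p)"
  using integrable_norm by (fastforce simp: abs_mult)
 have "norm (conv K f x) \<le> (LBINT z. norm (K z *\<^sub>R f (x - z)))"
  using integral_norm_bound[of lborel "\<lambda>z. K z *\<^sub>R f (x - z)"] by (simp add: conv_reflect del: norm_scaleR)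
 also have "... = (LBINT z. \<bar>K z\<bar> * norm (f (x - z)))" by simp
 finally have "norm (conv K f x) ^ p \<le> (LBINT z. \<bar>K z\<bar> * norm (f (x - z))) ^ p"
  by (intro power_mono) auto
 also have "... \<le> (LBINT z. \<bar>K z\<bar>) ^ (p - 1) * (LBINT z. \<bar>K z\<bar> * norm (f (x - z)) ^ p)"
  by (rule integral_power_mean(2)[OF _ _ _ _ p i]) (use kernel_integrable[OF K] in auto)
 finally show "norm (conv K f x) ^ p \<le> (LBINT z. \<bar>K z\<bar>) ^ (p - 1) * (LBINT z. \<bar>K z\<bar> * norm (f (x - z)) ^ p)" .
qed

text \<open>Young's inequality: Jensen for the measure \<open>\<bar>K\<bar>\<close>, then translation invariance on the torus.\<close>

lemma conv_Lp_bound: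
 fixes f :: "space \<Rightarrow> 'b::euclidean_space"
 assumes K: "bump_kernel K" and f: "torus_Lp p f" and p: "p = 2 \<or> p = 3"
 shows "(LINT x|torus. norm (conv K f x) ^ p) \<le> (LBINT z. \<bar>K z\<bar>) ^ p * (LINT x|torus. norm (f x) ^ p)"
proof -
 note [measurable] = torus_LpD(2)[OF f] kernel_measurable[OF K]
 have f1: "torus_L1 f" using torus_Lp_imp_L1[OF f] p by auto
 have Ki: "integrable lborel (\<lambda>z. \<bar>K z\<bar>)" using kernel_integrable[OF K] by simp
 let ?A = "LBINT z. \<bar>K z\<bar>"
 have s: "(LINT x|torus. norm (f (x - z)) ^ p) = (LINT x|torus. norm (f x) ^ p)" for z
  using integral_torus_norm_shift[of f "- z" p] torus_LpD[OF f] by simp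
 have sw: "integrable torus (\<lambda>x. (LBINT z. \<bar>K z\<bar> *\<^sub>R norm (f (x - z)) ^ p))"
  "(LINT x|torus. (LBINT z. \<bar>K z\<bar> *\<^sub>R norm (f (x - z)) ^ p)) = (LBINT z. \<bar>K z\<bar> *\<^sub>R (LINT x|torus. norm (f (x - z)) ^ p))"
 proof -
  have b: "(nnT x. norm (norm (f (x - z)) ^ p)) \<le> ennreal (LINT x|torus. norm (f x) ^ p)" for z
   using nn_integral_torus_norm_shift[OF torus_LpD(1,2)[OF f], of "- z" p]
    nn_integral_eq_integral[OF torus_LpD(3)[OF f]] by simp
  have m: "(\<lambda>(x, z). norm (f (x - z)) ^ p) \<in> Borel2" by measurable
  show "integrable torus (\<lambda>x. (LBINT z. \<bar>K z\<bar> *\<^sub>R norm (f (x - z)) ^ p))"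
   "(LINT x|torus. (LBINT z. \<bar>K z\<bar> *\<^sub>R norm (f (x - z)) ^ p)) = (LBINT z. \<bar>K z\<bar> *\<^sub>R (LINT x|torus. norm (f (x - z)) ^ p))"
   by (rule kernel_swap(2)[OF Ki m b], rule kernel_swap(4)[OF Ki m b])
 qed
 have "(LINT x|torus. norm (conv K f x) ^ p) \<le> (LINT x|torus. ?A ^ (p - 1) * (LBINT z. \<bar>K z\<bar> *\<^sub>R norm (f (x - z)) ^ p))"
 proof (rule integral_mono)
  show "integrable torus (\<lambda>x. norm (conv K f x) ^ p)"
   using torus_LpD(3)[OF torus_Lp_smooth[OF conv_periodic[OF K f1] smooth_conv[OF K f1]]] .
  show "integrable torus (\<lambda>x. ?A ^ (p - 1) * (LBINT z. \<bar>K z\<bar> *\<^sub>R norm (f (x - z)) ^ p))"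
   using sw(1) by (rule integrable_mult_right)
  show "norm (conv K f x) ^ p \<le> ?A ^ (p - 1) * (LBINT z. \<bar>K z\<bar> *\<^sub>R norm (f (x - z)) ^ p)" for x
   using conv_norm_power(1)[OF K f p, of x] by simp
 qed
 also have "... = ?A ^ (p - 1) * (?A * (LINT x|torus. norm (f x) ^ p))"
  using sw(2) Ki by (simp add: s)
 also have "... = ?A ^ p * (LINT x|torus. norm (f x) ^ p)" using p by (auto simp: power2_eq_square power3_eq_cube)
 finally show ?thesis .
qed

lemma torus_translation_continuous:
 fixes f :: "space \<Rightarrow> 'b::euclidean_space"
 assumes f: "torus_Lp p f" and p: "p > 0" and e: "e > 0"
 obtains d where "d > 0" "\<And>h. norm h < d ==> (nnT x. norm (f (x + h) - f x) ^ p) \<le> ennreal e"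
proof -
 note [measurable] = torus_LpD(2)[OF f]
 have [measurable]: "ball (0::space) 4 \<in> sets borel" by simp
 define g where "g x = indicator (ball 0 4) x *\<^sub>R f x" for x
 have [measurable]: "g \<in> Borel" unfolding g_def by measurable
 have fp: "torus_L1 (\<lambda>y. norm (f y) ^ p)"
  using torus_LpD[OF f] by (auto simp: torus_L1_def intro: periodic_compose)
 have "integrable lborel (\<lambda>x. indicator (ball 0 4) x *\<^sub>R norm (f x) ^ p)"
  by (rule torus_L1_locally_integrable[OF fp]) auto
 moreover have "norm (g x) ^ p = indicator (ball 0 4) x *\<^sub>R norm (f x) ^ p" for x
  using p by (auto simp: g_def indicator_def power_0_left)
 ultimately have "integrable lborel (\<lambda>x. norm (g x) ^ p)" by simp
 then have "translation_continuous p g"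
  by (intro translation_continuous_Lp p) (auto simp: integrable_iff_bounded)
 then obtain d where d: "d > 0" "\<And>h. norm h < d ==> (nnL x. norm (g (x + h) - g x) ^ p) \<le> ennreal e"
  using e unfolding translation_continuous_def by blast
 have cube: "norm x < 3" if "x \<in> unit_cube" for x
 proof -
  have "norm x \<le> (\<Sum>i\<in>UNIV. \<bar>x $ i\<bar>)" by (rule norm_le_l1_cart)
  also have "... < (\<Sum>i\<in>(UNIV::3 set). 1)"
   using that by (intro sum_strict_mono) (auto simp: unit_cube_def)
  finally show ?thesis by simp
 qed
 show thesis
 proof (rule that[of "min d 1"])
  fix h :: space assume h: "norm h < min d 1"
  have "(nnT x. norm (f (x + h) - f x) ^ p) = (nnL x. indicator unit_cube x * ennreal (norm (f (x + h) - f x) ^ p))"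
   by (rule nn_integral_torus) measurable
  also have "... \<le> (nnL x. norm (g (x + h) - g x) ^ p)"
  proof (rule nn_integral_mono)
   fix x
   show "indicator unit_cube x * ennreal (norm (f (x + h) - f x) ^ p) \<le> ennreal (norm (g (x + h) - g x) ^ p)"
   proof (cases "x \<in> unit_cube")
    case True
    then have "norm x < 3" by (rule cube)
    moreover have "norm (x + h) < 4" using norm_triangle_ineq[of x h] h \<open>norm x < 3\<close> by simp
    ultimately show ?thesis using True by (simp add: g_def)
   qed simp
  qed
  also have "... \<le> ennreal e" using d(2) h by simp
  finally show "(nnT x. norm (f (x + h) - f x) ^ p) \<le> ennreal e" .
 qed (use d in auto)
qed

lemma torus_Lp_Suc_0: "torus_Lp (Suc 0) f \<longleftrightarrow> torus_L1 f"
 using torus_Lp_1[of f] by simp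

section \<open>Rescaled kernels and approximation\<close>

lemma lborel_scale:
 fixes g :: "space \<Rightarrow> 'b::euclidean_space"
 assumes [measurable]: "g \<in> Borel" and s: "s > 0"
 shows "(LBINT x. g (x /\<^sub>R s)) = s ^ 3 *\<^sub>R (LBINT x. g x)"
proof -
 have "(lborel :: space measure) = density (distr lborel borel (\<lambda>x::space. 0 + s *\<^sub>R x)) (\<lambda>_. ennreal (\<bar>s\<bar>^DIM(space)))"
  by (rule lborel_affine) (use s in auto)
 then have "(LBINT x. g (x /\<^sub>R s)) = (LINT x|density (distr lborel borel (\<lambda>x::space. s *\<^sub>R x)) (\<lambda>_. ennreal (s ^ 3)). g (x /\<^sub>R s))"
  using s by simp
 also have "... = (LINT x|distr lborel borel (\<lambda>x::space. s *\<^sub>R x). s ^ 3 *\<^sub>R g (x /\<^sub>R s))"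
  using s by (subst integral_density) auto
 also have "... = (LBINT x. s ^ 3 *\<^sub>R g x)"
  using s by (subst integral_distr) auto
 finally show ?thesis by simp
qed

lemma kernel_rescale:
 assumes K: "bump_kernel K" and s: "s > 0"
 shows "bump_kernel (rescale K s)"
proof -
 have "smooth (\<lambda>x. (1 / s ^ 3) * K (x /\<^sub>R s + 0))"
  by (intro smooth_mult smooth_const smooth_affine[OF _ kernel_smooth[OF K]] bounded_linear_scaleR_right)
 moreover have "{x. K (x /\<^sub>R s) \<noteq> 0} \<subseteq> (\<lambda>x. s *\<^sub>R x) ` {x. K x \<noteq> 0}"
 proof
  fix x assume "x \<in> {x. K (x /\<^sub>R s) \<noteq> 0}"
  then show "x \<in> (\<lambda>x. s *\<^sub>R x) ` {x. K x \<noteq> 0}"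
   using s by (intro image_eqI[of _ _ "x /\<^sub>R s"]) auto
 qed
 moreover have "bounded ((\<lambda>x. s *\<^sub>R x) ` {x. K x \<noteq> 0})"
  using K by (simp add: bump_kernel_def bounded_scaling)
 ultimately show ?thesis
  using s by (auto simp: bump_kernel_def rescale_def[abs_def] intro: bounded_subset)
qed

lemma integral_rescale:
 assumes [measurable]: "K \<in> Borel" and s: "s > 0"
 shows "(LBINT x. rescale K s x) = (LBINT x. K x)" "(LBINT x. \<bar>rescale K s x\<bar>) = (LBINT x. \<bar>K x\<bar>)"
 using lborel_scale[of K s] lborel_scale[of "\<lambda>x. \<bar>K x\<bar>" s] s by (simp_all add: rescale_def abs_mult)

lemma partial_rescale:
 assumes K: "smooth K" and s: "s > 0"
 shows "partial b (rescale K s) x = partial b K (x /\<^sub>R s) / s ^ 4"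
proof -
 have "((\<lambda>x. K (x /\<^sub>R s)) has_derivative (\<lambda>h. frechet_derivative K (at (x /\<^sub>R s)) (h /\<^sub>R s))) (at x)"
  using diff_chain_at[OF bounded_linear_imp_has_derivative[OF bounded_linear_scaleR_right[of "inverse s"]]
    smooth_has_derivative[OF K]] by (simp add: o_def)
 then have "((\<lambda>x. K (x /\<^sub>R s) * (1 / s ^ 3)) has_derivative
   (\<lambda>h. frechet_derivative K (at (x /\<^sub>R s)) (h /\<^sub>R s) * (1 / s ^ 3))) (at x)"
  by (rule has_derivative_mult_left)
 then have "partial b (rescale K s) x = frechet_derivative K (at (x /\<^sub>R s)) (b /\<^sub>R s) * (1 / s ^ 3)"
  by (intro partial_eq) (simp add: rescale_def[abs_def])
 also have "frechet_derivative K (at (x /\<^sub>R s)) (b /\<^sub>R s) = partial b K (x /\<^sub>R s) / s"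
  using linear_scale[OF linear_frechet_derivative[OF smooth_differentiable[OF K]]]
  by (simp add: partial_def divide_inverse mult.commute)
 finally show ?thesis using s by (simp add: power_numeral_reduce field_simps)
qed

lemma rescale_support:
 assumes "\<And>x. R < norm x ==> K x = 0" and "s > 0" "R * s < norm x"
 shows "rescale K s x = 0"
proof -
 have "R < norm (x /\<^sub>R s)" using assms(2,3) by (simp add: field_simps)
 then show ?thesis using assms(1) by (simp add: rescale_def)
qed

lemma conv_diff_kernel:
 assumes "bump_kernel K" "bump_kernel L" "torus_L1 f"
 shows "conv (\<lambda>x. K x - c * L x) f x = conv K f x - c *\<^sub>R conv L f x"
proof -
 have "conv (\<lambda>x. K x - c * L x) f x = (LBINT y. K (x - y) *\<^sub>R f y - c *\<^sub>R (L (x - y) *\<^sub>R f y))"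
  by (simp only: conv_def scaleR_diff_left scaleR_scaleR)
 also have "... = conv K f x - c *\<^sub>R conv L f x"
  using conv_integrable[OF assms(1,3)] conv_integrable[OF assms(2,3)]
  by (simp add: conv_def del: scaleR_scaleR)
 finally show ?thesis .
qed

lemma conv_diff:
 assumes "bump_kernel K" "torus_L1 f" "torus_L1 g"
 shows "conv K (\<lambda>x. f x - g x) x = conv K f x - conv K g x"
 using conv_integrable[OF assms(1,2)] conv_integrable[OF assms(1,3)]
 by (simp add: conv_def scaleR_diff_right)

lemma conv_linear:
 assumes "bump_kernel K" "torus_L1 f" "bounded_linear h"
 shows "h (conv K f x) = conv K (\<lambda>y. h (f y)) x"
 using integral_bounded_linear[OF assms(3) conv_integrable[OF assms(1,2)], of x]
 by (simp add: conv_def linear_simps[OF assms(3)])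

lemma conv_shift:
 fixes f :: "space \<Rightarrow> 'b::euclidean_space"
 assumes "bump_kernel K" "torus_L1 f"
 shows "conv K (\<lambda>y. f (y + a)) x = conv K f (x + a)"
proof -
 note [measurable] = kernel_measurable[OF assms(1)] torus_L1D(2)[OF assms(2)]
 show ?thesis
  by (subst (1 2) conv_reflect) (auto simp: algebra_simps)
qed

lemma mollify_L1_bound:
 fixes f :: "space \<Rightarrow> 'b::euclidean_space"
 assumes K: "bump_kernel K" "(LBINT z. K z) = 1" and f: "torus_L1 f"
  and supp: "\<And>z. K z \<noteq> 0 ==> norm z < d"
  and e: "\<And>h. norm h < d ==> (nnT x. norm (f (x + h) - f x)) \<le> ennreal e" "0 \<le> e"
 shows "(LINT x|torus. norm (conv K f x - f x)) \<le> (LBINT z. \<bar>K z\<bar>) * e"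
proof -
 note [measurable] = kernel_measurable[OF K(1)] torus_L1D(2)[OF f]
 have Ki: "integrable lborel (\<lambda>z. \<bar>K z\<bar>)" using kernel_integrable[OF K(1)] by simp
 define h where "h x z = indicator (ball 0 d) z * norm (f (x - z) - f x)" for x z
 have [measurable]: "ball (0::space) d \<in> sets borel" by simp
 have m: "(\<lambda>(x, z). h x z) \<in> Borel2"
  unfolding h_def by measurable
 have b: "(nnT x. norm (h x z)) \<le> ennreal e" for z
  using e(1)[of "- z"] by (cases "z \<in> ball 0 d") (auto simp: h_def)
 note sw = kernel_swap[OF Ki m b]
 have "norm (conv K f x - f x) \<le> (LBINT z. \<bar>K z\<bar> *\<^sub>R h x z)" for x
 proof -
  have i: "integrable lborel (\<lambda>z. K z *\<^sub>R f (x - z))"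
   using lborel_reflect(2)[of "\<lambda>y. K (x - y) *\<^sub>R f y" x] conv_integrable[OF K(1) f, of x] by simp
  have i2: "integrable lborel (\<lambda>z. K z *\<^sub>R f x)" using kernel_integrable[OF K(1)] by simp
  have "conv K f x - f x = (LBINT z. K z *\<^sub>R (f (x - z) - f x))"
   using i i2 K(2) kernel_integrable[OF K(1)] by (simp add: conv_reflect scaleR_diff_right)
  also have "norm \<dots> \<le> (LBINT z. norm (K z *\<^sub>R (f (x - z) - f x)))"
   by (rule integral_norm_bound)
  also have "... = (LBINT z. \<bar>K z\<bar> *\<^sub>R h x z)"
   using supp by (intro L_integral_cong) (auto simp: h_def indicator_def)
  finally show ?thesis .
 qed
 then have "(LINT x|torus. norm (conv K f x - f x)) \<le> (LINT x|torus. (LBINT z. \<bar>K z\<bar> *\<^sub>R h x z))"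
 proof (intro integral_mono_AE' AE_I2)
  show "0 \<le> (LBINT z. \<bar>K z\<bar> *\<^sub>R h x z)" for x
   by (intro L_integral_nonneg) (simp add: h_def)
 qed (use sw(2) in auto)
 also have "... = (LBINT z. \<bar>K z\<bar> * (LINT x|torus. h x z))"
  using sw(4) by simp
 also have "... \<le> (LBINT z. \<bar>K z\<bar> * e)"
 proof (rule integral_mono)
  show "integrable lborel (\<lambda>z. \<bar>K z\<bar> * (LINT x|torus. h x z))" using sw(3) by simp
  show "integrable lborel (\<lambda>z. \<bar>K z\<bar> * e)" using Ki by simp
  fix z
  have "(LINT x|torus. h x z) \<le> e"
  proof (rule integral_real_bounded)
   show "(nnT x. ennreal (h x z)) \<le> ennreal e"
    using b[of z] by (simp add: h_def)
  qed fact
  then show "\<bar>K z\<bar> * (LINT x|torus. h x z) \<le> \<bar>K z\<bar> * e" by (intro mult_left_mono) auto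
 qed
 finally show ?thesis by simp
qed

lemma mollify_tendsto_L1:
 fixes f :: "space \<Rightarrow> 'b::euclidean_space"
 assumes K: "bump_kernel K" "(LBINT z. K z) = 1" and f: "torus_L1 f"
 shows "(\<lambda>n. LINT x|torus. norm (conv (rescale K (1 / Suc n)) f x - f x)) \<longlonglongrightarrow> 0"
proof (rule LIMSEQ_I)
 fix r :: real assume r: "r > 0"
 note [measurable] = kernel_measurable[OF K(1)]
 define A where "A = (LBINT z. \<bar>K z\<bar>) + 1"
 have A: "A > 0" unfolding A_def by (intro add_nonneg_pos L_integral_nonneg) auto
 obtain R M where RM: "R > 0" "M > 0" "\<And>x. \<bar>K x\<bar> \<le> M * indicator (cball 0 R) x"
  using kernel_bound[OF K(1)] by blast
 have supp: "K x = 0" if "R < norm x" for x using RM(3)[of x] that by (auto simp: indicator_def)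
 have "torus_Lp 1 f" using f by (simp add: torus_Lp_Suc_0)
 then obtain d where d: "d > 0" "\<And>h. norm h < d ==> (nnT x. norm (f (x + h) - f x) ^ 1) \<le> ennreal (r / (2 * A))"
  by (rule torus_translation_continuous[of 1 f "r / (2 * A)"]) (use r A in simp_all)
 obtain N :: nat where N: "R / d < real N" using reals_Archimedean2 by blast
 show "\<exists>no. \<forall>n\<ge>no. norm ((LINT x|torus. norm (conv (rescale K (1 / Suc n)) f x - f x)) - 0) < r"
 proof (intro exI[of _ N] allI impI)
  fix n assume n: "N \<le> n"
  let ?s = "1 / real (Suc n)"
  have Rs: "R * ?s < d"
  proof -
   have "R / d < real (Suc n)" using N n by linarith
   then show ?thesis using d(1) by (simp add: field_simps)
  qed
  have "(LINT x|torus. norm (conv (rescale K ?s) f x - f x)) \<le> (LBINT z. \<bar>rescale K ?s z\<bar>) * (r / (2 * A))"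
  proof (rule mollify_L1_bound)
   show "bump_kernel (rescale K ?s)" by (rule kernel_rescale[OF K(1)]) simp
   show "(LBINT z. rescale K ?s z) = 1" using integral_rescale(1)[of K ?s] K(2) by simp
   show "norm z < d" if "rescale K ?s z \<noteq> 0" for z
    using rescale_support[of R K ?s z] supp that Rs by fastforce
   show "(nnT x. norm (f (x + h) - f x)) \<le> ennreal (r / (2 * A))" if "norm h < d" for h
    using d(2)[OF that] by simp
  qed (use f r A in auto)
  also have "(LBINT z. \<bar>rescale K ?s z\<bar>) = (LBINT z. \<bar>K z\<bar>)"
   by (rule integral_rescale) auto
  also have "(LBINT z. \<bar>K z\<bar>) * (r / (2 * A)) \<le> A * (r / (2 * A))"
   using r A by (intro mult_right_mono) (auto simp: A_def)
  also have "... < r" using A r by simp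
  finally show "norm ((LINT x|torus. norm (conv (rescale K ?s) f x - f x)) - 0) < r"
   using L_integral_nonneg[of torus "\<lambda>x. norm (conv (rescale K ?s) f x - f x)"] by simp
 qed
qed

text \<open>Mollifications converge in \<open>L\<^sup>1\<close>, hence almost everywhere along a subsequence, so Fatou's lemma transfers uniform bounds.\<close>

lemma mollify_fatou:
 fixes f :: "space \<Rightarrow> 'b::euclidean_space"
 assumes K: "bump_kernel K" "(LBINT z. K z) = 1" and f: "torus_L1 f"
  and bound: "\<And>n. (nnT x. norm (conv (rescale K (1 / Suc n)) f x) ^ p) \<le> C"
 shows "(nnT x. norm (f x) ^ p) \<le> C"
proof -
 let ?g = "\<lambda>n. conv (rescale K (1 / Suc n)) f"
 have Kn: "bump_kernel (rescale K (1 / Suc n))" for n by (rule kernel_rescale[OF K(1)]) simp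
 note [measurable] = torus_L1D(2)[OF f]
 have [measurable]: "?g n \<in> Borel" for n
  by (rule borel_measurable_continuous_onI[OF smooth_continuous[OF smooth_conv[OF Kn f]]])
 have i: "integrable torus (\<lambda>x. ?g n x - f x)" for n
  using torus_Lp_smooth[OF conv_periodic[OF Kn f] smooth_conv[OF Kn f], of 1 n]
  by (intro L_integrable_diff torus_L1D(3)[OF f]) (simp add: torus_Lp_Suc_0 torus_L1_def)
 obtain r where r: "strict_mono r" "AE x in torus. (\<lambda>n. ?g (r n) x - f x) \<longlonglongrightarrow> 0"
  using tendsto_L1_AE_subseq[OF i mollify_tendsto_L1[OF K f]] by blast
 have "(nnT x. norm (f x) ^ p) \<le> (nnT x. liminf (\<lambda>n. ennreal (norm (?g (r n) x) ^ p)))"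
 proof (rule nn_integral_mono_AE)
  show "AE x in torus. ennreal (norm (f x) ^ p) \<le> liminf (\<lambda>n. ennreal (norm (?g (r n) x) ^ p))"
   using r(2)
  proof eventually_elim
   case (elim x)
   then have "(\<lambda>n. ?g (r n) x) \<longlonglongrightarrow> f x" by (simp add: LIM_zero_cancel)
   then have "(\<lambda>n. ennreal (norm (?g (r n) x) ^ p)) \<longlonglongrightarrow> ennreal (norm (f x) ^ p)"
    by (intro tendsto_ennrealI tendsto_intros)
   then have "liminf (\<lambda>n. ennreal (norm (?g (r n) x) ^ p)) = ennreal (norm (f x) ^ p)"
    by (rule lim_imp_Liminf[OF sequentially_bot])
   then show ?case by (simp only: order_refl)
  qed
 qed
 also have "... \<le> liminf (\<lambda>n. nnT x. ennreal (norm (?g (r n) x) ^ p))"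
  by (rule nn_integral_liminf) measurable
 also have "... \<le> limsup (\<lambda>n. nnT x. ennreal (norm (?g (r n) x) ^ p))"
  by (rule Liminf_le_Limsup) simp
 also have "... \<le> C"
  by (rule Limsup_bounded) (use bound in auto)
 finally show ?thesis .
qed

section \<open>The Helmholtz equation on the torus\<close>

text \<open>The weak form of \<open>u - \<alpha>\<^sup>2\<Delta>u = v\<close> for one component.\<close>

definition helmholtz :: "real \<Rightarrow> (space \<Rightarrow> real) \<Rightarrow> (space \<Rightarrow> real) \<Rightarrow> bool" where
 "helmholtz \<alpha> v u \<longleftrightarrow> torus_Lp 2 u \<and> torus_Lp 2 v \<and>
  (\<forall>\<psi>. smooth \<psi> \<and> periodic \<psi> \<longrightarrow>
    (LINT x|torus. (\<psi> x - \<alpha>\<^sup>2 * laplacian \<psi> x) * u x) = (LINT x|torus. \<psi> x * v x))"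

lemma axis_Basis: "axis i (1::real) \<in> Basis"
 by (simp add: axis_in_Basis_iff)

lemma kernel_dx: "bump_kernel K ==> bump_kernel (dx i K)"
 unfolding dx_def by (rule kernel_partial[OF _ axis_Basis])

lemma dx_conv: "bump_kernel K ==> torus_L1 f ==> dx i (conv K f) = conv (dx i K) f"
 unfolding dx_def by (rule partial_conv[OF _ _ axis_Basis])

lemma kernel_sum: "finite I ==> (\<And>i. i \<in> I ==> bump_kernel (f i)) ==> bump_kernel (\<lambda>x. \<Sum>i\<in>I. f i x)"
proof -
 assume I: "finite I" "\<And>i. i \<in> I ==> bump_kernel (f i)"
 have "{x. (\<Sum>i\<in>I. f i x) \<noteq> 0} \<subseteq> (\<Union>i\<in>I. {x. f i x \<noteq> 0})"
  by (auto dest: sum.not_neutral_contains_not_neutral)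
 moreover have "bounded (\<Union>i\<in>I. {x. f i x \<noteq> 0})"
  using I by (intro bounded_UN) (auto simp: bump_kernel_def)
 ultimately show ?thesis
  using I by (auto simp: bump_kernel_def intro: smooth_sum bounded_subset)
qed

lemma kernel_laplacian: "bump_kernel K ==> bump_kernel (laplacian K)"
 unfolding laplacian_def[abs_def] by (intro kernel_sum kernel_dx) auto

lemma laplacian_conv:
 assumes "bump_kernel K" "torus_L1 f"
 shows "laplacian (conv K f) x = conv (laplacian K) f x"
proof -
 have "laplacian (conv K f) x = (\<Sum>i\<in>UNIV. conv (dx i (dx i K)) f x)"
  by (simp add: laplacian_def dx_conv kernel_dx assms)
 also have "... = conv (laplacian K) f x"
  using conv_integrable[OF kernel_dx[OF kernel_dx[OF assms(1)]] assms(2)]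
  by (simp add: conv_def laplacian_def sum_distrib_right)
 finally show ?thesis .
qed

lemma kernel_diff: "bump_kernel K ==> bump_kernel L ==> bump_kernel (\<lambda>x. K x - c * L x)"
proof -
 assume K: "bump_kernel K" and L: "bump_kernel L"
 have "smooth (\<lambda>x. K x + (- c) * L x)"
  by (intro smooth_add smooth_mult smooth_const kernel_smooth K L)
 moreover have "{x. K x - c * L x \<noteq> 0} \<subseteq> {x. K x \<noteq> 0} \<union> {x. L x \<noteq> 0}" by auto
 moreover have "bounded ({x. K x \<noteq> 0} \<union> {x. L x \<noteq> 0})"
  using K L by (simp add: bump_kernel_def)
 ultimately show ?thesis
  using bounded_subset[of "{x. K x \<noteq> 0} \<union> {x. L x \<noteq> 0}" "{x. K x - c * L x \<noteq> 0}"]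
  by (simp add: bump_kernel_def)
qed

lemma dx_reflect:
 assumes "smooth K"
 shows "dx i (\<lambda>z. K (- z)) x = - dx i K (- x)"
proof -
 have "((\<lambda>z. K (- z)) has_derivative (\<lambda>h. frechet_derivative K (at (- x)) (- h))) (at x)"
  using diff_chain_at[OF bounded_linear_imp_has_derivative[OF bounded_linear_minus[OF bounded_linear_ident]]
    smooth_has_derivative[OF assms]] by (simp add: o_def)
 then have "partial (axis i 1) (\<lambda>z. K (- z)) x = frechet_derivative K (at (- x)) (- axis i 1)"
  by (rule partial_eq)
 then show ?thesis
  using linear_neg[OF linear_frechet_derivative[OF smooth_differentiable[OF assms]]]
  by (simp add: dx_def partial_def)
qed

lemma dx_uminus:
 assumes "smooth f"
 shows "dx i (\<lambda>x. - f x) x = - dx i f x"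
 using partial_eq[OF has_derivative_minus[OF smooth_has_derivative[OF assms]]]
 by (simp add: dx_def partial_def)

lemma smooth_dx: "smooth f ==> smooth (dx i f)"
 unfolding dx_def by (rule smooth_partial[OF _ axis_Basis])

lemma laplacian_reflect:
 assumes "smooth K"
 shows "laplacian (\<lambda>z. K (- z)) x = laplacian K (- x)"
proof -
 have "dx i (dx i (\<lambda>z. K (- z))) x = dx i (dx i K) (- x)" for i
 proof -
  have "dx i (\<lambda>z. K (- z)) = (\<lambda>x. - dx i K (- x))"
   using dx_reflect[OF assms] by blast
  moreover have "smooth (\<lambda>x. dx i K (- x))"
   using smooth_affine[OF bounded_linear_minus[OF bounded_linear_ident] smooth_dx[OF assms, of i], of 0] by simp
  ultimately show ?thesis
   using dx_uminus[of "\<lambda>x. dx i K (- x)" i x] dx_reflect[OF smooth_dx[OF assms], of i i x] by simp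
 qed
 then show ?thesis by (simp add: laplacian_def)
qed

lemma periodic_continuous_AE_zero:
 fixes g :: "space \<Rightarrow> 'b::euclidean_space"
 assumes g: "periodic g" "continuous_on UNIV g" and "AE x in torus. g x = 0"
 shows "g x = 0"
proof -
 have [measurable]: "g \<in> Borel" using g(2) by (rule borel_measurable_continuous_onI)
 have "AE x in lborel. x \<in> unit_cube \<longrightarrow> g x = 0"
  using assms(3) unfolding torus_def by (subst (asm) AE_density) (auto simp: indicator_def)
 then have "AE x in lborel. x \<in> box 0 One \<longrightarrow> x \<in> {x. g x = 0}"
  by eventually_elim (use unit_cube_box(1) in blast)
 then have ae: "AE x\<in>box 0 One in lebesgue. x \<in> {x. g x = 0}"
  by (rule AE_completion)
 have cl: "closed {x. g x = 0}" by (intro closed_Collect_eq g(2) continuous_intros)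
 have "box 0 One \<subseteq> {x. g x = 0}"
  using mem_closed_if_AE_lebesgue_open[OF open_box cl ae] by blast
 then have "closure (box 0 One) \<subseteq> {x. g x = 0}" using cl by (rule closure_minimal)
 moreover have "closure (box 0 (One::space)) = cell"
  unfolding cell_def by (rule closure_box) (auto simp: box_ne_empty)
 ultimately have "g (x - vfloor x) = 0" using minus_vfloor[of x] unit_cube_box(2) by blast
 then show ?thesis using periodic_vfrac[OF g(1)] by simp
qed

lemma periodic_continuous_zero:
 fixes g :: "space \<Rightarrow> real"
 assumes g: "periodic g" "continuous_on UNIV g" and i: "(LINT x|torus. g x * g x) = 0"
 shows "g x = 0"
proof (rule periodic_continuous_AE_zero[OF g])
 have m: "g \<in> Borel" using g(2) by (rule borel_measurable_continuous_onI)
 obtain M where "\<And>x. norm (g x) \<le> M" using periodic_continuous_bounded[OF g] by blast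
 then have "torus_Lp 2 g" by (intro torus_Lp_bounded[OF g(1) m])
 then have "integrable torus (\<lambda>x. g x * g x)"
  using torus_L2_inner_integrable(1)[of g g] by simp
 then have "AE x in torus. g x * g x = 0"
  using i by (subst (asm) integral_nonneg_eq_0_iff_AE) auto
 then show "AE x in torus. g x = 0" by simp
qed

text \<open>Testing the weak equation with a reflected mollification of \<open>g\<close> gives the mollified equation paired with \<open>g\<close>; taking for \<open>g\<close> the smooth difference of both sides shows that it vanishes at every point.\<close>

lemma helmholtz_mollified:
 assumes H: "helmholtz \<alpha> v u" and K: "bump_kernel K"
 shows "conv K u x - \<alpha>\<^sup>2 * conv (laplacian K) u x = conv K v x"
proof -
 have u: "torus_Lp 2 u" and v: "torus_Lp 2 v" using H by (auto simp: helmholtz_def)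
 have u1: "torus_L1 u" and v1: "torus_L1 v" using torus_Lp_imp_L1 u v by fastforce+
 define K' where "K' x = K x - \<alpha>\<^sup>2 * laplacian K x" for x
 have K': "bump_kernel K'" unfolding K'_def[abs_def] by (rule kernel_diff[OF K kernel_laplacian[OF K]])
 have cK': "conv K' u x = conv K u x - \<alpha>\<^sup>2 * conv (laplacian K) u x" for x
  unfolding K'_def[abs_def] using conv_diff_kernel[OF K kernel_laplacian[OF K] u1] by simp
 define g where "g x = conv K' u x - conv K v x" for x
 have sg: "smooth g"
 proof -
  have "smooth (\<lambda>x. conv K' u x + (- 1) * conv K v x)"
   by (intro smooth_add smooth_mult smooth_const smooth_conv K K' u1 v1)
  then show ?thesis by (simp add: g_def[abs_def])
 qed
 have pg: "periodic g" unfolding g_def[abs_def]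
  by (rule periodic_compose2[OF conv_periodic[OF K' u1] conv_periodic[OF K v1]])
 have g2: "torus_Lp 2 g" by (rule torus_Lp_smooth[OF pg sg])
 have g1: "torus_L1 g" using torus_Lp_imp_L1[OF g2] by simp
 define \<psi> where "\<psi> = conv (\<lambda>z. K (- z)) g"
 have Kr: "bump_kernel (\<lambda>z. K (- z))" by (rule kernel_reflect[OF K])
 have \<psi>: "smooth \<psi>" "periodic \<psi>"
  unfolding \<psi>_def by (auto intro: smooth_conv conv_periodic Kr g1)
 have "(LINT x|torus. g x * conv K' u x) = (LINT x|torus. conv (\<lambda>z. K' (- z)) g x * u x)"
  using conv_adjoint[OF K' u g2] by simp
 also have "... = (LINT x|torus. (\<psi> x - \<alpha>\<^sup>2 * laplacian \<psi> x) * u x)"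
 proof -
  have "conv (\<lambda>z. K' (- z)) g x = \<psi> x - \<alpha>\<^sup>2 * laplacian \<psi> x" for x
  proof -
   have "(\<lambda>z. K' (- z)) = (\<lambda>z. K (- z) - \<alpha>\<^sup>2 * laplacian (\<lambda>z. K (- z)) z)"
    by (simp add: K'_def laplacian_reflect[OF kernel_smooth[OF K]])
   then show ?thesis
    using conv_diff_kernel[OF Kr kernel_laplacian[OF Kr] g1]
    by (simp add: \<psi>_def laplacian_conv[OF Kr g1])
  qed
  then show ?thesis by simp
 qed
 also have "... = (LINT x|torus. \<psi> x * v x)"
  using H \<psi> by (simp add: helmholtz_def)
 also have "... = (LINT x|torus. g x * conv K v x)"
  using conv_adjoint[OF K v g2] by (simp add: \<psi>_def)
 finally have eq: "(LINT x|torus. g x * conv K' u x) = (LINT x|torus. g x * conv K v x)" .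
 have "(LINT x|torus. g x * g x) = (LINT x|torus. g x * conv K' u x - g x * conv K v x)"
  by (simp add: g_def right_diff_distrib)
 also have "... = 0"
  using torus_L2_inner_integrable(1)[OF g2 torus_Lp_smooth[OF conv_periodic[OF K' u1] smooth_conv[OF K' u1]]]
   torus_L2_inner_integrable(1)[OF g2 torus_Lp_smooth[OF conv_periodic[OF K v1] smooth_conv[OF K v1]]] eq
  by (subst L_integral_diff) auto
 finally have "g x = 0" by (rule periodic_continuous_zero[OF pg smooth_continuous[OF sg]])
 then show ?thesis by (simp add: g_def cK')
qed

lemma integral_torus_partial:
 fixes f :: "space \<Rightarrow> real"
 assumes f: "periodic f" "smooth f" and b: "b \<in> Basis"
 shows "(LINT x|torus. partial b f x) = 0"
proof -
 have pc: "continuous_on UNIV (partial b f)" by (rule smooth_continuous[OF smooth_partial[OF f(2) b]])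
 note [measurable] = borel_measurable_continuous_onI[OF smooth_continuous[OF f(2)]] borel_measurable_continuous_onI[OF pc]
 have pp: "periodic (partial b f)"
  unfolding periodic_def
 proof (intro allI)
  fix x i
  have "f = (\<lambda>y. f (y + - axis i 1))" 
   using f(1)[unfolded periodic_def, rule_format, of "_ + - axis i 1" i] by (simp add: fun_eq_iff)
  moreover have "((\<lambda>y. f (y + - axis i 1)) has_derivative frechet_derivative f (at x)) (at (x + axis i 1))"
  proof -
   have "((\<lambda>y. y + - axis i 1) has_derivative (\<lambda>h. h)) (at (x + axis i 1))"
    by (intro has_derivative_add_const has_derivative_ident)
   moreover have "(f has_derivative frechet_derivative f (at x)) (at ((x + axis i 1) + - axis i 1))"
    using smooth_has_derivative[OF f(2), of x] by simp
   ultimately show ?thesis using diff_chain_at by (fastforce simp: o_def)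
  qed
  ultimately show "partial b f (x + axis i 1) = partial b f x"
   using partial_eq[of f _ "x + axis i 1" b] by (simp add: partial_def)
 qed
 obtain M where M: "M > 0" "\<And>x. norm (partial b f x) \<le> M"
  using periodic_continuous_bounded[OF pp pc] by blast
 let ?q = "\<lambda>n x. (f (x + (1 / Suc n) *\<^sub>R b) - f x) / (1 / Suc n)"
 have lim: "(\<lambda>n. ?q n x) \<longlonglongrightarrow> partial b f x"
  and bd: "norm (?q n x) \<le> M" for n x
 proof -
  have d: "((\<lambda>t. f (x + t *\<^sub>R b)) has_real_derivative partial b f (x + t *\<^sub>R b)) (at t)" for t
  proof -
   have "((\<lambda>t. x + t *\<^sub>R b) has_derivative (\<lambda>h. h *\<^sub>R b)) (at t)"
    by (auto intro!: derivative_eq_intros)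
   from diff_chain_at[OF this smooth_has_derivative[OF f(2)]]
   have "((\<lambda>t. f (x + t *\<^sub>R b)) has_derivative (\<lambda>h. frechet_derivative f (at (x + t *\<^sub>R b)) (h *\<^sub>R b))) (at t)"
    by (simp add: o_def)
   moreover have "(\<lambda>h. frechet_derivative f (at (x + t *\<^sub>R b)) (h *\<^sub>R b)) = (*) (partial b f (x + t *\<^sub>R b))"
    using linear_scale[OF linear_frechet_derivative[OF smooth_differentiable[OF f(2)]]]
    by (simp add: partial_def fun_eq_iff mult.commute)
   ultimately show ?thesis by (simp add: has_field_derivative_def)
  qed
  have "((\<lambda>h. (f (x + (0 + h) *\<^sub>R b) - f (x + 0 *\<^sub>R b)) / h) \<longlongrightarrow> partial b f (x + 0 *\<^sub>R b)) (at 0)"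
   using d[of 0] unfolding DERIV_def .
  then have l: "((\<lambda>h. (f (x + h *\<^sub>R b) - f x) / h) \<longlongrightarrow> partial b f x) (at 0)" by simp
  have "filterlim (\<lambda>n. 1 / real (Suc n)) (at 0) sequentially"
   using LIMSEQ_inverse_real_of_nat by (auto simp: filterlim_at divide_inverse)
  from filterlim_compose[OF l this] show "(\<lambda>n. ?q n x) \<longlonglongrightarrow> partial b f x" .
  obtain z where "f (x + (1 / Suc n) *\<^sub>R b) - f (x + 0 *\<^sub>R b) = (1 / Suc n - 0) * partial b f (x + z *\<^sub>R b)"
   using MVT2[of 0 "1 / Suc n" "\<lambda>t. f (x + t *\<^sub>R b)" "\<lambda>t. partial b f (x + t *\<^sub>R b)"] d by auto
  then have "?q n x = partial b f (x + z *\<^sub>R b)" by simp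
  then show "norm (?q n x) \<le> M" using M(2)[of "x + z *\<^sub>R b"] by (simp only:)
 qed
 have "(\<lambda>n. LINT x|torus. ?q n x) \<longlonglongrightarrow> (LINT x|torus. partial b f x)"
  by (rule integral_dominated_convergence[where w = "\<lambda>_. M"]) (use lim bd in \<open>auto\<close>)
 moreover have "(LINT x|torus. ?q n x) = 0" for n
 proof -
  have i: "integrable torus f" using torus_Lp_smooth[OF f, of 1] by (simp add: torus_Lp_Suc_0 torus_L1_def)
  then have "integrable torus (\<lambda>x. f (x + (1 / Suc n) *\<^sub>R b))"
   using integral_torus_shift(2)[OF f(1)] by simp
  then have "(LINT x|torus. ?q n x) = ((LINT x|torus. f (x + (1 / Suc n) *\<^sub>R b)) - (LINT x|torus. f x)) / (1 / Suc n)"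
   using i by (simp add: L_integral_diff)
  then show ?thesis using integral_torus_shift(1)[OF f(1)] by simp
 qed
 ultimately have "(\<lambda>n::nat. 0::real) \<longlonglongrightarrow> (LINT x|torus. partial b f x)" by (simp only:)
 then show ?thesis by (simp add: LIMSEQ_const_iff)
qed

lemma integral_laplacian_nonpos:
 fixes f :: "space \<Rightarrow> real"
 assumes f: "periodic f" "smooth f" and pd: "\<And>i. periodic (dx i f)" "\<And>i. periodic (dx i (dx i f))"
 shows "(LINT x|torus. f x * laplacian f x) \<le> 0"
proof -
 note sm = smooth_dx[OF f(2)] smooth_dx[OF smooth_dx[OF f(2)]]
 have int: "integrable torus (\<lambda>x. g x * h x)" if "periodic g" "smooth g" "periodic h" "smooth h" for g h :: "space \<Rightarrow> real"
  using torus_L2_inner_integrable(1)[OF torus_Lp_smooth[OF that(1,2)] torus_Lp_smooth[OF that(3,4)]] by simp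
 have "(LINT x|torus. f x * dx i (dx i f) x) \<le> 0" for i
 proof -
  have "partial (axis i 1) (\<lambda>x. f x * dx i f x) x = f x * dx i (dx i f) x + dx i f x * dx i f x" for x
   using partial_eq[OF has_derivative_mult[OF smooth_has_derivative[OF f(2)] smooth_has_derivative[OF sm(1)[of i]]], of "axis i 1" x]
   by (simp add: dx_def partial_def)
  moreover have "(LINT x|torus. partial (axis i 1) (\<lambda>x. f x * dx i f x) x) = 0"
   by (rule integral_torus_partial[OF periodic_compose2[OF f(1) pd(1)[of i], of "(*)"] smooth_mult[OF f(2) sm(1)] axis_Basis])
  ultimately have "(LINT x|torus. f x * dx i (dx i f) x) + (LINT x|torus. dx i f x * dx i f x) = 0"
   using L_integral_add[OF int[OF f pd(2) sm(2)] int[OF pd(1) sm(1) pd(1) sm(1)], of i i i]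
   by (simp only:)
  moreover have "(LINT x|torus. dx i f x * dx i f x) \<ge> 0" by (intro L_integral_nonneg) simp
  ultimately show ?thesis by linarith
 qed
 moreover have "(LINT x|torus. f x * laplacian f x) = (\<Sum>i\<in>UNIV. (LINT x|torus. f x * dx i (dx i f) x))"
  unfolding laplacian_def sum_distrib_left
  by (rule L_integral_sum) (rule int[OF f pd(2) sm(2)])
 ultimately show ?thesis by (simp add: sum_nonpos)
qed

text \<open>Pairing the mollified equation with the mollified \<open>u\<close>, the Laplacian contributes with a good sign.\<close>

lemma helmholtz_L2_bound:
 assumes H: "helmholtz \<alpha> v u" and K: "bump_kernel K" "(LBINT z. K z) = 1" "(LBINT z. \<bar>K z\<bar>) = 1"
 shows "(LINT x|torus. (u x)\<^sup>2) \<le> (LINT x|torus. (v x)\<^sup>2)"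
proof -
 have u: "torus_Lp 2 u" and v: "torus_Lp 2 v" using H by (auto simp: helmholtz_def)
 have u1: "torus_L1 u" and v1: "torus_L1 v" using torus_Lp_imp_L1 u v by fastforce+
 note [measurable] = kernel_measurable[OF K(1)]
 have step: "(LINT x|torus. (conv (rescale K s) u x)\<^sup>2) \<le> (LINT x|torus. (v x)\<^sup>2)" if s: "s > 0" for s
 proof -
  have Ks: "bump_kernel (rescale K s)" by (rule kernel_rescale[OF K(1) s])
  let ?u = "conv (rescale K s) u" and ?v = "conv (rescale K s) v"
  have pu: "periodic ?u" "smooth ?u" and pv: "periodic ?v" "smooth ?v"
   by (auto intro: conv_periodic smooth_conv Ks u1 v1)
  have L: "laplacian ?u x = conv (laplacian (rescale K s)) u x" for x by (rule laplacian_conv[OF Ks u1])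
  have lp: "periodic (laplacian ?u)" "smooth (laplacian ?u)"
   using conv_periodic[OF kernel_laplacian[OF Ks] u1] smooth_conv[OF kernel_laplacian[OF Ks] u1] L
   by (simp_all only: ext[of "laplacian ?u", OF L])
  have neg: "(LINT x|torus. ?u x * laplacian ?u x) \<le> 0"
   by (intro integral_laplacian_nonpos pu) (simp_all add: dx_conv kernel_dx Ks u1 conv_periodic)
  have int: "integrable torus (\<lambda>x. g x * h x)" if "periodic g" "smooth g" "periodic h" "smooth h" for g h :: "space \<Rightarrow> real"
   using torus_L2_inner_integrable(1)[OF torus_Lp_smooth[OF that(1,2)] torus_Lp_smooth[OF that(3,4)]] by simp
  have "(LINT x|torus. ?u x * ?u x) - \<alpha>\<^sup>2 * (LINT x|torus. ?u x * laplacian ?u x) = (LINT x|torus. ?u x * ?u x - \<alpha>\<^sup>2 * (?u x * laplacian ?u x))"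
   using int[OF pu pu] int[OF pu lp] by simp
  also have "... = (LINT x|torus. ?u x * ?v x)"
  proof (intro L_integral_cong refl)
   fix x
   have "?u x * ?u x - \<alpha>\<^sup>2 * (?u x * laplacian ?u x) = ?u x * (?u x - \<alpha>\<^sup>2 * conv (laplacian (rescale K s)) u x)"
    by (simp add: L algebra_simps)
   then show "?u x * ?u x - \<alpha>\<^sup>2 * (?u x * laplacian ?u x) = ?u x * ?v x"
    using helmholtz_mollified[OF H Ks, of x] by simp
  qed
  also have "... \<le> (LINT x|torus. (1/2) * (?u x * ?u x) + (1/2) * (?v x * ?v x))"
  proof (rule integral_mono)
   fix x show "?u x * ?v x \<le> (1/2) * (?u x * ?u x) + (1/2) * (?v x * ?v x)"
    using sum_squares_bound[of "?u x" "?v x"] by (simp add: power2_eq_square)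
  qed (use int[OF pu pv] int[OF pu pu] int[OF pv pv] in auto)
  also have "... = (1/2) * (LINT x|torus. ?u x * ?u x) + (1/2) * (LINT x|torus. ?v x * ?v x)"
   using int[OF pu pu] int[OF pv pv] by simp
  finally have "(LINT x|torus. ?u x * ?u x) \<le> (LINT x|torus. ?v x * ?v x) + 2 * (\<alpha>\<^sup>2 * (LINT x|torus. ?u x * laplacian ?u x))"
   by linarith
  moreover have "\<alpha>\<^sup>2 * (LINT x|torus. ?u x * laplacian ?u x) \<le> 0"
   using neg by (simp add: mult_nonneg_nonpos)
  ultimately have "(LINT x|torus. (?u x)\<^sup>2) \<le> (LINT x|torus. (?v x)\<^sup>2)" by (simp add: power2_eq_square)
  also have "... \<le> (LBINT z. \<bar>rescale K s z\<bar>) ^ 2 * (LINT x|torus. (v x)\<^sup>2)"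
   using conv_Lp_bound[OF Ks v] by simp
  also have "(LBINT z. \<bar>rescale K s z\<bar>) = 1" using integral_rescale(2)[of K s] s K(3) by simp
  finally show ?thesis by simp
 qed
 have "(nnT x. norm (u x) ^ 2) \<le> ennreal (LINT x|torus. (v x)\<^sup>2)"
 proof (rule mollify_fatou[OF K(1,2) u1])
  fix n
  have Ks: "bump_kernel (rescale K (1 / Suc n))" by (rule kernel_rescale[OF K(1)]) simp
  have "integrable torus (\<lambda>x. (conv (rescale K (1 / Suc n)) u x)\<^sup>2)"
   using torus_LpD(3)[OF torus_Lp_smooth[OF conv_periodic[OF Ks u1] smooth_conv[OF Ks u1], of 2]] by simp
  then show "(nnT x. norm (conv (rescale K (1 / Suc n)) u x) ^ 2) \<le> ennreal (LINT x|torus. (v x)\<^sup>2)"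
   using step[of "1 / Suc n"] by (simp add: nn_integral_eq_integral ennreal_leI)
 qed
 moreover have "(nnT x. norm (u x) ^ 2) = ennreal (LINT x|torus. (u x)\<^sup>2)"
  using torus_LpD(3)[OF u] by (simp add: nn_integral_eq_integral)
 ultimately show ?thesis
  by (simp add: ennreal_le_iff L_integral_nonneg)
qed

section \<open>A gradient estimate for the Helmholtz equation\<close>

definition bump_mass :: real where
 "bump_mass = (LBINT x::space. 2 * flat 2 (1 - x \<bullet> x))"

definition bump :: "space \<Rightarrow> real" where
 "bump x = (1 / bump_mass) * (2 * flat 2 (1 - x \<bullet> x))"

text \<open>The constant makes \<open>\<nabla>\<close> of the potential equal to \<open>x\<close> times the bump.\<close>

definition bump_potential :: "space \<Rightarrow> real" where
 "bump_potential x = (- 1 / bump_mass) * flat 0 (1 - x \<bullet> x)"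

lemma flat_nonneg: "0 \<le> flat k x"
 by (simp add: flat_def)

lemma kernel_radial:
 assumes "smooth f" "\<And>r. r \<le> 0 ==> f r = 0"
 shows "bump_kernel (\<lambda>x. c * f (1 - x \<bullet> x))"
proof -
 have "smooth (\<lambda>x::space. 1 + (- 1) * (x \<bullet> x))"
  by (intro smooth_add smooth_mult smooth_const smooth_norm_sq)
 then have "smooth (\<lambda>x::space. f (1 + (- 1) * (x \<bullet> x)))"
  by (rule smooth_compose_real[OF assms(1)])
 then have "smooth (\<lambda>x::space. c * f (1 - x \<bullet> x))"
  by (intro smooth_mult smooth_const) simp
 moreover have "{x::space. c * f (1 - x \<bullet> x) \<noteq> 0} \<subseteq> cball 0 1"
 proof
  fix x :: space assume "x \<in> {x. c * f (1 - x \<bullet> x) \<noteq> 0}"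
  then have "\<not> 1 - x \<bullet> x \<le> 0" using assms(2)[of "1 - x \<bullet> x"] by auto
  then have "(norm x)\<^sup>2 \<le> 1" by (simp add: power2_norm_eq_inner)
  then show "x \<in> cball 0 1" by (simp add: power_le_one_iff abs_square_le_1)
 qed
 then have "bounded {x::space. c * f (1 - x \<bullet> x) \<noteq> 0}"
  by (rule bounded_subset[OF bounded_cball])
 ultimately show ?thesis by (simp only: bump_kernel_def)
qed

lemma flat_nonpos: "r \<le> 0 ==> flat k r = 0"
 by (simp add: flat_def)

lemma kernel_bump: "bump_kernel bump"
 unfolding bump_def[abs_def] using kernel_radial[OF smooth_flat flat_nonpos, of "2 / bump_mass" 2] by simp

lemma kernel_bump_potential: "bump_kernel bump_potential"
 unfolding bump_potential_def[abs_def] by (rule kernel_radial[OF smooth_flat flat_nonpos])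

lemma bump_mass_pos: "bump_mass > 0"
proof -
 let ?f = "\<lambda>x::space. 2 * flat 2 (1 - x \<bullet> x)"
 have k: "bump_kernel ?f" by (rule kernel_radial[OF smooth_flat flat_nonpos])
 have nn: "0 \<le> bump_mass"
  unfolding bump_mass_def by (intro L_integral_nonneg) (simp add: flat_nonneg)
 moreover have "bump_mass \<noteq> 0"
 proof
  assume "bump_mass = 0"
  then have "AE x in lborel. ?f x = 0"
   using integral_nonneg_eq_0_iff_AE[OF kernel_integrable[OF k]] by (simp add: bump_mass_def flat_nonneg)
  then have "AE x in lebesgue. x \<in> {x. ?f x = 0}"
   by (intro AE_completion) (simp only: mem_Collect_eq)
  moreover have "closed {x. ?f x = 0}"
   by (intro closed_Collect_eq kernel_continuous[OF k] continuous_intros)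
  ultimately have "(0::space) \<in> {x. ?f x = 0}" by (intro mem_closed_if_AE_lebesgue)
  then show False by (simp add: flat_def)
 qed
 ultimately show ?thesis by simp
qed

lemma bump_nonneg: "0 \<le> bump x"
 using bump_mass_pos by (simp add: bump_def flat_nonneg)

lemma integral_bump: "(LBINT x. bump x) = 1" "(LBINT x. \<bar>bump x\<bar>) = 1"
proof -
 have "(LBINT x. bump x) = (1 / bump_mass) * bump_mass"
  unfolding bump_def bump_mass_def by (rule integral_mult_right_zero)
 then show "(LBINT x. bump x) = 1" using bump_mass_pos by simp
 then show "(LBINT x. \<bar>bump x\<bar>) = 1" using bump_nonneg by simp
qed

lemma bump_outside: "norm x > 1 ==> bump x = 0" "norm x > 1 ==> bump_potential x = 0"
proof -
 assume "norm x > 1"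
 then have "1 < (norm x)\<^sup>2" by (simp add: one_less_power)
 then have "1 - x \<bullet> x \<le> 0" by (simp add: power2_norm_eq_inner)
 then show "bump x = 0" "bump_potential x = 0"
  by (auto simp: bump_def bump_potential_def flat_nonpos)
qed

lemma dx_bump_potential: "dx i bump_potential x = x $ i * bump x"
proof -
 have 1: "((\<lambda>x::space. 1 - x \<bullet> x) has_derivative (\<lambda>h. - (2 * (x \<bullet> h)))) (at x)"
  by (auto intro!: derivative_eq_intros simp: inner_commute)
 have 2: "(flat 0 has_derivative (\<lambda>h. h * flat 2 (1 - x \<bullet> x))) (at (1 - x \<bullet> x))"
  using flat_has_derivative[of 0 "1 - x \<bullet> x"] unfolding has_field_derivative_def
  by (rule has_derivative_eq_rhs) (simp add: fun_eq_iff numeral_2_eq_2)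
 have "((\<lambda>x. flat 0 (1 - x \<bullet> x)) has_derivative (\<lambda>h. - (2 * (x \<bullet> h)) * flat 2 (1 - x \<bullet> x))) (at x)"
  using diff_chain_at[OF 1 2] by (simp add: o_def)
 then have "((\<lambda>x. (- 1 / bump_mass) * flat 0 (1 - x \<bullet> x)) has_derivative
   (\<lambda>h. (- 1 / bump_mass) * (- (2 * (x \<bullet> h)) * flat 2 (1 - x \<bullet> x)))) (at x)"
  by (rule has_derivative_mult_right)
 then have "dx i bump_potential x = (- 1 / bump_mass) * (- (2 * (x \<bullet> axis i 1)) * flat 2 (1 - x \<bullet> x))"
  unfolding dx_def bump_potential_def[abs_def] by (rule partial_eq)
 then show ?thesis by (simp add: bump_def inner_axis)
qed

lemma laplacian_bump_potential:
 "laplacian bump_potential x = 3 * bump x + frechet_derivative bump (at x) x"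
proof -
 have sm: "smooth bump" by (rule kernel_smooth[OF kernel_bump])
 have "dx i (dx i bump_potential) x = bump x + x $ i * dx i bump x" for i
 proof -
  have n: "((\<lambda>x::space. x $ i) has_derivative (\<lambda>h. h $ i)) (at x)"
   by (rule bounded_linear_imp_has_derivative) (rule bounded_linear_vec_nth)
  have "dx i bump_potential = (\<lambda>x. x $ i * bump x)" using dx_bump_potential by blast
  then show ?thesis
   using partial_eq[OF has_derivative_mult[OF n smooth_has_derivative[OF sm]], of "axis i 1"]
   by (simp add: dx_def partial_def axis_def algebra_simps)
 qed
 then have "laplacian bump_potential x = 3 * bump x + (\<Sum>i\<in>UNIV. x $ i * dx i bump x)"
  by (simp add: laplacian_def sum.distrib)
 also have "(\<Sum>i\<in>UNIV. x $ i * dx i bump x) = frechet_derivative bump (at x) x"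
 proof -
  have L: "linear (frechet_derivative bump (at x))"
   by (rule linear_frechet_derivative[OF smooth_differentiable[OF sm]])
  have "frechet_derivative bump (at x) x = frechet_derivative bump (at x) (\<Sum>i\<in>UNIV. x $ i *\<^sub>R axis i 1)"
   using basis_expansion[of x] by (simp add: scalar_mult_eq_scaleR)
  then show ?thesis unfolding linear_sum[OF L] linear_scale[OF L] by (simp add: dx_def partial_def)
 qed
 finally show ?thesis .
qed

lemma laplacian_rescale:
 assumes K: "smooth K" and s: "s > 0"
 shows "laplacian (rescale K s) x = laplacian K (x /\<^sub>R s) / s ^ 5"
proof -
 have "dx i (dx i (rescale K s)) x = dx i (dx i K) (x /\<^sub>R s) / s ^ 5" for i
 proof -
  have 1: "dx i (rescale K s) = (\<lambda>x. (1 / s) * rescale (dx i K) s x)"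
   using partial_rescale[OF K s, of "axis i 1"] s
   by (auto simp: dx_def rescale_def fun_eq_iff field_simps power_numeral_reduce)
  have d: "smooth (rescale (dx i K) s)"
   unfolding rescale_def[abs_def] divide_inverse
   using smooth_affine[OF bounded_linear_scaleR_right[of "inverse s"] smooth_dx[OF K, of i], of 0]
   by (intro smooth_mult smooth_const) simp
  have "dx i (\<lambda>x. (1 / s) * rescale (dx i K) s x) x = (1 / s) * partial (axis i 1) (rescale (dx i K) s) x"
   using partial_eq[OF has_derivative_mult_right[OF smooth_has_derivative[OF d]], of "axis i 1" "1 / s" x]
   by (simp add: dx_def partial_def)
  then show ?thesis
   unfolding 1 using partial_rescale[OF smooth_dx[OF K] s, of "axis i 1" i x] s
   by (simp add: dx_def power_numeral_reduce field_simps)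
 qed
 then show ?thesis by (simp add: laplacian_def sum_divide_distrib)
qed

lemma rescale_bump_has_derivative:
 assumes s: "s > 0"
 shows "((\<lambda>s. rescale bump s x) has_real_derivative - (laplacian bump_potential (x /\<^sub>R s) / s ^ 4)) (at s)"
proof -
 let ?y = "x /\<^sub>R s"
 have sm: "smooth bump" by (rule kernel_smooth[OF kernel_bump])
 have L: "linear (frechet_derivative bump (at ?y))"
  by (rule linear_frechet_derivative[OF smooth_differentiable[OF sm]])
 have "((\<lambda>s. inverse s *\<^sub>R x) has_derivative (\<lambda>h. (- (inverse s * h * inverse s)) *\<^sub>R x)) (at s)"
  using s by (auto intro!: derivative_eq_intros)
 from diff_chain_at[OF this smooth_has_derivative[OF sm]]
 have "((\<lambda>s. bump (x /\<^sub>R s)) has_derivative (\<lambda>h. frechet_derivative bump (at ?y) ((- (inverse s * h * inverse s)) *\<^sub>R x))) (at s)"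
  by (simp add: o_def)
 moreover have "(\<lambda>h. frechet_derivative bump (at ?y) ((- (inverse s * h * inverse s)) *\<^sub>R x))
   = (*) (- (frechet_derivative bump (at ?y) ?y / s))"
 proof
  fix h
  have "(- (inverse s * h * inverse s)) *\<^sub>R x = (- (h / s)) *\<^sub>R ?y" by (simp add: divide_inverse)
  then have "frechet_derivative bump (at ?y) ((- (inverse s * h * inverse s)) *\<^sub>R x) = (- (h / s)) *\<^sub>R frechet_derivative bump (at ?y) ?y"
   using linear_scale[OF L] by metis
  then show "frechet_derivative bump (at ?y) ((- (inverse s * h * inverse s)) *\<^sub>R x) = - (frechet_derivative bump (at ?y) ?y / s) * h"
   by simp
 qed
 ultimately have d: "((\<lambda>s. bump (x /\<^sub>R s)) has_real_derivative - (frechet_derivative bump (at ?y) ?y / s)) (at s)"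
  by (simp add: has_field_derivative_def)
 have "((\<lambda>s. bump (x /\<^sub>R s) / s ^ 3) has_real_derivative
   ((- (frechet_derivative bump (at ?y) ?y / s)) * s ^ 3 - bump ?y * (3 * s ^ 2)) / (s ^ 3 * s ^ 3)) (at s)"
  using s by (auto intro!: derivative_eq_intros d)
 moreover have "((- (frechet_derivative bump (at ?y) ?y / s)) * s ^ 3 - bump ?y * (3 * s ^ 2)) / (s ^ 3 * s ^ 3)
   = - (laplacian bump_potential ?y / s ^ 4)"
  unfolding laplacian_bump_potential using s by (simp add: field_simps power_numeral_reduce)
 ultimately show ?thesis by (simp add: rescale_def)
qed

lemma continuous_laplacian: "smooth K ==> continuous_on UNIV (laplacian K)"
 unfolding laplacian_def[abs_def] by (intro continuous_on_sum smooth_continuous smooth_dx)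

lemma rescale_bump_diff:
 assumes e: "0 < e" "e \<le> 1"
 shows "rescale bump e x - rescale bump 1 x
  = (LBINT s. indicator {e..1} s * (laplacian bump_potential (x /\<^sub>R s) / s ^ 4))"
proof -
 have "(LBINT s. indicator {e..1} s *\<^sub>R (- (laplacian bump_potential (x /\<^sub>R s) / s ^ 4))) = rescale bump 1 x - rescale bump e x"
 proof (rule integral_FTC_Icc)
  show "continuous_on {e..1} (\<lambda>s. - (laplacian bump_potential (x /\<^sub>R s) / s ^ 4))"
   by (intro continuous_intros continuous_on_compose2[OF continuous_laplacian[OF kernel_smooth[OF kernel_bump_potential]]])
    (use e in auto)
  show "((\<lambda>s. rescale bump s x) has_vector_derivative - (laplacian bump_potential (x /\<^sub>R s) / s ^ 4)) (at s within {e..1})"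
   if "e \<le> s" "s \<le> 1" for s
   using rescale_bump_has_derivative[of s x] that e
   by (auto simp: has_real_derivative_iff_has_vector_derivative intro: has_vector_derivative_at_within)
 qed (use e in auto)
 then have "- (LBINT s. indicator {e..1} s * (laplacian bump_potential (x /\<^sub>R s) / s ^ 4)) = rescale bump 1 x - rescale bump e x"
  by simp
 then show ?thesis by linarith
qed

text \<open>The mollification of \<open>u\<close> at scale \<open>e\<close> differs from the one at scale \<open>1\<close> by an average, over the
 scales in between, of convolutions of \<open>u - v\<close> with smooth kernels: the scale derivative of the bump
 is the Laplacian of its potential, and the equation turns the Laplacian of \<open>u\<close> into \<open>u - v\<close>.\<close>

lemma helmholtz_scale_formula:
 assumes \<alpha>: "\<alpha> > 0" and H: "helmholtz \<alpha> v u" and e: "0 < e" "e \<le> 1"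
 shows "conv (rescale bump e) u x = conv (rescale bump 1) u x
  + (1 / \<alpha>\<^sup>2) * (LBINT s. indicator {e..1} s * (s * conv (rescale bump_potential s) (\<lambda>y. u y - v y) x))"
  and "integrable lborel (\<lambda>s. indicator {e..1} s * (s * conv (rescale bump_potential s) (\<lambda>y. u y - v y) x))"
proof -
 have u: "torus_Lp 2 u" and v: "torus_Lp 2 v" using H by (auto simp: helmholtz_def)
 have u1: "torus_L1 u" and v1: "torus_L1 v" using torus_Lp_imp_L1 u v by fastforce+
 note [measurable] = torus_L1D(2)[OF u1]
 let ?T = "\<lambda>s. rescale bump_potential s"
 define G where "G = laplacian bump_potential"
 have Gk: "bump_kernel G" unfolding G_def by (rule kernel_laplacian[OF kernel_bump_potential])
 note [measurable] = kernel_measurable[OF Gk]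
 obtain R M where RM: "R > 0" "M > 0" "\<And>x. \<bar>G x\<bar> \<le> M * indicator (cball 0 R) x"
  using kernel_bound[OF Gk] by blast
 have smp: "smooth bump_potential" by (rule kernel_smooth[OF kernel_bump_potential])
 have [measurable]: "cball x R \<in> sets borel" by simp
 define F where "F s y = indicator {e..1} s * (G ((x - y) /\<^sub>R s) / s ^ 4) * u y" for s y
 have F_meas: "(\<lambda>(s, y). F s y) \<in> Borel2"
  unfolding F_def by measurable
 define g where "g y = norm (indicator (cball x R) y *\<^sub>R u y)" for y
 have g: "integrable lborel g"
  unfolding g_def by (intro integrable_norm torus_L1_locally_integrable[OF u1]) auto
 have [measurable]: "g \<in> Borel" using g by auto
 have F_bound: "\<bar>F s y\<bar> \<le> indicator {e..1} s * (M / e ^ 4) * g y" for s y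
 proof (cases "s \<in> {e..1}")
  case True
  then have s: "0 < s" "s \<le> 1" "e \<le> s" using e by auto
  have "indicator (cball 0 R) ((x - y) /\<^sub>R s) \<le> (indicator (cball x R) y :: real)"
  proof (cases "(x - y) /\<^sub>R s \<in> cball 0 R")
   case True
   moreover have "norm ((x - y) /\<^sub>R s) = norm (x - y) / s"
    using s by (simp add: divide_inverse mult.commute)
   ultimately have "norm (x - y) \<le> R * s" using s by (simp add: pos_divide_le_eq)
   also have "... \<le> R" using s RM(1) by simp
   finally show ?thesis by (simp add: dist_norm)
  qed simp
  then have 1: "\<bar>G ((x - y) /\<^sub>R s)\<bar> \<le> M * indicator (cball x R) y"
   using RM(2) by (intro order_trans[OF RM(3)] mult_left_mono) auto
  have "\<bar>G ((x - y) /\<^sub>R s)\<bar> / s ^ 4 \<le> (M * indicator (cball x R) y) / e ^ 4"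
   using 1 s e RM(2) by (intro frac_le power_mono) auto
  then have "\<bar>G ((x - y) /\<^sub>R s)\<bar> / s ^ 4 * \<bar>u y\<bar> \<le> (M * indicator (cball x R) y) / e ^ 4 * \<bar>u y\<bar>"
   by (rule mult_right_mono) simp
  then show ?thesis using True s by (simp add: F_def g_def abs_mult)
 qed (simp add: F_def)
 have F_int: "integrable (lborel \<Otimes>\<^sub>M lborel) (\<lambda>(s, y). F s y)"
 proof (rule integrableI_bounded)
  show "(\<lambda>(s, y). F s y) \<in> borel_measurable (lborel \<Otimes>\<^sub>M lborel)" using F_meas by simp
  have "(\<integral>\<^sup>+p. norm (case p of (s, y) \<Rightarrow> F s y) \<partial>(lborel \<Otimes>\<^sub>M lborel))
    \<le> (\<integral>\<^sup>+p. ennreal (indicator {e..1} (fst p) * (M / e ^ 4)) * ennreal (g (snd p)) \<partial>(lborel \<Otimes>\<^sub>M lborel))"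
  proof (rule nn_integral_mono)
   fix p :: "real \<times> space"
   show "ennreal (norm (case p of (s, y) \<Rightarrow> F s y)) \<le> ennreal (indicator {e..1} (fst p) * (M / e ^ 4)) * ennreal (g (snd p))"
    using F_bound[of "fst p" "snd p"] RM(2) e
    by (subst ennreal_mult[symmetric]) (auto simp: case_prod_beta' g_def intro!: ennreal_leI)
  qed
  also have "... = (nnL s. ennreal (indicator {e..1} s * (M / e ^ 4))) * (nnL y. ennreal (g y))"
   by (subst lborel.nn_integral_fst[symmetric]) (auto simp: nn_integral_cmult nn_integral_multc)
  also have "... < \<infinity>"
  proof -
   have "integrable lborel (\<lambda>s. indicator {e..1} s * (M / e ^ 4))"
    by (intro integrable_mult_left integrable_real_indicator) (auto simp: emeasure_lborel_Icc_eq)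
   then have "(nnL s. ennreal (indicator {e..1} s * (M / e ^ 4))) < \<infinity>"
    using RM(2) e by (simp add: integrable_iff_bounded)
   moreover have "(nnL y. ennreal (g y)) < \<infinity>"
    using g by (simp add: integrable_iff_bounded g_def)
   ultimately show ?thesis by (simp add: ennreal_mult_less_top)
  qed
  finally show "(\<integral>\<^sup>+p. norm (case p of (s, y) \<Rightarrow> F s y) \<partial>(lborel \<Otimes>\<^sub>M lborel)) < \<infinity>" .
 qed
 have ke: "bump_kernel (rescale bump e)" "bump_kernel (rescale bump 1)"
  using e by (auto intro: kernel_rescale kernel_bump)
 let ?I = "\<lambda>s. indicator {e..1} s * (s * conv (?T s) (\<lambda>y. u y - v y) x)"
 have slice: "(LBINT y. F s y) = (1 / \<alpha>\<^sup>2) * ?I s" for s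
 proof (cases "s \<in> {e..1}")
  case True
  then have s: "s > 0" using e by auto
  have Tk: "bump_kernel (?T s)" by (rule kernel_rescale[OF kernel_bump_potential s])
  have "(LBINT y. F s y) = (LBINT y. s * (laplacian (?T s) (x - y) * u y))"
   using True s by (intro L_integral_cong refl)
    (simp add: F_def G_def laplacian_rescale[OF smp s] power_numeral_reduce)
  also have "... = s * conv (laplacian (?T s)) u x" by (simp add: conv_def)
  also have "conv (laplacian (?T s)) u x = (1 / \<alpha>\<^sup>2) * (conv (?T s) u x - conv (?T s) v x)"
   using helmholtz_mollified[OF H Tk, of x] \<alpha> by (simp add: field_simps)
  also have "conv (?T s) u x - conv (?T s) v x = conv (?T s) (\<lambda>y. u y - v y) x"
   by (rule conv_diff[OF Tk u1 v1, symmetric])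
  finally show ?thesis using True by simp
 qed (simp add: F_def)
 have "conv (rescale bump e) u x - conv (rescale bump 1) u x
   = (LBINT y. (rescale bump e (x - y) - rescale bump 1 (x - y)) * u y)"
  using conv_integrable[OF ke(1) u1, of x] conv_integrable[OF ke(2) u1, of x]
  by (simp add: conv_def left_diff_distrib)
 also have "... = (LBINT y. (LBINT s. F s y))"
  by (intro L_integral_cong refl)
   (simp only: rescale_bump_diff[OF e] F_def G_def integral_mult_left_zero)
 also have "... = (LBINT s. (LBINT y. F s y))"
  using lborel_pair.Fubini_integral[OF F_int] .
 also have "... = (1 / \<alpha>\<^sup>2) * (LBINT s. ?I s)" unfolding slice by (rule integral_mult_right_zero)
 finally show "conv (rescale bump e) u x = conv (rescale bump 1) u x + (1 / \<alpha>\<^sup>2) * (LBINT s. ?I s)" by simp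
 show "integrable lborel ?I"
  using integrable_mult_right[OF lborel_pair.integrable_fst'[OF F_int], of "\<alpha>\<^sup>2"] \<alpha>
  unfolding case_prod_conv slice by simp
qed

lemma norm_integral_le_nn_integral:
 fixes f :: "'x \<Rightarrow> 'b::{banach, second_countable_topology}"
 shows "ennreal (norm (LINT x|M. f x)) \<le> (\<integral>\<^sup>+x. norm (f x) \<partial>M)"
 by (cases "integrable M f") (auto intro: integral_norm_bound_ennreal simp: not_integrable_integral_eq)

lemma kernel_shift:
 assumes "bump_kernel K"
 shows "bump_kernel (\<lambda>z. K (z + a))"
proof -
 have "{z. K (z + a) \<noteq> 0} \<subseteq> (\<lambda>z. - a + z) ` {z. K z \<noteq> 0}"
  by (auto intro!: image_eqI[of _ _ "_ + a"])
 then have "bounded {z. K (z + a) \<noteq> 0}"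
  using assms bounded_translation bounded_subset unfolding bump_kernel_def by blast
 then show ?thesis
  using smooth_affine[OF bounded_linear_ident, of K a] assms by (simp add: bump_kernel_def)
qed

lemma kernel_increment: "bump_kernel K ==> bump_kernel (\<lambda>z. K (z + a) - K z)"
 using kernel_diff[of "\<lambda>z. K (z + a)" K 1] kernel_shift by simp

text \<open>Rescaling turns a shift by \<open>\<xi>\<close> into one by \<open>\<xi> / s\<close>, so the increment of a kernel of scale \<open>s\<close>
 has mass of order \<open>\<bar>\<xi>\<bar> / s\<close>.\<close>

lemma kernel_increment_mass:
 assumes K: "bump_kernel K"
 obtains L where "L \<ge> 0"
  "\<And>s \<xi>. s > 0 ==> (LBINT z. \<bar>rescale K s (z + \<xi>) - rescale K s z\<bar>) \<le> L * norm \<xi> / s"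
proof -
 obtain R B where RB: "R > 0" "B > 0" "\<And>x. \<bar>K x\<bar> \<le> B * indicator (cball 0 R) x"
  using kernel_bound[OF K] by blast
 obtain L where L: "L > 0" "\<And>x y. \<bar>K x - K y\<bar> \<le> L * norm (x - y)"
  "\<And>x h. \<bar>frechet_derivative K (at x) h\<bar> \<le> L * norm h"
  using kernel_lipschitz[OF K] by blast
 define m where "m = measure lborel (cball (0::space) R)"
 have m: "emeasure lborel (cball (0::space) R) = ennreal m"
  using emeasure_bounded_finite[of "cball (0::space) R"] by (simp add: m_def emeasure_eq_ennreal_measure)
 let ?g = "\<lambda>z::space. indicator (cball 0 R) z :: ennreal"
 have [measurable]: "cball (0::space) R \<in> sets borel" by simp
 have unit: "(LBINT z. \<bar>K (z + \<eta>) - K z\<bar>) \<le> L * (2 * m) * norm \<eta>" for \<eta>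
 proof -
  have "(nnL z. ennreal \<bar>K (z + \<eta>) - K z\<bar>) \<le> (nnL z. ennreal (L * norm \<eta>) * (?g (z + \<eta>) + ?g z))"
  proof (rule nn_integral_mono)
   fix z
   have "K (z + \<eta>) = 0" if "z + \<eta> \<notin> cball 0 R" using RB(3)[of "z + \<eta>"] that by (auto simp: indicator_def)
   moreover have "K z = 0" if "z \<notin> cball 0 R" using RB(3)[of z] that by (auto simp: indicator_def)
   moreover have "ennreal \<bar>K (z + \<eta>) - K z\<bar> \<le> ennreal (L * norm \<eta>)" using L(2)[of "z + \<eta>" z] by (simp add: ennreal_leI)
   moreover have "ennreal (L * norm \<eta>) * 1 \<le> ennreal (L * norm \<eta>) * (1 + 1)"
    by (intro mult_left_mono) auto
   ultimately show "ennreal \<bar>K (z + \<eta>) - K z\<bar> \<le> ennreal (L * norm \<eta>) * (?g (z + \<eta>) + ?g z)"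
    by (cases "z + \<eta> \<in> cball 0 R"; cases "z \<in> cball 0 R") (auto intro: order_trans simp del: mem_cball)
  qed
  also have "... = ennreal (L * norm \<eta>) * ((nnL z. ?g (z + \<eta>)) + (nnL z. ?g z))"
   by (simp add: nn_integral_cmult nn_integral_add)
  also have "... = ennreal (L * norm \<eta>) * (ennreal m + ennreal m)"
   by (simp add: nn_integral_lborel_shift[of ?g] m)
  also have "... = ennreal (L * (2 * m) * norm \<eta>)"
   using L(1) by (simp add: ennreal_plus[symmetric] ennreal_mult'[symmetric] m_def mult_ac del: ennreal_plus)
  finally show ?thesis
   using nn_integral_eq_integral[of lborel "\<lambda>z. \<bar>K (z + \<eta>) - K z\<bar>"] kernel_integrable[OF kernel_increment[OF K, of \<eta>]] L(1)
   by (simp add: m_def)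
 qed
 show thesis
 proof (rule that[of "L * (2 * m)"])
  fix s :: real and \<xi> :: space assume s: "s > 0"
  note [measurable] = kernel_measurable[OF K]
  have "(LBINT z. \<bar>rescale K s (z + \<xi>) - rescale K s z\<bar>) = (LBINT z. \<bar>rescale (\<lambda>z. K (z + \<xi> /\<^sub>R s) - K z) s z\<bar>)"
   by (simp add: rescale_def scaleR_add_right diff_divide_distrib)
  also have "... = (LBINT z. \<bar>K (z + \<xi> /\<^sub>R s) - K z\<bar>)" by (rule integral_rescale(2)[OF _ s]) measurable
  also have "... \<le> L * (2 * m) * norm \<xi> / s" using unit[of "\<xi> /\<^sub>R s"] s by (simp add: divide_inverse mult_ac)
  finally show "(LBINT z. \<bar>rescale K s (z + \<xi>) - rescale K s z\<bar>) \<le> L * (2 * m) * norm \<xi> / s" .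
 qed (use L in \<open>simp add: m_def\<close>)
qed

text \<open>By the Cauchy-Schwarz inequality with respect to the kernel, whose supremum is of order \<open>s\<^sup>-\<^sup>3\<close>, on a set that meets a bounded number of cells.\<close>

lemma conv_rescale_sup:
 assumes K: "bump_kernel K"
 obtains C where "C \<ge> 0"
  "\<And>(w :: space \<Rightarrow> real) s x. torus_Lp 2 w ==> 0 < s ==> s \<le> 1 ==>
   \<bar>conv (rescale K s) w x\<bar> \<le> C * sqrt (LINT x|torus. (w x)\<^sup>2) / (s * sqrt s)"
proof -
 obtain R B where RB: "R > 0" "B > 0" "\<And>x. \<bar>K x\<bar> \<le> B * indicator (cball 0 R) x"
  using kernel_bound[OF K] by blast
 obtain C0 where C0: "C0 \<ge> 0" "\<And>g. periodic g ==> g \<in> Borel ==>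
   (nnL x. indicator (cball 0 R :: space set) x * g x) \<le> ennreal C0 * (nnT x. g x)"
  using nn_integral_periodic_bounded_set[of "cball 0 R :: space set"] by auto
 define P where "P = (LBINT z. \<bar>K z\<bar>)"
 have P: "P \<ge> 0" unfolding P_def by (intro L_integral_nonneg) simp
 show thesis
 proof (rule that[of "sqrt (P * B * C0)"])
  fix w :: "space \<Rightarrow> real" and s :: real and x assume w: "torus_Lp 2 w" and s: "0 < s" "s \<le> 1"
  note [measurable] = torus_LpD(2)[OF w] kernel_measurable[OF K]
  have [measurable]: "cball (0::space) R \<in> sets borel" by simp
  define W where "W = (LINT x|torus. (w x)\<^sup>2)"
  have W: "W \<ge> 0" unfolding W_def by (intro L_integral_nonneg) simp
  have Ks: "bump_kernel (rescale K s)" by (rule kernel_rescale[OF K s(1)])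
  note cp = conv_norm_power[OF Ks w, of x, simplified]
  define b where "b = B / s ^ 3"
  have b: "b \<ge> 0" using RB s by (simp add: b_def)
  have Kb: "\<bar>rescale K s z\<bar> \<le> b * indicator (cball 0 R) z" for z
  proof -
   have "indicator (cball 0 R) (z /\<^sub>R s) \<le> (indicator (cball 0 R) z :: real)"
   proof (cases "z /\<^sub>R s \<in> cball 0 R")
    case True
    then have "norm z \<le> R * s" using s by (simp add: divide_inverse[symmetric] mult.commute[of "inverse s"] pos_divide_le_eq)
    also have "... \<le> R" using s RB by simp
    finally show ?thesis by simp
   qed simp
   then have "\<bar>K (z /\<^sub>R s)\<bar> \<le> B * indicator (cball 0 R) z"
    using RB by (intro order_trans[OF RB(3)] mult_left_mono) auto
   then show ?thesis using s divide_right_mono[of "\<bar>K (z /\<^sub>R s)\<bar>" _ "s ^ 3"] by (simp add: rescale_def b_def)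
  qed
  have "ennreal (LBINT z. \<bar>rescale K s z\<bar> * (w (x - z))\<^sup>2) = (nnL z. ennreal (\<bar>rescale K s z\<bar> * (w (x - z))\<^sup>2))"
   using cp(2) by (intro nn_integral_eq_integral[symmetric]) auto
  also have "... \<le> (nnL z. ennreal b * (indicator (cball 0 R) z * ennreal ((w (x - z))\<^sup>2)))"
  proof (rule nn_integral_mono)
   fix z
   show "ennreal (\<bar>rescale K s z\<bar> * (w (x - z))\<^sup>2) \<le> ennreal b * (indicator (cball 0 R) z * ennreal ((w (x - z))\<^sup>2))"
    using ennreal_leI[OF mult_right_mono[OF Kb[of z], of "(w (x - z))\<^sup>2"]] b
    by (auto simp: indicator_def ennreal_mult split: if_splits)
  qed
  also have "... = ennreal b * (nnL z. indicator (cball 0 R) z * ennreal ((w (x - z))\<^sup>2))"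
   by (rule nn_integral_cmult) measurable
  also have "... \<le> ennreal b * (ennreal C0 * (nnT z. ennreal ((w (x - z))\<^sup>2)))"
  proof (intro mult_left_mono C0(2))
   show "periodic (\<lambda>z. ennreal ((w (x - z))\<^sup>2))"
    by (rule periodic_compose[OF periodic_reflect[OF torus_LpD(1)[OF w]], of "\<lambda>r. ennreal (r\<^sup>2)"])
  qed auto
  also have "(nnT z. ennreal ((w (x - z))\<^sup>2)) = (nnT z. ennreal ((w z)\<^sup>2))"
   by (rule nn_integral_torus_reflect[of "\<lambda>z. ennreal ((w z)\<^sup>2)"]) (auto intro: periodic_compose[OF torus_LpD(1)[OF w]])
  also have "... = ennreal W"
   unfolding W_def using torus_LpD(3)[OF w] by (intro nn_integral_eq_integral) auto
  also have "ennreal b * (ennreal C0 * ennreal W) = ennreal (b * (C0 * W))"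
   using b C0(1) W by (simp add: ennreal_mult)
  finally have q: "(LBINT z. \<bar>rescale K s z\<bar> * (w (x - z))\<^sup>2) \<le> b * (C0 * W)"
   using b C0(1) W by (subst (asm) ennreal_le_iff) auto
  have "(conv (rescale K s) w x)\<^sup>2 \<le> P * (LBINT z. \<bar>rescale K s z\<bar> * (w (x - z))\<^sup>2)"
   using cp(1) integral_rescale(2)[OF kernel_measurable[OF K] s(1)] by (simp add: P_def)
  also have "... \<le> P * (b * (C0 * W))" by (rule mult_left_mono[OF q P])
  also have "... = P * B * C0 * W / s ^ 3" by (simp add: b_def)
  finally have "\<bar>conv (rescale K s) w x\<bar> \<le> sqrt (P * B * C0 * W / s ^ 3)"
   by (intro real_le_rsqrt) simp
  also have "... = sqrt (P * B * C0) * sqrt W / (s * sqrt s)"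
   using s by (simp add: real_sqrt_divide real_sqrt_mult power3_eq_cube)
  finally show "\<bar>conv (rescale K s) w x\<bar> \<le> sqrt (P * B * C0) * sqrt (LINT x|torus. (w x)\<^sup>2) / (s * sqrt s)"
   by (simp add: W_def)
 qed (use P RB C0 in simp)
qed

text \<open>The singularity \<open>s\<^sup>-\<^sup>1\<^sup>/\<^sup>2\<close> that is left after multiplication by \<open>s\<close> is integrable at \<open>0\<close>.\<close>

lemma scale_integral_sup:
 assumes e: "0 < e" "e \<le> 1" and A: "A \<ge> 0" and c: "\<And>s. s \<in> {e..1} ==> \<bar>c s\<bar> \<le> A / (s * sqrt s)"
 shows "\<bar>LBINT s. indicator {e..1} s * (s * c s)\<bar> \<le> 2 * A"
proof -
 have "ennreal \<bar>LBINT s. indicator {e..1} s * (s * c s)\<bar> \<le> (nnL s. norm (indicator {e..1} s * (s * c s)))"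
  using norm_integral_le_nn_integral[of lborel "\<lambda>s. indicator {e..1} s * (s * c s)"] by simp
 also have "... \<le> (nnL s. ennreal (A / sqrt s) * indicator {e..1} s)"
 proof (rule nn_integral_mono)
  fix s
  show "ennreal (norm (indicator {e..1} s * (s * c s))) \<le> ennreal (A / sqrt s) * indicator {e..1} s"
  proof (cases "s \<in> {e..1}")
   case True
   then have "s * \<bar>c s\<bar> \<le> s * (A / (s * sqrt s))" using c e by (intro mult_left_mono) auto
   also have "... = A / sqrt s" using True e by simp
   finally show ?thesis using True e by (simp add: abs_mult ennreal_leI)
  qed simp
 qed
 also have "... = ennreal (2 * A * sqrt 1 - 2 * A * sqrt e)"
 proof (rule nn_integral_FTC_Icc)
  fix s :: real assume s: "s \<in> {e..1}"
  then have "0 < s" using e by simp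
  from DERIV_cmult[OF DERIV_real_sqrt[OF this], of "2 * A"]
  show "((\<lambda>s. 2 * A * sqrt s) has_real_derivative A / sqrt s) (at s)" by (simp add: inverse_eq_divide)
  show "0 \<le> A / sqrt s" using A s e by simp
 qed (use e in auto)
 also have "... \<le> ennreal (2 * A)" using A e by (intro ennreal_leI) simp
 finally show ?thesis using A by simp
qed

interpretation torus_time: pair_sigma_finite torus "lborel :: real measure" ..

text \<open>Minkowski's inequality for the average over scales, combined with Young's inequality at each scale.\<close>

lemma scale_integral_L3:
 fixes w :: "space \<Rightarrow> real"
 assumes e: "0 < e" "e \<le> 1" and w: "torus_Lp 3 w"
  and k: "\<And>s. s \<in> {e..1} ==> bump_kernel (k s)" and km: "(\<lambda>(s, z). k s z) \<in> Borel2"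
  and L: "\<And>s. s \<in> {e..1} ==> s * (LBINT z. \<bar>k s z\<bar>) \<le> L" "L \<ge> 0"
 shows "(nnT x. norm (LBINT s. indicator {e..1} s * (s * conv (k s) w x)) ^ 3)
  \<le> ennreal (L ^ 3) * (nnT x. norm (w x) ^ 3)"
proof -
 note [measurable] = torus_LpD(2)[OF w]
 have w1: "torus_L1 w" using torus_Lp_imp_L1[OF w] by simp
 define g where "g s x = \<bar>s * conv (k s) w x\<bar>" for s x
 have cm: "(\<lambda>p. conv (k (snd p)) w (fst p)) \<in> borel_measurable borelXT"
 proof -
  have "(\<lambda>q :: (space \<times> real) \<times> space. (snd (fst q), fst (fst q) - snd q)) \<in> measurable ((borel \<Otimes>\<^sub>M borel) \<Otimes>\<^sub>M borel) (borel \<Otimes>\<^sub>M borel)"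
   by measurable
  from measurable_compose[OF this km]
  have [measurable]: "(\<lambda>q :: (space \<times> real) \<times> space. k (snd (fst q)) (fst (fst q) - snd q)) \<in> borel_measurable ((borel \<Otimes>\<^sub>M borel) \<Otimes>\<^sub>M borel)"
   by simp
  have "(\<lambda>p :: space \<times> real. LBINT y. (k (snd p) (fst p - y) *\<^sub>R w y)) \<in> Borel2"
   by (rule lborel.borel_measurable_lebesgue_integral) (simp add: case_prod_beta')
  then show ?thesis by (simp add: conv_def)
 qed
 then have gm[measurable]: "(\<lambda>p. g (snd p) (fst p)) \<in> borel_measurable borelXT"
  unfolding g_def by measurable
 have gs[measurable]: "(\<lambda>s. g s x) \<in> Borel" for x
  using measurable_compose[OF _ gm, of "\<lambda>s. (x, s)" borel] by simp
 let ?h = "\<lambda>s x. ennreal (indicator {e..1} s * g s x ^ 3)"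
 have "(nnT x. norm (LBINT s. indicator {e..1} s * (s * conv (k s) w x)) ^ 3) \<le> (nnT x. (nnL s. ?h s x))"
 proof (rule nn_integral_mono)
  fix x
  show "ennreal (norm (LBINT s. indicator {e..1} s * (s * conv (k s) w x)) ^ 3) \<le> (nnL s. ?h s x)"
  proof (cases "(nnL s. ?h s x) = \<infinity>")
   case False
   then have i: "integrable lborel (\<lambda>s. indicator {e..1} s * g s x ^ 3)"
    by (intro integrableI_bounded) (use gs in measurable, simp add: g_def less_top)
   have ii: "integrable lborel (\<lambda>s. indicator {e..1} s :: real)"
    by (rule integrable_real_indicator) (auto simp: emeasure_lborel_Icc_eq)
   have "norm (LBINT s. indicator {e..1} s * (s * conv (k s) w x)) \<le> (LBINT s. norm (indicator {e..1} s * (s * conv (k s) w x)))"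
    by (rule integral_norm_bound)
   also have "... = (LBINT s. indicator {e..1} s * g s x)" by (simp add: g_def abs_mult)
   finally have "norm (LBINT s. indicator {e..1} s * (s * conv (k s) w x)) ^ 3 \<le> (LBINT s. indicator {e..1} s * g s x) ^ 3"
    by (intro power_mono) auto
   also have "... \<le> (LBINT s. indicator {e..1} s) ^ (3 - 1) * (LBINT s. indicator {e..1} s * g s x ^ 3)"
    by (rule integral_power_mean(2)[OF ii _ _ _ _ i]) (simp, measurable, simp add: g_def, simp)
   also have "... \<le> 1 * (LBINT s. indicator {e..1} s * g s x ^ 3)"
    using e by (intro mult_right_mono L_integral_nonneg) (auto simp: g_def power_le_one)
   finally have "ennreal (norm (LBINT s. indicator {e..1} s * (s * conv (k s) w x)) ^ 3) \<le> ennreal (LBINT s. indicator {e..1} s * g s x ^ 3)"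
    by (simp add: ennreal_leI)
   also have "... = (nnL s. ?h s x)"
    by (rule nn_integral_eq_integral[OF i, symmetric]) (simp add: g_def)
   finally show ?thesis .
  qed simp
 qed
 also have "... = (nnL s. (nnT x. ?h s x))"
  by (rule torus_time.Fubini'[symmetric]) (simp add: case_prod_beta')
 also have "... \<le> (nnL s. ennreal (L ^ 3) * (nnT x. norm (w x) ^ 3) * indicator {e..1} s)"
 proof (rule nn_integral_mono)
  fix s
  show "(nnT x. ?h s x) \<le> ennreal (L ^ 3) * (nnT x. norm (w x) ^ 3) * indicator {e..1} s"
  proof (cases "s \<in> {e..1}")
   case True
   then have s: "0 < s" using e by simp
   note ks = k[OF True]
   have c3: "torus_Lp 3 (conv (k s) w)"
    by (rule torus_Lp_smooth[OF conv_periodic[OF ks w1] smooth_conv[OF ks w1]])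
   have "(nnT x. ?h s x) = ennreal (s ^ 3 * (LINT x|torus. norm (conv (k s) w x) ^ 3))"
    using True s torus_LpD(3)[OF c3] by (subst nn_integral_eq_integral) (auto simp: g_def abs_mult power_mult_distrib)
   also have "s ^ 3 * (LINT x|torus. norm (conv (k s) w x) ^ 3) \<le> s ^ 3 * ((LBINT z. \<bar>k s z\<bar>) ^ 3 * (LINT x|torus. norm (w x) ^ 3))"
    using s by (intro mult_left_mono conv_Lp_bound[OF ks w]) auto
   also have "... = (s * (LBINT z. \<bar>k s z\<bar>)) ^ 3 * (LINT x|torus. norm (w x) ^ 3)" by (simp add: power_mult_distrib)
   also have "... \<le> L ^ 3 * (LINT x|torus. norm (w x) ^ 3)"
    using s L(1)[OF True] by (intro mult_right_mono power_mono mult_nonneg_nonneg L_integral_nonneg) auto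
   also have "ennreal ... = ennreal (L ^ 3) * (nnT x. norm (w x) ^ 3)"
    using nn_integral_eq_integral[OF torus_LpD(3)[OF w]] L(2) by (simp add: ennreal_mult)
   finally show ?thesis using True by (simp add: ennreal_leI)
  qed simp
 qed
 also have "... = ennreal (L ^ 3) * (nnT x. norm (w x) ^ 3) * ennreal (1 - e)"
  using e by (simp add: nn_integral_cmult)
 also have "... \<le> ennreal (L ^ 3) * (nnT x. norm (w x) ^ 3) * 1"
  using e by (intro mult_left_mono) (auto simp: ennreal_le_1)
 finally show ?thesis by simp
qed

lemma conv_L3_nn:
 fixes w :: "space \<Rightarrow> real"
 assumes k: "bump_kernel k" and w: "torus_Lp 3 w" and L: "(LBINT z. \<bar>k z\<bar>) \<le> L"
 shows "(nnT x. norm (conv k w x) ^ 3) \<le> ennreal (L ^ 3) * (nnT x. norm (w x) ^ 3)"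
proof -
 have w1: "torus_L1 w" using torus_Lp_imp_L1[OF w] by simp
 have c3: "torus_Lp 3 (conv k w)" by (rule torus_Lp_smooth[OF conv_periodic[OF k w1] smooth_conv[OF k w1]])
 have A: "0 \<le> (LBINT z. \<bar>k z\<bar>)" by (intro L_integral_nonneg) simp
 have "(LINT x|torus. norm (conv k w x) ^ 3) \<le> (LBINT z. \<bar>k z\<bar>) ^ 3 * (LINT x|torus. norm (w x) ^ 3)"
  by (rule conv_Lp_bound[OF k w]) simp
 also have "... \<le> L ^ 3 * (LINT x|torus. norm (w x) ^ 3)"
  using A L by (intro mult_right_mono power_mono L_integral_nonneg) auto
 finally have "ennreal (LINT x|torus. norm (conv k w x) ^ 3) \<le> ennreal (L ^ 3) * ennreal (LINT x|torus. norm (w x) ^ 3)"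
  using order_trans[OF A L] by (subst ennreal_mult[symmetric]) (auto intro: ennreal_leI simp del: abs_ge_zero)
 then show ?thesis
  using nn_integral_eq_integral[OF torus_LpD(3)[OF w]] nn_integral_eq_integral[OF torus_LpD(3)[OF c3]] by simp
qed

text \<open>The bound for \<open>u\<close>: at scale \<open>s\<close> the convolution is bounded by \<open>s\<^sup>-\<^sup>3\<^sup>/\<^sup>2\<close> times the \<open>L\<^sup>2\<close> norm, which
 is integrable against \<open>s ds\<close>, so \<open>u\<close> is even bounded. The bound for the increment: at scale \<open>s\<close> the
 kernel increment has mass \<open>\<bar>\<xi>\<bar> / s\<close>, and \<open>s ds\<close> removes the singularity.\<close>

lemma helmholtz_L3_bounds:
 assumes \<alpha>: "\<alpha> > 0"
 obtains C where "C \<ge> 0"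
  "\<And>v u V. helmholtz \<alpha> v u ==> (LINT x|torus. (v x)\<^sup>2) \<le> V ==>
   (nnT x. norm (u x) ^ 3) \<le> ennreal (C * (V * sqrt V))"
  "\<And>v u \<xi>. helmholtz \<alpha> v u ==> torus_Lp 3 v ==> torus_Lp 3 u ==>
   (nnT x. norm (u (x + \<xi>) - u x) ^ 3)
    \<le> ennreal (C * norm \<xi> ^ 3) * ((nnT x. norm (u x) ^ 3) + (nnT x. norm (v x) ^ 3))"
proof -
 let ?T = "\<lambda>s. rescale bump_potential s"
 obtain C1 where C1: "C1 \<ge> 0" "\<And>(w :: space \<Rightarrow> real) s x. torus_Lp 2 w ==> 0 < s ==> s \<le> 1 ==>
   \<bar>conv (rescale bump s) w x\<bar> \<le> C1 * sqrt (LINT x|torus. (w x)\<^sup>2) / (s * sqrt s)"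
  by (rule conv_rescale_sup[OF kernel_bump]) (rule that, assumption+)
 obtain C2 where C2: "C2 \<ge> 0" "\<And>(w :: space \<Rightarrow> real) s x. torus_Lp 2 w ==> 0 < s ==> s \<le> 1 ==>
   \<bar>conv (?T s) w x\<bar> \<le> C2 * sqrt (LINT x|torus. (w x)\<^sup>2) / (s * sqrt s)"
  by (rule conv_rescale_sup[OF kernel_bump_potential]) (rule that, assumption+)
 obtain M1 where M1: "M1 \<ge> 0"
  "\<And>s \<xi>. s > 0 ==> (LBINT z. \<bar>rescale bump s (z + \<xi>) - rescale bump s z\<bar>) \<le> M1 * norm \<xi> / s"
  by (rule kernel_increment_mass[OF kernel_bump]) (rule that, assumption+)
 obtain M2 where M2: "M2 \<ge> 0"
  "\<And>s \<xi>. s > 0 ==> (LBINT z. \<bar>?T s (z + \<xi>) - ?T s z\<bar>) \<le> M2 * norm \<xi> / s"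
  by (rule kernel_increment_mass[OF kernel_bump_potential]) (rule that, assumption+)
 define a where "a = 1 / \<alpha>\<^sup>2"
 have a: "a \<ge> 0" by (simp add: a_def)
 define D where "D = C1 + a * (4 * C2)"
 have D: "D \<ge> 0" using C1(1) C2(1) a by (simp add: D_def)
 define E where "E = 8 * M1 ^ 3 + 8 * a ^ 3 * (M2 ^ 3 * 8)"
 have E: "E \<ge> 0" using M1(1) M2(1) a by (simp add: E_def)
 show thesis
 proof (rule that[of "D ^ 3 + E"])
  show "0 \<le> D ^ 3 + E" using D E by simp
  fix v u :: "space \<Rightarrow> real" and V assume H: "helmholtz \<alpha> v u" and V: "(LINT x|torus. (v x)\<^sup>2) \<le> V"
  have u: "torus_Lp 2 u" and v: "torus_Lp 2 v" using H by (auto simp: helmholtz_def)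
  have u1: "torus_L1 u" using torus_Lp_imp_L1[OF u] by simp
  have w: "torus_Lp 2 (\<lambda>y. u y - v y)"
   using torus_Lp_add[OF u torus_Lp_linear[OF v bounded_linear_minus[OF bounded_linear_ident]]] by simp
  have "0 \<le> (LINT x|torus. (v x)\<^sup>2)" by (intro L_integral_nonneg) simp
  then have V0: "0 \<le> V" using V by linarith
  have uV: "(LINT x|torus. (u x)\<^sup>2) \<le> V"
   using helmholtz_L2_bound[OF H kernel_bump integral_bump] V by simp
  have wV: "(LINT x|torus. (u x - v x)\<^sup>2) \<le> 4 * V"
  proof -
   have "(LINT x|torus. (u x - v x)\<^sup>2) \<le> (LINT x|torus. 2 * (u x)\<^sup>2 + 2 * (v x)\<^sup>2)"
   proof (rule integral_mono)
    show "(u x - v x)\<^sup>2 \<le> 2 * (u x)\<^sup>2 + 2 * (v x)\<^sup>2" for x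
     using zero_le_power2[of "u x + v x"] by (simp add: power2_sum power2_diff)
   qed (use torus_LpD(3)[OF w] torus_LpD(3)[OF u] torus_LpD(3)[OF v] in auto)
   also have "... = 2 * (LINT x|torus. (u x)\<^sup>2) + 2 * (LINT x|torus. (v x)\<^sup>2)"
    using torus_LpD(3)[OF u] torus_LpD(3)[OF v] by simp
   finally show ?thesis using uV V by linarith
  qed
  have sup: "\<bar>conv (rescale bump e) u x\<bar> \<le> D * sqrt V" if e: "0 < e" "e \<le> 1" for e x
  proof -
   have 1: "\<bar>conv (rescale bump 1) u x\<bar> \<le> C1 * sqrt V"
    using C1(2)[OF u, of 1 x] mult_left_mono[OF real_sqrt_le_mono[OF uV] C1(1)] by simp
   have "\<bar>LBINT s. indicator {e..1} s * (s * conv (?T s) (\<lambda>y. u y - v y) x)\<bar> \<le> 2 * (C2 * sqrt (LINT x|torus. (u x - v x)\<^sup>2))"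
    by (rule scale_integral_sup[OF e]) (use C2 w e in auto)
   also have "... \<le> 2 * (C2 * sqrt (4 * V))"
    using C2(1) wV by (intro mult_left_mono real_sqrt_le_mono) auto
   finally have 2: "\<bar>LBINT s. indicator {e..1} s * (s * conv (?T s) (\<lambda>y. u y - v y) x)\<bar> \<le> 4 * C2 * sqrt V"
    by (simp add: real_sqrt_mult)
   show ?thesis
    unfolding helmholtz_scale_formula(1)[OF \<alpha> H e] a_def[symmetric] D_def
    using 1 mult_left_mono[OF 2 a] abs_triangle_ineq[of "conv (rescale bump 1) u x" "a * (LBINT s. indicator {e..1} s * (s * conv (?T s) (\<lambda>y. u y - v y) x))"] a
    by (simp add: abs_mult distrib_right mult.assoc)
  qed
  show "(nnT x. norm (u x) ^ 3) \<le> ennreal ((D ^ 3 + E) * (V * sqrt V))"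
  proof (rule mollify_fatou[OF kernel_bump integral_bump(1) u1])
   fix n
   have "(nnT x. norm (conv (rescale bump (1 / Suc n)) u x) ^ 3) \<le> (nnT x. ennreal ((D * sqrt V) ^ 3))"
    using sup[of "1 / Suc n"] by (intro nn_integral_mono ennreal_leI power_mono) auto
   also have "... = ennreal ((D * sqrt V) ^ 3)" by (simp add: emeasure_torus_UNIV)
   also have "(D * sqrt V) ^ 3 = D ^ 3 * (V * sqrt V)" using V0 by (simp add: power_mult_distrib power3_eq_cube)
   also have "ennreal ... \<le> ennreal ((D ^ 3 + E) * (V * sqrt V))"
    using E V0 by (intro ennreal_leI mult_right_mono) auto
   finally show "(nnT x. norm (conv (rescale bump (1 / Suc n)) u x) ^ 3) \<le> ennreal ((D ^ 3 + E) * (V * sqrt V))" .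
  qed
 next
  fix v u :: "space \<Rightarrow> real" and \<xi> :: space
  assume H: "helmholtz \<alpha> v u" and v: "torus_Lp 3 v" and u: "torus_Lp 3 u"
  note [measurable] = torus_LpD(2)[OF u] torus_LpD(2)[OF v]
  let ?w = "\<lambda>y. u y - v y" and ?f = "\<lambda>x. u (x + \<xi>) - u x"
  have neg: "torus_Lp 3 (\<lambda>y. - h y)" if "torus_Lp 3 h" for h :: "space \<Rightarrow> real"
   by (rule torus_Lp_linear[OF that bounded_linear_minus[OF bounded_linear_ident]])
  have w: "torus_Lp 3 ?w" using torus_Lp_add[OF u neg[OF v]] by simp
  have f: "torus_Lp 3 ?f" using torus_Lp_add[OF torus_Lp_shift[OF u] neg[OF u]] by simp
  have u1: "torus_L1 u" and w1: "torus_L1 ?w" and f1: "torus_L1 ?f" and us: "torus_L1 (\<lambda>x. u (x + \<xi>))"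
   using torus_Lp_imp_L1[OF u] torus_Lp_imp_L1[OF w] torus_Lp_imp_L1[OF f] torus_Lp_imp_L1[OF torus_Lp_shift[OF u]] by simp_all
  define X where "X = (nnT x. norm (u x) ^ 3)"
  define Y where "Y = (nnT x. norm (v x) ^ 3)"
  have wXY: "(nnT x. norm (?w x) ^ 3) \<le> ennreal 8 * (X + Y)"
   using nn_norm_power_add[of u torus "\<lambda>x. - v x" 3] by (simp add: X_def Y_def)
  let ?m = "\<lambda>s z. rescale bump s (z + \<xi>) - rescale bump s z" and ?k = "\<lambda>s z. ?T s (z + \<xi>) - ?T s z"
  have inc: "conv (\<lambda>z. K (z + \<xi>) - K z) h x = conv K h (x + \<xi>) - conv K h x"
   if K: "bump_kernel K" and h: "torus_L1 h" for K and h :: "space \<Rightarrow> real" and x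
   using conv_integrable[OF K h, of "x + \<xi>"] conv_integrable[OF K h, of x]
   by (simp add: conv_def left_diff_distrib algebra_simps flip: L_integral_diff)
  have bound: "(nnT x. norm (conv (rescale bump e) ?f x) ^ 3) \<le> ennreal (E * norm \<xi> ^ 3) * (X + Y)"
   if e: "0 < e" "e \<le> 1" for e
  proof -
   have ke: "bump_kernel (rescale bump s)" "bump_kernel (?T s)" if "s > 0" for s
    using that by (auto intro: kernel_rescale kernel_bump kernel_bump_potential)
   let ?J = "\<lambda>x. LBINT s. indicator {e..1} s * (s * conv (?k s) ?w x)"
   have eq: "conv (rescale bump e) ?f x = conv (?m 1) u x + a * ?J x" for x
   proof -
    let ?I = "\<lambda>x s. indicator {e..1} s * (s * conv (?T s) ?w x)"
    have "?J x = (LBINT s. ?I (x + \<xi>) s - ?I x s)"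
     using e by (intro L_integral_cong refl) (auto simp: indicator_def inc[OF ke(2) w1] right_diff_distrib)
    also have "... = (LBINT s. ?I (x + \<xi>) s) - (LBINT s. ?I x s)"
     by (intro L_integral_diff helmholtz_scale_formula(2)[OF \<alpha> H e])
    finally have J: "?J x = (LBINT s. ?I (x + \<xi>) s) - (LBINT s. ?I x s)" .
    have "conv (rescale bump e) ?f x = conv (rescale bump e) u (x + \<xi>) - conv (rescale bump e) u x"
     using conv_diff[OF ke(1)[OF e(1)] us u1, of x] conv_shift[OF ke(1)[OF e(1)] u1, of \<xi> x] by simp
    then show ?thesis
     unfolding helmholtz_scale_formula(1)[OF \<alpha> H e] J a_def inc[OF ke(1)[OF zero_less_one] u1] by (simp add: right_diff_distrib)
   qed
   have m1: "bump_kernel (?m 1)" by (rule kernel_increment[OF ke(1)]) simp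
   note [measurable] = kernel_measurable[OF kernel_bump_potential]
   have km: "(\<lambda>(s, z). ?k s z) \<in> Borel2" unfolding rescale_def by measurable
   have cm: "conv (?m 1) u \<in> Borel"
    by (rule borel_measurable_continuous_onI[OF smooth_continuous[OF smooth_conv[OF m1 u1]]])
   have Jm: "(\<lambda>x. a * ?J x) \<in> Borel"
   proof -
    have "(\<lambda>x. conv (rescale bump e) ?f x - conv (?m 1) u x) \<in> Borel"
     by (intro borel_measurable_diff cm borel_measurable_continuous_onI[OF smooth_continuous[OF smooth_conv[OF ke(1)[OF e(1)] f1]]])
    then show ?thesis by (simp add: eq)
   qed
   have "(nnT x. norm (conv (rescale bump e) ?f x) ^ 3)
     \<le> ennreal (2 ^ 3) * ((nnT x. norm (conv (?m 1) u x) ^ 3) + (nnT x. norm (a * ?J x) ^ 3))"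
    unfolding eq by (rule nn_norm_power_add) (use cm Jm in auto)
   also have "... \<le> ennreal 8 * (ennreal ((M1 * norm \<xi>) ^ 3) * (X + Y) + ennreal (a ^ 3 * ((M2 * norm \<xi>) ^ 3 * 8)) * (X + Y))"
   proof (intro mult_mono add_mono)
    have "(nnT x. norm (conv (?m 1) u x) ^ 3) \<le> ennreal ((M1 * norm \<xi>) ^ 3) * X"
     unfolding X_def using M1(2)[of 1 \<xi>] by (intro conv_L3_nn m1 u) simp
    also have "... \<le> ennreal ((M1 * norm \<xi>) ^ 3) * (X + Y)" by (intro mult_left_mono) auto
    finally show "(nnT x. norm (conv (?m 1) u x) ^ 3) \<le> ennreal ((M1 * norm \<xi>) ^ 3) * (X + Y)" .
    have J: "(nnT x. norm (?J x) ^ 3) \<le> ennreal ((M2 * norm \<xi>) ^ 3) * (ennreal 8 * (X + Y))"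
    proof (rule order_trans[OF scale_integral_L3[OF e w _ km] mult_left_mono[OF wXY]])
     show "bump_kernel (?k s)" if "s \<in> {e..1}" for s
      using that e by (intro kernel_increment ke) auto
     show "s * (LBINT z. \<bar>?k s z\<bar>) \<le> M2 * norm \<xi>" if "s \<in> {e..1}" for s
      using M2(2)[of s \<xi>] that e by (simp add: pos_le_divide_eq mult.commute)
    qed (use M2(1) in auto)
    have "(nnT x. norm (a * ?J x) ^ 3) = (nnT x. ennreal (a ^ 3) * ennreal (norm (?J x) ^ 3))"
     using a by (intro nn_integral_cong) (simp add: abs_mult power_mult_distrib ennreal_mult)
    also have "... = ennreal (a ^ 3) * (nnT x. norm (?J x) ^ 3)"
    proof (rule nn_integral_cmult)
     have "(\<lambda>x. \<alpha>\<^sup>2 * (a * ?J x)) \<in> Borel" by (intro borel_measurable_times borel_measurable_const Jm)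
     then have "?J \<in> Borel" using \<alpha> by (simp add: a_def)
     then show "(\<lambda>x. ennreal (norm (?J x) ^ 3)) \<in> borel_measurable torus" by simp
    qed
    also have "... \<le> ennreal (a ^ 3) * (ennreal ((M2 * norm \<xi>) ^ 3) * (ennreal 8 * (X + Y)))"
     by (rule mult_left_mono[OF J]) simp
    also have "... = ennreal (a ^ 3 * ((M2 * norm \<xi>) ^ 3 * 8)) * (X + Y)"
     using a M2(1) by (simp only: ennreal_mult zero_le_power mult_nonneg_nonneg norm_ge_zero zero_le_numeral mult.assoc)
    finally show "(nnT x. norm (a * ?J x) ^ 3) \<le> ennreal (a ^ 3 * ((M2 * norm \<xi>) ^ 3 * 8)) * (X + Y)" .
   qed auto
   also have "... = ennreal (8 * ((M1 * norm \<xi>) ^ 3 + a ^ 3 * ((M2 * norm \<xi>) ^ 3 * 8))) * (X + Y)"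
   proof -
    have comb: "ennreal 8 * (ennreal p * Z + ennreal q * Z) = ennreal (8 * (p + q)) * Z" if "0 \<le> p" "0 \<le> q" for p q Z
     using that by (simp add: ennreal_mult ennreal_plus distrib_right distrib_left mult.assoc del: ennreal_numeral)
    show ?thesis using M1(1) M2(1) a by (intro comb) auto
   qed
   also have "8 * ((M1 * norm \<xi>) ^ 3 + a ^ 3 * ((M2 * norm \<xi>) ^ 3 * 8)) = E * norm \<xi> ^ 3"
    by (simp add: E_def power_mult_distrib algebra_simps)
   finally show ?thesis .
  qed
  have "(nnT x. norm (?f x) ^ 3) \<le> ennreal (E * norm \<xi> ^ 3) * (X + Y)"
   by (rule mollify_fatou[OF kernel_bump integral_bump(1) f1]) (rule bound, auto)
  also have "... \<le> ennreal ((D ^ 3 + E) * norm \<xi> ^ 3) * (X + Y)"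
   using D by (intro mult_right_mono ennreal_leI) auto
  finally show "(nnT x. norm (?f x) ^ 3)
    \<le> ennreal ((D ^ 3 + E) * norm \<xi> ^ 3) * ((nnT x. norm (u x) ^ 3) + (nnT x. norm (v x) ^ 3))"
   by (simp add: X_def Y_def)
 qed
qed



section \<open>The energy flux at a fixed time\<close>

lemma kernel_swap_dominated:
 fixes h :: "space \<Rightarrow> space \<Rightarrow> real" and P :: "space \<Rightarrow> real"
 assumes K: "integrable lborel K"
  and m: "(\<lambda>(x, z). h x z) \<in> Borel2"
  and P: "torus_L1 P" "\<And>x. 0 \<le> P x" and c: "c \<ge> 0" and s: "s = 1 \<or> s = - 1"
  and bound: "\<And>x z. \<bar>h x z\<bar> \<le> c * (P x + P (x + s *\<^sub>R z))"
 shows "(LINT x|torus. (LBINT z. K z * h x z)) = (LBINT z. K z * (LINT x|torus. h x z))"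
  and "integrable torus (\<lambda>x. h x z)"
  and "integrable lborel (\<lambda>z. K z * (LINT x|torus. h x z))"
  and "integrable torus (\<lambda>x. (LBINT z. K z * h x z))"
proof -
 note [measurable] = torus_L1D(2)[OF P(1)]
 have mp: "(\<lambda>p. h (fst p) (snd p)) \<in> Borel2"
  using m by (simp add: case_prod_beta')
 have [measurable]: "(\<lambda>x. h x z) \<in> Borel" for z
  using measurable_compose[OF measurable_Pair2' mp, of z] by simp
 have Ps: "integrable torus (\<lambda>x. P (x + a))" "(LINT x|torus. P (x + a)) = (LINT x|torus. P x)" for a
  using integral_torus_shift[OF torus_L1D(1,2)[OF P(1)], of a] torus_L1D(3)[OF P(1)] by auto
 have i: "integrable torus (\<lambda>x. c * (P x + P (x + s *\<^sub>R z)))" for z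
  using torus_L1D(3)[OF P(1)] Ps(1)[of "s *\<^sub>R z"] by simp
 show "integrable torus (\<lambda>x. h x z)" for z
 proof (rule L_integrable_bound[OF i[of z]])
  show "AE x in torus. norm (h x z) \<le> norm (c * (P x + P (x + s *\<^sub>R z)))"
   using bound P(2) c by (intro AE_I2) (simp add: abs_of_nonneg)
 qed measurable
 have b: "(nnT x. norm (h x z)) \<le> ennreal (2 * c * (LINT x|torus. P x))" for z
 proof -
  have "(nnT x. norm (h x z)) \<le> (nnT x. ennreal (c * (P x + P (x + s *\<^sub>R z))))"
   by (intro nn_integral_mono ennreal_leI) (simp add: bound)
  also have "... = ennreal (LINT x|torus. c * (P x + P (x + s *\<^sub>R z)))"
   by (rule nn_integral_eq_integral[OF i]) (use P(2) c in simp)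
  also have "(LINT x|torus. c * (P x + P (x + s *\<^sub>R z))) = 2 * c * (LINT x|torus. P x)"
   using torus_L1D(3)[OF P(1)] Ps[of "s *\<^sub>R z"] by (simp add: algebra_simps)
  finally show ?thesis .
 qed
 show "(LINT x|torus. (LBINT z. K z * h x z)) = (LBINT z. K z * (LINT x|torus. h x z))"
  using kernel_swap(4)[OF K m b] by simp
 show "integrable lborel (\<lambda>z. K z * (LINT x|torus. h x z))"
  using kernel_swap(3)[OF K m b] by simp
 show "integrable torus (\<lambda>x. (LBINT z. K z * h x z))"
  using kernel_swap(2)[OF K m b] by simp
qed

lemma odd_kernel_integral:
 fixes k g :: "space \<Rightarrow> real"
 assumes "\<And>z. k (- z) = - k z" and [measurable]: "k \<in> Borel" "g \<in> Borel"
 shows "(LBINT z. k z * g (- z)) = - (LBINT z. k z * g z)"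
  and "integrable lborel (\<lambda>z. k z * g (- z)) \<longleftrightarrow> integrable lborel (\<lambda>z. k z * g z)"
proof -
 have "(LBINT z. k (0 - z) * g (0 - z)) = (LBINT z. k z * g z)"
  by (rule lborel_reflect(1)[of "\<lambda>z. k z * g z"]) measurable
 then show "(LBINT z. k z * g (- z)) = - (LBINT z. k z * g z)" by (simp add: assms(1))
 have "integrable lborel (\<lambda>z. k (0 - z) * g (0 - z)) = integrable lborel (\<lambda>z. k z * g z)"
  by (rule lborel_reflect(2)[of "\<lambda>z. k z * g z"]) measurable
 then show "integrable lborel (\<lambda>z. k z * g (- z)) \<longleftrightarrow> integrable lborel (\<lambda>z. k z * g z)" by (simp add: assms(1))
qed

lemma triple_product_bound:
 fixes a b c :: real
 assumes "0 \<le> a" "0 \<le> b" "0 \<le> c"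
 shows "a * b * c \<le> a ^ 3 + b ^ 3 + c ^ 3"
proof -
 define m where "m = max a (max b c)"
 have "a * b * c \<le> m * m * m" using assms by (intro mult_mono) (auto simp: m_def)
 also have "... = m ^ 3" by (simp add: power3_eq_cube)
 also have "... \<le> a ^ 3 + b ^ 3 + c ^ 3" using assms by (auto simp: m_def max_def)
 finally show ?thesis .
qed

text \<open>For an odd kernel \<open>k\<close> the cubic expression in the increments of \<open>f\<close> and \<open>g\<close> reduces, after
 translations in \<open>x\<close>, to one term quadratic in \<open>g\<close> at a single point, in which \<open>f\<close> is convolved with
 \<open>k\<close>, and one term that contains \<open>g\<close> at both points.\<close>

lemma cubic_increment_identity:
 fixes f :: "space \<Rightarrow> real" and g :: "space \<Rightarrow> space"
 assumes k: "bump_kernel k" and odd: "\<And>z. k (- z) = - k z"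
  and f: "torus_Lp 3 f" and g: "torus_Lp 3 g"
 shows "(LINT x|torus. (LBINT z. k z * ((f (x + z) - f x) * (norm (g (x + z) - g x))\<^sup>2)))
  = - 2 * (LINT x|torus. (norm (g x))\<^sup>2 * conv k f x) - 4 * (LINT x|torus. f x * (g x \<bullet> conv k g x))"
  and "integrable torus (\<lambda>x. (LBINT z. k z * ((f (x + z) - f x) * (norm (g (x + z) - g x))\<^sup>2)))"
  and "integrable torus (\<lambda>x. (norm (g x))\<^sup>2 * conv k f x)"
  and "integrable torus (\<lambda>x. f x * (g x \<bullet> conv k g x))"
proof -
 note [measurable] = torus_LpD(2)[OF f] torus_LpD(2)[OF g] kernel_measurable[OF k]
 have f1: "torus_L1 f" and g1: "torus_L1 g" using torus_Lp_imp_L1[OF f] torus_Lp_imp_L1[OF g] by auto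
 have ki: "integrable lborel k" by (rule kernel_integrable[OF k])
 define P where "P x = \<bar>f x\<bar> ^ 3 + norm (g x) ^ 3" for x
 have P0: "0 \<le> P x" for x by (simp add: P_def)
 have P: "torus_L1 P"
  using torus_LpD(3)[OF f] torus_LpD(3)[OF g]
   periodic_compose2[OF torus_LpD(1)[OF f] torus_LpD(1)[OF g], of "\<lambda>a b. \<bar>a\<bar> ^ 3 + norm b ^ 3"]
  unfolding P_def[abs_def] torus_L1_def by auto
 define h1 where "h1 x z = f x * (norm (g (x + z)))\<^sup>2" for x z
 define h2 where "h2 x z = f x * (g x \<bullet> g (x + z))" for x z
 define h3 where "h3 x z = f x * (norm (g x))\<^sup>2" for x z :: space
 define h where "h x z = (f (x + z) - f x) * (norm (g (x + z) - g x))\<^sup>2" for x z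
 have m: "(\<lambda>(x, z). h1 x z) \<in> Borel2"
  "(\<lambda>(x, z). h2 x z) \<in> Borel2"
  "(\<lambda>(x, z). h x z) \<in> Borel2"
  "(\<lambda>(x, z). h3 x z) \<in> Borel2"
  unfolding h1_def h2_def h3_def h_def by measurable
 have p0: "0 \<le> norm (g y) ^ 3" "0 \<le> \<bar>f y\<bar> ^ 3" for y by simp_all
 have lin: "a \<le> 4 * (F + G + (F' + G'))"
  if "a \<le> F + X + Y" "X = G \<or> X = G'" "Y = G \<or> Y = G'" "0 \<le> F" "0 \<le> G" "0 \<le> F'" "0 \<le> G'" for a F X Y G F' G' :: real
  using that by auto
 have b1: "\<bar>h1 x z\<bar> \<le> 4 * (P x + P (x + 1 *\<^sub>R z))" for x z
 proof -
  have "\<bar>h1 x z\<bar> \<le> \<bar>f x\<bar> ^ 3 + norm (g (x + z)) ^ 3 + norm (g (x + z)) ^ 3"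
   using triple_product_bound[of "\<bar>f x\<bar>" "norm (g (x + z))" "norm (g (x + z))"]
   by (simp add: h1_def abs_mult power2_eq_square mult.assoc)
  then show ?thesis unfolding P_def scaleR_one by (rule lin) (use p0 in auto)
 qed
 have b2: "\<bar>h2 x z\<bar> \<le> 4 * (P x + P (x + 1 *\<^sub>R z))" for x z
 proof -
  have "\<bar>h2 x z\<bar> \<le> \<bar>f x\<bar> * (norm (g x) * norm (g (x + z)))"
   by (simp add: h2_def abs_mult Cauchy_Schwarz_ineq2 mult_left_mono)
  also have "... \<le> \<bar>f x\<bar> ^ 3 + norm (g x) ^ 3 + norm (g (x + z)) ^ 3"
   using triple_product_bound[of "\<bar>f x\<bar>" "norm (g x)" "norm (g (x + z))"] by (simp add: mult.assoc)
  finally show ?thesis unfolding P_def scaleR_one by (rule lin) (use p0 in auto)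
 qed
 have b3: "\<bar>h3 x z\<bar> \<le> 4 * (P x + P (x + 1 *\<^sub>R z))" for x z
 proof -
  have "\<bar>h3 x z\<bar> \<le> \<bar>f x\<bar> ^ 3 + norm (g x) ^ 3 + norm (g x) ^ 3"
   using triple_product_bound[of "\<bar>f x\<bar>" "norm (g x)" "norm (g x)"]
   by (simp add: h3_def abs_mult power2_eq_square mult.assoc)
  then show ?thesis unfolding P_def scaleR_one by (rule lin) (use p0 in auto)
 qed
 have bh: "\<bar>h x z\<bar> \<le> 16 * (P x + P (x + 1 *\<^sub>R z))" for x z
 proof -
  have "\<bar>h x z\<bar> = \<bar>f (x + z) - f x\<bar> * norm (g (x + z) - g x) * norm (g (x + z) - g x)"
   by (simp add: h_def abs_mult power2_eq_square mult.assoc)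
  also have "... \<le> \<bar>f (x + z) - f x\<bar> ^ 3 + norm (g (x + z) - g x) ^ 3 + norm (g (x + z) - g x) ^ 3"
   by (rule triple_product_bound) auto
  also have "... \<le> 2 ^ 3 * (\<bar>f (x + z)\<bar> ^ 3 + \<bar>f x\<bar> ^ 3) + 2 ^ 3 * (norm (g (x + z)) ^ 3 + norm (g x) ^ 3)
    + 2 ^ 3 * (norm (g (x + z)) ^ 3 + norm (g x) ^ 3)"
  proof (intro add_mono)
   have "\<bar>f (x + z) - f x\<bar> ^ 3 \<le> (\<bar>f (x + z)\<bar> + \<bar>f x\<bar>) ^ 3" by (intro power_mono) auto
   also have "... \<le> 2 ^ 3 * (\<bar>f (x + z)\<bar> ^ 3 + \<bar>f x\<bar> ^ 3)" by (rule power_add_le) auto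
   finally show "\<bar>f (x + z) - f x\<bar> ^ 3 \<le> 2 ^ 3 * (\<bar>f (x + z)\<bar> ^ 3 + \<bar>f x\<bar> ^ 3)" .
   have "norm (g (x + z) - g x) ^ 3 \<le> (norm (g (x + z)) + norm (g x)) ^ 3"
    by (intro power_mono norm_triangle_ineq4) auto
   also have "... \<le> 2 ^ 3 * (norm (g (x + z)) ^ 3 + norm (g x) ^ 3)" by (rule power_add_le) auto
   finally have n: "norm (g (x + z) - g x) ^ 3 \<le> 2 ^ 3 * (norm (g (x + z)) ^ 3 + norm (g x) ^ 3)" .
   show "norm (g (x + z) - g x) ^ 3 \<le> 2 ^ 3 * (norm (g (x + z)) ^ 3 + norm (g x) ^ 3)"
    "norm (g (x + z) - g x) ^ 3 \<le> 2 ^ 3 * (norm (g (x + z)) ^ 3 + norm (g x) ^ 3)" by (rule n)+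
  qed
  also have "... \<le> 16 * (P x + P (x + 1 *\<^sub>R z))"
  proof -
   have "2 ^ 3 * (F' + F) + 2 ^ 3 * (G' + G) + 2 ^ 3 * (G' + G) \<le> 16 * (F + G + (F' + G'))"
    if "0 \<le> F" "0 \<le> F'" for F F' G G' :: real
    using that by simp
   then show ?thesis unfolding P_def scaleR_one using p0 by blast
  qed
  finally show ?thesis .
 qed
 note s1 = kernel_swap_dominated[OF ki m(1) P P0 _ disjI1[OF refl] b1, simplified]
 note s2 = kernel_swap_dominated[OF ki m(2) P P0 _ disjI1[OF refl] b2, simplified]
 note s3 = kernel_swap_dominated[OF ki m(4) P P0 _ disjI1[OF refl] b3, simplified]
 note sh = kernel_swap_dominated[OF ki m(3) P P0 _ disjI1[OF refl] bh, simplified]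
 define a where "a z = (LINT x|torus. h1 x z)" for z
 define c where "c z = (LINT x|torus. h2 x z)" for z
 have am[measurable]: "a \<in> Borel" "c \<in> Borel"
 proof -
  have "(\<lambda>p. h1 (snd p) (fst p)) \<in> borel_measurable (borel \<Otimes>\<^sub>M torus)" "(\<lambda>p. h2 (snd p) (fst p)) \<in> borel_measurable (borel \<Otimes>\<^sub>M torus)"
   unfolding h1_def h2_def by measurable
  then show "a \<in> Borel" "c \<in> Borel"
   unfolding a_def[abs_def] c_def[abs_def]
   by (auto intro!: torus.borel_measurable_lebesgue_integral simp: case_prod_beta')
 qed
 have per: "periodic f" "periodic g" using torus_LpD(1)[OF f] torus_LpD(1)[OF g] .
 have per_h: "periodic (\<lambda>x. h1 x z)" "periodic (\<lambda>x. h2 x z)" "periodic (\<lambda>x. h3 x z)" for z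
 proof -
  have gz: "periodic (\<lambda>x. g (x + z))" by (rule periodic_shift[OF per(2)])
  show "periodic (\<lambda>x. h1 x z)" unfolding h1_def by (rule periodic_compose2[OF per(1) gz, of "\<lambda>a b. a * (norm b)\<^sup>2"])
  show "periodic (\<lambda>x. h3 x z)" unfolding h3_def by (rule periodic_compose2[OF per(1) per(2), of "\<lambda>a b. a * (norm b)\<^sup>2"])
  show "periodic (\<lambda>x. h2 x z)" unfolding h2_def
   by (rule periodic_compose2[OF per(1) periodic_compose2[OF per(2) gz, of "(\<bullet>)"], of "(*)"])
 qed
 have mx[measurable]: "(\<lambda>x. h1 x z) \<in> Borel" "(\<lambda>x. h2 x z) \<in> Borel" "(\<lambda>x. h3 x z) \<in> Borel" for z
  unfolding h1_def h2_def h3_def by measurable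
 have i1: "integrable torus (\<lambda>x. h1 x z)" "integrable torus (\<lambda>x. h2 x z)" "integrable torus (\<lambda>x. h3 x z)" for z
  using s1(2) s2(2) s3(2) by auto
 have sh1: "integrable torus (\<lambda>x. h1 (x + y) z)" "(LINT x|torus. h1 (x + y) z) = a z"
  "integrable torus (\<lambda>x. h2 (x + y) z)" "(LINT x|torus. h2 (x + y) z) = c z"
  "integrable torus (\<lambda>x. h3 (x + y) z)" "(LINT x|torus. h3 (x + y) z) = (LINT x|torus. h3 x z)" for y z
  using integral_torus_shift[OF per_h(1) mx(1), of y z] integral_torus_shift[OF per_h(2) mx(2), of y z]
   integral_torus_shift[OF per_h(3) mx(3), of y z] i1 by (auto simp: a_def c_def)
 have expand: "(LINT x|torus. h x z) = a (- z) - a z - 2 * c (- z) + 2 * c z" for z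
 proof -
  have sq: "(norm (p - q))\<^sup>2 = (norm p)\<^sup>2 - 2 * (q \<bullet> p) + (norm q)\<^sup>2" for p q :: space
   by (simp add: power2_norm_eq_inner inner_diff_left inner_diff_right inner_commute)
  have "h x z = h1 (x + z) (- z) - h1 x z - 2 * h2 (x + z) (- z) + 2 * h2 x z + (h3 (x + z) z - h3 x z)" for x
   by (simp add: h_def h1_def h2_def h3_def sq algebra_simps inner_commute)
  then have "(LINT x|torus. h x z) = (LINT x|torus. h1 (x + z) (- z) - h1 x z - 2 * h2 (x + z) (- z) + 2 * h2 x z + (h3 (x + z) z - h3 x z))"
   by simp
  also have "... = a (- z) - a z - 2 * c (- z) + 2 * c z"
   using i1 sh1 by (simp add: a_def c_def)
  finally show ?thesis .
 qed
 have ka: "integrable lborel (\<lambda>z. k z * a z)" "integrable lborel (\<lambda>z. k z * c z)"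
  using s1(3) s2(3) by (auto simp: a_def c_def)
 have ka': "integrable lborel (\<lambda>z. k z * a (- z))" "integrable lborel (\<lambda>z. k z * c (- z))"
  using ka odd_kernel_integral(2)[of k a, OF odd kernel_measurable[OF k] am(1)] odd_kernel_integral(2)[of k c, OF odd kernel_measurable[OF k] am(2)] by auto
 have "(LINT x|torus. (LBINT z. k z * h x z)) = (LBINT z. k z * (LINT x|torus. h x z))"
  by (rule sh(1))
 also have "... = (LBINT z. k z * a (- z) - k z * a z - 2 * (k z * c (- z)) + 2 * (k z * c z))"
  by (intro L_integral_cong refl) (simp add: expand algebra_simps)
 also have "... = - 2 * (LBINT z. k z * a z) + 4 * (LBINT z. k z * c z)"
  using ka ka' odd_kernel_integral(1)[of k a, OF odd kernel_measurable[OF k] am(1)] odd_kernel_integral(1)[of k c, OF odd kernel_measurable[OF k] am(2)] by simp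
 finally have main: "(LINT x|torus. (LBINT z. k z * h x z)) = - 2 * (LBINT z. k z * a z) + 4 * (LBINT z. k z * c z)" .
 have cA: "(LBINT z. k z * h2 x z) = - (f x * (g x \<bullet> conv k g x))" for x
 proof -
  have i: "integrable lborel (\<lambda>z. k z *\<^sub>R g (x - z))"
   using lborel_reflect(2)[of "\<lambda>y. k (x - y) *\<^sub>R g y" x] conv_integrable[OF k g1, of x] by simp
  have "(LBINT z. k z * h2 x z) = (LBINT z. k (0 - z) * h2 x (0 - z))"
   by (rule lborel_reflect(1)[of "\<lambda>z. k z * h2 x z", symmetric]) (unfold h2_def, measurable)
  also have "... = (LBINT z. - (f x * (g x \<bullet> (k z *\<^sub>R g (x - z)))))"
   by (intro L_integral_cong refl) (simp add: h2_def odd)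
  also have "... = - (f x * (LBINT z. g x \<bullet> (k z *\<^sub>R g (x - z))))"
   by (simp only: L_integral_minus integral_mult_right_zero)
  also have "(LBINT z. g x \<bullet> (k z *\<^sub>R g (x - z))) = g x \<bullet> (LBINT z. k z *\<^sub>R g (x - z))"
   by (rule integral_inner_right[OF i])
  also have "(LBINT z. k z *\<^sub>R g (x - z)) = conv k g x" by (subst conv_reflect) auto
  finally show ?thesis .
 qed
 have cA': "integrable torus (\<lambda>x. f x * (g x \<bullet> conv k g x))"
  using s2(4) by (simp add: cA)
 then show "integrable torus (\<lambda>x. f x * (g x \<bullet> conv k g x))" .
 have c_eq: "(LBINT z. k z * c z) = - (LINT x|torus. f x * (g x \<bullet> conv k g x))"
 proof -
  have "(LBINT z. k z * c z) = (LINT x|torus. (LBINT z. k z * h2 x z))"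
   unfolding c_def by (rule s2(1)[symmetric])
  also have "... = - (LINT x|torus. f x * (g x \<bullet> conv k g x))" by (simp add: cA)
  finally show ?thesis .
 qed
 define h1' where "h1' x z = f (x - z) * (norm (g x))\<^sup>2" for x z
 have m1': "(\<lambda>(x, z). h1' x z) \<in> Borel2"
  unfolding h1'_def by measurable
 have b1': "\<bar>h1' x z\<bar> \<le> 4 * (P x + P (x + (- 1) *\<^sub>R z))" for x z
  using b1[of "x - z" z] by (simp add: h1_def h1'_def add.commute)
 note s1' = kernel_swap_dominated[OF ki m1' P P0 _ disjI2[OF refl] b1', simplified]
 have a': "a z = (LINT x|torus. h1' x z)" for z
  using sh1(2)[of "- z" z] by (simp add: h1_def h1'_def)
 have aA: "(LBINT z. k z * h1' x z) = (norm (g x))\<^sup>2 * conv k f x" for x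
 proof -
  have "(LBINT z. k z * h1' x z) = (LBINT z. (norm (g x))\<^sup>2 * (k z * f (x - z)))"
   by (intro L_integral_cong refl) (simp add: h1'_def)
  also have "... = (norm (g x))\<^sup>2 * (LBINT z. k z *\<^sub>R f (x - z))" by simp
  also have "(LBINT z. k z *\<^sub>R f (x - z)) = conv k f x" by (subst conv_reflect) auto
  finally show ?thesis .
 qed
 show "integrable torus (\<lambda>x. (norm (g x))\<^sup>2 * conv k f x)"
  using s1'(4) by (simp add: aA)
 have a_eq: "(LBINT z. k z * a z) = (LINT x|torus. (norm (g x))\<^sup>2 * conv k f x)"
 proof -
  have "(LBINT z. k z * a z) = (LINT x|torus. (LBINT z. k z * h1' x z))"
   unfolding a' by (rule s1'(1)[symmetric])
  then show ?thesis by (simp add: aA)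
 qed
 show "(LINT x|torus. (LBINT z. k z * ((f (x + z) - f x) * (norm (g (x + z) - g x))\<^sup>2)))
  = - 2 * (LINT x|torus. (norm (g x))\<^sup>2 * conv k f x) - 4 * (LINT x|torus. f x * (g x \<bullet> conv k g x))"
  using main unfolding h_def a_eq c_eq by simp
 show "integrable torus (\<lambda>x. (LBINT z. k z * ((f (x + z) - f x) * (norm (g (x + z) - g x))\<^sup>2)))"
  using sh(4) unfolding h_def .
qed

lemma vec_nth_linear: "bounded_linear (\<lambda>x::space. x $ i)"
 by (rule bounded_linear_vec_nth)

text \<open>The defect integral of a divergence-free field is minus four times the energy flux.\<close>

lemma energy_flux_identity:
 fixes f g :: "space \<Rightarrow> space"
 assumes K: "bump_kernel K" and even: "\<And>z. K (- z) = K z"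
  and f: "torus_Lp 3 f" and g: "torus_Lp 3 g"
  and div: "\<And>y. (\<Sum>i\<in>UNIV. conv (dx i K) (\<lambda>x. f x $ i) y) = 0"
 shows "(LINT x|torus. (LBINT z. (grad K z \<bullet> fdiff z f x) * (norm (fdiff z g x))\<^sup>2))
  = - 4 * (LINT x|torus. (\<Sum>i\<in>UNIV. f x $ i * (g x \<bullet> conv (dx i K) g x)))"
  and "integrable torus (\<lambda>x. \<Sum>i\<in>UNIV. f x $ i * (g x \<bullet> conv (dx i K) g x))"
proof -
 note [measurable] = torus_LpD(2)[OF f] torus_LpD(2)[OF g]
 have ke: "bump_kernel (dx i K)" for i by (rule kernel_dx[OF K])
 note [measurable] = kernel_measurable[OF ke]
 have odd: "dx i K (- z) = - dx i K z" for i z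
 proof -
  have "(\<lambda>z. K (- z)) = K" using even by blast
  then show ?thesis using dx_reflect[OF kernel_smooth[OF K], of i z] by simp
 qed
 have fi: "torus_Lp 3 (\<lambda>x. f x $ i)" for i by (rule torus_Lp_linear[OF f vec_nth_linear])
 let ?h = "\<lambda>i x z. dx i K z * ((f (x + z) $ i - f x $ i) * (norm (g (x + z) - g x))\<^sup>2)"
 note cub = cubic_increment_identity[OF ke odd fi g]
 have g3: "torus_L1 (\<lambda>x. norm (g x) ^ 3)" and f3: "torus_L1 (\<lambda>x. norm (f x) ^ 3)"
  using torus_LpD[OF f] torus_LpD[OF g] by (auto simp: torus_L1_def intro: periodic_compose)
 have int: "integrable lborel (\<lambda>z. ?h i x z)" for i x
 proof -
  have s: "integrable lborel (\<lambda>z. dx i K z * norm (F (x + z)) ^ 3)"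
   if F: "torus_L1 (\<lambda>x. norm (F x) ^ 3)" for F :: "space \<Rightarrow> space"
  proof -
   have m: "(\<lambda>z. dx i K z * norm (F (x + z)) ^ 3) \<in> Borel"
    using measurable_compose[of "\<lambda>z. x + z" borel borel "\<lambda>x. norm (F x) ^ 3" borel] torus_L1D(2)[OF F] by simp
   have "integrable lborel (\<lambda>y. dx i K (x - y) * norm (F y) ^ 3)"
    using conv_integrable[OF ke F, of i x] by simp
   moreover have "(\<lambda>y. dx i K (- (x - y)) * norm (F y) ^ 3) = (\<lambda>y. - (dx i K (x - y) * norm (F y) ^ 3))"
    by (simp only: odd mult_minus_left)
   ultimately have "integrable lborel (\<lambda>y. dx i K (- (x - y)) * norm (F y) ^ 3)" by simp
   moreover have "integrable lborel (\<lambda>y. dx i K (- (x - y)) * norm (F y) ^ 3) \<longleftrightarrow> integrable lborel (\<lambda>z. dx i K z * norm (F (x + z)) ^ 3)"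
   proof -
    have "integrable lborel (\<lambda>z. (\<lambda>y. dx i K (- (x - y)) * norm (F y) ^ 3) (x + z)) \<longleftrightarrow> integrable lborel (\<lambda>y. dx i K (- (x - y)) * norm (F y) ^ 3)"
     using torus_L1D(2)[OF F]
     by (subst (2) lborel_distr_plus[of x, symmetric]) (subst integrable_distr_eq, auto)
    then show ?thesis by simp
   qed
   ultimately show ?thesis by simp
  qed
  have k1: "integrable lborel (\<lambda>z. dx i K z * c)" for c using kernel_integrable[OF ke, of i] by simp
  have "integrable lborel (\<lambda>z. 8 * norm (dx i K z * norm (f (x + z)) ^ 3) + 8 * norm (dx i K z * norm (f x) ^ 3)
    + 16 * norm (dx i K z * norm (g (x + z)) ^ 3) + 16 * norm (dx i K z * norm (g x) ^ 3))"
   by (intro L_integrable_add integrable_mult_right integrable_norm s[OF f3] s[OF g3] k1)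
  then show ?thesis
  proof (rule L_integrable_bound)
   show "AE z in lborel. norm (?h i x z) \<le> norm (8 * norm (dx i K z * norm (f (x + z)) ^ 3) + 8 * norm (dx i K z * norm (f x) ^ 3)
    + 16 * norm (dx i K z * norm (g (x + z)) ^ 3) + 16 * norm (dx i K z * norm (g x) ^ 3))"
   proof (rule AE_I2)
    fix z
    have "\<bar>f (x + z) $ i - f x $ i\<bar> \<le> norm (f (x + z) - f x)"
     using component_le_norm_cart[of "f (x + z) - f x" i] by simp
    then have "\<bar>f (x + z) $ i - f x $ i\<bar> * (norm (g (x + z) - g x))\<^sup>2 \<le> norm (f (x + z) - f x) * (norm (g (x + z) - g x))\<^sup>2"
     by (rule mult_right_mono) simp
    also have "... = norm (f (x + z) - f x) * norm (g (x + z) - g x) * norm (g (x + z) - g x)"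
     by (simp add: power2_eq_square)
    also have "... \<le> norm (f (x + z) - f x) ^ 3 + norm (g (x + z) - g x) ^ 3 + norm (g (x + z) - g x) ^ 3"
     by (rule triple_product_bound) auto
    also have "... \<le> 2 ^ 3 * (norm (f (x + z)) ^ 3 + norm (f x) ^ 3) + 2 ^ 3 * (norm (g (x + z)) ^ 3 + norm (g x) ^ 3)
     + 2 ^ 3 * (norm (g (x + z)) ^ 3 + norm (g x) ^ 3)"
    proof -
     have "norm (p - q) ^ 3 \<le> 2 ^ 3 * (norm p ^ 3 + norm q ^ 3)" for p q :: space
      using order_trans[OF power_mono[OF norm_triangle_ineq4[of p q], of 3] power_add_le[of "norm p" "norm q" 3]] by simp
     then show ?thesis by (intro add_mono)
    qed
    finally have "\<bar>f (x + z) $ i - f x $ i\<bar> * (norm (g (x + z) - g x))\<^sup>2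
      \<le> 8 * norm (f (x + z)) ^ 3 + 8 * norm (f x) ^ 3 + 16 * norm (g (x + z)) ^ 3 + 16 * norm (g x) ^ 3" by simp
    from mult_left_mono[OF this, of "\<bar>dx i K z\<bar>"]
    show "norm (?h i x z) \<le> norm (8 * norm (dx i K z * norm (f (x + z)) ^ 3) + 8 * norm (dx i K z * norm (f x) ^ 3)
     + 16 * norm (dx i K z * norm (g (x + z)) ^ 3) + 16 * norm (dx i K z * norm (g x) ^ 3))"
     by (simp add: abs_mult distrib_left mult.left_commute)
   qed
  qed measurable
 qed
 have "(LBINT z. (grad K z \<bullet> fdiff z f x) * (norm (fdiff z g x))\<^sup>2) = (\<Sum>i\<in>UNIV. (LBINT z. ?h i x z))" for x
 proof -
  have "(LBINT z. (grad K z \<bullet> fdiff z f x) * (norm (fdiff z g x))\<^sup>2) = (LBINT z. (\<Sum>i\<in>UNIV. ?h i x z))"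
   by (intro L_integral_cong refl)
    (simp add: grad_def fdiff_def inner_vec_def sum_distrib_right mult.assoc)
  also have "... = (\<Sum>i\<in>UNIV. (LBINT z. ?h i x z))"
   by (rule L_integral_sum) (rule int)
  finally show ?thesis .
 qed
 then have "(LINT x|torus. (LBINT z. (grad K z \<bullet> fdiff z f x) * (norm (fdiff z g x))\<^sup>2))
   = (\<Sum>i\<in>UNIV. (LINT x|torus. (LBINT z. ?h i x z)))"
  using L_integral_sum[OF cub(2)] by simp
 also have "... = (\<Sum>i\<in>UNIV. - 2 * (LINT x|torus. (norm (g x))\<^sup>2 * conv (dx i K) (\<lambda>x. f x $ i) x))
   + (\<Sum>i\<in>UNIV. - 4 * (LINT x|torus. f x $ i * (g x \<bullet> conv (dx i K) g x)))"
  by (simp only: cub(1) sum.distrib[symmetric]) simp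
 also have "(\<Sum>i\<in>UNIV. - 2 * (LINT x|torus. (norm (g x))\<^sup>2 * conv (dx i K) (\<lambda>x. f x $ i) x))
   = - 2 * (LINT x|torus. (\<Sum>i\<in>UNIV. (norm (g x))\<^sup>2 * conv (dx i K) (\<lambda>x. f x $ i) x))"
 proof -
  have "(LINT x|torus. (\<Sum>i\<in>UNIV. (norm (g x))\<^sup>2 * conv (dx i K) (\<lambda>x. f x $ i) x))
    = (\<Sum>i\<in>UNIV. (LINT x|torus. (norm (g x))\<^sup>2 * conv (dx i K) (\<lambda>x. f x $ i) x))"
   by (rule L_integral_sum) (rule cub(3))
  then show ?thesis by (simp only: sum_distrib_left)
 qed
 also have "(LINT x|torus. (\<Sum>i\<in>UNIV. (norm (g x))\<^sup>2 * conv (dx i K) (\<lambda>x. f x $ i) x)) = 0"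
  by (simp only: sum_distrib_left[symmetric] div) simp
 also have "(\<Sum>i\<in>UNIV. - 4 * (LINT x|torus. f x $ i * (g x \<bullet> conv (dx i K) g x)))
   = - 4 * (LINT x|torus. (\<Sum>i\<in>UNIV. f x $ i * (g x \<bullet> conv (dx i K) g x)))"
 proof -
  have "(LINT x|torus. (\<Sum>i\<in>UNIV. f x $ i * (g x \<bullet> conv (dx i K) g x)))
    = (\<Sum>i\<in>UNIV. (LINT x|torus. f x $ i * (g x \<bullet> conv (dx i K) g x)))"
   by (rule L_integral_sum) (rule cub(4))
  then show ?thesis by (simp only: sum_distrib_left)
 qed
 finally show "(LINT x|torus. (LBINT z. (grad K z \<bullet> fdiff z f x) * (norm (fdiff z g x))\<^sup>2))
  = - 4 * (LINT x|torus. (\<Sum>i\<in>UNIV. f x $ i * (g x \<bullet> conv (dx i K) g x)))" by simp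
 show "integrable torus (\<lambda>x. \<Sum>i\<in>UNIV. f x $ i * (g x \<bullet> conv (dx i K) g x))"
  by (rule L_integrable_sum) (rule cub(4))
qed

lemma norm_vec_cube_le: "norm (x :: space) ^ 3 \<le> 27 * (\<Sum>i\<in>UNIV. \<bar>x $ i\<bar> ^ 3)"
proof -
 define m where "m = Max (range (\<lambda>i. \<bar>x $ i\<bar>))"
 have le: "\<bar>x $ i\<bar> \<le> m" for i unfolding m_def by (rule Max_ge) auto
 have "m \<in> range (\<lambda>i. \<bar>x $ i\<bar>)" unfolding m_def by (rule Max_in) auto
 then obtain j where j: "m = \<bar>x $ j\<bar>" by blast
 have "norm x \<le> (\<Sum>i\<in>UNIV. \<bar>x $ i\<bar>)" by (rule norm_le_l1_cart)
 also have "... \<le> (\<Sum>i\<in>(UNIV::3 set). m)" by (intro sum_mono le)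
 finally have "norm x \<le> 3 * m" by simp
 then have "norm x ^ 3 \<le> (3 * m) ^ 3" by (intro power_mono) auto
 also have "... = 27 * \<bar>x $ j\<bar> ^ 3" by (simp add: j power_mult_distrib)
 also have "\<bar>x $ j\<bar> ^ 3 \<le> (\<Sum>i\<in>UNIV. \<bar>x $ i\<bar> ^ 3)"
  by (rule member_le_sum[of j UNIV "\<lambda>i. \<bar>x $ i\<bar> ^ 3"]) auto
 finally show ?thesis by simp
qed

text \<open>The scalar bounds applied to each component; the factor \<open>81\<close> is \<open>3\<^sup>4\<close>, from \<open>\<bar>x\<bar>\<^sup>3 \<le> 27 \<Sum> \<bar>x\<^sub>i\<bar>\<^sup>3\<close> and three components.\<close>

lemma helmholtz_vector_bounds:
 assumes \<alpha>: "\<alpha> > 0"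
 obtains C where "C \<ge> 0"
  "\<And>v u :: space \<Rightarrow> space. \<And>V. (\<And>i. helmholtz \<alpha> (\<lambda>x. v x $ i) (\<lambda>x. u x $ i)) ==> u \<in> Borel ==> torus_Lp 2 v ==>
   (LINT x|torus. (norm (v x))\<^sup>2) \<le> V ==> (nnT x. norm (u x) ^ 3) \<le> ennreal (C * (V * sqrt V))"
  "\<And>v u :: space \<Rightarrow> space. \<And>\<xi>. (\<And>i. helmholtz \<alpha> (\<lambda>x. v x $ i) (\<lambda>x. u x $ i)) ==> torus_Lp 3 v ==> torus_Lp 3 u ==>
   (nnT x. norm (u (x + \<xi>) - u x) ^ 3)
    \<le> ennreal (C * norm \<xi> ^ 3) * ((nnT x. norm (u x) ^ 3) + (nnT x. norm (v x) ^ 3))"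
proof (rule helmholtz_L3_bounds[OF \<alpha>])
 fix C :: real
 assume C: "C \<ge> 0"
  "\<And>v u V. helmholtz \<alpha> v u ==> (LINT x|torus. (v x)\<^sup>2) \<le> V ==>
   (nnT x. norm (u x) ^ 3) \<le> ennreal (C * (V * sqrt V))"
  "\<And>v u \<xi>. helmholtz \<alpha> v u ==> torus_Lp 3 v ==> torus_Lp 3 u ==>
   (nnT x. norm (u (x + \<xi>) - u x) ^ 3)
    \<le> ennreal (C * norm \<xi> ^ 3) * ((nnT x. norm (u x) ^ 3) + (nnT x. norm (v x) ^ 3))"
 have assemble: "(nnT x. norm (w x) ^ 3) \<le> ennreal 81 * B"
  if [measurable]: "w \<in> Borel" and B: "\<And>i. (nnT x. norm (w x $ i) ^ 3) \<le> B"
  for w :: "space \<Rightarrow> space" and B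
 proof -
  have "(nnT x. norm (w x) ^ 3) \<le> (nnT x. ennreal 27 * (\<Sum>i\<in>UNIV. ennreal (norm (w x $ i) ^ 3)))"
  proof (rule nn_integral_mono)
   fix x
   show "ennreal (norm (w x) ^ 3) \<le> ennreal 27 * (\<Sum>i\<in>UNIV. ennreal (norm (w x $ i) ^ 3))"
    using ennreal_leI[OF norm_vec_cube_le[of "w x"]]
    by (subst sum_ennreal) (auto simp: ennreal_mult'' sum_nonneg)
  qed
  also have "... = ennreal 27 * (\<Sum>i\<in>UNIV. (nnT x. ennreal (norm (w x $ i) ^ 3)))"
   by (subst nn_integral_cmult, measurable) (subst nn_integral_sum, auto)
  also have "... \<le> ennreal 27 * (\<Sum>i\<in>(UNIV::3 set). B)" by (intro mult_left_mono sum_mono B) auto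
  also have "... = ennreal 81 * B" by (simp add: mult.assoc[symmetric])
  finally show ?thesis .
 qed
 show thesis
 proof (rule that[of "81 * C"])
  show "81 * C \<ge> 0" using C(1) by simp
  fix v u :: "space \<Rightarrow> space" and V
  assume H: "\<And>i. helmholtz \<alpha> (\<lambda>x. v x $ i) (\<lambda>x. u x $ i)" and um: "u \<in> Borel"
   and v: "torus_Lp 2 v" and V: "(LINT x|torus. (norm (v x))\<^sup>2) \<le> V"
  have "(LINT x|torus. (v x $ i)\<^sup>2) \<le> (LINT x|torus. (norm (v x))\<^sup>2)" for i
  proof (rule integral_mono)
   show "integrable torus (\<lambda>x. (v x $ i)\<^sup>2)" using torus_LpD(3)[OF torus_Lp_linear[OF v vec_nth_linear[of i]]] by simp
   show "(v x $ i)\<^sup>2 \<le> (norm (v x))\<^sup>2" for x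
    using power_mono[OF component_le_norm_cart[of "v x" i], of 2] by simp
  qed (rule torus_LpD(3)[OF v])
  then have "(nnT x. norm (u x $ i) ^ 3) \<le> ennreal (C * (V * sqrt V))" for i
   using V order_trans by (intro C(2)[OF H]) blast
  from assemble[OF um this] show "(nnT x. norm (u x) ^ 3) \<le> ennreal (81 * C * (V * sqrt V))"
   by (simp add: ennreal_mult' mult.assoc)
 next
  fix v u :: "space \<Rightarrow> space" and \<xi> :: space
  assume H: "\<And>i. helmholtz \<alpha> (\<lambda>x. v x $ i) (\<lambda>x. u x $ i)" and v: "torus_Lp 3 v" and u: "torus_Lp 3 u"
  note [measurable] = torus_LpD(2)[OF u] torus_LpD(2)[OF torus_Lp_shift[OF u, of \<xi>]]
  let ?B = "(nnT x. norm (u x) ^ 3) + (nnT x. norm (v x) ^ 3)"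
  have le: "(nnT x. norm (w x $ i) ^ 3) \<le> (nnT x. norm (w x) ^ 3)" for w :: "space \<Rightarrow> space" and i
   by (intro nn_integral_mono ennreal_leI power_mono) (auto simp: component_le_norm_cart)
  have "(nnT x. norm ((u (x + \<xi>) - u x) $ i) ^ 3) \<le> ennreal (C * norm \<xi> ^ 3) * ?B" for i
  proof -
   have "(nnT x. norm (u (x + \<xi>) $ i - u x $ i) ^ 3)
     \<le> ennreal (C * norm \<xi> ^ 3) * ((nnT x. norm (u x $ i) ^ 3) + (nnT x. norm (v x $ i) ^ 3))"
    by (rule C(3)[OF H torus_Lp_linear[OF v vec_nth_linear] torus_Lp_linear[OF u vec_nth_linear]])
   also have "... \<le> ennreal (C * norm \<xi> ^ 3) * ?B" by (intro mult_left_mono add_mono le) simp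
   finally show ?thesis by simp
  qed
  from assemble[OF _ this] show "(nnT x. norm (u (x + \<xi>) - u x) ^ 3) \<le> ennreal (81 * C * norm \<xi> ^ 3) * ?B"
   by (simp add: ennreal_mult' mult.assoc)
 qed
qed

section \<open>Doubling of the time variable\<close>

text \<open>Only a bounded piece of space matters for small shifts, and cutting off there turns the field into an integrable power on all of space-time.\<close>

lemma spacetime_translation:
 fixes W :: "spacetime \<Rightarrow> 'b::euclidean_space"
 assumes W[measurable]: "W \<in> Borel" and per: "\<And>t. periodic (\<lambda>x. W (x, t))"
  and fin: "(nnL t. (nnT x. norm (W (x, t)) ^ p)) < \<infinity>" and p: "p > 0" and e: "e > 0"
 obtains d where "d > 0"
  "\<And>\<xi> h. norm \<xi> < d ==> \<bar>h\<bar> < d ==>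
   (nnL t. (nnT x. norm (W (x + \<xi>, t + h) - W (x, t)) ^ p)) \<le> ennreal e"
proof -
 have [measurable]: "ball (0::space) 4 \<in> sets borel" by simp
 have Wp[measurable]: "(\<lambda>p. W (fst p, snd p)) \<in> Borel2"
  using W by (simp add: borel_prod)
 obtain C0 where C0: "C0 \<ge> 0" "\<And>g. periodic g ==> g \<in> Borel ==>
   (nnL x. indicator (ball 0 4 :: space set) x * g x) \<le> ennreal C0 * (nnT x. g x)"
  using nn_integral_periodic_bounded_set[of "ball 0 4 :: space set"] by auto
 define f where "f z = indicator (ball 0 4) (fst z) *\<^sub>R W z" for z
 have f[measurable]: "f \<in> Borel"
 proof -
  have [measurable]: "W \<in> borel_measurable borelXT"
   using W by (simp add: borel_prod)
  have "f \<in> borel_measurable borelXT"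
   unfolding f_def by measurable
  then show ?thesis by (simp add: borel_prod)
 qed
 have nn_prod: "(nnL z. g z) = (nnL t. (nnL x. g (x, t)))"
  if g: "g \<in> Borel" for g :: "spacetime \<Rightarrow> ennreal"
 proof -
  have "g \<in> borel_measurable (lborel \<Otimes>\<^sub>M lborel)"
   using g by (simp add: lborel_prod)
  then have "(nnL t. (nnL x. g (x, t))) = (\<integral>\<^sup>+z. g z \<partial>(lborel \<Otimes>\<^sub>M lborel))"
   by (rule lborel_pair.nn_integral_snd)
  then show ?thesis by (simp add: lborel_prod)
 qed
 have "(nnL z. norm (f z) ^ p) = (nnL t. (nnL x. indicator (ball 0 4) x * ennreal (norm (W (x, t)) ^ p)))"
 proof -
  have "(\<lambda>z. ennreal (norm (f z) ^ p)) \<in> Borel" by measurable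
  from nn_prod[OF this] show ?thesis
   using p by (simp only:) (auto intro!: nn_integral_cong simp: f_def indicator_def power_0_left)
 qed
 also have "... \<le> (nnL t. ennreal C0 * (nnT x. norm (W (x, t)) ^ p))"
  by (intro nn_integral_mono C0(2) periodic_compose[OF per]) auto
 also have "... = ennreal C0 * (nnL t. (nnT x. norm (W (x, t)) ^ p))"
  by (rule nn_integral_cmult) measurable
 also have "... < \<infinity>" using fin by (simp add: ennreal_mult_less_top)
 finally have "translation_continuous p f" by (intro translation_continuous_Lp p) auto
 then obtain d where d: "d > 0" "\<And>h. norm h < d ==> (nnL z. norm (f (z + h) - f z) ^ p) \<le> ennreal e"
  using e unfolding translation_continuous_def by blast
 have cube: "norm x < 3" if "x \<in> unit_cube" for x
 proof -
  have "norm x \<le> (\<Sum>i\<in>UNIV. \<bar>x $ i\<bar>)" by (rule norm_le_l1_cart)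
  also have "... < (\<Sum>i\<in>(UNIV::3 set). 1)"
   using that by (intro sum_strict_mono) (auto simp: unit_cube_def)
  finally show ?thesis by simp
 qed
 show thesis
 proof (rule that[of "min (d / 2) 1"])
  fix \<xi> :: space and h :: real assume \<xi>: "norm \<xi> < min (d / 2) 1" and h: "\<bar>h\<bar> < min (d / 2) 1"
  have [measurable]: "(\<lambda>x. W (x + \<xi>, t + h)) \<in> Borel" "(\<lambda>x. W (x, t)) \<in> Borel" for t
  proof -
   have "(\<lambda>x. (x + \<xi>, t + h)) \<in> Borel" "(\<lambda>x. (x, t)) \<in> Borel"
    by (auto intro!: borel_measurable_continuous_onI continuous_intros)
   then show "(\<lambda>x. W (x + \<xi>, t + h)) \<in> Borel" "(\<lambda>x. W (x, t)) \<in> Borel"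
    using measurable_compose[OF _ W] by auto
  qed
  have "(nnL t. (nnT x. norm (W (x + \<xi>, t + h) - W (x, t)) ^ p))
    = (nnL t. (nnL x. indicator unit_cube x * ennreal (norm (W (x + \<xi>, t + h) - W (x, t)) ^ p)))"
   by (intro nn_integral_cong nn_integral_torus) measurable
  also have "... \<le> (nnL t. (nnL x. norm (f ((x, t) + (\<xi>, h)) - f (x, t)) ^ p))"
  proof (intro nn_integral_mono)
   fix t :: real and x :: space
   show "indicator unit_cube x * ennreal (norm (W (x + \<xi>, t + h) - W (x, t)) ^ p) \<le> ennreal (norm (f ((x, t) + (\<xi>, h)) - f (x, t)) ^ p)"
   proof (cases "x \<in> unit_cube")
    case True
    then have "norm x < 3" by (rule cube)
    moreover have "norm (x + \<xi>) < 4" using norm_triangle_ineq[of x \<xi>] \<xi> \<open>norm x < 3\<close> by simp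
    ultimately show ?thesis using True by (simp add: f_def)
   qed simp
  qed
  also have "... = (nnL z. norm (f (z + (\<xi>, h)) - f z) ^ p)"
   by (rule nn_prod[symmetric]) measurable
  also have "... \<le> ennreal e"
  proof (rule d(2))
   show "norm (\<xi>, h) < d" using norm_Pair_le[of \<xi> h] \<xi> h by simp
  qed
  finally show "(nnL t. (nnT x. norm (W (x + \<xi>, t + h) - W (x, t)) ^ p)) \<le> ennreal e" .
 qed (use d in auto)
qed

lemma conv_sup_bound:
 assumes k: "bump_kernel k"
 obtains C where "C \<ge> 0" "\<And>(f :: space \<Rightarrow> space) x. torus_L1 f ==> norm (conv k f x) \<le> C * (LINT x|torus. norm (f x))"
proof -
 obtain R M where RM: "R > 0" "M > 0" "\<And>x. \<bar>k x\<bar> \<le> M * indicator (cball 0 R) x"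
  using kernel_bound[OF k] by blast
 have [measurable]: "cball (0::space) R \<in> sets borel" by simp
 obtain C0 where C0: "C0 \<ge> 0" "\<And>g. periodic g ==> g \<in> Borel ==>
   (nnL x. indicator (cball 0 R :: space set) x * g x) \<le> ennreal C0 * (nnT x. g x)"
  using nn_integral_periodic_bounded_set[of "cball 0 R :: space set"] by auto
 show thesis
 proof (rule that[of "M * C0"])
  fix f :: "space \<Rightarrow> space" and x assume f: "torus_L1 f"
  note [measurable] = torus_L1D(2)[OF f] kernel_measurable[OF k]
  have n1: "torus_L1 (\<lambda>x. norm (f x))" using f by (auto simp: torus_L1_def intro: periodic_compose)
  have J0: "0 \<le> (LINT x|torus. norm (f x))" by (intro L_integral_nonneg) simp
  have "ennreal (norm (conv k f x)) \<le> (nnL z. norm (k z *\<^sub>R f (x - z)))"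
  proof -
   have "integrable lborel (\<lambda>z. k z *\<^sub>R f (x - z))"
    using lborel_reflect(2)[of "\<lambda>y. k (x - y) *\<^sub>R f y" x] conv_integrable[OF k f, of x] by simp
   from integral_norm_bound_ennreal[OF this] show ?thesis
    by (simp only: conv_reflect[OF kernel_measurable[OF k] torus_L1D(2)[OF f]])
  qed
  also have "... \<le> (nnL z. ennreal M * (indicator (cball 0 R) z * ennreal (norm (f (x - z)))))"
  proof (rule nn_integral_mono)
   fix z
   have "norm (k z *\<^sub>R f (x - z)) \<le> M * indicator (cball 0 R) z * norm (f (x - z))"
    using mult_right_mono[OF RM(3)[of z], of "norm (f (x - z))"] by simp
   from ennreal_leI[OF this]
   show "ennreal (norm (k z *\<^sub>R f (x - z))) \<le> ennreal M * (indicator (cball 0 R) z * ennreal (norm (f (x - z))))"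
    using RM(2) by (auto simp: indicator_def ennreal_mult split: if_splits)
  qed
  also have "... = ennreal M * (nnL z. indicator (cball 0 R) z * ennreal (norm (f (x - z))))"
   by (rule nn_integral_cmult) measurable
  also have "... \<le> ennreal M * (ennreal C0 * (nnT z. ennreal (norm (f (x - z)))))"
  proof (intro mult_left_mono C0(2))
   show "periodic (\<lambda>z. ennreal (norm (f (x - z))))"
    by (rule periodic_compose[OF periodic_reflect[OF torus_L1D(1)[OF f]]])
  qed auto
  also have "(nnT z. ennreal (norm (f (x - z)))) = (nnT z. ennreal (norm (f z)))"
   by (rule nn_integral_torus_reflect[OF periodic_compose[OF torus_L1D(1)[OF f]]]) measurable
  also have "... = ennreal (LINT x|torus. norm (f x))"
   by (rule nn_integral_eq_integral) (use torus_L1D(3)[OF n1] in auto)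
  also have "ennreal M * (ennreal C0 * ennreal (LINT x|torus. norm (f x))) = ennreal (M * C0 * (LINT x|torus. norm (f x)))"
   using RM(2) C0(1) J0 by (simp add: ennreal_mult mult.assoc)
  finally show "norm (conv k f x) \<le> M * C0 * (LINT x|torus. norm (f x))"
   using RM(2) C0(1) J0 by (simp add: ennreal_le_iff)
 qed (use RM C0 in simp)
qed

text \<open>The solution is extended by zero to all times, and the properties that hold at almost every time are assumed at every time; the momentum equation is kept only for solenoidal tests, for which the pressure drops out.\<close>

locale energy_setting =
 fixes U V :: "spacetime \<Rightarrow> space" and K :: "space \<Rightarrow> real" and T C :: real
 assumes T_pos: "T > 0"
  and U_meas[measurable]: "U \<in> Borel" and V_meas[measurable]: "V \<in> Borel"
  and U3: "\<And>t. torus_Lp 3 (\<lambda>x. U (x, t))" and V3: "\<And>t. torus_Lp 3 (\<lambda>x. V (x, t))"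
  and U_bound: "\<And>t. (LINT x|torus. (norm (U (x, t)))\<^sup>2) \<le> C"
  and V_bound: "\<And>t. (LINT x|torus. (norm (V (x, t)))\<^sup>2) \<le> C"
  and V_zero: "\<And>t x. t \<notin> {0<..<T} ==> V (x, t) = 0"
  and K: "bump_kernel K" and K_even: "\<And>z. K (- z) = K z"
  and div_V: "\<And>t y. (\<Sum>i\<in>UNIV. conv (dx i K) (\<lambda>x. V (x, t) $ i) y) = 0"
  and momentum: "\<And>\<theta> \<psi>. time_test T \<theta> ==> smooth \<psi> ==> periodic \<psi> ==>
   (\<And>x. (\<Sum>i\<in>UNIV. dx i \<psi> x $ i) = 0) ==>
   (LBINT t. partial 1 \<theta> t * (LINT x|torus. V (x, t) \<bullet> \<psi> x))
   + (LBINT t. \<theta> t * (LINT x|torus. (\<Sum>i\<in>UNIV. U (x, t) $ i * (V (x, t) \<bullet> dx i \<psi> x)))) = 0"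
begin

definition pairing :: "real \<Rightarrow> real \<Rightarrow> real" where
 "pairing t s = (LINT x|torus. V (x, t) \<bullet> conv K (\<lambda>y. V (y, s)) x)"

definition flux :: "real \<Rightarrow> real \<Rightarrow> real" where
 "flux t s = (LINT x|torus. (\<Sum>i\<in>UNIV. U (x, t) $ i * (V (x, t) \<bullet> conv (dx i K) (\<lambda>y. V (y, s)) x)))"

lemma U2: "torus_Lp 2 (\<lambda>x. U (x, t))" and V2: "torus_Lp 2 (\<lambda>x. V (x, t))" and V1: "torus_L1 (\<lambda>x. V (x, t))"
 using torus_Lp_mono[OF U3] torus_Lp_mono[OF V3] torus_Lp_imp_L1[OF V3] by auto

lemma C_nonneg: "0 \<le> C"
proof -
 have "0 \<le> (LINT x|torus. (norm (V (x, 0)))\<^sup>2)" by (intro L_integral_nonneg) simp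
 then show ?thesis using V_bound[of 0] by linarith
qed

lemma dxK: "bump_kernel (dx i K)"
 by (rule kernel_dx[OF K])

lemma VU_pair_measurable[measurable]:
 "(\<lambda>p. V (fst p, snd p)) \<in> Borel2"
 "(\<lambda>p. U (fst p, snd p)) \<in> Borel2"
 using U_meas V_meas by (simp_all add: borel_prod)

lemma conv_V_measurable:
 assumes k: "bump_kernel k"
 shows "(\<lambda>p. conv k (\<lambda>y. V (y, snd p)) (fst p)) \<in> Borel2"
proof -
 note [measurable] = kernel_measurable[OF k]
 have "(\<lambda>q :: (space \<times> real) \<times> space. (snd q, snd (fst q))) \<in> measurable ((borel \<Otimes>\<^sub>M borel) \<Otimes>\<^sub>M borel) (borel \<Otimes>\<^sub>M borel)"
  by measurable
 from measurable_compose[OF this VU_pair_measurable(1)]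
 have [measurable]: "(\<lambda>q :: (space \<times> real) \<times> space. V (snd q, snd (fst q))) \<in> borel_measurable ((borel \<Otimes>\<^sub>M borel) \<Otimes>\<^sub>M borel)"
  by simp
 have "(\<lambda>p :: space \<times> real. LBINT y. (k (fst p - y) *\<^sub>R V (y, snd p))) \<in> Borel2"
  by (rule lborel.borel_measurable_lebesgue_integral) (simp add: case_prod_beta')
 then show ?thesis by (simp add: conv_def)
qed

lemma slice_measurable[measurable]:
 "(\<lambda>x. V (x, t)) \<in> Borel" "(\<lambda>x. U (x, t)) \<in> Borel"
 using torus_LpD(2)[OF V2] torus_LpD(2)[OF U2] .

lemma triple_measurable:
 assumes k: "bump_kernel k"
 shows "(\<lambda>q. V (snd q, fst (fst q))) \<in> borel_measurable borelTTX"
  "(\<lambda>q. U (snd q, fst (fst q))) \<in> borel_measurable borelTTX"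
  "(\<lambda>q. conv k (\<lambda>y. V (y, snd (fst q))) (snd q)) \<in> borel_measurable borelTTX"
proof -
 have 1: "(\<lambda>q. (snd q, fst (fst q))) \<in> measurable borelTTX (borel \<Otimes>\<^sub>M borel)"
  and 2: "(\<lambda>q. (snd q, snd (fst q))) \<in> measurable borelTTX (borel \<Otimes>\<^sub>M borel)"
  by measurable
 show "(\<lambda>q. V (snd q, fst (fst q))) \<in> borel_measurable borelTTX"
  "(\<lambda>q. U (snd q, fst (fst q))) \<in> borel_measurable borelTTX"
  using measurable_compose[OF 1 VU_pair_measurable(1)] measurable_compose[OF 1 VU_pair_measurable(2)] by simp_all
 show "(\<lambda>q. conv k (\<lambda>y. V (y, snd (fst q))) (snd q)) \<in> borel_measurable borelTTX"
  using measurable_compose[OF 2 conv_V_measurable[OF k]] by simp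
qed

lemma pairing_measurable[measurable]: "(\<lambda>p. pairing (fst p) (snd p)) \<in> Borel2"
proof -
 note [measurable] = triple_measurable[OF K]
 have "(\<lambda>p. (LINT x|torus. V (x, fst p) \<bullet> conv K (\<lambda>y. V (y, snd p)) x)) \<in> borel_measurable borelTT"
  by (rule torus.borel_measurable_lebesgue_integral) (simp add: case_prod_beta')
 then show ?thesis by (simp add: pairing_def)
qed

lemma flux_measurable[measurable]: "(\<lambda>p. flux (fst p) (snd p)) \<in> Borel2"
proof -
 note [measurable] = triple_measurable[OF dxK]
 have "(\<lambda>p. (LINT x|torus. (\<Sum>i\<in>UNIV. U (x, fst p) $ i * (V (x, fst p) \<bullet> conv (dx i K) (\<lambda>y. V (y, snd p)) x)))) \<in> borel_measurable borelTT"
  by (rule torus.borel_measurable_lebesgue_integral) (simp add: case_prod_beta')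
 then show ?thesis by (simp add: flux_def)
qed

lemma zero_conv: "conv k (\<lambda>y. 0 :: space) x = 0"
 by (simp add: conv_def)

lemma pairing_flux_zero:
 assumes "t \<notin> {0<..<T} \<or> s \<notin> {0<..<T}"
 shows "pairing t s = 0" "flux t s = 0"
proof -
 have "V (x, t) \<bullet> conv k (\<lambda>y. V (y, s)) x = 0" for x k
  using V_zero[of t] V_zero[of s] assms by (auto simp: zero_conv)
 then show "pairing t s = 0" "flux t s = 0"
  by (simp_all add: pairing_def flux_def)
qed

lemma pairing_sym: "pairing t s = pairing s t"
proof -
 have "(\<lambda>z. K (- z)) = K" using K_even by blast
 then show ?thesis
  using conv_adjoint[OF K V2 V2, of t s] by (simp add: pairing_def inner_commute)
qed

definition time_increment :: "real \<Rightarrow> real \<Rightarrow> real" where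
 "time_increment s s' = (LINT x|torus. norm (V (x, s) - V (x, s')))"

lemma time_increment_nonneg: "0 \<le> time_increment s s'"
 unfolding time_increment_def by (intro L_integral_nonneg) simp

lemma L1_le: assumes "torus_Lp 2 f" "(LINT x|torus. (norm (f x))\<^sup>2) \<le> C" shows "(LINT x|torus. norm (f x)) \<le> 1 + C"
proof -
 have "(LINT x|torus. norm (f x)) \<le> (LINT x|torus. 1 + (norm (f x))\<^sup>2)"
 proof (rule integral_mono)
  show "integrable torus (\<lambda>x. norm (f x))" using torus_L1D(3)[OF torus_Lp_imp_L1[OF assms(1)]] by simp
  show "integrable torus (\<lambda>x. 1 + (norm (f x))\<^sup>2)" using torus_LpD(3)[OF assms(1)] by simp
  show "norm (f x) \<le> 1 + (norm (f x))\<^sup>2" for x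
   using zero_le_power2[of "norm (f x) - 1"] by (simp add: power2_diff) (smt (verit) zero_le_power2)
 qed
 also have "... = 1 + (LINT x|torus. (norm (f x))\<^sup>2)" using torus_LpD(3)[OF assms(1)] by simp
 finally show ?thesis using assms(2) by linarith
qed

text \<open>Both bilinear quantities are bounded, and they vary with the second time as little as
 the field does in \<open>L\<^sup>1\<close>: smoothing in space makes them insensitive to everything else.\<close>

lemma pairing_flux_bounds:
 obtains B where "B \<ge> 0" "\<And>t s. \<bar>pairing t s\<bar> \<le> B" "\<And>t s. \<bar>flux t s\<bar> \<le> B"
  "\<And>t s s'. \<bar>pairing t s - pairing t s'\<bar> \<le> B * time_increment s s'"
  "\<And>t s s'. \<bar>flux t s - flux t s'\<bar> \<le> B * time_increment s s'"
proof -
 obtain c0 where c0: "c0 \<ge> 0" "\<And>(f :: space \<Rightarrow> space) x. torus_L1 f ==> norm (conv K f x) \<le> c0 * (LINT x|torus. norm (f x))"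
  using conv_sup_bound[OF K] by blast
 have "\<forall>i. \<exists>c. c \<ge> 0 \<and> (\<forall>(f :: space \<Rightarrow> space) x. torus_L1 f \<longrightarrow> norm (conv (dx i K) f x) \<le> c * (LINT x|torus. norm (f x)))"
 proof
  fix i
  show "\<exists>c. c \<ge> 0 \<and> (\<forall>(f :: space \<Rightarrow> space) x. torus_L1 f \<longrightarrow> norm (conv (dx i K) f x) \<le> c * (LINT x|torus. norm (f x)))"
   by (rule conv_sup_bound[OF dxK[of i]]) blast
 qed
 then obtain ci where ci: "\<And>i. ci i \<ge> 0" "\<And>i (f :: space \<Rightarrow> space) x. torus_L1 f ==> norm (conv (dx i K) f x) \<le> ci i * (LINT x|torus. norm (f x))"
  by metis
 define c where "c = c0 + (\<Sum>i\<in>UNIV. ci i)"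
 have cK: "c \<ge> 0" "c0 \<le> c" "ci i \<le> c" for i
  using c0(1) ci(1) member_le_sum[of i UNIV ci] by (auto simp: c_def sum_nonneg add_nonneg_nonneg intro: add_increasing)
 have sup: "norm (conv K f x) \<le> c * (LINT x|torus. norm (f x))" "norm (conv (dx i K) f x) \<le> c * (LINT x|torus. norm (f x))"
  if f: "torus_L1 f" for f :: "space \<Rightarrow> space" and x i
 proof -
  have "0 \<le> (LINT x|torus. norm (f x))" by (intro L_integral_nonneg) simp
  then show "norm (conv K f x) \<le> c * (LINT x|torus. norm (f x))" "norm (conv (dx i K) f x) \<le> c * (LINT x|torus. norm (f x))"
   using c0(2)[OF f, of x] ci(2)[OF f, of i x] mult_right_mono[OF cK(2)] mult_right_mono[OF cK(3)[of i]] order_trans by blast+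
 qed
 have conv_meas: "conv k f \<in> Borel" if "bump_kernel k" "torus_L1 f" for k and f :: "space \<Rightarrow> space"
  by (rule borel_measurable_continuous_onI[OF smooth_continuous[OF smooth_conv[OF that]]])
 have gen: "\<bar>LINT x|torus. V (x, t) \<bullet> conv K f x\<bar> \<le> (1 + C) * (c * (LINT x|torus. norm (f x)))"
  "\<bar>LINT x|torus. (\<Sum>i\<in>UNIV. U (x, t) $ i * (V (x, t) \<bullet> conv (dx i K) f x))\<bar> \<le> 3 * (2 * C) * (c * (LINT x|torus. norm (f x)))"
  "integrable torus (\<lambda>x. V (x, t) \<bullet> conv K f x)"
  "integrable torus (\<lambda>x. \<Sum>i\<in>UNIV. U (x, t) $ i * (V (x, t) \<bullet> conv (dx i K) f x))"
  if f: "torus_L1 f" for f t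
 proof -
  let ?J = "LINT x|torus. norm (f x)"
  have J: "0 \<le> c * ?J" using cK(1) by (intro mult_nonneg_nonneg L_integral_nonneg) auto
  note [measurable] = conv_meas[OF K f] conv_meas[OF dxK f]
  have iV: "integrable torus (\<lambda>x. norm (V (x, t)))" using torus_L1D(3)[OF V1] by simp
  have p: "\<bar>V (x, t) \<bullet> conv K f x\<bar> \<le> norm (V (x, t)) * (c * ?J)" for x
   using Cauchy_Schwarz_ineq2[of "V (x, t)" "conv K f x"] mult_left_mono[OF sup(1)[OF f, of x], of "norm (V (x, t))"] by simp
  have ib: "integrable torus (\<lambda>x. norm (V (x, t)) * (c * ?J))" using iV by simp
  show i: "integrable torus (\<lambda>x. V (x, t) \<bullet> conv K f x)"
  proof (rule L_integrable_bound[OF ib])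
   show "AE x in torus. norm (V (x, t) \<bullet> conv K f x) \<le> norm (norm (V (x, t)) * (c * ?J))"
    using p by (intro AE_I2) (simp only: real_norm_def order_trans[OF _ abs_ge_self])
  qed measurable
  have "\<bar>LINT x|torus. V (x, t) \<bullet> conv K f x\<bar> \<le> (LINT x|torus. \<bar>V (x, t) \<bullet> conv K f x\<bar>)" by (rule integral_abs_bound)
  also have "... \<le> (LINT x|torus. norm (V (x, t)) * (c * ?J))"
   by (rule integral_mono) (use i ib p in auto)
  also have "... = (LINT x|torus. norm (V (x, t))) * (c * ?J)" by simp
  also have "... \<le> (1 + C) * (c * ?J)" by (intro mult_right_mono J L1_le V2 V_bound)
  finally show "\<bar>LINT x|torus. V (x, t) \<bullet> conv K f x\<bar> \<le> (1 + C) * (c * ?J)" .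
  have q: "\<bar>\<Sum>i\<in>UNIV. U (x, t) $ i * (V (x, t) \<bullet> conv (dx i K) f x)\<bar> \<le> 3 * (norm (U (x, t)) * norm (V (x, t))) * (c * ?J)" for x
  proof -
   have "\<bar>\<Sum>i\<in>UNIV. U (x, t) $ i * (V (x, t) \<bullet> conv (dx i K) f x)\<bar> \<le> (\<Sum>i\<in>UNIV. \<bar>U (x, t) $ i * (V (x, t) \<bullet> conv (dx i K) f x)\<bar>)"
    by (rule sum_abs)
   also have "... \<le> (\<Sum>i\<in>(UNIV::3 set). norm (U (x, t)) * (norm (V (x, t)) * (c * ?J)))"
   proof (rule sum_mono)
    fix i :: 3
    have "\<bar>V (x, t) \<bullet> conv (dx i K) f x\<bar> \<le> norm (V (x, t)) * (c * ?J)"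
     using Cauchy_Schwarz_ineq2[of "V (x, t)" "conv (dx i K) f x"] mult_left_mono[OF sup(2)[OF f, of i x], of "norm (V (x, t))"] by simp
    then show "\<bar>U (x, t) $ i * (V (x, t) \<bullet> conv (dx i K) f x)\<bar> \<le> norm (U (x, t)) * (norm (V (x, t)) * (c * ?J))"
     unfolding abs_mult by (intro mult_mono component_le_norm_cart) auto
   qed
   also have "... = 3 * (norm (U (x, t)) * norm (V (x, t))) * (c * ?J)" by simp
   finally show ?thesis .
  qed
  have iUV: "integrable torus (\<lambda>x. norm (U (x, t)) * norm (V (x, t)))" by (rule torus_L2_inner_integrable(2)[OF U2 V2])
  then have ib2: "integrable torus (\<lambda>x. 3 * (norm (U (x, t)) * norm (V (x, t))) * (c * ?J))" by simp
  show i2: "integrable torus (\<lambda>x. \<Sum>i\<in>UNIV. U (x, t) $ i * (V (x, t) \<bullet> conv (dx i K) f x))"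
  proof (rule L_integrable_bound[OF ib2])
   show "AE x in torus. norm (\<Sum>i\<in>UNIV. U (x, t) $ i * (V (x, t) \<bullet> conv (dx i K) f x)) \<le> norm (3 * (norm (U (x, t)) * norm (V (x, t))) * (c * ?J))"
    using q by (intro AE_I2) (simp only: real_norm_def order_trans[OF _ abs_ge_self])
  qed measurable
  have UVC: "(LINT x|torus. norm (U (x, t)) * norm (V (x, t))) \<le> 2 * C"
  proof -
   have "(LINT x|torus. norm (U (x, t)) * norm (V (x, t))) \<le> (LINT x|torus. (norm (U (x, t)))\<^sup>2) + (LINT x|torus. (norm (V (x, t)))\<^sup>2)"
   proof (rule integral_real_bounded)
    show "0 \<le> (LINT x|torus. (norm (U (x, t)))\<^sup>2) + (LINT x|torus. (norm (V (x, t)))\<^sup>2)"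
     by (intro add_nonneg_nonneg L_integral_nonneg) auto
   qed (rule torus_L2_inner_integrable(3)[OF U2 V2])
   then show ?thesis using U_bound[of t] V_bound[of t] by linarith
  qed
  have "\<bar>LINT x|torus. (\<Sum>i\<in>UNIV. U (x, t) $ i * (V (x, t) \<bullet> conv (dx i K) f x))\<bar>
    \<le> (LINT x|torus. \<bar>\<Sum>i\<in>UNIV. U (x, t) $ i * (V (x, t) \<bullet> conv (dx i K) f x)\<bar>)" by (rule integral_abs_bound)
  also have "... \<le> (LINT x|torus. 3 * (norm (U (x, t)) * norm (V (x, t))) * (c * ?J))"
   by (rule integral_mono) (use i2 ib2 q in auto)
  also have "... = 3 * (LINT x|torus. norm (U (x, t)) * norm (V (x, t))) * (c * ?J)" by simp
  also have "... \<le> 3 * (2 * C) * (c * ?J)" by (intro mult_right_mono mult_left_mono UVC J) auto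
  finally show "\<bar>LINT x|torus. (\<Sum>i\<in>UNIV. U (x, t) $ i * (V (x, t) \<bullet> conv (dx i K) f x))\<bar> \<le> 3 * (2 * C) * (c * ?J)" .
 qed
 define A where "A = (1 + 6 * C) * c"
 have A: "A \<ge> 0" using C_nonneg cK by (simp add: A_def)
 have A1: "(1 + C) * (c * r) \<le> A * r" "3 * (2 * C) * (c * r) \<le> A * r" if "0 \<le> r" for r
 proof -
  have "0 \<le> C * (c * r)" "0 \<le> c * r" using C_nonneg cK(1) that by auto
  then show "(1 + C) * (c * r) \<le> A * r" "3 * (2 * C) * (c * r) \<le> A * r" by (auto simp: A_def algebra_simps)
 qed
 have J0: "0 \<le> (LINT x|torus. norm (f x))" for f :: "space \<Rightarrow> space" by (intro L_integral_nonneg) simp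
 have AJ: "A * (LINT x|torus. norm (V (x, s))) \<le> A * (1 + C)" for s
  by (intro mult_left_mono A L1_le V2 V_bound)
 have AC: "A \<le> A * (1 + C)" using A C_nonneg by (simp add: algebra_simps)
 have diff: "torus_L1 (\<lambda>x. V (x, s) - V (x, s'))" for s s'
 proof -
  have "torus_Lp 2 (\<lambda>x. - V (x, s'))" by (rule torus_Lp_linear[OF V2 bounded_linear_minus[OF bounded_linear_ident]])
  from torus_Lp_add[OF V2 this, of s] have "torus_Lp 2 (\<lambda>x. V (x, s) - V (x, s'))" by simp
  then show ?thesis using torus_Lp_imp_L1 by fastforce
 qed
 show thesis
 proof (rule that[of "A * (1 + C)"])
  show "A * (1 + C) \<ge> 0" using A C_nonneg by simp
  show "\<bar>pairing t s\<bar> \<le> A * (1 + C)" for t s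
   unfolding pairing_def by (rule order_trans[OF gen(1)[OF V1] order_trans[OF A1(1)[OF J0] AJ]])
  show "\<bar>flux t s\<bar> \<le> A * (1 + C)" for t s
   unfolding flux_def by (rule order_trans[OF gen(2)[OF V1] order_trans[OF A1(2)[OF J0] AJ]])
  fix t s s'
  have cd: "conv k (\<lambda>y. V (y, s)) x - conv k (\<lambda>y. V (y, s')) x = conv k (\<lambda>y. V (y, s) - V (y, s')) x" if "bump_kernel k" for k x
   by (rule conv_diff[OF that V1 V1, symmetric])
  have J: "A * time_increment s s' \<le> A * (1 + C) * time_increment s s'"
   by (intro mult_right_mono AC time_increment_nonneg)
  have "pairing t s - pairing t s' = (LINT x|torus. V (x, t) \<bullet> conv K (\<lambda>y. V (y, s)) x - V (x, t) \<bullet> conv K (\<lambda>y. V (y, s')) x)"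
   unfolding pairing_def by (rule L_integral_diff[symmetric]) (rule gen(3)[OF V1])+
  also have "... = (LINT x|torus. V (x, t) \<bullet> conv K (\<lambda>y. V (y, s) - V (y, s')) x)"
   by (simp only: inner_diff_right[symmetric] cd[OF K])
  finally have "\<bar>pairing t s - pairing t s'\<bar> \<le> A * time_increment s s'"
   using order_trans[OF gen(1)[OF diff, of t s s'] A1(1)[OF J0]] unfolding time_increment_def by (simp only:)
  then show "\<bar>pairing t s - pairing t s'\<bar> \<le> A * (1 + C) * time_increment s s'" using J by linarith
  have "flux t s - flux t s' = (LINT x|torus. (\<Sum>i\<in>UNIV. U (x, t) $ i * (V (x, t) \<bullet> conv (dx i K) (\<lambda>y. V (y, s)) x))
    - (\<Sum>i\<in>UNIV. U (x, t) $ i * (V (x, t) \<bullet> conv (dx i K) (\<lambda>y. V (y, s')) x)))"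
   unfolding flux_def by (rule L_integral_diff[symmetric]) (rule gen(4)[OF V1])+
  also have "... = (LINT x|torus. (\<Sum>i\<in>UNIV. U (x, t) $ i * (V (x, t) \<bullet> conv (dx i K) (\<lambda>y. V (y, s) - V (y, s')) x)))"
   by (simp only: sum_subtractf[symmetric] right_diff_distrib[symmetric] inner_diff_right[symmetric] cd[OF dxK])
  finally have "\<bar>flux t s - flux t s'\<bar> \<le> A * time_increment s s'"
   using order_trans[OF gen(2)[OF diff, of t s s'] A1(2)[OF J0]] unfolding time_increment_def by (simp only:)
  then show "\<bar>flux t s - flux t s'\<bar> \<le> A * (1 + C) * time_increment s s'" using J by linarith
 qed
qed

end

lemma integrable_bounded_support:
 fixes f :: "real \<times> real \<Rightarrow> real"
 assumes [measurable]: "f \<in> Borel2" and M: "\<And>p. \<bar>f p\<bar> \<le> M"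
  and zero: "\<And>p. fst p \<notin> {- T..T} \<or> snd p \<notin> {- T..T} ==> f p = 0"
 shows "integrable (lborel \<Otimes>\<^sub>M lborel) f" and "integrable lborel (\<lambda>t. f (t, s))"
proof -
 let ?S = "{- T..T} \<times> {- T..T}"
 have "emeasure lborel ?S < \<infinity>" by (intro emeasure_bounded_finite bounded_Times) auto
 then have fin: "emeasure (lborel \<Otimes>\<^sub>M lborel) ?S < \<infinity>" by (simp add: lborel_prod)
 have M0: "M \<ge> 0" using M[of undefined] by linarith
 have "integrable (lborel \<Otimes>\<^sub>M lborel) (\<lambda>p. indicator ?S p * M)"
  by (intro integrable_mult_left integrable_real_indicator) (use fin in auto)
 then show "integrable (lborel \<Otimes>\<^sub>M lborel) f"
 proof (rule L_integrable_bound)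
  show "AE p in lborel \<Otimes>\<^sub>M lborel. norm (f p) \<le> norm (indicator ?S p * M)"
  proof (rule AE_I2)
   fix p show "norm (f p) \<le> norm (indicator ?S p * M)"
    using M[of p] zero[of p] M0 by (cases "p \<in> ?S") (auto simp: mem_Times_iff)
  qed
 qed measurable
 have "integrable lborel (\<lambda>t. indicator {- T..T} t * M)"
  by (intro integrable_mult_left integrable_real_indicator) (auto simp: emeasure_lborel_Icc_eq)
 then show "integrable lborel (\<lambda>t. f (t, s))"
 proof (rule L_integrable_bound)
  show "AE t in lborel. norm (f (t, s)) \<le> norm (indicator {- T..T} t * M)"
  proof (rule AE_I2)
   fix t show "norm (f (t, s)) \<le> norm (indicator {- T..T} t * M)"
    using M[of "(t, s)"] zero[of "(t, s)"] M0 by (cases "t \<in> {- T..T}") auto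
  qed
 qed measurable
qed

lemma smooth_bounded_derivative_lipschitz:
 fixes f :: "real \<Rightarrow> real"
 assumes "smooth f" "\<And>t. \<bar>partial 1 f t\<bar> \<le> M"
 shows "\<bar>f a - f b\<bar> \<le> M * \<bar>a - b\<bar>"
proof -
 have "norm (f a - f b) \<le> M * norm (a - b)"
 proof (rule field_differentiable_bound[where S = UNIV and f' = "partial 1 f"])
  show "(f has_field_derivative partial 1 f z) (at z within UNIV)" for z
   using smooth_real_has_derivative[OF assms(1)] by simp
 qed (use assms(2) in auto)
 then show ?thesis by simp
qed

definition even_cutoff :: "real \<Rightarrow> real \<Rightarrow> real" where
 "even_cutoff \<tau> r = flat 0 (\<tau> * \<tau> - r * r)"

lemma even_cutoff_smooth: "smooth (even_cutoff \<tau>)"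
proof -
 have "smooth (\<lambda>r::real. \<tau> * \<tau> + (- 1) * (r * r))"
  by (intro smooth_add smooth_mult smooth_const smooth_linear bounded_linear_ident)
 from smooth_compose_real[OF smooth_flat this, of 0] show ?thesis
  by (simp add: even_cutoff_def[abs_def])
qed

lemma even_cutoff_derivative: "partial 1 (even_cutoff \<tau>) r = flat 2 (\<tau> * \<tau> - r * r) * (- 2 * r)"
proof -
 have d: "((\<lambda>r. \<tau> * \<tau> - r * r) has_real_derivative (- 2 * r)) (at r)"
  by (auto intro!: derivative_eq_intros)
 have "(flat 0 has_real_derivative flat 2 (\<tau> * \<tau> - r * r)) (at (\<tau> * \<tau> - r * r))"
  using flat_has_derivative[of 0 "\<tau> * \<tau> - r * r"] by (simp add: numeral_2_eq_2)
 from DERIV_chain2[OF this d] show ?thesis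
  unfolding even_cutoff_def[abs_def] by (intro partial_real)
qed

lemma even_cutoff_props:
 "even_cutoff \<tau> (- r) = even_cutoff \<tau> r" "0 \<le> even_cutoff \<tau> r" "even_cutoff \<tau> r \<le> 1"
 "\<tau> > 0 ==> \<bar>r\<bar> > \<tau> ==> even_cutoff \<tau> r = 0" "\<tau> > 0 ==> even_cutoff \<tau> 0 > 0"
 "partial 1 (even_cutoff \<tau>) (- r) = - partial 1 (even_cutoff \<tau>) r"
 "\<tau> > 0 ==> \<bar>r\<bar> > \<tau> ==> partial 1 (even_cutoff \<tau>) r = 0"
proof -
 have "\<tau> * \<tau> - r * r \<le> 0" if "\<tau> > 0" "\<bar>r\<bar> > \<tau>"
 proof -
  have "\<tau> * \<tau> \<le> \<bar>r\<bar> * \<bar>r\<bar>" using that by (intro mult_mono) auto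
  then show ?thesis by simp
 qed
 then show "\<tau> > 0 ==> \<bar>r\<bar> > \<tau> ==> even_cutoff \<tau> r = 0" "\<tau> > 0 ==> \<bar>r\<bar> > \<tau> ==> partial 1 (even_cutoff \<tau>) r = 0"
  by (auto simp: even_cutoff_def even_cutoff_derivative flat_nonpos)
 show "even_cutoff \<tau> (- r) = even_cutoff \<tau> r" "0 \<le> even_cutoff \<tau> r" "even_cutoff \<tau> r \<le> 1"
  "\<tau> > 0 ==> even_cutoff \<tau> 0 > 0" "partial 1 (even_cutoff \<tau>) (- r) = - partial 1 (even_cutoff \<tau>) r"
  by (auto simp: even_cutoff_def even_cutoff_derivative flat_0_bounds)
qed

lemma even_cutoff_integral:
 assumes "\<tau> > 0"
 shows "integrable lborel (even_cutoff \<tau>)" "(LBINT r. even_cutoff \<tau> r) > 0"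
proof -
 have c: "continuous_on A (even_cutoff \<tau>)" for A
  using smooth_continuous[OF even_cutoff_smooth] continuous_on_subset by blast
 have "integrable lborel (\<lambda>r. indicator {- \<tau>..\<tau>} r *\<^sub>R even_cutoff \<tau> r)"
  by (rule borel_integrable_compact[OF _ c]) simp
 moreover have "indicator {- \<tau>..\<tau>} r *\<^sub>R even_cutoff \<tau> r = even_cutoff \<tau> r" for r
 proof (cases "\<bar>r\<bar> > \<tau>")
  case True
  then show ?thesis using even_cutoff_props(4)[OF assms True] by simp
 qed (auto simp: indicator_def)
 ultimately show i: "integrable lborel (even_cutoff \<tau>)" by (simp only:)
 have "(LBINT r. even_cutoff \<tau> r) \<noteq> 0"
 proof
  assume "(LBINT r. even_cutoff \<tau> r) = 0"
  then have "AE r in lborel. even_cutoff \<tau> r = 0"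
   using integral_nonneg_eq_0_iff_AE[OF i] even_cutoff_props(2) by simp
  then have "AE r in lebesgue. r \<in> {r. even_cutoff \<tau> r = 0}"
   by (intro AE_completion) (simp only: mem_Collect_eq)
  moreover have "closed {r. even_cutoff \<tau> r = 0}"
   by (intro closed_Collect_eq c continuous_intros)
  ultimately have "0 \<in> {r. even_cutoff \<tau> r = 0}" by (intro mem_closed_if_AE_lebesgue)
  then show False using even_cutoff_props(5)[OF assms] by simp
 qed
 moreover have "0 \<le> (LBINT r. even_cutoff \<tau> r)"
  by (intro L_integral_nonneg even_cutoff_props(2))
 ultimately show "(LBINT r. even_cutoff \<tau> r) > 0" by simp
qed

context energy_setting
begin

lemma weak_evolution:
 assumes "time_test T \<theta>"
 shows "(LBINT t. partial 1 \<theta> t * pairing t s) + (LBINT t. \<theta> t * flux t s) = 0"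
proof -
 let ?\<psi> = "conv K (\<lambda>y. V (y, s))"
 have d: "dx i ?\<psi> = conv (dx i K) (\<lambda>y. V (y, s))" for i by (rule dx_conv[OF K V1])
 have "(\<Sum>i\<in>UNIV. dx i ?\<psi> x $ i) = 0" for x
 proof -
  have "(\<Sum>i\<in>UNIV. dx i ?\<psi> x $ i) = (\<Sum>i\<in>UNIV. conv (dx i K) (\<lambda>y. V (y, s) $ i) x)"
   unfolding d by (intro sum.cong refl conv_linear[OF dxK V1 vec_nth_linear])
  then show ?thesis using div_V by simp
 qed
 from momentum[OF assms smooth_conv[OF K V1] conv_periodic[OF K V1] this]
 show ?thesis by (simp add: pairing_def flux_def d)
qed

lemma time_increment_small:
 assumes "e > 0"
 obtains d where "d > 0" "\<And>h. \<bar>h\<bar> < d ==> (nnL t. ennreal (time_increment (t + h) t)) \<le> ennreal e"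
proof -
 have p: "periodic (\<lambda>x. V (x, t))" for t by (rule torus_LpD(1)[OF V2])
 have n: "(nnT x. norm (V (x, t)) ^ 1) = ennreal (LINT x|torus. norm (V (x, t)))" for t
  using torus_L1D(3)[OF V1] by (simp add: nn_integral_eq_integral)
 have "(nnL t. (nnT x. norm (V (x, t)) ^ 1)) \<le> (nnL t. ennreal (1 + C) * indicator {0..T} t)"
 proof (rule nn_integral_mono)
  fix t
  show "(nnT x. norm (V (x, t)) ^ 1) \<le> ennreal (1 + C) * indicator {0..T} t"
  proof (cases "t \<in> {0<..<T}")
   case True
   then show ?thesis unfolding n using ennreal_leI[OF L1_le[OF V2 V_bound, of t]] by (auto simp: indicator_def)
  next
   case False
   then show ?thesis using V_zero[OF False] by simp
  qed
 qed
 also have "... < \<infinity>" by (simp add: nn_integral_cmult ennreal_mult_less_top emeasure_lborel_Icc_eq)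
 finally have fin: "(nnL t. (nnT x. norm (V (x, t)) ^ 1)) < \<infinity>" .
 obtain d where d: "d > 0" "\<And>\<xi> h. norm \<xi> < d ==> \<bar>h\<bar> < d ==>
   (nnL t. (nnT x. norm (V (x + \<xi>, t + h) - V (x, t)) ^ 1)) \<le> ennreal e"
  by (rule spacetime_translation[OF V_meas p fin zero_less_one assms]) (rule that, assumption+)
 show thesis
 proof (rule that[OF d(1)])
  fix h :: real assume h: "\<bar>h\<bar> < d"
  have "ennreal (time_increment s s') = (nnT x. norm (V (x, s) - V (x, s')) ^ 1)" for s s'
  proof -
   have "integrable torus (\<lambda>x. V (x, s) - V (x, s'))"
    using torus_L1D(3)[OF V1] by (intro L_integrable_diff) auto
   then show ?thesis by (simp add: time_increment_def nn_integral_eq_integral)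
  qed
  then show "(nnL t. ennreal (time_increment (t + h) t)) \<le> ennreal e"
   using d(2)[of 0 h] d(1) h by simp
 qed
qed

text \<open>Testing the equation at time \<open>t\<close> with the mollified solution at time \<open>s\<close> and a weight
 \<open>\<eta>((t + s) / 2) \<rho>(t - s)\<close> with even \<open>\<rho>\<close>, and integrating over \<open>s\<close>: the derivative of \<open>\<rho>\<close> is
 odd and meets the symmetric pairing, so it drops out, and \<open>\<rho>\<close> can be concentrated at \<open>0\<close>
 although the solution has no time derivative.\<close>

lemma energy_balance:
 assumes \<eta>: "time_test T \<eta>"
 shows "(LBINT t. partial 1 \<eta> t * pairing t t) + 2 * (LBINT t. \<eta> t * flux t t) = 0"
proof -
 define \<eta>' where "\<eta>' = partial 1 \<eta>"
 have \<eta>': "time_test T \<eta>'" unfolding \<eta>'_def by (rule time_test_partial[OF \<eta>])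
 obtain a b where ab: "0 < a" "b < T" "\<And>t. t \<notin> {a..b} ==> \<eta> t = 0"
  using \<eta> by (auto simp: time_test_def)
 have sm: "smooth \<eta>" using \<eta> by (simp add: time_test_def)
 have sm': "smooth \<eta>'" using \<eta>' by (simp add: time_test_def)
 note [measurable] = time_test_measurable[OF \<eta>] time_test_measurable[OF \<eta>']
 obtain M0 where M0: "M0 > 0" "\<And>t. \<bar>\<eta> t\<bar> \<le> M0" using time_test_bounded[OF \<eta>] by blast
 obtain M1 where M1: "M1 > 0" "\<And>t. \<bar>\<eta>' t\<bar> \<le> M1" using time_test_bounded[OF \<eta>'] by blast
 obtain M2 where M2: "M2 > 0" "\<And>t. \<bar>partial 1 \<eta>' t\<bar> \<le> M2" using time_test_bounded[OF time_test_partial[OF \<eta>']] by blast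
 obtain B where B: "B \<ge> 0" "\<And>t s. \<bar>pairing t s\<bar> \<le> B" "\<And>t s. \<bar>flux t s\<bar> \<le> B"
  "\<And>t s s'. \<bar>pairing t s - pairing t s'\<bar> \<le> B * time_increment s s'"
  "\<And>t s s'. \<bar>flux t s - flux t s'\<bar> \<le> B * time_increment s s'"
  by (rule pairing_flux_bounds) (rule that, assumption+)
 define L where "L t s = (1/2) * \<eta>' ((t + s) / 2) * pairing t s + \<eta> ((t + s) / 2) * flux t s" for t s
 have L_meas[measurable]: "(\<lambda>p. L (fst p) (snd p)) \<in> Borel2"
  unfolding L_def by measurable
 have L_bound: "\<bar>L t s\<bar> \<le> (M1 + M0) * B" for t s
 proof -
  have "\<bar>(1/2) * \<eta>' ((t + s) / 2) * pairing t s\<bar> \<le> M1 * B"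
   unfolding abs_mult using M1(2)[of "(t + s) / 2"] by (intro mult_mono B) auto
  moreover have "\<bar>\<eta> ((t + s) / 2) * flux t s\<bar> \<le> M0 * B"
   unfolding abs_mult using M0(2)[of "(t + s) / 2"] by (intro mult_mono B) auto
  ultimately show ?thesis unfolding L_def by (simp add: distrib_right)
 qed
 have L_zero: "L t s = 0" if "t \<notin> {0<..<T} \<or> s \<notin> {0<..<T}" for t s
  using pairing_flux_zero[OF that] by (simp add: L_def)
 define G where "G h = (LBINT t. L t (t + h))" for h
 have Lh_int: "integrable lborel (\<lambda>t. L t (t + h))" for h
 proof -
  have m: "(\<lambda>p. L (fst p) (fst p + h)) \<in> borel_measurable (borel \<Otimes>\<^sub>M (borel :: real measure))"
   using measurable_compose[OF _ L_meas, of "\<lambda>p. (fst p, fst p + h)" "borel \<Otimes>\<^sub>M (borel :: real measure)"] by simp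
  have "integrable lborel (\<lambda>t. indicator {0..T} t * ((M1 + M0) * B))"
   by (intro integrable_mult_left integrable_real_indicator) (auto simp: emeasure_lborel_Icc_eq)
  then show ?thesis
  proof (rule L_integrable_bound)
   show "AE t in lborel. norm (L t (t + h)) \<le> norm (indicator {0..T} t * ((M1 + M0) * B))"
   proof (rule AE_I2)
    fix t show "norm (L t (t + h)) \<le> norm (indicator {0..T} t * ((M1 + M0) * B))"
     using L_bound[of t "t + h"] L_zero[of t "t + h"] by (cases "t \<in> {0<..<T}") auto
   qed
   show "(\<lambda>t. L t (t + h)) \<in> borel_measurable lborel"
    using measurable_compose[OF measurable_Pair2' m, of 0] by simp
  qed
 qed
 have zero: "(LBINT h. even_cutoff \<tau> h * G h) = 0 \<and> integrable lborel (\<lambda>h. even_cutoff \<tau> h * G h)"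
  if \<tau>: "0 < \<tau>" "\<tau> < a" "\<tau> < T - b" for \<tau>
 proof -
  let ?\<rho> = "even_cutoff \<tau>"
  let ?\<rho>' = "partial 1 (even_cutoff \<tau>)"
  have sr: "smooth ?\<rho>" by (rule even_cutoff_smooth)
  have [measurable]: "?\<rho> \<in> Borel" "?\<rho>' \<in> Borel"
   using smooth_continuous[OF sr] smooth_continuous[OF smooth_partial[OF sr, of 1]]
   by (auto intro: borel_measurable_continuous_onI)
  have "continuous_on {- \<tau>..\<tau>} ?\<rho>'"
   using smooth_continuous[OF smooth_partial[OF sr, of 1]] continuous_on_subset by fastforce
  then have "compact (?\<rho>' ` {- \<tau>..\<tau>})" by (intro compact_continuous_image) auto
  then obtain Q where Q: "Q > 0" "\<And>y. y \<in> ?\<rho>' ` {- \<tau>..\<tau>} ==> norm y \<le> Q"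
   using compact_imp_bounded bounded_pos by metis
  have Qb: "\<bar>?\<rho>' r\<bar> \<le> Q" for r
  proof (cases "\<bar>r\<bar> > \<tau>")
   case True
   then show ?thesis using even_cutoff_props(7)[OF \<tau>(1) True] Q(1) by simp
  next
   case False
   then have "?\<rho>' r \<in> ?\<rho>' ` {- \<tau>..\<tau>}" by (intro imageI) auto
   then show ?thesis using Q(2) by fastforce
  qed
  define N1 where "N1 t s = ?\<rho> (t - s) * L t s" for t s
  define N2 where "N2 t s = \<eta> ((t + s) / 2) * ?\<rho>' (t - s) * pairing t s" for t s
  have m1: "(\<lambda>p. N1 (fst p) (snd p)) \<in> Borel2"
   unfolding N1_def by measurable
  have m2: "(\<lambda>p. N2 (fst p) (snd p)) \<in> Borel2"
   unfolding N2_def by measurable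
  have b1: "\<bar>N1 t s\<bar> \<le> (M1 + M0) * B" for t s
   using mult_mono[OF even_cutoff_props(3)[of \<tau> "t - s"] L_bound[of t s]] even_cutoff_props(2)[of \<tau> "t - s"]
   by (simp add: N1_def abs_mult)
  have b2: "\<bar>N2 t s\<bar> \<le> M0 * Q * B" for t s
   unfolding N2_def abs_mult using M0 Q by (intro mult_mono Qb B) auto
  have z1: "N1 t s = 0" "N2 t s = 0" if "t \<notin> {- T..T} \<or> s \<notin> {- T..T}" for t s
  proof -
   have "t \<notin> {0<..<T} \<or> s \<notin> {0<..<T}" using that by auto
   then show "N1 t s = 0" "N2 t s = 0" using L_zero pairing_flux_zero(1) by (auto simp: N1_def N2_def)
  qed
  have i1: "integrable (lborel \<Otimes>\<^sub>M lborel) (\<lambda>p. N1 (fst p) (snd p))" "integrable lborel (\<lambda>t. N1 t s)" for s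
   using integrable_bounded_support[OF m1, of "(M1 + M0) * B" T] b1 z1 by auto
  have i2: "integrable (lborel \<Otimes>\<^sub>M lborel) (\<lambda>p. N2 (fst p) (snd p))" "integrable lborel (\<lambda>t. N2 t s)" for s
   using integrable_bounded_support[OF m2, of "M0 * Q * B" T] b2 z1 by auto
  have slice: "(LBINT t. N1 t s) + (LBINT t. N2 t s) = 0" for s
  proof -
   define \<theta> where "\<theta> t = \<eta> ((t + s) / 2) * ?\<rho> (t - s)" for t
   have s1: "smooth (\<lambda>t. \<eta> ((1/2) * t + s / 2))"
    by (rule smooth_affine[where L = "\<lambda>t. (1/2) * t", OF bounded_linear_mult_right sm])
   have s2: "smooth (\<lambda>t. ?\<rho> (1 * t + - s))"
    by (rule smooth_affine[where L = "\<lambda>t. 1 * t", OF bounded_linear_mult_right sr])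
   have "smooth \<theta>" using smooth_mult[OF s1 s2] unfolding \<theta>_def by (simp add: add_divide_distrib)
   moreover have "\<theta> t = 0" if "t \<notin> {a - \<tau> / 2..b + \<tau> / 2}" for t
   proof (cases "(t + s) / 2 \<in> {a..b}")
    case True
    then have "\<bar>t - s\<bar> > \<tau>" using that by (auto simp: field_simps)
    then show ?thesis using even_cutoff_props(4)[OF \<tau>(1)] by (simp add: \<theta>_def)
   next
    case False
    then show ?thesis using ab(3) by (simp add: \<theta>_def)
   qed
   ultimately have tt: "time_test T \<theta>"
    by (intro time_testI[of \<theta> "a - \<tau> / 2" "b + \<tau> / 2"]) (use \<tau> in auto)
   have der: "partial 1 \<theta> t = (1/2) * \<eta>' ((t + s) / 2) * ?\<rho> (t - s) + \<eta> ((t + s) / 2) * ?\<rho>' (t - s)" for t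
   proof (rule partial_real)
    have "((\<lambda>t. \<eta> ((t + s) / 2)) has_real_derivative \<eta>' ((t + s) / 2) * (1/2)) (at t)"
     unfolding \<eta>'_def by (rule DERIV_chain2[OF smooth_real_has_derivative[OF sm]]) (auto intro!: derivative_eq_intros)
    moreover have "((\<lambda>t. ?\<rho> (t - s)) has_real_derivative ?\<rho>' (t - s) * 1) (at t)"
     by (rule DERIV_chain2[OF smooth_real_has_derivative[OF sr]]) (auto intro!: derivative_eq_intros)
    ultimately show "(\<theta> has_real_derivative (1/2) * \<eta>' ((t + s) / 2) * ?\<rho> (t - s) + \<eta> ((t + s) / 2) * ?\<rho>' (t - s)) (at t)"
     unfolding \<theta>_def[abs_def] by (auto intro!: derivative_eq_intros)
   qed
   let ?P = "\<lambda>t. partial 1 \<theta> t * pairing t s" and ?F = "\<lambda>t. \<theta> t * flux t s"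
   have F: "integrable lborel ?F"
   proof -
    have "(\<lambda>p. \<eta> ((fst p + snd p) / 2) * ?\<rho> (fst p - snd p) * flux (fst p) (snd p)) \<in> Borel2"
     by measurable
    then have "integrable lborel (\<lambda>t. (\<lambda>p. \<eta> ((fst p + snd p) / 2) * ?\<rho> (fst p - snd p) * flux (fst p) (snd p)) (t, s))"
    proof (rule integrable_bounded_support(2)[of _ "M0 * 1 * B" T])
     show "\<bar>\<eta> ((fst p + snd p) / 2) * ?\<rho> (fst p - snd p) * flux (fst p) (snd p)\<bar> \<le> M0 * 1 * B" for p
      unfolding abs_mult using M0 even_cutoff_props(2,3) by (intro mult_mono B) auto
     show "\<eta> ((fst p + snd p) / 2) * ?\<rho> (fst p - snd p) * flux (fst p) (snd p) = 0"
      if "fst p \<notin> {- T..T} \<or> snd p \<notin> {- T..T}" for p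
      using pairing_flux_zero(2)[of "fst p" "snd p"] that by auto
    qed
    then show ?thesis by (simp add: \<theta>_def)
   qed
   have "?P t + ?F t = N1 t s + N2 t s" for t
    by (simp add: N1_def N2_def L_def der \<theta>_def algebra_simps)
   then have eq: "(\<lambda>t. N1 t s + N2 t s) = (\<lambda>t. ?P t + ?F t)" by simp
   have "integrable lborel (\<lambda>t. N1 t s + N2 t s - ?F t)"
    using i1(2) i2(2) F by simp
   then have P: "integrable lborel ?P" by (simp add: eq[unfolded fun_eq_iff, rule_format])
   have "(LBINT t. N1 t s) + (LBINT t. N2 t s) = (LBINT t. N1 t s + N2 t s)"
    using i1(2) i2(2) by simp
   also have "... = (LBINT t. ?P t) + (LBINT t. ?F t)" unfolding eq using P F by simp
   also have "... = 0" by (rule weak_evolution[OF tt])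
   finally show ?thesis .
  qed
  have F1: "(LBINT s. (LBINT t. N1 t s)) = (LBINT t. (LBINT s. N1 t s))" and F2: "(LBINT s. (LBINT t. N2 t s)) = (LBINT t. (LBINT s. N2 t s))"
   using lborel_pair.Fubini_integral[of N1] lborel_pair.Fubini_integral[of N2] i1(1) i2(1)
   by (simp_all add: case_prod_beta')
  have anti: "N2 s t = - N2 t s" for s t
  proof -
   have "?\<rho>' (s - t) = - ?\<rho>' (t - s)" using even_cutoff_props(6)[of \<tau> "t - s"] by simp
   then show ?thesis using pairing_sym[of s t] by (simp add: N2_def add.commute)
  qed
  have "(LBINT t. (LBINT s. N2 t s)) = - (LBINT s. (LBINT t. N2 t s))"
   by (subst anti) simp
  then have N2_0: "(LBINT s. (LBINT t. N2 t s)) = 0" using F2 by simp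
  have "integrable lborel (\<lambda>s. (LBINT t. N1 t s))" "integrable lborel (\<lambda>s. (LBINT t. N2 t s))"
   using lborel_pair.integrable_snd[of N1] lborel_pair.integrable_snd[of N2] i1(1) i2(1) by (simp_all add: case_prod_beta')
  then have "(LBINT s. (LBINT t. N1 t s)) + (LBINT s. (LBINT t. N2 t s)) = (LBINT s. (LBINT t. N1 t s) + (LBINT t. N2 t s))"
   by simp
  then have N1_0: "(LBINT t. (LBINT s. N1 t s)) = 0" using slice N2_0 F1 by simp
  define N3 where "N3 t h = ?\<rho> h * L t (t + h)" for t h
  have "N1 t (t + h) = N3 t h" for t h
   using even_cutoff_props(1)[of \<tau> h] by (simp add: N1_def N3_def)
  moreover have "(LBINT s. N1 t s) = (LBINT h. N1 t (t + h))" for t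
  proof -
   have "N1 t \<in> Borel" using measurable_compose[OF measurable_Pair1' m1, of t] by simp
   then have "(LINT s|distr lborel borel ((+) t). N1 t s) = (LBINT h. N1 t (t + h))"
    by (subst integral_distr) auto
   then show ?thesis by (simp add: lborel_distr_plus)
  qed
  ultimately have N3_0: "(LBINT t. (LBINT h. N3 t h)) = 0" using N1_0 by simp
  have m3: "(\<lambda>p. N3 (fst p) (snd p)) \<in> Borel2"
  proof -
   have [measurable]: "(\<lambda>p. L (fst p) (fst p + snd p)) \<in> Borel2"
    using measurable_compose[OF _ L_meas, of "\<lambda>p. (fst p, fst p + snd p)" "borel \<Otimes>\<^sub>M borel"] by simp
   show ?thesis unfolding N3_def by measurable
  qed
  have i3: "integrable (lborel \<Otimes>\<^sub>M lborel) (\<lambda>p. N3 (fst p) (snd p))"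
  proof (rule integrable_bounded_support(1)[OF m3, of "(M1 + M0) * B" T])
   show "\<bar>N3 (fst p) (snd p)\<bar> \<le> (M1 + M0) * B" for p
    using mult_mono[OF even_cutoff_props(3)[of \<tau> "snd p"] L_bound[of "fst p" "fst p + snd p"]] even_cutoff_props(2)[of \<tau> "snd p"]
    by (simp add: N3_def abs_mult)
   show "N3 (fst p) (snd p) = 0" if "fst p \<notin> {- T..T} \<or> snd p \<notin> {- T..T}" for p
   proof -
    have "fst p \<notin> {0<..<T} \<or> fst p + snd p \<notin> {0<..<T}" using that by auto
    then show ?thesis using L_zero by (simp add: N3_def)
   qed
  qed
  have "(LBINT h. (LBINT t. N3 t h)) = (LBINT t. (LBINT h. N3 t h))"
   using lborel_pair.Fubini_integral[of N3] i3 by (simp add: case_prod_beta')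
  moreover have "(LBINT t. N3 t h) = ?\<rho> h * G h" for h
   unfolding N3_def G_def by simp
  moreover have "integrable lborel (\<lambda>h. (LBINT t. N3 t h))"
   using lborel_pair.integrable_snd[of N3] i3 by (simp add: case_prod_beta')
  ultimately show ?thesis using N3_0 by simp
 qed
 define c where "c = (M2 + M1) * B + (M1 + M0) * B + 1"
 have c: "c > 0" using M0 M1 M2 B by (simp add: c_def add_nonneg_pos)
 have L_diff: "\<bar>L t (t + h) - L t t\<bar> \<le> c * (\<bar>h\<bar> * indicator {0..T} t + time_increment (t + h) t)" for t h
 proof (cases "t \<in> {0<..<T}")
  case True
  have mid: "(t + (t + h)) / 2 = t + h / 2" "(t + t) / 2 = t" by (auto simp: field_simps)
  have e1: "\<bar>\<eta>' (t + h / 2) - \<eta>' t\<bar> \<le> M2 * \<bar>h\<bar>"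
   by (rule order_trans[OF smooth_bounded_derivative_lipschitz[OF sm' M2(2)]]) (use M2(1) in auto)
  have e0: "\<bar>\<eta> (t + h / 2) - \<eta> t\<bar> \<le> M1 * \<bar>h\<bar>"
   by (rule order_trans[OF smooth_bounded_derivative_lipschitz[OF sm M1(2)[unfolded \<eta>'_def]]]) (use M1(1) in auto)
  have eq: "L t (t + h) - L t t = (1/2) * ((\<eta>' (t + h / 2) - \<eta>' t) * pairing t (t + h) + \<eta>' t * (pairing t (t + h) - pairing t t))
    + ((\<eta> (t + h / 2) - \<eta> t) * flux t (t + h) + \<eta> t * (flux t (t + h) - flux t t))"
   unfolding L_def mid by (simp add: algebra_simps)
  have "\<bar>L t (t + h) - L t t\<bar> \<le> (\<bar>\<eta>' (t + h / 2) - \<eta>' t\<bar> * \<bar>pairing t (t + h)\<bar> + \<bar>\<eta>' t\<bar> * \<bar>pairing t (t + h) - pairing t t\<bar>)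
    + (\<bar>\<eta> (t + h / 2) - \<eta> t\<bar> * \<bar>flux t (t + h)\<bar> + \<bar>\<eta> t\<bar> * \<bar>flux t (t + h) - flux t t\<bar>)"
  proof -
   have "\<bar>(1/2) * (p + q) + (r + s)\<bar> \<le> (\<bar>p\<bar> + \<bar>q\<bar>) + (\<bar>r\<bar> + \<bar>s\<bar>)" for p q r s :: real
   proof -
    have "\<bar>(1/2) * (p + q)\<bar> \<le> \<bar>p + q\<bar>" by (simp add: abs_mult)
    then have "\<bar>(1/2) * (p + q)\<bar> \<le> \<bar>p\<bar> + \<bar>q\<bar>" using abs_triangle_ineq[of p q] by (rule order_trans)
    then show ?thesis
     by (intro order_trans[OF abs_triangle_ineq add_mono[OF _ abs_triangle_ineq]])
   qed
   then show ?thesis unfolding eq abs_mult[symmetric] .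
  qed
  also have "... \<le> ((M2 * \<bar>h\<bar>) * B + M1 * (B * time_increment (t + h) t)) + ((M1 * \<bar>h\<bar>) * B + M0 * (B * time_increment (t + h) t))"
   using M0 M1 M2 B time_increment_nonneg
   by (intro add_mono mult_mono e1 e0) (auto intro: mult_nonneg_nonneg)
  also have "... = (M2 + M1) * B * \<bar>h\<bar> + (M1 + M0) * B * time_increment (t + h) t" by (simp add: algebra_simps)
  also have "... \<le> c * \<bar>h\<bar> + c * time_increment (t + h) t"
   using M0 M1 M2 B time_increment_nonneg by (intro add_mono mult_right_mono) (auto simp: c_def)
  finally show ?thesis using True by (simp add: distrib_left)
 next
  case False
  then show ?thesis using L_zero[of t] c time_increment_nonneg[of "t + h" t] by simp
 qed
 have inc_meas[measurable]: "(\<lambda>t. time_increment (t + h) t) \<in> Borel" for h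
 proof -
  have 1: "(\<lambda>q. (snd q, fst q + h)) \<in> measurable borelTX (borel \<Otimes>\<^sub>M borel)"
   and 2: "(\<lambda>q. (snd q, fst q)) \<in> measurable borelTX (borel \<Otimes>\<^sub>M borel)"
   by measurable
  have "(\<lambda>q. V (snd q, fst q + h)) \<in> borel_measurable borelTX"
   "(\<lambda>q. V (snd q, fst q)) \<in> borel_measurable borelTX"
   using measurable_compose[OF 1 VU_pair_measurable(1)] measurable_compose[OF 2 VU_pair_measurable(1)] by simp_all
  note [measurable] = this
  show ?thesis unfolding time_increment_def
   by (rule torus.borel_measurable_lebesgue_integral) (simp add: case_prod_beta')
 qed
 have G_diff: "\<bar>G h - G 0\<bar> \<le> c * (\<bar>h\<bar> * T + e)" if e: "e \<ge> 0" "(nnL t. ennreal (time_increment (t + h) t)) \<le> ennreal e" for h e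
 proof -
  have "G h - G 0 = (LBINT t. L t (t + h) - L t (t + 0))"
   unfolding G_def by (rule L_integral_diff[symmetric]) (rule Lh_int)+
  then have "ennreal \<bar>G h - G 0\<bar> \<le> (nnL t. ennreal (norm (L t (t + h) - L t (t + 0))))"
   using integral_norm_bound_ennreal[OF L_integrable_diff[OF Lh_int Lh_int], of h 0] by simp
  also have "... \<le> (nnL t. ennreal c * (ennreal \<bar>h\<bar> * indicator {0..T} t + ennreal (time_increment (t + h) t)))"
  proof (rule nn_integral_mono)
   fix t
   have "ennreal (norm (L t (t + h) - L t (t + 0))) \<le> ennreal (c * (\<bar>h\<bar> * indicator {0..T} t + time_increment (t + h) t))"
    using L_diff[of t h] by (intro ennreal_leI) simp
   also have "... = ennreal c * (ennreal \<bar>h\<bar> * indicator {0..T} t + ennreal (time_increment (t + h) t))"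
    using c time_increment_nonneg[of "t + h" t] by (cases "t \<in> {0..T}") (auto simp: ennreal_mult ennreal_plus)
   finally show "ennreal (norm (L t (t + h) - L t (t + 0))) \<le> ennreal c * (ennreal \<bar>h\<bar> * indicator {0..T} t + ennreal (time_increment (t + h) t))" .
  qed
  also have "... = ennreal c * (ennreal \<bar>h\<bar> * ennreal T + (nnL t. ennreal (time_increment (t + h) t)))"
   using T_pos by (subst nn_integral_cmult, measurable) (simp add: nn_integral_add nn_integral_cmult)
  also have "... \<le> ennreal c * (ennreal \<bar>h\<bar> * ennreal T + ennreal e)"
   using e(2) by (intro mult_left_mono add_mono) auto
  also have "... = ennreal (c * (\<bar>h\<bar> * T + e))"
   using c T_pos e(1) by (simp add: ennreal_mult ennreal_plus)
  finally show ?thesis using c T_pos e(1) by (subst (asm) ennreal_le_iff) auto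
 qed
 have "\<bar>G 0\<bar> \<le> e" if e: "e > 0" for e
 proof -
  define r where "r = e / (2 * c)"
  have r: "r > 0" using e c by (simp add: r_def)
  obtain d where d: "d > 0" "\<And>h. \<bar>h\<bar> < d ==> (nnL t. ennreal (time_increment (t + h) t)) \<le> ennreal r"
   by (rule time_increment_small[OF r]) (rule that, assumption+)
  define \<tau> where "\<tau> = min (min (a / 2) ((T - b) / 2)) (min (d / 2) (r / T))"
  have \<tau>: "0 < \<tau>" "\<tau> < a" "\<tau> < T - b" "\<tau> < d" "\<tau> \<le> r / T"
  proof -
   have "0 < r / T" using r T_pos by simp
   then show "0 < \<tau>" using ab(1,2) d(1) by (simp add: \<tau>_def)
   have l: "\<tau> \<le> a / 2" "\<tau> \<le> (T - b) / 2" "\<tau> \<le> d / 2" "\<tau> \<le> r / T"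
    unfolding \<tau>_def by (meson min.cobounded1 min.cobounded2 order_trans)+
   show "\<tau> < a" using l(1) ab(1) by simp
   show "\<tau> < T - b" using l(2) ab(2) by simp
   show "\<tau> < d" using l(3) d(1) by simp
   show "\<tau> \<le> r / T" by (rule l(4))
  qed
  let ?\<rho> = "even_cutoff \<tau>"
  have close: "\<bar>?\<rho> h * G 0 - ?\<rho> h * G h\<bar> \<le> ?\<rho> h * e" for h
  proof (cases "\<bar>h\<bar> > \<tau>")
   case True
   then show ?thesis using even_cutoff_props(4)[OF \<tau>(1) True] by simp
  next
   case False
   then have "\<bar>G h - G 0\<bar> \<le> c * (\<bar>h\<bar> * T + r)"
    using d(2)[of h] \<tau>(4) r by (intro G_diff) auto
   also have "... \<le> c * (r + r)"
   proof -
    have "\<bar>h\<bar> * T \<le> r / T * T" using False \<tau>(5) T_pos by (intro mult_right_mono) auto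
    then show ?thesis using c T_pos by (intro mult_left_mono add_mono) auto
   qed
   also have "... = e" using c by (simp add: r_def)
   finally have "?\<rho> h * \<bar>G 0 - G h\<bar> \<le> ?\<rho> h * e"
    using even_cutoff_props(2)[of \<tau> h] by (intro mult_left_mono) (auto simp: abs_minus_commute)
   then show ?thesis using even_cutoff_props(2)[of \<tau> h]
    by (simp only: right_diff_distrib[symmetric] abs_mult abs_of_nonneg)
  qed
  note zt = zero[OF \<tau>(1-3)]
  note \<rho>i = even_cutoff_integral[OF \<tau>(1)]
  have i0: "integrable lborel (\<lambda>h. ?\<rho> h * G 0)" "integrable lborel (\<lambda>h. ?\<rho> h * e)" using \<rho>i(1) by auto
  have "\<bar>G 0\<bar> * (LBINT h. ?\<rho> h) = \<bar>(LBINT h. ?\<rho> h * G 0) - (LBINT h. ?\<rho> h * G h)\<bar>"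
   using zt \<rho>i(2) by (simp add: abs_mult mult.commute)
  also have "... = \<bar>LBINT h. ?\<rho> h * G 0 - ?\<rho> h * G h\<bar>"
   using i0(1) zt by simp
  also have "... \<le> (LBINT h. \<bar>?\<rho> h * G 0 - ?\<rho> h * G h\<bar>)" by (rule integral_abs_bound)
  also have "... \<le> (LBINT h. ?\<rho> h * e)"
   using i0 zt close by (intro integral_mono) auto
  also have "... = e * (LBINT h. ?\<rho> h)" by simp
  finally show ?thesis using \<rho>i(2) by simp
 qed
 then have "G 0 = 0" using field_le_epsilon[of "\<bar>G 0\<bar>" 0] by auto
 have diag: "integrable lborel (\<lambda>t. w t * f t t)"
  if [measurable]: "w \<in> Borel" "(\<lambda>p. f (fst p) (snd p)) \<in> Borel2"
   and w: "\<And>t. \<bar>w t\<bar> \<le> M" "M > 0" and f: "\<And>t. \<bar>f t t\<bar> \<le> B" "\<And>t. t \<notin> {0<..<T} ==> f t t = 0"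
  for w :: "real \<Rightarrow> real" and f :: "real \<Rightarrow> real \<Rightarrow> real" and M
 proof -
  have [measurable]: "(\<lambda>t. f t t) \<in> Borel"
   using measurable_compose[OF _ that(2), of "\<lambda>t. (t, t)" borel] by simp
  have "integrable lborel (\<lambda>t. indicator {0..T} t * (M * B))"
   by (intro integrable_mult_left integrable_real_indicator) (auto simp: emeasure_lborel_Icc_eq)
  then show ?thesis
  proof (rule L_integrable_bound)
   show "AE t in lborel. norm (w t * f t t) \<le> norm (indicator {0..T} t * (M * B))"
   proof (rule AE_I2)
    fix t
    have "\<bar>w t\<bar> * \<bar>f t t\<bar> \<le> M * B" using w f(1)[of t] B(1) by (intro mult_mono) auto
    then show "norm (w t * f t t) \<le> norm (indicator {0..T} t * (M * B))"
     using f(2)[of t] w(2) B(1) by (cases "t \<in> {0<..<T}") (auto simp: abs_mult)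
   qed
  qed measurable
 qed
 have dp: "integrable lborel (\<lambda>t. \<eta>' t * pairing t t)"
  by (rule diag[OF _ pairing_measurable M1(2) M1(1) B(2)]) (auto simp: pairing_flux_zero)
 have df: "integrable lborel (\<lambda>t. \<eta> t * flux t t)"
  by (rule diag[OF _ flux_measurable M0(2) M0(1) B(3)]) (auto simp: pairing_flux_zero)
 have "G 0 = (LBINT t. (1/2) * (\<eta>' t * pairing t t) + \<eta> t * flux t t)"
  by (simp add: G_def L_def)
 also have "... = (1/2) * (LBINT t. \<eta>' t * pairing t t) + (LBINT t. \<eta> t * flux t t)"
  using dp df by simp
 finally show ?thesis using \<open>G 0 = 0\<close> unfolding \<eta>'_def by simp
qed

end

section \<open>The limit of vanishing mollification\<close>

lemma young_cubic:
 fixes a b l :: real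
 assumes "0 \<le> a" "0 \<le> b" "l > 0"
 shows "a * b\<^sup>2 \<le> l\<^sup>2 * a ^ 3 + b ^ 3 / l"
proof (cases "b \<le> l * a")
 case True
 then have "a * b\<^sup>2 \<le> a * (l * a)\<^sup>2" using assms by (intro mult_left_mono power_mono) auto
 also have "... = l\<^sup>2 * a ^ 3" by (simp add: power2_eq_square power3_eq_cube)
 also have "... \<le> l\<^sup>2 * a ^ 3 + b ^ 3 / l" using assms by simp
 finally show ?thesis .
next
 case False
 then have "a \<le> b / l" using assms by (simp add: pos_le_divide_eq mult.commute)
 then have "a * b\<^sup>2 \<le> b / l * b\<^sup>2" using assms by (intro mult_right_mono) auto
 also have "... = b ^ 3 / l" by (simp add: power2_eq_square power3_eq_cube)
 also have "... \<le> l\<^sup>2 * a ^ 3 + b ^ 3 / l" using assms by simp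
 finally show ?thesis .
qed

lemma young_quadratic:
 fixes a b l :: real
 assumes "0 \<le> a" "0 \<le> b" "l > 0"
 shows "a * b \<le> l * a\<^sup>2 + b\<^sup>2 / l"
proof (cases "b \<le> l * a")
 case True
 then have "a * b \<le> a * (l * a)" using assms by (intro mult_left_mono) auto
 also have "... \<le> l * a\<^sup>2 + b\<^sup>2 / l" using assms by (simp add: power2_eq_square)
 finally show ?thesis .
next
 case False
 then have "a \<le> b / l" using assms by (simp add: pos_le_divide_eq mult.commute)
 then have "a * b \<le> b / l * b" using assms by (intro mult_right_mono) auto
 also have "... \<le> l * a\<^sup>2 + b\<^sup>2 / l" using assms by (simp add: power2_eq_square)
 finally show ?thesis .
qed

lemma grad_measurable: "bump_kernel K ==> grad K \<in> Borel"
proof -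
 assume K: "bump_kernel K"
 have "continuous_on UNIV (\<lambda>x. \<chi> i. dx i K x)"
  by (intro continuous_intros kernel_continuous kernel_dx K)
 then show ?thesis unfolding grad_def[abs_def] by (rule borel_measurable_continuous_onI)
qed

lemma grad_rescale:
 assumes "bump_kernel K" "s > 0"
 shows "grad (rescale K s) x = grad K (x /\<^sub>R s) /\<^sub>R s ^ 4"
 using partial_rescale[OF kernel_smooth[OF assms(1)] assms(2)]
 by (simp add: grad_def dx_def vec_eq_iff divide_inverse mult.commute)

text \<open>The same setting for all kernels of the mollifying sequence at once, together with the \<open>L\<^sup>3\<close> bounds that control the defect.\<close>

locale leray_fields =
 fixes U V :: "spacetime \<Rightarrow> space" and \<phi> :: "space \<Rightarrow> real" and T C CU :: real
 assumes T_pos: "T > 0"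
  and U_meas[measurable]: "U \<in> Borel" and V_meas[measurable]: "V \<in> Borel"
  and U3: "\<And>t. torus_Lp 3 (\<lambda>x. U (x, t))" and V3: "\<And>t. torus_Lp 3 (\<lambda>x. V (x, t))"
  and U_bound: "\<And>t. (LINT x|torus. (norm (U (x, t)))\<^sup>2) \<le> C"
  and V_bound: "\<And>t. (LINT x|torus. (norm (V (x, t)))\<^sup>2) \<le> C"
  and V_zero: "\<And>t x. t \<notin> {0<..<T} ==> V (x, t) = 0"
  and CU: "CU \<ge> 0"
  and U_lip: "\<And>\<xi>. (nnL t. (nnT x. norm (U (x + \<xi>, t) - U (x, t)) ^ 3)) \<le> ennreal (CU * norm \<xi> ^ 3)"
  and V_L3: "(nnL t. (nnT x. norm (V (x, t)) ^ 3)) < \<infinity>"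
  and \<phi>: "bump_kernel \<phi>" and \<phi>_even: "\<And>z. \<phi> (- z) = \<phi> z" and \<phi>_int: "(LBINT z. \<phi> z) = 1"
  and div_U: "\<And>n t y. (\<Sum>i\<in>UNIV. conv (dx i (rescale \<phi> (1 / real (Suc n)))) (\<lambda>x. U (x, t) $ i) y) = 0"
  and div_V: "\<And>n t y. (\<Sum>i\<in>UNIV. conv (dx i (rescale \<phi> (1 / real (Suc n)))) (\<lambda>x. V (x, t) $ i) y) = 0"
  and momentum: "\<And>\<theta> \<psi>. time_test T \<theta> ==> smooth \<psi> ==> periodic \<psi> ==>
   (\<And>x. (\<Sum>i\<in>UNIV. dx i \<psi> x $ i) = 0) ==>
   (LBINT t. partial 1 \<theta> t * (LINT x|torus. V (x, t) \<bullet> \<psi> x))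
   + (LBINT t. \<theta> t * (LINT x|torus. (\<Sum>i\<in>UNIV. U (x, t) $ i * (V (x, t) \<bullet> dx i \<psi> x)))) = 0"
begin

lemma VU_pair_measurable[measurable]:
 "(\<lambda>p. V (fst p, snd p)) \<in> Borel2"
 "(\<lambda>p. U (fst p, snd p)) \<in> Borel2"
 using U_meas V_meas by (simp_all add: borel_prod)

lemma per: "periodic (\<lambda>x. V (x, t))" "periodic (\<lambda>x. U (x, t))"
 using torus_LpD(1)[OF V3] torus_LpD(1)[OF U3] .

lemma slices[measurable]:
 "(\<lambda>x. V (x, t)) \<in> Borel" "(\<lambda>x. U (x, t)) \<in> Borel"
 using torus_LpD(2)[OF V3] torus_LpD(2)[OF U3] .

text \<open>Measurability of the increments in the three variables shift, point and time.\<close>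

lemma increments_measurable[measurable]:
 "(\<lambda>q. V (fst (snd q) + fst q, snd (snd q)) - V (fst (snd q), snd (snd q)))
  \<in> borel_measurable borelXXT"
 "(\<lambda>q. U (fst (snd q) + fst q, snd (snd q)) - U (fst (snd q), snd (snd q)))
  \<in> borel_measurable borelXXT"
proof -
 let ?M = "borelXXT"
 have 1: "(\<lambda>q. (fst (snd q) + fst q, snd (snd q))) \<in> measurable ?M (borel \<Otimes>\<^sub>M borel)"
  and 2: "(\<lambda>q. (fst (snd q), snd (snd q))) \<in> measurable ?M (borel \<Otimes>\<^sub>M borel)"
  by measurable
 have [measurable]: "(\<lambda>q. V (fst (snd q) + fst q, snd (snd q))) \<in> borel_measurable ?M"
  "(\<lambda>q. V (fst (snd q), snd (snd q))) \<in> borel_measurable ?M"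
  "(\<lambda>q. U (fst (snd q) + fst q, snd (snd q))) \<in> borel_measurable ?M"
  "(\<lambda>q. U (fst (snd q), snd (snd q))) \<in> borel_measurable ?M"
  using measurable_compose[OF 1 VU_pair_measurable(1)] measurable_compose[OF 2 VU_pair_measurable(1)]
   measurable_compose[OF 1 VU_pair_measurable(2)] measurable_compose[OF 2 VU_pair_measurable(2)] by simp_all
 show "(\<lambda>q. V (fst (snd q) + fst q, snd (snd q)) - V (fst (snd q), snd (snd q))) \<in> borel_measurable ?M"
  "(\<lambda>q. U (fst (snd q) + fst q, snd (snd q)) - U (fst (snd q), snd (snd q))) \<in> borel_measurable ?M"
  by measurable
qed

lemma nn_integral_reorder:
 fixes f :: "space \<Rightarrow> space \<Rightarrow> real \<Rightarrow> ennreal"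
 assumes f: "(\<lambda>q. f (fst q) (fst (snd q)) (snd (snd q))) \<in> borel_measurable borelXXT"
 shows "(nnL t. (nnT x. (nnL z. f z x t))) = (nnL z. (nnL t. (nnT x. f z x t)))"
proof -
 let ?M = "borelXXT"
 have "(\<lambda>p. f (snd p) (fst p) t) \<in> borel_measurable borelXX" for t
 proof -
  have "(\<lambda>p. (snd p, (fst p, t))) \<in> measurable borelXX ?M" by measurable
  from measurable_compose[OF this f] show ?thesis by simp
 qed
 then have "(nnT x. (nnL z. f z x t)) = (nnL z. (nnT x. f z x t))" for t
  by (intro torus_lborel.Fubini'[symmetric]) (simp add: case_prod_beta')
 then have "(nnL t. (nnT x. (nnL z. f z x t))) = (nnL t. (nnL z. (nnT x. f z x t)))"
  by simp
 also have "... = (nnL z. (nnL t. (nnT x. f z x t)))"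
 proof (rule lborel_pair.Fubini')
  have "(\<lambda>q. (fst (fst q), (snd q, snd (fst q)))) \<in> measurable borelXTX ?M"
   by measurable
  from measurable_compose[OF this f]
  have "(\<lambda>q. f (fst (fst q)) (snd q) (snd (fst q))) \<in> borel_measurable borelXTX"
   by simp
  then have "(\<lambda>p. nnT x. f (fst p) x (snd p)) \<in> borel_measurable borelXT"
   by (intro torus.borel_measurable_nn_integral) (simp add: case_prod_beta')
  then show "(\<lambda>(z, t). nnT x. f z x t) \<in> borel_measurable (lborel \<Otimes>\<^sub>M lborel)"
   by (simp add: case_prod_beta')
 qed
 finally show ?thesis .
qed

definition increment_mass :: "space \<Rightarrow> ennreal" where
 "increment_mass z = (nnL t. (nnT x. norm (U (x + z, t) - U (x, t)) * (norm (V (x + z, t) - V (x, t)))\<^sup>2))"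

text \<open>The increment of \<open>u\<close> is of order \<open>\<bar>z\<bar>\<close> in \<open>L\<^sup>3\<close>; Young's inequality, balanced so that both terms
 carry the factor \<open>\<bar>z\<bar>\<close>, leaves the increment of \<open>v\<close> in \<open>L\<^sup>3\<close> as the small quantity.\<close>

lemma increment_mass_le:
 assumes z: "z \<noteq> 0" and l: "l > 0" and w: "w \<ge> 0"
  and small: "(nnL t. (nnT x. norm (V (x + z, t) - V (x, t)) ^ 3)) \<le> ennreal w"
 shows "increment_mass z \<le> ennreal (norm z * (l\<^sup>2 * CU + w / l))"
proof -
 let ?a = "\<lambda>x t. norm (U (x + z, t) - U (x, t))" and ?b = "\<lambda>x t. norm (V (x + z, t) - V (x, t))"
 define k where "k = l / norm z"
 have nz: "norm z > 0" using z by simp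
 have k: "k > 0" using l nz by (simp add: k_def)
 have [measurable]: "(\<lambda>x. V (x + z, t)) \<in> Borel" "(\<lambda>x. U (x + z, t)) \<in> Borel" for t
  using torus_LpD(2)[OF torus_Lp_shift[OF V3[of t], of z]] torus_LpD(2)[OF torus_Lp_shift[OF U3[of t], of z]] by auto
 have slice: "(nnT x. ?a x t * (?b x t)\<^sup>2) \<le> ennreal (k\<^sup>2) * (nnT x. ?a x t ^ 3)
   + ennreal (1 / k) * (nnT x. ?b x t ^ 3)" for t
 proof -
  have "(nnT x. ?a x t * (?b x t)\<^sup>2) \<le> (nnT x. ennreal (k\<^sup>2) * ennreal (?a x t ^ 3) + ennreal (1 / k) * ennreal (?b x t ^ 3))"
  proof (rule nn_integral_mono)
   fix x
   have "ennreal (?a x t * (?b x t)\<^sup>2) \<le> ennreal (k\<^sup>2 * ?a x t ^ 3 + ?b x t ^ 3 / k)"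
    by (intro ennreal_leI young_cubic k) auto
   also have "... = ennreal (k\<^sup>2) * ennreal (?a x t ^ 3) + ennreal (1 / k) * ennreal (?b x t ^ 3)"
    using k by (subst ennreal_plus) (auto simp: ennreal_mult[symmetric])
   finally show "ennreal (?a x t * (?b x t)\<^sup>2) \<le> ennreal (k\<^sup>2) * ennreal (?a x t ^ 3) + ennreal (1 / k) * ennreal (?b x t ^ 3)" .
  qed
  also have "... = ennreal (k\<^sup>2) * (nnT x. ?a x t ^ 3) + ennreal (1 / k) * (nnT x. ?b x t ^ 3)"
   by (subst nn_integral_add) (auto simp: nn_integral_cmult)
  finally show ?thesis .
 qed
 have m: "(\<lambda>t. nnT x. ?a x t ^ 3) \<in> Borel" "(\<lambda>t. nnT x. ?b x t ^ 3) \<in> Borel"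
 proof -
  have c: "(\<lambda>p. (z, (snd p, fst p))) \<in> measurable borelTX borelXXT"
   by measurable
  from measurable_compose[OF c increments_measurable(1)] measurable_compose[OF c increments_measurable(2)]
  have [measurable]: "(\<lambda>p. V (snd p + z, fst p) - V (snd p, fst p)) \<in> borel_measurable borelTX"
   "(\<lambda>p. U (snd p + z, fst p) - U (snd p, fst p)) \<in> borel_measurable borelTX" by simp_all
  show "(\<lambda>t. nnT x. ?a x t ^ 3) \<in> Borel" "(\<lambda>t. nnT x. ?b x t ^ 3) \<in> Borel"
   by (rule torus.borel_measurable_nn_integral, simp add: case_prod_beta')+
 qed
 have "increment_mass z \<le> (nnL t. ennreal (k\<^sup>2) * (nnT x. ?a x t ^ 3) + ennreal (1 / k) * (nnT x. ?b x t ^ 3))"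
  unfolding increment_mass_def by (intro nn_integral_mono slice)
 also have "... = ennreal (k\<^sup>2) * (nnL t. (nnT x. ?a x t ^ 3)) + ennreal (1 / k) * (nnL t. (nnT x. ?b x t ^ 3))"
  using m by (subst nn_integral_add) (auto simp: nn_integral_cmult)
 also have "... \<le> ennreal (k\<^sup>2) * ennreal (CU * norm z ^ 3) + ennreal (1 / k) * ennreal w"
  by (intro add_mono mult_left_mono small U_lip) auto
 also have "... = ennreal (k\<^sup>2 * (CU * norm z ^ 3) + 1 / k * w)"
  using k w CU by (subst ennreal_plus) (auto simp: ennreal_mult[symmetric])
 also have "k\<^sup>2 * (CU * norm z ^ 3) + 1 / k * w = norm z * (l\<^sup>2 * CU + w / l)"
  using nz l by (simp add: k_def power2_eq_square power3_eq_cube field_simps)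
 finally show ?thesis .
qed

definition defect_mass :: "real \<Rightarrow> ennreal" where
 "defect_mass s = (nnL t. (nnT x. (nnL z. ennreal (norm (grad (rescale \<phi> s) z)
   * (norm (U (x + z, t) - U (x, t)) * (norm (V (x + z, t) - V (x, t)))\<^sup>2)))))"

lemma defect_small:
 assumes e: "e > 0"
 obtains s0 where "s0 > 0" "\<And>s. 0 < s ==> s < s0 ==> defect_mass s \<le> ennreal e"
proof -
 obtain R where R: "R > 0" "\<And>z. norm z > R ==> \<phi> z = 0"
 proof -
  obtain R M where "R > 0" "M > 0" "\<And>x. \<bar>\<phi> x\<bar> \<le> M * indicator (cball 0 R) x"
   using kernel_bound[OF \<phi>] by blast
  note RM = this
  have "\<phi> z = 0" if b: "norm z > R" for z using RM(3)[of z] b by (auto simp: indicator_def)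
  then show thesis by (rule that[OF RM(1)])
 qed
 have gz: "grad \<phi> z = 0" if "norm z > R" for z
 proof -
  have "dx i \<phi> z = 0" for i
  proof -
   have "((\<lambda>_. 0) has_derivative (\<lambda>_. 0)) (at z)" by simp
   then have "(\<phi> has_derivative (\<lambda>_. 0)) (at z)"
    by (rule has_derivative_transform_within_open[where s = "- cball 0 R"]) (use R(2) that in auto)
   then show ?thesis by (simp add: dx_def partial_eq)
  qed
  then show ?thesis by (simp add: grad_def vec_eq_iff)
 qed
 note [measurable] = grad_measurable[OF \<phi>]
 define A where "A = (LBINT z. norm (grad \<phi> z) * norm z)"
 have gi: "integrable lborel (\<lambda>z. norm (grad \<phi> z) * norm z)"
 proof -
  have "integrable lborel (\<lambda>z. (\<Sum>i\<in>UNIV. \<bar>dx i \<phi> z\<bar>) * R)"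
   by (intro integrable_mult_left L_integrable_sum integrable_abs kernel_integrable kernel_dx \<phi>)
  then show ?thesis
  proof (rule L_integrable_bound)
   show "AE z in lborel. norm (norm (grad \<phi> z) * norm z) \<le> norm ((\<Sum>i\<in>UNIV. \<bar>dx i \<phi> z\<bar>) * R)"
   proof (rule AE_I2)
    fix z
    show "norm (norm (grad \<phi> z) * norm z) \<le> norm ((\<Sum>i\<in>UNIV. \<bar>dx i \<phi> z\<bar>) * R)"
    proof (cases "norm z > R")
     case True
     then show ?thesis using gz by simp
    next
     case False
     have "norm (grad \<phi> z) \<le> (\<Sum>i\<in>UNIV. \<bar>dx i \<phi> z\<bar>)"
      using norm_le_l1_cart[of "grad \<phi> z"] by (simp add: grad_def)
     then have "norm (grad \<phi> z) * norm z \<le> (\<Sum>i\<in>UNIV. \<bar>dx i \<phi> z\<bar>) * R"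
      using False R(1) by (intro mult_mono sum_nonneg) auto
     then show ?thesis by (simp add: order_trans[OF _ abs_ge_self])
    qed
   qed
  qed measurable
 qed
 have A0: "A \<ge> 0" unfolding A_def by (intro L_integral_nonneg) simp
 have scaleA: "(nnL z. ennreal (norm (grad (rescale \<phi> s) z) * norm z)) = ennreal A" if s: "s > 0" for s
 proof -
  have eq: "norm (grad (rescale \<phi> s) z) * norm z = (1 / s ^ 3) * (norm (grad \<phi> (z /\<^sub>R s)) * norm (z /\<^sub>R s))" for z
   unfolding grad_rescale[OF \<phi> s] using s by (simp add: power_numeral_reduce field_simps)
  have "(LBINT z. norm (grad (rescale \<phi> s) z) * norm z) = (1 / s ^ 3) * (LBINT z. norm (grad \<phi> (z /\<^sub>R s)) * norm (z /\<^sub>R s))"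
   unfolding eq by (rule integral_mult_right_zero)
  also have "(LBINT z. norm (grad \<phi> (z /\<^sub>R s)) * norm (z /\<^sub>R s)) = s ^ 3 *\<^sub>R A"
   unfolding A_def by (rule lborel_scale[of "\<lambda>z. norm (grad \<phi> z) * norm z", OF _ s]) measurable
  finally have i: "(LBINT z. norm (grad (rescale \<phi> s) z) * norm z) = A" using s by simp
  have "integrable lborel (\<lambda>z. norm (grad (rescale \<phi> s) z) * norm z)"
  proof -
   have "lborel = density (distr lborel borel (\<lambda>x::space. 0 + s *\<^sub>R x)) (\<lambda>_. ennreal (\<bar>s\<bar>^DIM(space)))"
    by (rule lborel_affine) (use s in auto)
   then have l: "lborel = density (distr lborel borel (\<lambda>x::space. s *\<^sub>R x)) (\<lambda>_. ennreal (s ^ 3))" using s by simp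
   have "integrable (distr lborel borel (\<lambda>x::space. s *\<^sub>R x)) (\<lambda>z. norm (grad \<phi> (z /\<^sub>R s)) * norm (z /\<^sub>R s))"
    using gi s by (subst integrable_distr_eq) auto
   then have "integrable lborel (\<lambda>z. norm (grad \<phi> (z /\<^sub>R s)) * norm (z /\<^sub>R s))"
    using s by (subst l) (subst integrable_density, auto)
   then show ?thesis unfolding eq by simp
  qed
  then show ?thesis using i by (simp add: nn_integral_eq_integral)
 qed
 define l where "l = sqrt (e / (2 * (A + 1) * (CU + 1)))"
 have pos: "0 < 2 * (A + 1) * (CU + 1)" using A0 CU by simp
 have l: "l > 0" using e pos by (simp add: l_def)
 have l2: "l\<^sup>2 * CU * A \<le> e / 2"
 proof -
  define P where "P = (CU + 1) * (A + 1)"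
  have P: "P > 0" using A0 CU by (simp add: P_def)
  have "l\<^sup>2 = e / (2 * (A + 1) * (CU + 1))" using e pos by (simp add: l_def)
  then have "l\<^sup>2 = e / (2 * P)" unfolding P_def by (simp only: mult_ac)
  then have "l\<^sup>2 * ((CU + 1) * (A + 1)) = e / 2" using P unfolding P_def[symmetric] by simp
  moreover have "l\<^sup>2 * (CU * A) \<le> l\<^sup>2 * ((CU + 1) * (A + 1))"
   using A0 CU by (intro mult_left_mono mult_mono) auto
  ultimately have "l\<^sup>2 * (CU * A) \<le> e / 2" by (simp only:)
  then show ?thesis by (simp only: mult.assoc)
 qed
 define w where "w = l * e / (2 * (A + 1))"
 have w: "w > 0" using l e A0 by (simp add: w_def)
 have w2: "w / l * A \<le> e / 2"
 proof -
  have "w / l = e / (2 * (A + 1))" using l by (simp add: w_def)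
  then have "w / l * A = e / 2 * (A / (A + 1))" by simp
  also have "... \<le> e / 2 * 1" using e A0 by (intro mult_left_mono) auto
  finally show ?thesis by simp
 qed
 obtain d where d: "d > 0" "\<And>\<xi> h. norm \<xi> < d ==> \<bar>h\<bar> < d ==>
   (nnL t. (nnT x. norm (V (x + \<xi>, t + h) - V (x, t)) ^ 3)) \<le> ennreal w"
  by (rule spacetime_translation[OF V_meas per(1) V_L3 _ w]) (simp, rule that, assumption+)
 show thesis
 proof (rule that[of "min d 1 / R"])
  show "min d 1 / R > 0" using d R by simp
  fix s assume s: "0 < s" "s < min d 1 / R"
  have sR: "R * s < min d 1" using s R by (simp add: pos_less_divide_eq mult.commute)
  have Ks: "bump_kernel (rescale \<phi> s)" by (rule kernel_rescale[OF \<phi> s(1)])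
  note [measurable] = grad_measurable[OF Ks]
  have "defect_mass s = (nnL z. (nnL t. (nnT x. ennreal (norm (grad (rescale \<phi> s) z)
   * (norm (U (x + z, t) - U (x, t)) * (norm (V (x + z, t) - V (x, t)))\<^sup>2)))))"
   unfolding defect_mass_def by (rule nn_integral_reorder) measurable
  also have "... \<le> (nnL z. ennreal (norm (grad (rescale \<phi> s) z) * norm z) * ennreal (l\<^sup>2 * CU + w / l))"
  proof (rule nn_integral_mono)
   fix z
   have [measurable]: "(\<lambda>x. V (x + z, t)) \<in> Borel" "(\<lambda>x. U (x + z, t)) \<in> Borel" for t
    using torus_LpD(2)[OF torus_Lp_shift[OF V3[of t], of z]] torus_LpD(2)[OF torus_Lp_shift[OF U3[of t], of z]] by auto
   have mt: "(\<lambda>t. nnT x. ennreal (norm (U (x + z, t) - U (x, t)) * (norm (V (x + z, t) - V (x, t)))\<^sup>2)) \<in> Borel"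
   proof (rule torus.borel_measurable_nn_integral)
    have c: "(\<lambda>p. (z, (snd p, fst p))) \<in> measurable borelTX borelXXT"
     by measurable
    from measurable_compose[OF c increments_measurable(1)] measurable_compose[OF c increments_measurable(2)]
    have [measurable]: "(\<lambda>p. V (snd p + z, fst p) - V (snd p, fst p)) \<in> borel_measurable borelTX"
     "(\<lambda>p. U (snd p + z, fst p) - U (snd p, fst p)) \<in> borel_measurable borelTX" by simp_all
    show "(\<lambda>(t, x). ennreal (norm (U (x + z, t) - U (x, t)) * (norm (V (x + z, t) - V (x, t)))\<^sup>2)) \<in> borel_measurable (borel \<Otimes>\<^sub>M torus)"
     by (simp add: case_prod_beta')
   qed
   have "(nnL t. (nnT x. ennreal (norm (grad (rescale \<phi> s) z)
     * (norm (U (x + z, t) - U (x, t)) * (norm (V (x + z, t) - V (x, t)))\<^sup>2))))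
     = (nnL t. ennreal (norm (grad (rescale \<phi> s) z)) * (nnT x. ennreal (norm (U (x + z, t) - U (x, t)) * (norm (V (x + z, t) - V (x, t)))\<^sup>2)))"
    by (intro nn_integral_cong) (subst nn_integral_cmult[symmetric], auto simp: ennreal_mult)
   also have "... = ennreal (norm (grad (rescale \<phi> s) z)) * increment_mass z"
    unfolding increment_mass_def using mt by (intro nn_integral_cmult) auto
   also have "... \<le> ennreal (norm (grad (rescale \<phi> s) z)) * ennreal (norm z * (l\<^sup>2 * CU + w / l))"
   proof (cases "z = 0 \<or> norm z > R * s")
    case True
    then show ?thesis
    proof
     assume "z = 0"
     then show ?thesis by (simp add: increment_mass_def)
    next
     assume "norm z > R * s"
     then have "norm (z /\<^sub>R s) > R" using s(1) by (simp add: field_simps)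
     then show ?thesis by (simp add: grad_rescale[OF \<phi> s(1)] gz)
    qed
   next
    case False
    then have z: "z \<noteq> 0" "norm z < d" "norm z \<le> 1" using sR by auto
    have "increment_mass z \<le> ennreal (norm z * (l\<^sup>2 * CU + w / l))"
     by (rule increment_mass_le[OF z(1) l]) (use d(2)[OF z(2), of 0] d(1) w in auto)
    then show ?thesis by (rule mult_left_mono) simp
   qed
   also have "... = ennreal (norm (grad (rescale \<phi> s) z) * norm z) * ennreal (l\<^sup>2 * CU + w / l)"
    using CU w l by (simp add: ennreal_mult mult.assoc)
   finally show "(nnL t. (nnT x. ennreal (norm (grad (rescale \<phi> s) z)
     * (norm (U (x + z, t) - U (x, t)) * (norm (V (x + z, t) - V (x, t)))\<^sup>2))))
     \<le> ennreal (norm (grad (rescale \<phi> s) z) * norm z) * ennreal (l\<^sup>2 * CU + w / l)" .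
  qed
  also have "... = ennreal A * ennreal (l\<^sup>2 * CU + w / l)"
   by (subst nn_integral_multc) (auto simp: scaleA[OF s(1)])
  also have "... = ennreal (A * (l\<^sup>2 * CU + w / l))"
   using A0 CU w l by (simp add: ennreal_mult)
  also have "A * (l\<^sup>2 * CU + w / l) = l\<^sup>2 * CU * A + w / l * A"
   by (simp only: distrib_left mult.commute[of A])
  also have "ennreal ... \<le> ennreal e"
   using l2 w2 by (intro ennreal_leI) linarith
  finally show "defect_mass s \<le> ennreal e" .
 qed
qed

definition kernel :: "nat \<Rightarrow> space \<Rightarrow> real" where
 "kernel n = rescale \<phi> (1 / real (Suc n))"

lemma bump_kernel_kernel: "bump_kernel (kernel n)"
 unfolding kernel_def by (rule kernel_rescale[OF \<phi>]) simp

lemma energy_setting_kernel: "energy_setting U V (kernel n) T C"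
proof
 show "kernel n (- z) = kernel n z" for z by (simp add: kernel_def rescale_def \<phi>_even)
 show "(\<Sum>i\<in>UNIV. conv (dx i (kernel n)) (\<lambda>x. V (x, t) $ i) y) = 0" for t y
  unfolding kernel_def by (rule div_V)
qed (fact T_pos U_meas V_meas U3 V3 U_bound V_bound V_zero bump_kernel_kernel momentum)+

lemma flux_le_defect_mass:
 "(nnL t. ennreal \<bar>energy_setting.flux U V (kernel n) t t\<bar>) \<le> defect_mass (1 / real (Suc n))"
proof -
 interpret E: energy_setting U V "kernel n" T C by (rule energy_setting_kernel)
 have "ennreal \<bar>E.flux t t\<bar> \<le> (nnT x. (nnL z. ennreal (norm (grad (kernel n) z)
   * (norm (U (x + z, t) - U (x, t)) * (norm (V (x + z, t) - V (x, t)))\<^sup>2))))" for t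
 proof -
  let ?D = "\<lambda>x. LBINT z. ((grad (kernel n) z \<bullet> fdiff z (\<lambda>x. U (x, t)) x) * (norm (fdiff z (\<lambda>x. V (x, t)) x))\<^sup>2)"
  have "(LINT x|torus. ?D x) = - 4 * E.flux t t"
   unfolding E.flux_def
   by (rule energy_flux_identity(1)[OF bump_kernel_kernel E.K_even U3 V3]) (unfold kernel_def, rule div_U)
  then have "ennreal \<bar>E.flux t t\<bar> \<le> ennreal (norm (LINT x|torus. ?D x))" by (intro ennreal_leI) simp
  also have "... \<le> (nnT x. norm (?D x))" by (rule norm_integral_le_nn_integral)
  also have "... \<le> (nnT x. (nnL z. norm ((grad (kernel n) z \<bullet> fdiff z (\<lambda>x. U (x, t)) x) * (norm (fdiff z (\<lambda>x. V (x, t)) x))\<^sup>2)))"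
   by (intro nn_integral_mono norm_integral_le_nn_integral)
  also have "... \<le> (nnT x. (nnL z. ennreal (norm (grad (kernel n) z)
   * (norm (U (x + z, t) - U (x, t)) * (norm (V (x + z, t) - V (x, t)))\<^sup>2))))"
  proof (intro nn_integral_mono ennreal_leI)
   fix x z
   have "norm (grad (kernel n) z \<bullet> (U (x + z, t) - U (x, t))) \<le> norm (grad (kernel n) z) * norm (U (x + z, t) - U (x, t))"
    using Cauchy_Schwarz_ineq2 by simp
   from mult_right_mono[OF this, of "(norm (V (x + z, t) - V (x, t)))\<^sup>2"]
   show "norm ((grad (kernel n) z \<bullet> fdiff z (\<lambda>x. U (x, t)) x) * (norm (fdiff z (\<lambda>x. V (x, t)) x))\<^sup>2)
    \<le> norm (grad (kernel n) z) * (norm (U (x + z, t) - U (x, t)) * (norm (V (x + z, t) - V (x, t)))\<^sup>2)"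
    by (simp add: fdiff_def abs_mult mult.assoc)
  qed
  finally show ?thesis .
 qed
 then show ?thesis unfolding defect_mass_def kernel_def[symmetric] by (intro nn_integral_mono)
qed

definition energy :: "real \<Rightarrow> real" where
 "energy t = (LINT x|torus. (norm (V (x, t)))\<^sup>2)"

lemma energy_facts:
 "0 \<le> energy t" "energy t \<le> C" "t \<notin> {0<..<T} ==> energy t = 0"
 "(nnT x. (norm (V (x, t)))\<^sup>2) = ennreal (energy t)"
 "energy \<in> Borel" "integrable lborel energy"
 "(nnL t. energy t) \<le> ennreal (T * C)"
proof -
 show 1: "0 \<le> energy t" for t unfolding energy_def by (intro L_integral_nonneg) simp
 show 2: "energy t \<le> C" for t unfolding energy_def by (rule V_bound)
 show 3: "t \<notin> {0<..<T} ==> energy t = 0" for t by (simp add: energy_def V_zero)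
 show "(nnT x. (norm (V (x, t)))\<^sup>2) = ennreal (energy t)"
  unfolding energy_def using torus_LpD(3)[OF torus_Lp_mono[OF V3[of t], of 2]]
  by (intro nn_integral_eq_integral) auto
 show 4: "energy \<in> Borel"
 proof -
  have [measurable]: "(\<lambda>p. V (snd p, fst p)) \<in> borel_measurable borelTX"
   using measurable_compose[OF _ VU_pair_measurable(1), of "\<lambda>p. (snd p, fst p)"] by simp
  show ?thesis unfolding energy_def[abs_def]
   by (rule torus.borel_measurable_lebesgue_integral) (simp add: case_prod_beta')
 qed
 have C0: "0 \<le> C" using 1[of 0] 2[of 0] by linarith
 have "(nnL t. energy t) \<le> (nnL t. ennreal C * indicator {0..T} t)"
  using 1 2 3 by (intro nn_integral_mono) (auto simp: indicator_def intro: ennreal_leI)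
 also have "... = ennreal (T * C)" using T_pos C0 by (simp add: nn_integral_cmult ennreal_mult mult.commute)
 finally show 5: "(nnL t. energy t) \<le> ennreal (T * C)" .
 show "integrable lborel energy"
  using 1 4 5 by (auto simp: integrable_iff_bounded intro: le_less_trans)
qed

text \<open>The mollified energy converges because \<open>V\<close> is translation continuous in \<open>L\<^sup>2\<close> of space-time.\<close>

lemma pairing_near_energy:
 assumes e: "e > 0"
 obtains n0 where "\<And>n. n \<ge> n0 ==> (nnL t. ennreal \<bar>energy_setting.pairing V (kernel n) t t - energy t\<bar>) \<le> ennreal e"
proof -
 have C0: "0 \<le> C" using energy_facts(1,2)[of 0] by linarith
 define B where "B = (LBINT z. \<bar>\<phi> z\<bar>)"
 have B: "0 \<le> B" unfolding B_def by (intro L_integral_nonneg) simp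
 define e1 where "e1 = e / (2 * (B + 1))"
 have e1: "e1 > 0" using e B by (simp add: e1_def)
 define l where "l = e1 / (T * C + 1)"
 have TC: "0 \<le> T * C" using T_pos C0 by simp
 have l: "l > 0" using e1 TC by (simp add: l_def)
 have l1: "l * (T * C) \<le> e1"
 proof -
  have "l * (T * C) \<le> l * (T * C + 1)" using l by simp
  also have "... = e1" using TC by (simp add: l_def)
  finally show ?thesis .
 qed
 define w where "w = l * e1"
 have w: "w > 0" using l e1 by (simp add: w_def)
 have "(nnL t. (nnT x. norm (V (x, t)) ^ 2)) < \<infinity>"
  unfolding energy_facts(4) using energy_facts(7) by (auto intro: le_less_trans)
 then obtain d where d: "d > 0" "\<And>\<xi> h. norm \<xi> < d ==> \<bar>h\<bar> < d ==>
   (nnL t. (nnT x. norm (V (x + \<xi>, t + h) - V (x, t)) ^ 2)) \<le> ennreal w"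
  by (rule spacetime_translation[OF V_meas per(1) _ _ w]) (simp, rule that, assumption+)
 obtain R where R: "R > 0" "\<And>z. R < norm z ==> \<phi> z = 0"
 proof -
  obtain R M where RM: "R > 0" "M > 0" "\<And>x. \<bar>\<phi> x\<bar> \<le> M * indicator (cball 0 R) x"
   using kernel_bound[OF \<phi>] by blast
  have "\<phi> z = 0" if b: "R < norm z" for z using RM(3)[of z] b by (auto simp: indicator_def)
  then show thesis by (rule that[OF RM(1)])
 qed
 obtain n0 where n0: "R / d < real n0" using reals_Archimedean2 by blast
 show thesis
 proof (rule that[of n0])
  fix n assume n: "n \<ge> n0"
  interpret E: energy_setting U V "kernel n" T C by (rule energy_setting_kernel)
  let ?K = "kernel n"
  have Rn: "R * (1 / real (Suc n)) < d"
  proof -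
   have "R / d < real (Suc n)" using n0 n by linarith
   then show ?thesis using d(1) by (simp add: field_simps)
  qed
  have K0: "?K z = 0" if "d \<le> norm z" for z
   unfolding kernel_def using rescale_support[where s = "1 / real (Suc n)" and x = z, OF R(2)] Rn that by simp
  note Ki = kernel_integrable[OF bump_kernel_kernel[of n]]
  have K1: "(LBINT z. ?K z) = 1" and KB: "(LBINT z. \<bar>?K z\<bar>) = B"
   unfolding kernel_def B_def using integral_rescale[OF kernel_measurable[OF \<phi>], of "1 / real (Suc n)"] \<phi>_int by simp_all
  note [measurable] = kernel_measurable[OF bump_kernel_kernel[of n]]
  let ?f = "\<lambda>z x t. ennreal (\<bar>?K z\<bar> * (norm (V (x, t)) * norm (V (x - z, t) - V (x, t))))"
  have slice: "ennreal \<bar>E.pairing t t - energy t\<bar> \<le> (nnT x. (nnL z. ?f z x t))" for t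
  proof -
   have L1: "torus_L1 (\<lambda>y. V (y, t))" using torus_Lp_imp_L1[OF V3] by simp
   have V2: "torus_Lp 2 (\<lambda>y. V (y, t))" using torus_Lp_mono[OF V3] by simp
   have c2: "torus_Lp 2 (conv ?K (\<lambda>y. V (y, t)))"
    by (rule torus_Lp_smooth[OF conv_periodic[OF bump_kernel_kernel L1] smooth_conv[OF bump_kernel_kernel L1]])
   have id: "conv ?K (\<lambda>y. V (y, t)) x - V (x, t) = (LBINT z. ?K z *\<^sub>R (V (x - z, t) - V (x, t)))" for x
   proof -
    have i: "integrable lborel (\<lambda>z. ?K z *\<^sub>R V (x - z, t))"
     using lborel_reflect(2)[of "\<lambda>y. ?K (x - y) *\<^sub>R V (y, t)" x] conv_integrable[OF bump_kernel_kernel L1, of n x] by simp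
    have "(LBINT z. ?K z *\<^sub>R (V (x - z, t) - V (x, t))) = (LBINT z. ?K z *\<^sub>R V (x - z, t)) - (LBINT z. ?K z *\<^sub>R V (x, t))"
     using i Ki by (simp add: scaleR_diff_right)
    also have "(LBINT z. ?K z *\<^sub>R V (x, t)) = V (x, t)" using Ki K1 by simp
    finally show ?thesis using conv_reflect[of ?K "\<lambda>y. V (y, t)" x] by simp
   qed
   have "E.pairing t t - energy t = (LINT x|torus. V (x, t) \<bullet> (conv ?K (\<lambda>y. V (y, t)) x - V (x, t)))"
    unfolding E.pairing_def energy_def
    using torus_L2_inner_integrable(1)[OF V2 c2] torus_L2_inner_integrable(1)[OF V2 V2]
    by (simp add: inner_diff_right power2_norm_eq_inner)
   then have "ennreal \<bar>E.pairing t t - energy t\<bar> \<le> (nnT x. norm (V (x, t) \<bullet> (conv ?K (\<lambda>y. V (y, t)) x - V (x, t))))"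
    using norm_integral_le_nn_integral[of torus "\<lambda>x. V (x, t) \<bullet> (conv ?K (\<lambda>y. V (y, t)) x - V (x, t))"] by simp
   also have "... \<le> (nnT x. (nnL z. ?f z x t))"
   proof (rule nn_integral_mono)
    fix x
    have "ennreal (norm (V (x, t) \<bullet> (conv ?K (\<lambda>y. V (y, t)) x - V (x, t)))) \<le> ennreal (norm (V (x, t))) * ennreal (norm (LBINT z. ?K z *\<^sub>R (V (x - z, t) - V (x, t))))"
     unfolding id by (subst ennreal_mult[symmetric]) (auto intro!: ennreal_leI Cauchy_Schwarz_ineq2)
    also have "... \<le> ennreal (norm (V (x, t))) * (nnL z. norm (?K z *\<^sub>R (V (x - z, t) - V (x, t))))"
     by (intro mult_left_mono norm_integral_le_nn_integral) simp
    also have "... = (nnL z. ?f z x t)"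
    proof (subst nn_integral_cmult[symmetric])
     have [measurable]: "(\<lambda>z. V (x - z, t)) \<in> Borel"
      using measurable_compose[OF _ slices(1)[of t], of "\<lambda>z. x - z" borel] by simp
     show "(\<lambda>z. ennreal (norm (?K z *\<^sub>R (V (x - z, t) - V (x, t))))) \<in> borel_measurable lborel" by measurable
    qed (simp add: ennreal_mult[symmetric] mult.left_commute)
    finally show "ennreal (norm (V (x, t) \<bullet> (conv ?K (\<lambda>y. V (y, t)) x - V (x, t)))) \<le> (nnL z. ?f z x t)" .
   qed
   finally show ?thesis .
  qed
  let ?M = "borelXXT"
  have [measurable]: "(\<lambda>q. V (fst (snd q) - fst q, snd (snd q)) - V (fst (snd q), snd (snd q))) \<in> borel_measurable ?M"
  proof -
   have "(\<lambda>q. (- fst q, snd q)) \<in> measurable ?M ?M" by measurable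
   from measurable_compose[OF this increments_measurable(1)] show ?thesis by simp
  qed
  have [measurable]: "(\<lambda>q. V (fst (snd q), snd (snd q))) \<in> borel_measurable ?M"
   using measurable_compose[OF _ VU_pair_measurable(1), of "\<lambda>q. (fst (snd q), snd (snd q))" ?M] by simp
  have "(nnL t. ennreal \<bar>E.pairing t t - energy t\<bar>) \<le> (nnL t. (nnT x. (nnL z. ?f z x t)))"
   by (intro nn_integral_mono slice)
  also have "... = (nnL z. (nnL t. (nnT x. ?f z x t)))"
   by (rule nn_integral_reorder) measurable
  also have "... \<le> (nnL z. ennreal \<bar>?K z\<bar> * ennreal (2 * e1))"
  proof (rule nn_integral_mono)
   fix z
   show "(nnL t. (nnT x. ?f z x t)) \<le> ennreal \<bar>?K z\<bar> * ennreal (2 * e1)"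
   proof (cases "d \<le> norm z")
    case True
    then show ?thesis by (simp add: K0)
   next
    case False
    have [measurable]: "(\<lambda>x. V (x - z, t)) \<in> Borel" for t
     using torus_LpD(2)[OF torus_Lp_shift[OF V3[of t], of "- z"]] by simp
    have mt: "(\<lambda>t. nnT x. ennreal (norm (V (x - z, t) - V (x, t)) ^ 2)) \<in> Borel"
    proof (rule torus.borel_measurable_nn_integral)
     have c: "(\<lambda>p. (- z, (snd p, fst p))) \<in> measurable borelTX ?M"
      by measurable
     from measurable_compose[OF c increments_measurable(1)]
     have [measurable]: "(\<lambda>p. V (snd p - z, fst p) - V (snd p, fst p)) \<in> borel_measurable borelTX"
      by simp
     show "(\<lambda>(t, x). ennreal (norm (V (x - z, t) - V (x, t)) ^ 2)) \<in> borel_measurable (borel \<Otimes>\<^sub>M torus)"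
      by (simp add: case_prod_beta')
    qed
    have "(nnT x. ?f z x t) \<le> ennreal \<bar>?K z\<bar> * (ennreal l * ennreal (energy t) + ennreal (1 / l) * (nnT x. norm (V (x - z, t) - V (x, t)) ^ 2))" for t
    proof -
     have "(nnT x. ?f z x t) \<le> (nnT x. ennreal \<bar>?K z\<bar> * (ennreal l * ennreal ((norm (V (x, t)))\<^sup>2) + ennreal (1 / l) * ennreal (norm (V (x - z, t) - V (x, t)) ^ 2)))"
     proof (rule nn_integral_mono)
      fix x
      have "ennreal (norm (V (x, t)) * norm (V (x - z, t) - V (x, t))) \<le> ennreal (l * (norm (V (x, t)))\<^sup>2 + (norm (V (x - z, t) - V (x, t)))\<^sup>2 / l)"
       by (intro ennreal_leI young_quadratic l) auto
      also have "... = ennreal l * ennreal ((norm (V (x, t)))\<^sup>2) + ennreal (1 / l) * ennreal (norm (V (x - z, t) - V (x, t)) ^ 2)"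
       using l by (subst ennreal_plus) (auto simp: ennreal_mult[symmetric])
      finally show "?f z x t \<le> ennreal \<bar>?K z\<bar> * (ennreal l * ennreal ((norm (V (x, t)))\<^sup>2) + ennreal (1 / l) * ennreal (norm (V (x - z, t) - V (x, t)) ^ 2))"
       by (subst ennreal_mult) (auto intro: mult_left_mono)
     qed
     also have "... = ennreal \<bar>?K z\<bar> * (ennreal l * ennreal (energy t) + ennreal (1 / l) * (nnT x. norm (V (x - z, t) - V (x, t)) ^ 2))"
      by (simp add: nn_integral_cmult nn_integral_add energy_facts(4))
     finally show ?thesis .
    qed
    then have "(nnL t. (nnT x. ?f z x t)) \<le> (nnL t. ennreal \<bar>?K z\<bar> * (ennreal l * ennreal (energy t) + ennreal (1 / l) * (nnT x. norm (V (x - z, t) - V (x, t)) ^ 2)))"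
     by (rule nn_integral_mono)
    also have "... = ennreal \<bar>?K z\<bar> * (ennreal l * (nnL t. energy t) + ennreal (1 / l) * (nnL t. (nnT x. norm (V (x - z, t) - V (x, t)) ^ 2)))"
     using mt energy_facts(5) by (simp add: nn_integral_cmult nn_integral_add)
    also have "... \<le> ennreal \<bar>?K z\<bar> * (ennreal l * ennreal (T * C) + ennreal (1 / l) * ennreal w)"
     using d(2)[of "- z" 0] False d(1) by (intro mult_left_mono add_mono energy_facts(7)) auto
    also have "ennreal l * ennreal (T * C) + ennreal (1 / l) * ennreal w = ennreal (l * (T * C) + 1 / l * w)"
     using l w TC by (subst ennreal_plus) (auto simp: ennreal_mult[symmetric])
    also have "ennreal \<bar>?K z\<bar> * ennreal (l * (T * C) + 1 / l * w) \<le> ennreal \<bar>?K z\<bar> * ennreal (2 * e1)"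
     using l1 l by (intro mult_left_mono ennreal_leI) (auto simp: w_def)
    finally show ?thesis .
   qed
  qed
  also have "... = (nnL z. ennreal \<bar>?K z\<bar>) * ennreal (2 * e1)" by (rule nn_integral_multc) measurable
  also have "(nnL z. ennreal \<bar>?K z\<bar>) = ennreal B"
   unfolding KB[symmetric] using Ki by (intro nn_integral_eq_integral) auto
  also have "ennreal B * ennreal (2 * e1) = ennreal (B * (2 * e1))" using B e1 by (simp add: ennreal_mult)
  also have "... \<le> ennreal e"
  proof (rule ennreal_leI)
   have e1': "2 * e1 = e / (B + 1)"
    unfolding e1_def by (simp only: times_divide_eq_right divide_divide_eq_left mult_divide_mult_cancel_left)
   have "B * (2 * e1) \<le> (B + 1) * (2 * e1)" using e1 by (intro mult_right_mono) auto
   also have "... = e" unfolding e1' using B by simp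
   finally show "B * (2 * e1) \<le> e" .
  qed
  finally show "(nnL t. ennreal \<bar>E.pairing t t - energy t\<bar>) \<le> ennreal e" .
 qed
qed

lemma energy_constant: "\<exists>c. AE t in lborel. t \<in> {0<..<T} \<longrightarrow> energy t = c"
proof (rule du_Bois_Reymond[OF T_pos energy_facts(6)])
 show "t \<notin> {0<..<T} ==> energy t = 0" for t by (rule energy_facts(3))
 fix \<eta> assume \<eta>: "time_test T \<eta>"
 obtain M where M: "M > 0" "\<And>t. \<bar>\<eta> t\<bar> \<le> M" using time_test_bounded[OF \<eta>] by blast
 obtain M' where M': "M' > 0" "\<And>t. \<bar>partial 1 \<eta> t\<bar> \<le> M'" using time_test_bounded[OF time_test_partial[OF \<eta>]] by blast
 note [measurable] = time_test_measurable[OF \<eta>] time_test_measurable[OF time_test_partial[OF \<eta>]] energy_facts(5)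
 have nn_bound: "\<bar>LBINT t. g t * h t\<bar> \<le> m * r"
  if "m > 0" "\<And>t. \<bar>g t\<bar> \<le> m" "(nnL t. ennreal \<bar>h t\<bar>) \<le> ennreal r" "0 \<le> r" "h \<in> Borel"
  for g h :: "real \<Rightarrow> real" and m r
 proof -
  have "ennreal \<bar>LBINT t. g t * h t\<bar> \<le> (nnL t. norm (g t * h t))"
   using norm_integral_le_nn_integral[of lborel "\<lambda>t. g t * h t"] by simp
  also have "... \<le> (nnL t. ennreal m * ennreal \<bar>h t\<bar>)"
  proof (rule nn_integral_mono)
   fix t
   have "norm (g t * h t) \<le> m * \<bar>h t\<bar>" using that(2)[of t] by (simp add: abs_mult mult_right_mono)
   then show "ennreal (norm (g t * h t)) \<le> ennreal m * ennreal \<bar>h t\<bar>"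
    using that(1) by (simp add: ennreal_mult[symmetric] ennreal_leI)
  qed
  also have "... = ennreal m * (nnL t. ennreal \<bar>h t\<bar>)"
   by (rule nn_integral_cmult) (use that(5) in measurable)
  also have "... \<le> ennreal m * ennreal r" by (intro mult_left_mono that(3)) simp
  also have "... = ennreal (m * r)" using that by (simp add: ennreal_mult)
  finally show ?thesis using that by simp
 qed
 have "\<bar>LBINT t. energy t * partial 1 \<eta> t\<bar> \<le> 0 + e" if e: "e > 0" for e
 proof -
  define r where "r = e / (M' + 2 * M)"
  have r: "r > 0" using e M M' by (simp add: r_def)
  obtain n0 where n0: "\<And>n. n \<ge> n0 ==> (nnL t. ennreal \<bar>energy_setting.pairing V (kernel n) t t - energy t\<bar>) \<le> ennreal r"
   by (rule pairing_near_energy[OF r]) (rule that, assumption)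
  obtain s0 where s0: "s0 > 0" "\<And>s. 0 < s ==> s < s0 ==> defect_mass s \<le> ennreal r"
   by (rule defect_small[OF r]) (rule that, assumption+)
  obtain n1 where n1: "1 / s0 < real n1" using reals_Archimedean2 by blast
  define n where "n = max n0 n1"
  have n: "n \<ge> n0" "1 / real (Suc n) < s0"
  proof -
   have "1 / s0 < real (Suc n)" using n1 by (simp add: n_def)
   then show "1 / real (Suc n) < s0" using s0(1) by (simp add: field_simps)
  qed (simp add: n_def)
  interpret E: energy_setting U V "kernel n" T C by (rule energy_setting_kernel)
  have mp: "(\<lambda>t. E.pairing t t) \<in> Borel" and mf: "(\<lambda>t. E.flux t t) \<in> Borel"
   using measurable_compose[OF _ E.pairing_measurable, of "\<lambda>t. (t, t)" borel]
    measurable_compose[OF _ E.flux_measurable, of "\<lambda>t. (t, t)" borel] by simp_all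
  have f: "\<bar>LBINT t. \<eta> t * E.flux t t\<bar> \<le> M * r"
   by (rule nn_bound[OF M order_trans[OF flux_le_defect_mass s0(2)[OF _ n(2)]] _ mf]) (use r in auto)
  have p: "\<bar>LBINT t. partial 1 \<eta> t * (E.pairing t t - energy t)\<bar> \<le> M' * r"
   by (rule nn_bound[OF M' n0[OF n(1)]]) (use r mp in auto)
  have ie: "integrable lborel (\<lambda>t. partial 1 \<eta> t * energy t)"
   by (rule L_integrable_bound[OF integrable_mult_right[OF energy_facts(6), of M']])
    (use M' energy_facts(1) in \<open>auto simp: abs_mult intro!: AE_I2 mult_right_mono\<close>)
  have ip: "integrable lborel (\<lambda>t. partial 1 \<eta> t * (E.pairing t t - energy t))"
  proof (rule L_integrable_bound[where f = "\<lambda>t. M' * (E.pairing t t - energy t)"])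
   have "integrable lborel (\<lambda>t. E.pairing t t - energy t)"
    using n0[OF n(1)] mp by (auto simp: integrable_iff_bounded intro: le_less_trans)
   then show "integrable lborel (\<lambda>t. M' * (E.pairing t t - energy t))" by simp
   show "(\<lambda>t. partial 1 \<eta> t * (E.pairing t t - energy t)) \<in> borel_measurable lborel" using mp by measurable
   show "AE t in lborel. norm (partial 1 \<eta> t * (E.pairing t t - energy t)) \<le> norm (M' * (E.pairing t t - energy t))"
    using M' by (auto simp: abs_mult intro!: AE_I2 mult_right_mono)
  qed
  have "(LBINT t. partial 1 \<eta> t * E.pairing t t) = (LBINT t. partial 1 \<eta> t * energy t) + (LBINT t. partial 1 \<eta> t * (E.pairing t t - energy t))"
   by (subst L_integral_add[OF ie ip, symmetric]) (simp add: algebra_simps)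
  then have "\<bar>LBINT t. energy t * partial 1 \<eta> t\<bar> \<le> M' * r + 2 * (M * r)"
   using f p E.energy_balance[OF \<eta>] by (simp add: mult.commute)
  also have "... = r * (M' + 2 * M)" by (simp add: distrib_left mult.commute mult.left_commute)
  also have "... = e" using M M' by (simp add: r_def)
  finally show ?thesis by simp
 qed
 then have "\<bar>LBINT t. energy t * partial 1 \<eta> t\<bar> \<le> 0" by (rule field_le_epsilon)
 then show "(LBINT t. energy t * partial 1 \<eta> t) = 0" by simp
qed

end

section \<open>Solenoidal fields at almost every time\<close>

text \<open>If the function were nonzero at an interior point of the cell, it would keep its sign on a small ball of the countable family.\<close>

lemma periodic_zero_if_ball_integrals_zero:
 fixes b :: "space \<Rightarrow> real"
 assumes per: "periodic b" and cont: "continuous_on UNIV b"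
  and D: "\<And>X. open X ==> X \<noteq> {} ==> \<exists>d\<in>D. d \<in> X"
  and zero: "\<And>q n. q \<in> D ==> (LINT x|torus. indicator (ball q (1 / real (Suc n))) (x - vfloor x) * b x) = 0"
 shows "b y = 0"
proof -
 have [measurable]: "b \<in> Borel" using cont by (rule borel_measurable_continuous_onI)
 have cl: "closed {x. b x = 0}" by (intro closed_Collect_eq cont continuous_intros)
 have box: "b x = 0" if x: "x \<in> box 0 One" for x
 proof (rule ccontr)
  assume nz: "b x \<noteq> 0"
  define s where "s = sgn (b x)"
  have s: "s \<noteq> 0" "s * b x > 0" using nz by (auto simp: s_def sgn_if)
  define Q where "Q = box 0 (One :: space) \<inter> {z. 0 < s * b z}"
  have "open Q" unfolding Q_def by (intro open_Int open_box open_Collect_less continuous_intros cont)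
  moreover have "x \<in> Q" using x s by (simp add: Q_def)
  ultimately obtain r where r: "r > 0" "ball x r \<subseteq> Q" using open_contains_ball by blast
  obtain n where n: "2 / r < real n" using reals_Archimedean2 by blast
  then have n2: "1 / real (Suc n) < r / 2"
  proof -
   have "2 / r < real (Suc n)" using n by simp
   then show ?thesis using r(1) by (simp add: field_simps)
  qed
  define e where "e = 1 / real (Suc n)"
  have e: "e > 0" by (simp add: e_def)
  have "ball x e \<noteq> {}" using e by simp
  then obtain q where q: "q \<in> D" "q \<in> ball x e" using D[of "ball x e"] by auto
  have sub: "ball q e \<subseteq> Q"
  proof
   fix z assume "z \<in> ball q e"
   then have "dist x z < e + e" using q(2) dist_triangle[of x z q] by (simp add: dist_commute)
   then show "z \<in> Q" using n2 r(2) by (auto simp: e_def)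
  qed
  have [measurable]: "ball q e \<in> sets borel" by simp
  have m: "(\<lambda>x. indicator (ball q e) (x - vfloor x) * (s * b x)) \<in> Borel"
   using measurable_compose[OF measurable_vfrac, of "indicator (ball q e) :: space \<Rightarrow> real" borel] by measurable
  have frac: "z - vfloor z = z" if "z \<in> unit_cube" for z
   using unit_cube_lattice_unique[of 0 z] that by (simp add: lattice_def)
  obtain M where M: "\<And>x. norm (b x) \<le> M" using periodic_continuous_bounded[OF per cont] by blast
  have i: "integrable torus (\<lambda>x. indicator (ball q e) (x - vfloor x) * (s * b x))"
  proof (rule torus.integrable_const_bound[where B = "\<bar>s\<bar> * M"])
   show "AE x in torus. norm (indicator (ball q e) (x - vfloor x) * (s * b x)) \<le> \<bar>s\<bar> * M"
   proof (rule AE_I2)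
    fix x
    have "0 \<le> M" using M[of x] norm_ge_zero order_trans by blast
    then show "norm (indicator (ball q e) (x - vfloor x) * (s * b x)) \<le> \<bar>s\<bar> * M"
     using M[of x] by (auto simp: indicator_def abs_mult mult_left_mono)
   qed
  qed (use m in simp)
  have nn: "AE x in torus. 0 \<le> indicator (ball q e) (x - vfloor x) * (s * b x)"
   unfolding torus_def using sub by (subst AE_density) (auto simp: indicator_def Q_def frac intro!: AE_I2)
  have "(LINT x|torus. indicator (ball q e) (x - vfloor x) * (s * b x)) = s * (LINT x|torus. indicator (ball q e) (x - vfloor x) * b x)"
   by (subst integral_mult_right_zero[symmetric]) (simp add: mult.left_commute)
  also have "... = 0" using zero[OF q(1), of n] by (simp add: e_def)
  finally have "AE x in torus. indicator (ball q e) (x - vfloor x) * (s * b x) = 0"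
   using integral_nonneg_eq_0_iff_AE[OF i nn] by simp
  then have "AE x in lborel. x \<in> unit_cube \<longrightarrow> indicator (ball q e) (x - vfloor x) * (s * b x) = 0"
   unfolding torus_def by (subst (asm) AE_density) (auto simp: indicator_def)
  then have "AE z in lborel. z \<in> ball q e \<longrightarrow> z \<in> {x. b x = 0}"
  proof eventually_elim
   case (elim z)
   show ?case
   proof
    assume z: "z \<in> ball q e"
    then have "z \<in> unit_cube" using sub unit_cube_box(1) by (auto simp: Q_def)
    then show "z \<in> {x. b x = 0}" using elim z s(1) by (simp add: frac)
   qed
  qed
  then have "AE z\<in>ball q e in lebesgue. z \<in> {x. b x = 0}" by (rule AE_completion)
  then have "x \<in> {x. b x = 0}"
   using mem_closed_if_AE_lebesgue_open[OF open_ball cl, of q e x] q(2) by (simp add: dist_commute)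
  then show False using nz by simp
 qed
 show ?thesis
 proof (rule periodic_continuous_AE_zero[OF per cont])
  have "AE x in lborel. x \<in> cbox 0 (One :: space) \<longrightarrow> x \<in> box 0 One"
   by (rule AE_I[where N = "cbox 0 One - box 0 (One :: space)"]) (auto simp: emeasure_lborel_cbox_eq emeasure_lborel_box_eq emeasure_Diff box_subset_cbox)
  then show "AE x in torus. b x = 0"
   unfolding torus_def by (subst AE_density) (use unit_cube_box(2) box in \<open>auto simp: indicator_def cell_def\<close>)
 qed
qed

text \<open>Testing with a mollified indicator turns the weak constraint into a statement for each single
 ball; countably many balls determine the continuous function \<open>div (conv K u)\<close>, so one null set of
 times serves all points.\<close>

lemma divergence_free_AE:
 fixes U :: "spacetime \<Rightarrow> space"
 assumes T: "T > 0" and K: "bump_kernel K"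
  and U[measurable]: "U \<in> Borel" and U2: "\<And>t. torus_Lp 2 (\<lambda>x. U (x, t))"
  and bound: "\<And>t. (LINT x|torus. (norm (U (x, t)))\<^sup>2) \<le> C"
  and zero: "\<And>t x. t \<notin> {0<..<T} ==> U (x, t) = 0"
  and weak: "\<And>\<theta> \<psi>. time_test T \<theta> ==> smooth \<psi> ==> periodic \<psi> ==>
   (LBINT t. \<theta> t * (LINT x|torus. (\<Sum>i\<in>UNIV. U (x, t) $ i * dx i \<psi> x))) = 0"
 shows "AE t in lborel. \<forall>y. (\<Sum>i\<in>UNIV. conv (dx i K) (\<lambda>x. U (x, t) $ i) y) = 0"
proof -
 define b where "b t y = (\<Sum>i\<in>UNIV. conv (dx i K) (\<lambda>x. U (x, t) $ i) y)" for t y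
 have Ui2: "torus_Lp 2 (\<lambda>x. U (x, t) $ i)" for t i by (rule torus_Lp_linear[OF U2 vec_nth_linear])
 have Ui1: "torus_L1 (\<lambda>x. U (x, t) $ i)" for t i using torus_Lp_imp_L1[OF Ui2] by simp
 have dK: "bump_kernel (dx i K)" for i by (rule kernel_dx[OF K])
 have bc: "continuous_on UNIV (b t)" for t
  unfolding b_def[abs_def] by (intro continuous_on_sum smooth_continuous smooth_conv dK Ui1)
 have bp: "periodic (b t)" for t
  using conv_periodic[OF dK Ui1] unfolding b_def[abs_def] periodic_def by simp
 have single: "AE t in lborel. (LINT x|torus. g x * b t x) = 0"
  if g: "periodic g" "g \<in> Borel" "\<And>x. \<bar>g x\<bar> \<le> 1" for g :: "space \<Rightarrow> real"
 proof -
  have g2: "torus_Lp 2 g" using g by (intro torus_Lp_bounded[where M = 1]) auto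
  have g1: "torus_L1 g" using torus_Lp_imp_L1[OF g2] by simp
  define \<psi> where "\<psi> = conv (\<lambda>z. K (- z)) g"
  have Kr: "bump_kernel (\<lambda>z. K (- z))" by (rule kernel_reflect[OF K])
  have \<psi>: "smooth \<psi>" "periodic \<psi>" unfolding \<psi>_def by (auto intro: smooth_conv conv_periodic Kr g1)
  have d\<psi>: "dx i \<psi> = conv (dx i (\<lambda>z. K (- z))) g" for i unfolding \<psi>_def by (rule dx_conv[OF Kr g1])
  have d2: "torus_Lp 2 (dx i \<psi>)" for i
   unfolding d\<psi> by (rule torus_Lp_smooth[OF conv_periodic[OF kernel_dx[OF Kr] g1] smooth_conv[OF kernel_dx[OF Kr] g1]])
  have adj: "(LINT x|torus. U (x, t) $ i * dx i \<psi> x) = - (LINT x|torus. g x * conv (dx i K) (\<lambda>x. U (x, t) $ i) x)" for t i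
  proof -
   have "(LINT x|torus. U (x, t) $ i * dx i \<psi> x) = (LINT x|torus. conv (\<lambda>z. dx i (\<lambda>z. K (- z)) (- z)) (\<lambda>x. U (x, t) $ i) x * g x)"
    unfolding d\<psi> using conv_adjoint[OF kernel_dx[OF Kr, of i] g2 Ui2[of t i]] by simp
   also have "(\<lambda>z. dx i (\<lambda>z. K (- z)) (- z)) = (\<lambda>z. - dx i K z)"
    by (simp add: dx_reflect[OF kernel_smooth[OF K]])
   also have "(LINT x|torus. conv (\<lambda>z. - dx i K z) (\<lambda>x. U (x, t) $ i) x * g x) = - (LINT x|torus. g x * conv (dx i K) (\<lambda>x. U (x, t) $ i) x)"
    by (simp add: conv_def mult.commute)
   finally show ?thesis .
  qed
  define h where "h t = (LINT x|torus. (\<Sum>i\<in>UNIV. U (x, t) $ i * dx i \<psi> x))" for t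
  have h_eq: "h t = - (LINT x|torus. g x * b t x)" for t
  proof -
   have c2: "torus_Lp 2 (conv (dx i K) (\<lambda>x. U (x, t) $ i))" for i
    by (rule torus_Lp_smooth[OF conv_periodic[OF dK Ui1] smooth_conv[OF dK Ui1]])
   have "h t = (\<Sum>i\<in>UNIV. (LINT x|torus. U (x, t) $ i * dx i \<psi> x))"
    unfolding h_def using torus_L2_inner_integrable(1)[OF Ui2 d2] by (intro L_integral_sum) simp
   also have "... = - (\<Sum>i\<in>UNIV. (LINT x|torus. g x * conv (dx i K) (\<lambda>x. U (x, t) $ i) x))"
    by (simp add: adj sum_negf)
   also have "(\<Sum>i\<in>UNIV. (LINT x|torus. g x * conv (dx i K) (\<lambda>x. U (x, t) $ i) x)) = (LINT x|torus. g x * b t x)"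
    unfolding b_def sum_distrib_left using torus_L2_inner_integrable(1)[OF g2 c2]
    by (intro L_integral_sum[symmetric]) simp
   finally show ?thesis .
  qed
  define \<Psi> :: "space \<Rightarrow> space" where "\<Psi> x = (\<chi> i. dx i \<psi> x)" for x
  have \<Psi>c: "continuous_on UNIV \<Psi>"
   unfolding \<Psi>_def[abs_def] by (intro continuous_intros smooth_continuous smooth_dx \<psi>)
  have \<Psi>p: "periodic \<Psi>"
   using torus_LpD(1)[OF d2] by (simp add: \<Psi>_def[abs_def] periodic_def)
  have \<Psi>2: "torus_Lp 2 \<Psi>"
  proof -
   obtain M where "\<And>x. norm (\<Psi> x) \<le> M" using periodic_continuous_bounded[OF \<Psi>p \<Psi>c] by blast
   then show ?thesis by (rule torus_Lp_bounded[OF \<Psi>p borel_measurable_continuous_onI[OF \<Psi>c]])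
  qed
  note [measurable] = torus_LpD(2)[OF \<Psi>2]
  have h_inner: "h t = (LINT x|torus. U (x, t) \<bullet> \<Psi> x)" for t
   by (simp add: h_def \<Psi>_def inner_vec_def)
  have h_bound: "\<bar>h t\<bar> \<le> C + (LINT x|torus. (norm (\<Psi> x))\<^sup>2)" for t
  proof -
   have "ennreal \<bar>h t\<bar> \<le> (nnT x. norm (U (x, t) \<bullet> \<Psi> x))"
    unfolding h_inner using norm_integral_le_nn_integral[of torus "\<lambda>x. U (x, t) \<bullet> \<Psi> x"] by simp
   also have "... \<le> (nnT x. norm (U (x, t)) * norm (\<Psi> x))"
    by (intro nn_integral_mono ennreal_leI) (simp add: Cauchy_Schwarz_ineq2)
   also have "... \<le> ennreal ((LINT x|torus. (norm (U (x, t)))\<^sup>2) + (LINT x|torus. (norm (\<Psi> x))\<^sup>2))"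
    by (rule torus_L2_inner_integrable(3)[OF U2 \<Psi>2])
   finally have "\<bar>h t\<bar> \<le> (LINT x|torus. (norm (U (x, t)))\<^sup>2) + (LINT x|torus. (norm (\<Psi> x))\<^sup>2)"
    by (subst (asm) ennreal_le_iff) (auto intro!: add_nonneg_nonneg L_integral_nonneg)
   then show ?thesis using bound[of t] by linarith
  qed
  have [measurable]: "h \<in> Borel"
  proof -
   have "(\<lambda>p. U (fst p, snd p)) \<in> Borel2" using U by (simp add: borel_prod)
   from measurable_compose[OF _ this, of "\<lambda>p. (snd p, fst p)"]
   have [measurable]: "(\<lambda>p. U (snd p, fst p)) \<in> borel_measurable borelTX" by simp
   show ?thesis unfolding h_inner[abs_def]
    by (rule torus.borel_measurable_lebesgue_integral) (simp add: case_prod_beta')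
  qed
  have h0: "h t = 0" if "t \<notin> {0<..<T}" for t using zero[OF that] by (simp add: h_def)
  have "AE t in lborel. h t = 0"
  proof (rule fundamental_lemma[OF _ h0])
   show "integrable lborel h"
   proof (rule L_integrable_bound[where f = "\<lambda>t. indicator {0..T} t *\<^sub>R (C + (LINT x|torus. (norm (\<Psi> x))\<^sup>2))"])
    show "AE t in lborel. norm (h t) \<le> norm (indicator {0..T} t *\<^sub>R (C + (LINT x|torus. (norm (\<Psi> x))\<^sup>2)))"
     using h_bound h0 by (auto simp: indicator_def intro!: AE_I2 order_trans[OF h_bound abs_ge_self])
   qed (auto simp: emeasure_lborel_Icc_eq)
   show "(LBINT t. h t * \<eta> t) = 0" if "time_test T \<eta>" for \<eta>
    using weak[OF that \<psi>] by (simp add: h_def mult.commute)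
  qed
  then show ?thesis by (simp add: h_eq)
 qed
 obtain D :: "space set" where D: "countable D" "\<And>X. open X ==> X \<noteq> {} ==> \<exists>d\<in>D. d \<in> X"
  using countable_dense_setE by metis
 have "AE t in lborel. \<forall>n::nat. \<forall>q\<in>D. (LINT x|torus. indicator (ball q (1 / real (Suc n))) (x - vfloor x) * b t x) = 0"
  unfolding AE_all_countable
 proof (intro allI)
  fix n :: nat
  show "AE t in lborel. \<forall>q\<in>D. (LINT x|torus. indicator (ball q (1 / real (Suc n))) (x - vfloor x) * b t x) = 0"
   unfolding AE_ball_countable[OF D(1)]
  proof (intro ballI single)
   fix q :: space
   show "periodic (\<lambda>x. indicator (ball q (1 / real (Suc n))) (x - vfloor x) :: real)"
    by (rule periodic_compose[OF vfrac_periodic])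
   show "(\<lambda>x. indicator (ball q (1 / real (Suc n))) (x - vfloor x) :: real) \<in> Borel"
    by (rule measurable_compose[OF measurable_vfrac]) (intro borel_measurable_indicator, simp)
  qed (auto simp: indicator_def)
 qed
 then show ?thesis
 proof eventually_elim
  case (elim t)
  have "b t y = 0" for y
   by (rule periodic_zero_if_ball_integrals_zero[OF bp bc D(2)]) (use elim in auto)
  then show ?case by (simp add: b_def)
 qed
qed

lemma dx_sum:
 fixes f :: "'i \<Rightarrow> space \<Rightarrow> real"
 assumes "\<And>i. smooth (f i)"
 shows "dx j (\<lambda>x. \<Sum>i\<in>I. f i x) = (\<lambda>x. \<Sum>i\<in>I. dx j (f i) x)"
proof
 fix x
 have "((\<lambda>x. \<Sum>i\<in>I. f i x) has_derivative (\<lambda>h. \<Sum>i\<in>I. frechet_derivative (f i) (at x) h)) (at x)"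
  by (intro has_derivative_sum smooth_has_derivative assms)
 then show "dx j (\<lambda>x. \<Sum>i\<in>I. f i x) x = (\<Sum>i\<in>I. dx j (f i) x)"
  by (simp add: dx_def partial_eq partial_def frechet_derivative_at[symmetric])
qed

text \<open>The Helmholtz operator commutes with derivatives, so the constraint passes from \<open>u\<close> to \<open>v\<close>.\<close>

lemma divergence_free_helmholtz:
 fixes u v :: "space \<Rightarrow> space"
 assumes H: "\<And>i. helmholtz \<alpha> (\<lambda>x. v x $ i) (\<lambda>x. u x $ i)" and K: "bump_kernel K"
  and div: "\<And>y. (\<Sum>i\<in>UNIV. conv (dx i K) (\<lambda>x. u x $ i) y) = 0"
 shows "(\<Sum>i\<in>UNIV. conv (dx i K) (\<lambda>x. v x $ i) y) = 0"
proof -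
 let ?f = "\<lambda>i. conv (dx i K) (\<lambda>x. u x $ i)"
 have u1: "torus_L1 (\<lambda>x. u x $ i)" for i
  using H[of i] torus_Lp_imp_L1[of 2 "\<lambda>x. u x $ i"] by (simp add: helmholtz_def)
 have f: "smooth (?f i)" for i by (rule smooth_conv[OF kernel_dx[OF K] u1])
 have "(\<lambda>x. \<Sum>i\<in>UNIV. dx j (dx j (?f i)) x) = (\<lambda>x. 0)" for j
 proof -
  have "(\<lambda>x. \<Sum>i\<in>UNIV. dx j (dx j (?f i)) x) = dx j (dx j (\<lambda>x. \<Sum>i\<in>UNIV. ?f i x))"
   by (simp add: dx_sum f smooth_dx)
  also have "(\<lambda>x. \<Sum>i\<in>UNIV. ?f i x) = (\<lambda>x. 0)" using div by (simp add: fun_eq_iff)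
  also have "dx j (\<lambda>x::space. 0 :: real) = (\<lambda>x. 0)"
   by (simp add: dx_def fun_eq_iff partial_eq[OF has_derivative_const])
  finally show ?thesis by (simp add: dx_def fun_eq_iff partial_eq[OF has_derivative_const])
 qed
 then have "(\<Sum>i\<in>UNIV. \<Sum>j\<in>UNIV. dx j (dx j (?f i)) y) = 0"
  by (subst sum.swap) (simp add: fun_eq_iff)
 then have lap: "(\<Sum>i\<in>UNIV. conv (laplacian (dx i K)) (\<lambda>x. u x $ i) y) = 0"
  by (simp add: laplacian_conv[OF kernel_dx[OF K] u1, symmetric] laplacian_def)
 have "conv (dx i K) (\<lambda>x. v x $ i) y = ?f i y - \<alpha>\<^sup>2 * conv (laplacian (dx i K)) (\<lambda>x. u x $ i) y" for i
  using helmholtz_mollified[OF H[of i] kernel_dx[OF K]] by simp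
 then show ?thesis using div[of y] lap by (simp add: sum_subtractf sum_distrib_left[symmetric])
qed

section \<open>From the weak formulation to slicewise properties\<close>

lemma in_Lp_iff:
 fixes f :: "space \<Rightarrow> 'b::euclidean_space"
 shows "in_Lp (numeral n) f \<longleftrightarrow> torus_Lp (numeral n) f"
proof -
 have "set_integrable lborel cell (\<lambda>x. norm (f x) powr numeral n) \<longleftrightarrow> integrable torus (\<lambda>x. norm (f x) ^ numeral n)"
  if "f \<in> Borel"
  using integral_torus(2)[of "\<lambda>x. norm (f x) ^ numeral n"] that by (simp add: powr_numeral)
 then show ?thesis by (auto simp: in_Lp_def torus_Lp_def)
qed

lemma Lp_norm_eq:
 fixes f :: "space \<Rightarrow> 'b::euclidean_space"
 assumes "f \<in> Borel"
 shows "Lp_norm (numeral n) f = (LINT x|torus. norm (f x) ^ numeral n) powr (1 / numeral n)"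
  and "Lp_norm (numeral n) f ^ numeral n = (LINT x|torus. norm (f x) ^ numeral n)"
proof -
 have I: "0 \<le> (LINT x|torus. norm (f x) ^ numeral n)" by (intro L_integral_nonneg) simp
 show 1: "Lp_norm (numeral n) f = (LINT x|torus. norm (f x) ^ numeral n) powr (1 / numeral n)"
  using assms integral_torus(1)[of "\<lambda>x. norm (f x) ^ numeral n"] by (simp add: Lp_norm_def powr_numeral)
 show "Lp_norm (numeral n) f ^ numeral n = (LINT x|torus. norm (f x) ^ numeral n)"
 proof -
  have "Lp_norm (numeral n) f ^ numeral n = ((LINT x|torus. norm (f x) ^ numeral n) powr (1 / numeral n)) powr numeral n"
   unfolding 1 by (rule powr_numeral[symmetric]) simp
  also have "... = (LINT x|torus. norm (f x) ^ numeral n)" by (subst powr_powr) (use I in simp)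
  finally show ?thesis .
 qed
qed

text \<open>The supremum of the difference quotients is at least any one of them, hence nonnegative.\<close>

lemma Lp_norm_le_besov_norm:
 assumes "in_besov \<theta> r f"
 shows "Lp_norm r f \<le> besov_norm \<theta> r f"
proof -
 let ?q = "norm (axis 1 1 :: space) powr (- \<theta>) * Lp_norm r ((fdiff (axis 1 1) ^^ (nat \<lfloor>\<theta>\<rfloor> + 1)) f)"
 have "(axis 1 1 :: space) \<noteq> 0" by (simp add: axis_eq_0_iff)
 then have "?q \<in> besov_quotients \<theta> r f" unfolding besov_quotients_def by (intro image_eqI[of _ _ "axis 1 1"]) auto
 then have "?q \<le> Sup (besov_quotients \<theta> r f)"
  using assms by (intro cSup_upper) (auto simp: in_besov_def)
 moreover have "0 \<le> ?q" by (simp add: Lp_norm_def)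
 ultimately show ?thesis by (simp add: besov_norm_def)
qed

lemma product_test:
 fixes \<psi> :: "space \<Rightarrow> 'b::euclidean_space"
 assumes \<psi>: "smooth \<psi>" "periodic \<psi>" and \<theta>: "time_test T \<theta>"
 shows "st_test T (\<lambda>z. \<theta> (snd z) *\<^sub>R \<psi> (fst z))"
  and "st_dt (\<lambda>z. \<theta> (snd z) *\<^sub>R \<psi> (fst z)) (x, t) = partial 1 \<theta> t *\<^sub>R \<psi> x"
  and "st_dx i (\<lambda>z. \<theta> (snd z) *\<^sub>R \<psi> (fst z)) (x, t) = \<theta> t *\<^sub>R dx i \<psi> x"
proof -
 obtain a b where s: "smooth \<theta>" and ab: "0 < a" "b < T" "\<And>t. t \<notin> {a..b} ==> \<theta> t = 0"
  using \<theta> unfolding time_test_def by blast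
 have "smooth (\<lambda>z :: spacetime. \<theta> (snd z))" "smooth (\<lambda>z :: spacetime. \<psi> (fst z))"
  using smooth_affine[OF bounded_linear_snd s, of 0] smooth_affine[OF bounded_linear_fst \<psi>(1), of 0] by simp_all
 then have "smooth (\<lambda>z :: spacetime. \<theta> (snd z) *\<^sub>R \<psi> (fst z))" by (rule smooth_scaleR)
 then show "st_test T (\<lambda>z. \<theta> (snd z) *\<^sub>R \<psi> (fst z))"
  unfolding st_test_def using \<psi>(2)
  by (intro conjI exI[of _ a] exI[of _ b] allI impI) (simp_all add: periodic_def ab)
 have 1: "((\<lambda>z :: spacetime. \<theta> (snd z)) has_derivative (\<lambda>h. snd h * partial 1 \<theta> t)) (at (x, t))"
 proof -
  have "(\<theta> has_derivative (\<lambda>h. h * partial 1 \<theta> t)) (at (snd (x, t)))"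
   using smooth_real_has_derivative[OF s, of t] by (simp add: has_field_derivative_def mult_commute_abs)
  from diff_chain_at[OF bounded_linear_imp_has_derivative[OF bounded_linear_snd] this] show ?thesis by (simp add: o_def)
 qed
 have 2: "((\<lambda>z :: spacetime. \<psi> (fst z)) has_derivative (\<lambda>h. frechet_derivative \<psi> (at x) (fst h))) (at (x, t))"
 proof -
  have "(\<psi> has_derivative frechet_derivative \<psi> (at x)) (at (fst (x, t)))"
   using smooth_has_derivative[OF \<psi>(1), of x] by simp
  from diff_chain_at[OF bounded_linear_imp_has_derivative[OF bounded_linear_fst] this] show ?thesis by (simp add: o_def)
 qed
 have z: "frechet_derivative \<psi> (at x) 0 = 0"
  by (rule linear_0[OF linear_frechet_derivative[OF smooth_differentiable[OF \<psi>(1)]]])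
 note d = partial_eq[OF has_derivative_scaleR[OF 1 2]]
 show "st_dt (\<lambda>z. \<theta> (snd z) *\<^sub>R \<psi> (fst z)) (x, t) = partial 1 \<theta> t *\<^sub>R \<psi> x"
  unfolding st_dt_def d by (simp add: z)
 show "st_dx i (\<lambda>z. \<theta> (snd z) *\<^sub>R \<psi> (fst z)) (x, t) = \<theta> t *\<^sub>R dx i \<psi> x"
  unfolding st_dx_def d by (simp add: dx_def partial_def)
qed

lemma st_test_derivatives_measurable:
 assumes "st_test T \<psi>"
 shows "st_dt \<psi> \<in> Borel" "st_dx i \<psi> \<in> Borel" "\<psi> \<in> Borel"
proof -
 have s: "smooth \<psi>" using assms by (simp add: st_test_def)
 have "((0, 1) :: spacetime) \<in> Basis" "((axis i 1, 0) :: spacetime) \<in> Basis"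
  using axis_Basis[of i] by (auto simp: Basis_prod_def)
 then show "st_dt \<psi> \<in> Borel" "st_dx i \<psi> \<in> Borel" "\<psi> \<in> Borel"
  unfolding st_dt_def st_dx_def
  by (auto intro!: borel_measurable_continuous_onI smooth_continuous smooth_partial s)
qed

lemma st_integral_eq:
 fixes f F :: "spacetime \<Rightarrow> real"
 assumes F: "F \<in> Borel" and eq: "\<And>x t. t \<in> {0<..<T} ==> f (x, t) = F (x, t)"
  and S[measurable]: "S \<in> sets borel" and sub: "S \<subseteq> {0<..<T}" and ae: "AE t in lborel. t \<in> {0<..<T} \<longrightarrow> t \<in> S"
 shows "st_integral T f = (LBINT t. indicator S t * (LINT x|torus. f (x, t)))"
proof -
 have F2: "F \<in> Borel2" using F by (simp add: borel_prod)
 have sl: "(\<lambda>x. F (x, t)) \<in> Borel" for t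
  using measurable_compose[OF _ F2, of "\<lambda>x. (x, t)" borel] by simp
 have "(\<lambda>p. F (snd p, fst p)) \<in> borel_measurable borelTX"
  using measurable_compose[OF _ F2, of "\<lambda>p. (snd p, fst p)"] by simp
 then have [measurable]: "(\<lambda>t. LINT x|torus. F (x, t)) \<in> Borel"
  by (intro torus.borel_measurable_lebesgue_integral) (simp add: case_prod_beta')
 have "st_integral T f = (LBINT t:{0<..<T}. (LINT x|torus. F (x, t)))"
  unfolding st_integral_def by (intro set_lebesgue_integral_cong) (auto simp: eq integral_torus(1)[OF sl])
 also have "... = (LBINT t. indicator S t * (LINT x|torus. F (x, t)))"
  unfolding set_lebesgue_integral_def
 proof (rule integral_cong_AE)
  show "AE t in lborel. indicator {0<..<T} t *\<^sub>R (LINT x|torus. F (x, t)) = indicator S t * (LINT x|torus. F (x, t))"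
   using ae by eventually_elim (use sub in \<open>auto simp: indicator_def\<close>)
 qed measurable
 also have "... = (LBINT t. indicator S t * (LINT x|torus. f (x, t)))"
  by (intro L_integral_cong refl) (use sub eq in \<open>auto simp: indicator_def\<close>)
 finally show ?thesis .
qed

lemma integral_scaleR_component:
 fixes f :: "space \<Rightarrow> space" and c :: "space \<Rightarrow> real"
 assumes c: "periodic c" "continuous_on UNIV c" and f: "torus_L1 f"
 shows "(LBINT x:cell. c x *\<^sub>R f x) $ i = (LINT x|torus. c x * f x $ i)"
proof -
 note [measurable] = borel_measurable_continuous_onI[OF c(2)] torus_L1D(2)[OF f]
 obtain M where M: "M > 0" "\<And>x. norm (c x) \<le> M" using periodic_continuous_bounded[OF c] by blast
 have i: "integrable torus (\<lambda>x. c x *\<^sub>R f x)"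
  by (rule L_integrable_bound[OF integrable_scaleR_right[OF torus_L1D(3)[OF f], of M]])
   (use M in \<open>auto intro!: AE_I2 mult_right_mono\<close>)
 have "(LBINT x:cell. c x *\<^sub>R f x) = (LINT x|torus. c x *\<^sub>R f x)" by (rule integral_torus(1)[symmetric]) measurable
 then show ?thesis using integral_bounded_linear[OF vec_nth_linear i, of i] by simp
qed

lemma periodic_partial:
 fixes f :: "space \<Rightarrow> real"
 assumes f: "periodic f" "smooth f"
 shows "periodic (partial b f)"
 unfolding periodic_def
proof (intro allI)
 fix x i
 have "f = (\<lambda>y. f (y + - axis i 1))"
  using f(1)[unfolded periodic_def, rule_format, of "_ + - axis i 1" i] by (simp add: fun_eq_iff)
 moreover have "((\<lambda>y. f (y + - axis i 1)) has_derivative frechet_derivative f (at x)) (at (x + axis i 1))"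
 proof -
  have "((\<lambda>y. y + - axis i 1) has_derivative (\<lambda>h. h)) (at (x + axis i 1))"
   by (intro has_derivative_add_const has_derivative_ident)
  moreover have "(f has_derivative frechet_derivative f (at x)) (at ((x + axis i 1) + - axis i 1))"
   using smooth_has_derivative[OF f(2), of x] by simp
  ultimately show ?thesis using diff_chain_at by (fastforce simp: o_def)
 qed
 ultimately show "partial b f (x + axis i 1) = partial b f x"
  using partial_eq[of f _ "x + axis i 1" b] by (simp add: partial_def)
qed

lemma helmholtz_components:
 assumes H: "inverse_helmholtz \<alpha> v u" and v: "torus_Lp 2 v"
 shows "helmholtz \<alpha> (\<lambda>x. v x $ i) (\<lambda>x. u x $ i)"
proof -
 have u: "torus_Lp 2 u" using H in_Lp_iff[of "num.Bit0 num.One" u] by (simp add: inverse_helmholtz_def)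
 have u1: "torus_L1 u" and v1: "torus_L1 v" using torus_Lp_imp_L1[OF u] torus_Lp_imp_L1[OF v] by simp_all
 have "(LINT x|torus. (\<psi> x - \<alpha>\<^sup>2 * laplacian \<psi> x) * u x $ i) = (LINT x|torus. \<psi> x * v x $ i)"
  if \<psi>: "smooth \<psi>" "periodic \<psi>" for \<psi>
 proof -
  have d: "smooth (dx j \<psi>)" "periodic (dx j \<psi>)" for j
   using smooth_dx[OF \<psi>(1)] periodic_partial[OF \<psi>(2,1)] by (simp_all add: dx_def)
  have dd: "smooth (dx j (dx j \<psi>))" "periodic (dx j (dx j \<psi>))" for j
   using d[of j] smooth_dx[OF d(1)[of j], of j] periodic_partial[OF d(2)[of j] d(1)[of j]] by (auto simp: dx_def)
  have "continuous_on UNIV (\<lambda>x. \<psi> x - \<alpha>\<^sup>2 * laplacian \<psi> x)"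
   unfolding laplacian_def by (intro continuous_intros smooth_continuous \<psi> dd)
  moreover have "periodic (\<lambda>x. \<psi> x - \<alpha>\<^sup>2 * laplacian \<psi> x)"
   using \<psi>(2) dd(2) by (simp add: periodic_def laplacian_def)
  ultimately have "(LINT x|torus. (\<psi> x - \<alpha>\<^sup>2 * laplacian \<psi> x) * u x $ i) = (LBINT x:cell. (\<psi> x - \<alpha>\<^sup>2 * laplacian \<psi> x) *\<^sub>R u x) $ i"
   by (intro integral_scaleR_component[symmetric] u1)
  also have "... = (LBINT x:cell. \<psi> x *\<^sub>R v x) $ i" using H \<psi> by (simp add: inverse_helmholtz_def)
  also have "... = (LINT x|torus. \<psi> x * v x $ i)"
   by (intro integral_scaleR_component v1 \<psi> smooth_continuous)
  finally show ?thesis .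
 qed
 then show ?thesis unfolding helmholtz_def using torus_Lp_linear[OF u vec_nth_linear] torus_Lp_linear[OF v vec_nth_linear] by blast
qed

section \<open>Removing the exceptional times\<close>

text \<open>The set \<open>S\<close> collects times at which all conditions hold that the definitions impose only almost everywhere.\<close>

locale leray_solution =
 fixes \<alpha> T C :: real and u v :: "spacetime \<Rightarrow> space" and p :: "spacetime \<Rightarrow> real" and S :: "real set"
 assumes \<alpha>_pos: "\<alpha> > 0" and T_pos: "T > 0" and sol: "leray_alpha_weak_solution \<alpha> T u v p"
  and S[measurable]: "S \<in> sets borel" and S_sub: "S \<subseteq> {0<..<T}" and S_AE: "AE t in lborel. t \<in> {0<..<T} \<longrightarrow> t \<in> S"
  and v3: "\<And>t. t \<in> S ==> torus_Lp 3 (\<lambda>x. v (x, t))"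
  and v_bound: "\<And>t. t \<in> S ==> (LINT x|torus. (norm (v (x, t)))\<^sup>2) \<le> C"
  and inv: "\<And>t. t \<in> S ==> inverse_helmholtz \<alpha> (\<lambda>x. v (x, t)) (\<lambda>x. u (x, t))"
  and v_L3: "(nnL t. indicator S t * (nnT x. norm (v (x, t)) ^ 3)) < \<infinity>"
begin

definition U :: "spacetime \<Rightarrow> space" where "U z = (if snd z \<in> S then u z else 0)"
definition V :: "spacetime \<Rightarrow> space" where "V z = (if snd z \<in> S then v z else 0)"

abbreviation strip :: "spacetime set" where "strip \<equiv> UNIV \<times> {0<..<T}"

lemma uv_measurable[measurable]:
 "(\<lambda>z. indicator strip z *\<^sub>R u z) \<in> Borel"
 "(\<lambda>z. indicator strip z *\<^sub>R v z) \<in> Borel"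
 using sol by (auto simp: leray_alpha_weak_solution_def in_Linf_L2_def st_function_def set_borel_measurable_def)

lemma UV_measurable[measurable]: "U \<in> Borel" "V \<in> Borel"
proof -
 have "UNIV \<times> S \<in> sets borelXT" by simp
 then have [measurable]: "UNIV \<times> S \<in> sets (borel :: spacetime measure)" by (simp only: borel_prod)
 have "U = (\<lambda>z. indicator (UNIV \<times> S) z *\<^sub>R (indicator strip z *\<^sub>R u z))"
  "V = (\<lambda>z. indicator (UNIV \<times> S) z *\<^sub>R (indicator strip z *\<^sub>R v z))"
  using S_sub by (auto simp: U_def V_def indicator_def fun_eq_iff)
 then show "U \<in> Borel" "V \<in> Borel"
  by (simp_all only:) measurable
qed

lemma v2: "t \<in> S ==> torus_Lp 2 (\<lambda>x. v (x, t))"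
 using torus_Lp_mono[OF v3] by simp

lemma helm: "t \<in> S ==> helmholtz \<alpha> (\<lambda>x. v (x, t) $ i) (\<lambda>x. u (x, t) $ i)"
 by (rule helmholtz_components[OF inv v2])

lemma u2: "t \<in> S ==> torus_Lp 2 (\<lambda>x. u (x, t))"
 using inv[of t] in_Lp_iff[of "num.Bit0 num.One" "\<lambda>x. u (x, t)"] by (simp add: inverse_helmholtz_def)

lemma V_cube:
 "(nnT x. norm (V (x, t)) ^ 3) = indicator S t * (nnT x. norm (v (x, t)) ^ 3)"
 "(\<lambda>t. nnT x. norm (V (x, t)) ^ 3) \<in> Borel"
proof -
 show "(nnT x. norm (V (x, t)) ^ 3) = indicator S t * (nnT x. norm (v (x, t)) ^ 3)"
  by (simp add: V_def indicator_def)
 have "(\<lambda>p. V (fst p, snd p)) \<in> Borel2" using UV_measurable(2) by (simp add: borel_prod)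
 from measurable_compose[OF _ this, of "\<lambda>p. (snd p, fst p)"]
 have [measurable]: "(\<lambda>p. V (snd p, fst p)) \<in> borel_measurable borelTX" by simp
 show "(\<lambda>t. nnT x. norm (V (x, t)) ^ 3) \<in> Borel"
  by (rule torus.borel_measurable_nn_integral) (simp add: case_prod_beta')
qed

lemma u_bounds:
 obtains C' A where "A \<ge> 0" "C \<le> C'" "0 \<le> C'" "\<And>t. t \<in> S ==> torus_Lp 3 (\<lambda>x. u (x, t))"
  "\<And>t. t \<in> S ==> (LINT x|torus. (norm (u (x, t)))\<^sup>2) \<le> C'"
  "\<And>\<xi>. (nnL t. indicator S t * (nnT x. norm (u (x + \<xi>, t) - u (x, t)) ^ 3)) \<le> ennreal (A * norm \<xi> ^ 3)"
proof (rule helmholtz_vector_bounds[OF \<alpha>_pos])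
 fix B :: real
 assume B: "B \<ge> 0"
  "\<And>v u :: space \<Rightarrow> space. \<And>V. (\<And>i. helmholtz \<alpha> (\<lambda>x. v x $ i) (\<lambda>x. u x $ i)) ==> u \<in> Borel ==> torus_Lp 2 v ==>
   (LINT x|torus. (norm (v x))\<^sup>2) \<le> V ==> (nnT x. norm (u x) ^ 3) \<le> ennreal (B * (V * sqrt V))"
  "\<And>v u :: space \<Rightarrow> space. \<And>\<xi>. (\<And>i. helmholtz \<alpha> (\<lambda>x. v x $ i) (\<lambda>x. u x $ i)) ==> torus_Lp 3 v ==> torus_Lp 3 u ==>
   (nnT x. norm (u (x + \<xi>) - u x) ^ 3)
    \<le> ennreal (B * norm \<xi> ^ 3) * ((nnT x. norm (u x) ^ 3) + (nnT x. norm (v x) ^ 3))"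
 define D where "D = max C 0"
 define A where "A = B * (D * sqrt D)"
 define g where "g = enn2real (nnL t. indicator S t * (nnT x. norm (v (x, t)) ^ 3))"
 have g: "(nnL t. indicator S t * (nnT x. norm (v (x, t)) ^ 3)) = ennreal g" "0 \<le> g"
  using v_L3 by (simp_all add: g_def)
 have D: "0 \<le> D" by (simp add: D_def)
 have A: "A \<ge> 0" using B(1) D by (simp add: A_def)
 have vD: "(LINT x|torus. (norm (v (x, t)))\<^sup>2) \<le> D" if "t \<in> S" for t
  using v_bound[OF that] by (simp add: D_def)
 have n3: "(nnT x. norm (u (x, t)) ^ 3) \<le> ennreal A" if "t \<in> S" for t
  unfolding A_def by (rule B(2)[OF helm[OF that] torus_LpD(2)[OF u2[OF that]] v2[OF that] vD[OF that]])
 have u3: "torus_Lp 3 (\<lambda>x. u (x, t))" if "t \<in> S" for t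
  using n3[OF that] torus_LpD(1,2)[OF u2[OF that]] by (auto simp: torus_Lp_iff_nn intro: le_less_trans)
 show thesis
 proof (rule that[of "B * (A * T + g)" "D + 1 + A"])
  fix t assume t: "t \<in> S"
  note i2 = torus_LpD(3)[OF u2[OF t]] and i3 = torus_LpD(3)[OF u3[OF t]]
  have "(LINT x|torus. (norm (u (x, t)))\<^sup>2) \<le> (LINT x|torus. 1 + norm (u (x, t)) ^ 3)"
  proof (rule integral_mono)
   fix x
   have "r\<^sup>2 \<le> 1 + r ^ 3" if "0 \<le> r" for r :: real
   proof (cases "r \<le> 1")
    case True
    then have "r\<^sup>2 \<le> 1" using that by (simp add: power_le_one)
    then show ?thesis using that by (simp add: add_increasing2)
   next
    case False
    then have "r ^ 2 \<le> r ^ 3" by (intro power_increasing) auto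
    then show ?thesis by simp
   qed
   then show "(norm (u (x, t)))\<^sup>2 \<le> 1 + norm (u (x, t)) ^ 3" by simp
  qed (use i2 i3 in auto)
  also have "... = 1 + (LINT x|torus. norm (u (x, t)) ^ 3)"
   using i3 by (subst L_integral_add) auto
  also have "(LINT x|torus. norm (u (x, t)) ^ 3) \<le> A"
   using n3[OF t] nn_integral_eq_integral[OF i3] A by simp
  finally show "(LINT x|torus. (norm (u (x, t)))\<^sup>2) \<le> D + 1 + A" using D by simp
 next
  fix \<xi> :: space
  have "(nnL t. indicator S t * (nnT x. norm (u (x + \<xi>, t) - u (x, t)) ^ 3))
    \<le> (nnL t. ennreal (B * norm \<xi> ^ 3) * (ennreal A * indicator {0..T} t + indicator S t * (nnT x. norm (v (x, t)) ^ 3)))"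
  proof (rule nn_integral_mono)
   fix t
   show "indicator S t * (nnT x. norm (u (x + \<xi>, t) - u (x, t)) ^ 3)
     \<le> ennreal (B * norm \<xi> ^ 3) * (ennreal A * indicator {0..T} t + indicator S t * (nnT x. norm (v (x, t)) ^ 3))"
   proof (cases "t \<in> S")
    case True
    have "(nnT x. norm (u (x + \<xi>, t) - u (x, t)) ^ 3)
      \<le> ennreal (B * norm \<xi> ^ 3) * (ennreal A + (nnT x. norm (v (x, t)) ^ 3))"
     by (rule order_trans[OF B(3)[OF helm[OF True] v3[OF True] u3[OF True]]]) (intro mult_left_mono add_mono n3 True, auto)
    then show ?thesis using True S_sub by (auto simp: indicator_def)
   qed simp
  qed
  also have "... = ennreal (B * norm \<xi> ^ 3) * (ennreal A * ennreal T + ennreal g)"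
   using V_cube(2) T_pos unfolding V_cube(1) g(1)[symmetric] by (simp add: nn_integral_cmult nn_integral_add)
  also have "... = ennreal (B * norm \<xi> ^ 3 * (A * T + g))"
   using B(1) A T_pos g(2) by (simp add: ennreal_mult ennreal_plus)
  finally show "(nnL t. indicator S t * (nnT x. norm (u (x + \<xi>, t) - u (x, t)) ^ 3)) \<le> ennreal (B * (A * T + g) * norm \<xi> ^ 3)"
   by (simp add: mult_ac)
 qed (use A D u3 B(1) g(2) T_pos in \<open>auto simp: D_def\<close>)
qed

lemma weak_divergence:
 assumes \<theta>: "time_test T \<theta>" and \<psi>: "smooth \<psi>" "periodic \<psi>"
 shows "(LBINT t. \<theta> t * (LINT x|torus. (\<Sum>i\<in>UNIV. U (x, t) $ i * dx i \<psi> x))) = 0"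
proof -
 let ?w = "\<lambda>z. \<theta> (snd z) *\<^sub>R \<psi> (fst z)"
 note w = product_test[OF \<psi> \<theta>]
 note [measurable] = st_test_derivatives_measurable[OF w(1)]
 have "0 = st_integral T (\<lambda>z. \<Sum>i\<in>UNIV. u z $ i * st_dx i ?w z)"
  using sol w(1) by (simp add: leray_alpha_weak_solution_def)
 also have "... = (LBINT t. indicator S t * (LINT x|torus. (\<Sum>i\<in>UNIV. u (x, t) $ i * st_dx i ?w (x, t))))"
 proof (rule st_integral_eq[OF _ _ S S_sub S_AE])
  show "(\<lambda>z. \<Sum>i\<in>UNIV. (indicator strip z *\<^sub>R u z) $ i * st_dx i ?w z) \<in> Borel"
   using measurable_compose[OF uv_measurable(1) measurable_vec_nth] by measurable
 qed simp
 also have "... = (LBINT t. \<theta> t * (LINT x|torus. (\<Sum>i\<in>UNIV. U (x, t) $ i * dx i \<psi> x)))"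
 proof (intro L_integral_cong refl)
  fix t
  have "(\<Sum>i\<in>UNIV. u (x, t) $ i * st_dx i ?w (x, t)) = \<theta> t * (\<Sum>i\<in>UNIV. u (x, t) $ i * dx i \<psi> x)" for x
   unfolding w(3) by (simp add: sum_distrib_left mult_ac)
  then show "indicator S t * (LINT x|torus. (\<Sum>i\<in>UNIV. u (x, t) $ i * st_dx i ?w (x, t)))
    = \<theta> t * (LINT x|torus. (\<Sum>i\<in>UNIV. U (x, t) $ i * dx i \<psi> x))"
   by (cases "t \<in> S") (simp_all add: U_def)
 qed
 finally show ?thesis by simp
qed

lemma weak_momentum:
 assumes \<theta>: "time_test T \<theta>" and \<psi>: "smooth \<psi>" "periodic \<psi>" and div: "\<And>x. (\<Sum>i\<in>UNIV. dx i \<psi> x $ i) = 0"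
 shows "(LBINT t. partial 1 \<theta> t * (LINT x|torus. V (x, t) \<bullet> \<psi> x))
   + (LBINT t. \<theta> t * (LINT x|torus. (\<Sum>i\<in>UNIV. U (x, t) $ i * (V (x, t) \<bullet> dx i \<psi> x)))) = 0"
proof -
 let ?w = "\<lambda>z. \<theta> (snd z) *\<^sub>R \<psi> (fst z)"
 note w = product_test[OF \<psi> \<theta>]
 note [measurable] = st_test_derivatives_measurable[OF w(1)]
  measurable_compose[OF st_test_derivatives_measurable(1)[OF w(1)] measurable_vec_nth]
  measurable_compose[OF st_test_derivatives_measurable(2)[OF w(1)] measurable_vec_nth]
  measurable_compose[OF uv_measurable(1) measurable_vec_nth] measurable_compose[OF uv_measurable(2) measurable_vec_nth]
 have e1: "st_integral T (\<lambda>z. \<Sum>i\<in>UNIV. v z $ i * st_dt ?w z $ i) = (LBINT t. partial 1 \<theta> t * (LINT x|torus. V (x, t) \<bullet> \<psi> x))"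
 proof -
  have "st_integral T (\<lambda>z. \<Sum>i\<in>UNIV. v z $ i * st_dt ?w z $ i)
    = (LBINT t. indicator S t * (LINT x|torus. (\<Sum>i\<in>UNIV. v (x, t) $ i * st_dt ?w (x, t) $ i)))"
  proof (rule st_integral_eq[OF _ _ S S_sub S_AE])
   show "(\<lambda>z. \<Sum>i\<in>UNIV. (indicator strip z *\<^sub>R v z) $ i * st_dt ?w z $ i) \<in> Borel"
    by measurable
  qed simp
  also have "... = (LBINT t. partial 1 \<theta> t * (LINT x|torus. V (x, t) \<bullet> \<psi> x))"
  proof (intro L_integral_cong refl)
   fix t
   have "(\<Sum>i\<in>UNIV. v (x, t) $ i * st_dt ?w (x, t) $ i) = partial 1 \<theta> t * (v (x, t) \<bullet> \<psi> x)" for x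
    unfolding w(2) by (simp add: inner_vec_def sum_distrib_left mult_ac)
   then show "indicator S t * (LINT x|torus. (\<Sum>i\<in>UNIV. v (x, t) $ i * st_dt ?w (x, t) $ i))
     = partial 1 \<theta> t * (LINT x|torus. V (x, t) \<bullet> \<psi> x)"
    by (cases "t \<in> S") (simp_all add: V_def)
  qed
  finally show ?thesis .
 qed
 have e2: "st_integral T (\<lambda>z. \<Sum>i\<in>UNIV. \<Sum>j\<in>UNIV. v z $ j * u z $ i * st_dx i ?w z $ j)
   = (LBINT t. \<theta> t * (LINT x|torus. (\<Sum>i\<in>UNIV. U (x, t) $ i * (V (x, t) \<bullet> dx i \<psi> x))))"
 proof -
  have "st_integral T (\<lambda>z. \<Sum>i\<in>UNIV. \<Sum>j\<in>UNIV. v z $ j * u z $ i * st_dx i ?w z $ j)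
    = (LBINT t. indicator S t * (LINT x|torus. (\<Sum>i\<in>UNIV. \<Sum>j\<in>UNIV. v (x, t) $ j * u (x, t) $ i * st_dx i ?w (x, t) $ j)))"
  proof (rule st_integral_eq[OF _ _ S S_sub S_AE])
   show "(\<lambda>z. \<Sum>i\<in>UNIV. \<Sum>j\<in>UNIV. (indicator strip z *\<^sub>R v z) $ j * (indicator strip z *\<^sub>R u z) $ i * st_dx i ?w z $ j) \<in> Borel"
    by measurable
  qed simp
  also have "... = (LBINT t. \<theta> t * (LINT x|torus. (\<Sum>i\<in>UNIV. U (x, t) $ i * (V (x, t) \<bullet> dx i \<psi> x))))"
  proof (intro L_integral_cong refl)
   fix t
   have "(\<Sum>i\<in>UNIV. \<Sum>j\<in>UNIV. v (x, t) $ j * u (x, t) $ i * st_dx i ?w (x, t) $ j)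
     = \<theta> t * (\<Sum>i\<in>UNIV. u (x, t) $ i * (v (x, t) \<bullet> dx i \<psi> x))" for x
    unfolding w(3) by (simp add: inner_vec_def sum_distrib_left mult_ac)
   then show "indicator S t * (LINT x|torus. (\<Sum>i\<in>UNIV. \<Sum>j\<in>UNIV. v (x, t) $ j * u (x, t) $ i * st_dx i ?w (x, t) $ j))
     = \<theta> t * (LINT x|torus. (\<Sum>i\<in>UNIV. U (x, t) $ i * (V (x, t) \<bullet> dx i \<psi> x)))"
    by (cases "t \<in> S") (simp_all add: U_def V_def)
  qed
  finally show ?thesis .
 qed
 have "(\<Sum>i\<in>UNIV. st_dx i ?w z $ i) = 0" for z
 proof -
  have "(\<Sum>i\<in>UNIV. st_dx i ?w z $ i) = \<theta> (snd z) * (\<Sum>i\<in>UNIV. dx i \<psi> (fst z) $ i)"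
   using w(3)[of _ "fst z" "snd z"] by (simp add: sum_distrib_left)
  then show ?thesis by (simp add: div)
 qed
 then have e3: "st_integral T (\<lambda>z. p z * (\<Sum>i\<in>UNIV. st_dx i ?w z $ i)) = 0"
  by (simp add: st_integral_def set_lebesgue_integral_def)
 have "st_integral T (\<lambda>z. \<Sum>i\<in>UNIV. v z $ i * st_dt ?w z $ i)
    + st_integral T (\<lambda>z. \<Sum>i\<in>UNIV. \<Sum>j\<in>UNIV. v z $ j * u z $ i * st_dx i ?w z $ j)
    + st_integral T (\<lambda>z. p z * (\<Sum>i\<in>UNIV. st_dx i ?w z $ i)) = 0"
  using sol w(1) by (simp add: leray_alpha_weak_solution_def)
 then show ?thesis unfolding e1 e2 e3 by simp
qed

lemma zero_Lp: "torus_Lp n (\<lambda>x. 0 :: space)"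
 by (rule torus_Lp_bounded[where M = 0]) (auto simp: periodic_def)

lemma divergence_AE:
 assumes K: "bump_kernel K"
 shows "AE t in lborel. t \<in> S \<longrightarrow> (\<forall>y. (\<Sum>i\<in>UNIV. conv (dx i K) (\<lambda>x. u (x, t) $ i) y) = 0)"
proof -
 obtain C' A where b: "C \<le> C'" "0 \<le> C'"
  "\<And>t. t \<in> S ==> (LINT x|torus. (norm (u (x, t)))\<^sup>2) \<le> C'"
  by (rule u_bounds) (rule that, assumption+)
 have "AE t in lborel. \<forall>y. (\<Sum>i\<in>UNIV. conv (dx i K) (\<lambda>x. U (x, t) $ i) y) = 0"
 proof (rule divergence_free_AE[OF T_pos K UV_measurable(1) _ _ _ weak_divergence])
  show "torus_Lp 2 (\<lambda>x. U (x, t))" for t using u2[of t] zero_Lp by (cases "t \<in> S") (simp_all add: U_def)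
  show "(LINT x|torus. (norm (U (x, t)))\<^sup>2) \<le> C'" for t using b by (cases "t \<in> S") (simp_all add: U_def)
  show "t \<notin> {0<..<T} ==> U (x, t) = 0" for t x using S_sub by (auto simp: U_def)
 qed
 then show ?thesis by eventually_elim (auto simp: U_def)
qed

lemma fields:
 assumes \<phi>: "bump_kernel \<phi>" "\<And>z. \<phi> (- z) = \<phi> z" "(LBINT z. \<phi> z) = 1"
  and div: "\<And>n t y. t \<in> S ==> (\<Sum>i\<in>UNIV. conv (dx i (rescale \<phi> (1 / real (Suc n)))) (\<lambda>x. u (x, t) $ i) y) = 0"
 obtains C' A where "leray_fields U V \<phi> T C' A"
proof -
 obtain C' A where b: "A \<ge> 0" "C \<le> C'" "0 \<le> C'" "\<And>t. t \<in> S ==> torus_Lp 3 (\<lambda>x. u (x, t))"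
  "\<And>t. t \<in> S ==> (LINT x|torus. (norm (u (x, t)))\<^sup>2) \<le> C'"
  "\<And>\<xi>. (nnL t. indicator S t * (nnT x. norm (u (x + \<xi>, t) - u (x, t)) ^ 3)) \<le> ennreal (A * norm \<xi> ^ 3)"
  by (rule u_bounds) (rule that, assumption+)
 have zc: "conv k (\<lambda>x. 0 :: real) y = 0" for k y by (simp add: conv_def)
 have "leray_fields U V \<phi> T C' A"
 proof
  show "torus_Lp 3 (\<lambda>x. U (x, t))" "torus_Lp 3 (\<lambda>x. V (x, t))" for t
   using b(4)[of t] v3[of t] zero_Lp by (cases "t \<in> S"; simp add: U_def V_def)+
  show "(LINT x|torus. (norm (U (x, t)))\<^sup>2) \<le> C'" "(LINT x|torus. (norm (V (x, t)))\<^sup>2) \<le> C'" for t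
   using b(2,3) b(5)[of t] v_bound[of t] by (cases "t \<in> S"; simp add: U_def V_def)+
  show "V (x, t) = 0" if "t \<notin> {0<..<T}" for t x using that S_sub by (auto simp: V_def)
  have "(nnT x. norm (U (x + \<xi>, t) - U (x, t)) ^ 3) = indicator S t * (nnT x. norm (u (x + \<xi>, t) - u (x, t)) ^ 3)" for t \<xi>
   by (simp add: U_def indicator_def)
  then show "(nnL t. (nnT x. norm (U (x + \<xi>, t) - U (x, t)) ^ 3)) \<le> ennreal (A * norm \<xi> ^ 3)" for \<xi>
   using b(6) by simp
  show "(nnL t. (nnT x. norm (V (x, t)) ^ 3)) < \<infinity>" unfolding V_cube(1) by (rule v_L3)
  fix n t y
  have s: "bump_kernel (rescale \<phi> (1 / real (Suc n)))" by (rule kernel_rescale[OF \<phi>(1)]) simp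
  show "(\<Sum>i\<in>UNIV. conv (dx i (rescale \<phi> (1 / real (Suc n)))) (\<lambda>x. U (x, t) $ i) y) = 0"
   using div[of t n y] by (cases "t \<in> S") (simp_all add: U_def zc)
  show "(\<Sum>i\<in>UNIV. conv (dx i (rescale \<phi> (1 / real (Suc n)))) (\<lambda>x. V (x, t) $ i) y) = 0"
     proof (cases "t \<in> S")
   case True
   show ?thesis using divergence_free_helmholtz[OF helm[OF True] s div[OF True], of y] True by (simp add: V_def)
  qed (simp add: V_def zc)
 qed (fact T_pos UV_measurable b(1) \<phi> weak_momentum)+
 then show thesis by (rule that)
qed

lemma restrict_times:
 assumes "R \<in> sets borel" "R \<subseteq> S" "AE t in lborel. t \<in> S \<longrightarrow> t \<in> R"
 shows "leray_solution \<alpha> T C u v p R"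
proof
 show "R \<subseteq> {0<..<T}" using assms(2) S_sub by blast
 show "AE t in lborel. t \<in> {0<..<T} \<longrightarrow> t \<in> R" using S_AE assms(3) by eventually_elim blast
 have "(nnL t. indicator R t * (nnT x. norm (v (x, t)) ^ 3)) \<le> (nnL t. indicator S t * (nnT x. norm (v (x, t)) ^ 3))"
  by (intro nn_integral_mono mult_right_mono) (use assms(2) in \<open>auto simp: indicator_def\<close>)
 then show "(nnL t. indicator R t * (nnT x. norm (v (x, t)) ^ 3)) < \<infinity>" using v_L3 by (rule le_less_trans)
qed (use assms v3 v_bound inv \<alpha>_pos T_pos sol in auto)

text \<open>Only countably many kernels occur, so the exceptional times for all of them form one null set.\<close>

lemma solenoidal_times:
 assumes \<phi>: "bump_kernel \<phi>"
 obtains R where "leray_solution \<alpha> T C u v p R"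
  "\<And>n t y. t \<in> R ==> (\<Sum>i\<in>UNIV. conv (dx i (rescale \<phi> (1 / real (Suc n)))) (\<lambda>x. u (x, t) $ i) y) = 0"
proof -
 let ?P = "\<lambda>t. t \<in> S \<longrightarrow> (\<forall>n y. (\<Sum>i\<in>UNIV. conv (dx i (rescale \<phi> (1 / real (Suc n)))) (\<lambda>x. u (x, t) $ i) y) = 0)"
 have "AE t in lborel. \<forall>n. t \<in> S \<longrightarrow> (\<forall>y. (\<Sum>i\<in>UNIV. conv (dx i (rescale \<phi> (1 / real (Suc n)))) (\<lambda>x. u (x, t) $ i) y) = 0)"
  unfolding AE_all_countable by (intro allI divergence_AE kernel_rescale \<phi>) simp
 then have "AE t in lborel. ?P t" by eventually_elim blast
 then obtain N where N: "{t \<in> space lborel. \<not> ?P t} \<subseteq> N" "emeasure lborel N = 0" "N \<in> sets lborel"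
  by (rule AE_E)
 have "AE t in lborel. t \<notin> N" using N(2,3) by (intro AE_not_in) (auto intro: null_setsI)
 then have "leray_solution \<alpha> T C u v p (S - N)"
  using N(3) by (intro restrict_times) auto
 then show thesis by (rule that) (use N(1) in auto)
qed

text \<open>The tested defect is at most the supremum of the test function times the defect mass.\<close>

lemma tested_defect_le:
 assumes fields: "leray_fields U V \<phi> T C' A" and s: "s > 0" and M: "M \<ge> 0" "\<And>x t. x \<in> cell ==> t \<in> {0<..<T} ==> \<bar>\<eta> (x, t)\<bar> \<le> M"
  and mass: "leray_fields.defect_mass U V \<phi> s \<le> ennreal e" and e: "e \<ge> 0"
 shows "\<bar>st_integral T (\<lambda>z. defect_approx \<phi> u v s z * \<eta> z)\<bar> \<le> M * e"
proof -
 interpret F: leray_fields U V \<phi> T C' A by (rule fields)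
 note [measurable] = grad_measurable[OF kernel_rescale[OF F.\<phi> s]]
 define d where "d z x t = norm (grad (rescale \<phi> s) z) * (norm (U (x + z, t) - U (x, t)) * (norm (V (x + z, t) - V (x, t)))\<^sup>2)" for z x t
 let ?H = "\<lambda>x t. (nnL z. ennreal (d z x t))"
 have md: "(\<lambda>q. d (fst q) (fst (snd q)) (snd (snd q))) \<in> borel_measurable borelXXT"
  unfolding d_def by measurable
 have mH: "(\<lambda>p. ?H (snd p) (fst p)) \<in> borel_measurable borelTX"
 proof (rule lborel.borel_measurable_nn_integral)
  have "(\<lambda>r. (snd r, (snd (fst r), fst (fst r)))) \<in> measurable borelTXX
    borelXXT" by measurable
  from measurable_compose[OF this md]
  show "(\<lambda>(p, z). ennreal (d z (snd p) (fst p))) \<in> borel_measurable (borelTX \<Otimes>\<^sub>M lborel)"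
   by (simp add: case_prod_beta')
 qed
 have mHx: "(\<lambda>x. ?H x t) \<in> Borel" for t
  using measurable_compose[OF _ mH, of "\<lambda>x. (t, x)" borel] by simp
 have mG: "(\<lambda>t. nnT x. ?H x t) \<in> Borel"
  by (rule torus.borel_measurable_nn_integral) (use mH in \<open>simp add: case_prod_beta'\<close>)
 have slice: "ennreal (norm (LBINT x:cell. defect_approx \<phi> u v s (x, t) * \<eta> (x, t))) \<le> ennreal M * (nnT x. ?H x t)"
  if t: "t \<in> S" for t
 proof -
  have pt: "ennreal (norm (indicator cell x *\<^sub>R (defect_approx \<phi> u v s (x, t) * \<eta> (x, t)))) \<le> indicator cell x * (ennreal M * ?H x t)" for x
  proof (cases "x \<in> cell")
   case True
   let ?g = "\<lambda>z. (grad (rescale \<phi> s) z \<bullet> fdiff z (\<lambda>y. u (y, t)) x) * (norm (fdiff z (\<lambda>y. v (y, t)) x))\<^sup>2"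
   have "ennreal (norm (defect_approx \<phi> u v s (x, t))) \<le> ennreal (norm (LBINT z. ?g z))"
    by (intro ennreal_leI) (simp add: defect_approx_def)
   also have "... \<le> (nnL z. norm (?g z))" by (rule norm_integral_le_nn_integral)
   also have "... \<le> ?H x t"
   proof (intro nn_integral_mono ennreal_leI)
    fix z
    have "norm (grad (rescale \<phi> s) z \<bullet> (u (x + z, t) - u (x, t))) \<le> norm (grad (rescale \<phi> s) z) * norm (u (x + z, t) - u (x, t))"
     using Cauchy_Schwarz_ineq2 by simp
    from mult_right_mono[OF this, of "(norm (v (x + z, t) - v (x, t)))\<^sup>2"]
    show "norm (?g z) \<le> d z x t" using t by (simp add: d_def U_def V_def fdiff_def abs_mult mult.assoc)
   qed
   finally have D: "ennreal (norm (defect_approx \<phi> u v s (x, t))) \<le> ?H x t" .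
   have "ennreal (norm (defect_approx \<phi> u v s (x, t) * \<eta> (x, t))) \<le> ennreal M * ennreal (norm (defect_approx \<phi> u v s (x, t)))"
    using M(1) mult_right_mono[OF M(2)[OF True, of t], of "\<bar>defect_approx \<phi> u v s (x, t)\<bar>"] t S_sub
    by (subst ennreal_mult[symmetric]) (auto intro!: ennreal_leI simp: abs_mult mult.commute)
   also have "... \<le> ennreal M * ?H x t" by (intro mult_left_mono D) simp
   finally show ?thesis using True by simp
  qed simp
  have "ennreal (norm (LBINT x:cell. defect_approx \<phi> u v s (x, t) * \<eta> (x, t))) \<le> (nnL x. indicator cell x * (ennreal M * ?H x t))"
   unfolding set_lebesgue_integral_def
   by (rule order_trans[OF norm_integral_le_nn_integral nn_integral_mono[OF pt]])
  also have "... = (nnL x. indicator unit_cube x * (ennreal M * ?H x t))"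
   by (rule nn_integral_cong_AE) (use AE_cell in eventually_elim, auto simp: indicator_def)
  also have "... = (nnT x. ennreal M * ?H x t)"
   by (rule nn_integral_torus[symmetric]) (use mHx in measurable)
  also have "... = ennreal M * (nnT x. ?H x t)"
   by (rule nn_integral_cmult) (use mHx in simp)
  finally show ?thesis .
 qed
 have "ennreal \<bar>st_integral T (\<lambda>z. defect_approx \<phi> u v s z * \<eta> z)\<bar>
   \<le> (nnL t. norm (indicator {0<..<T} t *\<^sub>R (LBINT x:cell. defect_approx \<phi> u v s (x, t) * \<eta> (x, t))))"
  unfolding st_integral_def set_lebesgue_integral_def[of lborel "{0<..<T}"] real_norm_def[symmetric] by (rule norm_integral_le_nn_integral)
 also have "... \<le> (nnL t. ennreal M * (nnT x. ?H x t))"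
 proof (rule nn_integral_mono_AE)
  show "AE t in lborel. ennreal (norm (indicator {0<..<T} t *\<^sub>R (LBINT x:cell. defect_approx \<phi> u v s (x, t) * \<eta> (x, t)))) \<le> ennreal M * (nnT x. ?H x t)"
   using S_AE
  proof eventually_elim
   case (elim t)
   then show ?case using slice[of t] by (cases "t \<in> {0<..<T}") auto
  qed
 qed
 also have "... = ennreal M * (nnL t. (nnT x. ?H x t))"
  by (rule nn_integral_cmult) (use mG in simp)
 also have "... \<le> ennreal M * ennreal e"
  using mass unfolding F.defect_mass_def d_def by (rule mult_left_mono) simp
 also have "... = ennreal (M * e)" using M e by (simp add: ennreal_mult)
 finally show ?thesis using M e by simp
qed

end

lemma st_test_bounded:
 fixes \<eta> :: "spacetime \<Rightarrow> real"
 assumes "st_test T \<eta>"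
 obtains M where "M > 0" "\<And>x t. x \<in> cell ==> \<bar>\<eta> (x, t)\<bar> \<le> M"
proof -
 obtain a b where ab: "\<And>x t. t \<notin> {a..b} ==> \<eta> (x, t) = 0" and s: "smooth \<eta>"
  using assms by (auto simp: st_test_def)
 have "compact (cell \<times> {a..b})" unfolding cell_def by (intro compact_Times compact_cbox compact_Icc)
 then have "bounded (\<eta> ` (cell \<times> {a..b}))"
  by (intro compact_imp_bounded compact_continuous_image continuous_on_subset[OF smooth_continuous[OF s]]) auto
 then obtain M where M: "M > 0" "\<And>z. z \<in> cell \<times> {a..b} ==> norm (\<eta> z) \<le> M"
  unfolding bounded_pos by auto
 show thesis
 proof (rule that[OF M(1)])
  fix x t assume "x \<in> cell"
  then show "\<bar>\<eta> (x, t)\<bar> \<le> M" using M(1) M(2)[of "(x, t)"] ab[of t x] by (cases "t \<in> {a..b}") auto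
 qed
qed

lemma leray_solution_exists:
 assumes pos: "\<alpha> > 0" "T > 0" and sol: "leray_alpha_weak_solution \<alpha> T u v p" and besov: "in_L3_besov T \<theta> v"
 obtains C S where "leray_solution \<alpha> T C u v p S"
proof -
 obtain C where C: "AE t in lborel. t \<in> {0<..<T} \<longrightarrow> in_Lp 2 (\<lambda>x. v (x, t)) \<and> Lp_norm 2 (\<lambda>x. v (x, t)) \<le> C"
  using sol by (auto simp: leray_alpha_weak_solution_def in_Linf_L2_def)
 let ?P = "\<lambda>t. t \<in> {0<..<T} \<longrightarrow> Lp_norm 2 (\<lambda>x. v (x, t)) \<le> C \<and> in_besov \<theta> 3 (\<lambda>x. v (x, t))
   \<and> inverse_helmholtz \<alpha> (\<lambda>x. v (x, t)) (\<lambda>x. u (x, t))"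
 have "AE t in lborel. t \<in> {0<..<T} \<longrightarrow> in_besov \<theta> 3 (\<lambda>x. v (x, t))"
  "AE t in lborel. t \<in> {0<..<T} \<longrightarrow> inverse_helmholtz \<alpha> (\<lambda>x. v (x, t)) (\<lambda>x. u (x, t))"
  using sol besov by (simp_all add: leray_alpha_weak_solution_def in_L3_besov_def)
 with C have "AE t in lborel. ?P t" by eventually_elim blast
 then obtain N where N: "{t \<in> space lborel. \<not> ?P t} \<subseteq> N" "emeasure lborel N = 0" "N \<in> sets lborel"
  by (rule AE_E)
 define S where "S = {0<..<T} - N"
 have P: "Lp_norm 2 (\<lambda>x. v (x, t)) \<le> C" "in_besov \<theta> 3 (\<lambda>x. v (x, t))"
  "inverse_helmholtz \<alpha> (\<lambda>x. v (x, t)) (\<lambda>x. u (x, t))" if "t \<in> S" for t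
  using that N(1) by (auto simp: S_def)
 have v3: "torus_Lp 3 (\<lambda>x. v (x, t))" if "t \<in> S" for t
  using P(2)[OF that] in_Lp_iff[of "num.Bit1 num.One" "\<lambda>x. v (x, t)"] by (simp add: in_besov_def)
 have cube: "(nnT x. norm (v (x, t)) ^ 3) \<le> ennreal (besov_norm \<theta> 3 (\<lambda>x. v (x, t)) ^ 3)" if t: "t \<in> S" for t
 proof -
  have "(nnT x. norm (v (x, t)) ^ 3) = ennreal (LINT x|torus. norm (v (x, t)) ^ 3)"
   by (rule nn_integral_eq_integral[OF torus_LpD(3)[OF v3[OF t]]]) simp
  also have "(LINT x|torus. norm (v (x, t)) ^ 3) = Lp_norm 3 (\<lambda>x. v (x, t)) ^ 3"
   by (rule Lp_norm_eq(2)[OF torus_LpD(2)[OF v3[OF t]], symmetric])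
  also have "ennreal ... \<le> ennreal (besov_norm \<theta> 3 (\<lambda>x. v (x, t)) ^ 3)"
   by (intro ennreal_leI power_mono Lp_norm_le_besov_norm P(2) t) (simp add: Lp_norm_def)
  finally show ?thesis .
 qed
 have "leray_solution \<alpha> T (C\<^sup>2) u v p S"
 proof
  show "S \<in> sets borel" "S \<subseteq> {0<..<T}" using N(3) by (auto simp: S_def)
  have "AE t in lborel. t \<notin> N" using N(2,3) by (intro AE_not_in) (auto intro: null_setsI)
  then show "AE t in lborel. t \<in> {0<..<T} \<longrightarrow> t \<in> S" by eventually_elim (simp add: S_def)
  show "(LINT x|torus. (norm (v (x, t)))\<^sup>2) \<le> C\<^sup>2" if t: "t \<in> S" for t
   using power_mono[OF P(1)[OF t], of 2] Lp_norm_eq(2)[OF torus_LpD(2)[OF v3[OF t]], of "num.Bit0 num.One"] by (simp add: Lp_norm_def)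
  have "(nnL t. indicator S t * (nnT x. norm (v (x, t)) ^ 3))
    \<le> (\<integral>\<^sup>+t\<in>{0<..<T}. ennreal (besov_norm \<theta> 3 (\<lambda>x. v (x, t)) ^ 3) \<partial>lborel)"
   by (intro nn_integral_mono) (use cube in \<open>auto simp: indicator_def S_def\<close>)
  also have "... < \<infinity>" using besov by (simp add: in_L3_besov_def)
  finally show "(nnL t. indicator S t * (nnT x. norm (v (x, t)) ^ 3)) < \<infinity>" .
 qed (use pos sol v3 P in auto)
 then show thesis by (rule that)
qed

theorem proposition2p6:
  fixes \<alpha> T \<theta> :: real
    and u v :: "spacetime \<Rightarrow> space"
    and p :: "spacetime \<Rightarrow> real"
    and \<phi> :: "space \<Rightarrow> real"
  assumes "\<alpha> > 0" and "T > 0" and "\<theta> > 0"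
    and "mollifier \<phi>"
    and "leray_alpha_weak_solution \<alpha> T u v p"
    and "in_L3_besov T \<theta> v"
  shows "has_defect T \<phi> u v (\<lambda>_. 0) \<and>
    (AE t1 in lborel. AE t2 in lborel. t1 \<in> {0<..<T} \<longrightarrow> t2 \<in> {0<..<T} \<longrightarrow>
       Lp_norm 2 (\<lambda>x. v (x, t1)) = Lp_norm 2 (\<lambda>x. v (x, t2)))"
proof -
 have radial: "\<forall>x y. norm x = norm y \<longrightarrow> \<phi> x = \<phi> y" using assms(4) unfolding mollifier_def by blast
 have even: "\<phi> (- z) = \<phi> z" for z using radial[rule_format, of "- z" z] by simp
 have "bump_kernel \<phi>" "(LBINT z. \<phi> z) = 1"
  using assms(4) unfolding mollifier_def bump_kernel_def by blast+
 note \<phi> = this(1) even this(2)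
 obtain C S where S: "leray_solution \<alpha> T C u v p S"
  by (rule leray_solution_exists[OF assms(1,2,5,6)])
 obtain R where R: "leray_solution \<alpha> T C u v p R"
  "\<And>n t y. t \<in> R ==> (\<Sum>i\<in>UNIV. conv (dx i (rescale \<phi> (1 / real (Suc n)))) (\<lambda>x. u (x, t) $ i) y) = 0"
  by (rule leray_solution.solenoidal_times[OF S \<phi>(1)]) (rule that, assumption+)
 interpret L: leray_solution \<alpha> T C u v p R by (rule R(1))
 obtain C' A where F: "leray_fields L.U L.V \<phi> T C' A" by (rule L.fields[OF \<phi> R(2)])
 interpret F: leray_fields L.U L.V \<phi> T C' A by (rule F)
 have "has_defect T \<phi> u v (\<lambda>_. 0)"
  unfolding has_defect_def distributional_limit_def
 proof (intro allI impI tendstoI)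
  fix \<eta> :: "spacetime \<Rightarrow> real" and e :: real assume \<eta>: "st_test T \<eta>" and e: "e > 0"
  obtain M where M: "M > 0" "\<And>x t. x \<in> cell ==> \<bar>\<eta> (x, t)\<bar> \<le> M" by (rule st_test_bounded[OF \<eta>]) (rule that, assumption+)
  have e2: "e / (2 * M) > 0" using e M by simp
  obtain s0 where s0: "s0 > 0" "\<And>s. 0 < s ==> s < s0 ==> F.defect_mass s \<le> ennreal (e / (2 * M))"
   by (rule F.defect_small[OF e2]) (rule that, assumption+)
  have "dist (st_integral T (\<lambda>z. defect_approx \<phi> u v s z * \<eta> z)) 0 < e" if s: "0 < s" "s < s0" for s
  proof -
   have "\<bar>st_integral T (\<lambda>z. defect_approx \<phi> u v s z * \<eta> z)\<bar> \<le> M * (e / (2 * M))"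
    by (rule L.tested_defect_le[OF F s(1)]) (use M e2 s0(2)[OF s] in auto)
   also have "... < e" using M e by simp
   finally show ?thesis by simp
  qed
  then show "\<forall>\<^sub>F s in at_right 0. dist (st_integral T (\<lambda>z. defect_approx \<phi> u v s z * \<eta> z)) 0 < e"
   unfolding eventually_at_right_field using s0(1) by blast
 qed
 moreover have "AE t1 in lborel. AE t2 in lborel. t1 \<in> {0<..<T} \<longrightarrow> t2 \<in> {0<..<T} \<longrightarrow>
   Lp_norm 2 (\<lambda>x. v (x, t1)) = Lp_norm 2 (\<lambda>x. v (x, t2))"
 proof -
  obtain c where "AE t in lborel. t \<in> {0<..<T} \<longrightarrow> F.energy t = c" using F.energy_constant by blast
  then have n: "AE t in lborel. t \<in> {0<..<T} \<longrightarrow> Lp_norm 2 (\<lambda>x. v (x, t)) = c powr (1 / 2)"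
   using L.S_AE
  proof eventually_elim
   case (elim t)
   then show ?case
    using Lp_norm_eq(1)[of "\<lambda>x. v (x, t)" "num.Bit0 num.One"] torus_LpD(2)[OF L.v2, of t]
    by (auto simp: F.energy_def L.V_def)
  qed
  show ?thesis
   using n
  proof eventually_elim
   case (elim t1)
   note t1 = elim
   show ?case using n by eventually_elim (use t1 in simp)
  qed
 qed
 ultimately show ?thesis by blast
qed

end
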